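(* Let $K$ be a field of any characteristic, let $L\subset\mathbb{Z}^m$ be a positive lattice and let $(L,\rho)$ be a partial character on $\mathbb{Z}^m$ with values in $K^*$. Then: (a) the lattice ideal $I_{L,\rho}\subset K[x_1,\dots,x_m]$ is a complete intersection if and only if the lattice $L$ is completely glued; (b) if $K$ has characteristic zero, then $I_{L,\rho}$ is a set-theoretic complete intersection on binomials if and only if $L$ is completely glued; (c) if $K$ has positive characteristic $p$, then $I_{L,\rho}$ is a set-theoretic complete intersection on binomials if and only if $L$ is completely $p$-glued.
   Context: $\mathbb{N}$ is the set of nonnegative integers. A lattice is a finitely generated free abelian group; a sublattice $L\subset\mathbb{Z}^m$ is positive if $L\cap\mathbb{N}^m=\{\mathbf 0\}$. A partial character $(L,\rho)$ on $\mathbb{Z}^m$ is a homomorphism $\rho$ from a sublattice $L\subset\mathbb{Z}^m$ to $K^*=K\setminus\{0\}$. For $\alpha\in\mathbb{Z}^m$ write $\alpha=\alpha^+-\alpha^-$ with $\alpha^+,\alpha^-\in\mathbb{N}^m$ the positive and negative parts. The lattice ideal is $I_{L,\rho}=(\mathbf{x}^{\alpha^+}-\rho(\alpha)\mathbf{x}^{\alpha^-} : \alpha\in L)\subset K[x_1,\dots,x_m]$. An ideal is a complete intersection if its minimal number of generators equals its height. A binomial ideal $I$ is a set-theoretic complete intersection on binomials if there exist $r=\mathrm{height}(I)$ binomials $F_1,\dots,F_r$ with $\mathrm{rad}(I)=\mathrm{rad}(F_1,\dots,F_r)$. Semigroups: finitely generated, cancellative, abelian semigroups with no invertible elements are regarded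 as subsemigroups $\mathbb{N}A$ (the set of $\mathbb{N}$-combinations) generated by a finite family $A=\{\mathbf a_1,\dots,\mathbf a_m\}$ in a group $\mathbb{Z}^n\oplus T$, $T$ a finite abelian group, with $\mathbb{N}A\cap(-\mathbb{N}A)=\{\mathbf 0\}$. For $E\subset\{1,\dots,m\}$, $A^E=\{\mathbf a_i: i\in E\}$, $\mathbb{N}A^E$ and $\mathbb{Z}A^E$ are the semigroup and group generated by $A^E$. For a prime $p$ and a semigroup $S\subset\mathbb{Z}^n\oplus T$, $(S:p^\infty)=\{\mathbf b\in\mathbb{Z}^n\oplus T : p^k\mathbf b\in S\text{ for some }k\in\mathbb{N}\}$. Let $E_1,E_2$ be nonempty disjoint subsets of $\{1,\dots,m\}$ with union $\{1,\dots,m\}$. $\mathbb{N}A$ is the gluing (resp. the $p$-gluing) of $\mathbb{N}A^{E_1}$ and $\mathbb{N}A^{E_2}$ if there is a nonzero $\mathbf a\in\mathbb{N}A^{E_1}\cap\mathbb{N}A^{E_2}$ (resp. a nonzero $\mathbf a\in((\mathbb{N}A^{E_1}\cap\mathbb{N}A^{E_2}):p^\infty)$) such that $\mathbb{Z}\mathbf a=\mathbb{Z}A^{E_1}\cap\mathbb{Z}A^{E_2}$. Elements $\mathbf a_1,\dots,\mathbf a_s$ of $\mathbb{Z}^n\oplus T$ are linearly independent if $\sum n_i\mathbf a_i=0$ with $n_i\in\mathbb{Z}$ implies all $n_i=0$. A semigroup is completely glued (resp. completely $p$-glued) if it belongs to the smallest class of finitely generated, cancellative, abelian semigroups with no invertible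 elements that includes all semigroups generated by linearly independent elements and is closed under gluing (resp. $p$-gluing). A lattice $L\subset\mathbb{Z}^m$ is completely glued (resp. completely $p$-glued) if the associated semigroup, generated by $\mathbf e_i+L$ ($1\le i\le m$, $\mathbf e_i$ the canonical basis vectors) in $\mathbb{Z}^m/L$, is completely glued (resp. completely $p$-glued). *)

theory Defs
  imports
    "HOL-Algebra.Free_Abelian_Groups"
    "HOL-Algebra.Generated_Groups"
    "HOL-Computational_Algebra.Computational_Algebra"
    "HOL-Library.Extended_Nat"
    "HOL-Library.Poly_Mapping"
begin

subsection \<open>Ideals of a commutative ring\<close>

text \<open>
  Ideals are the submodules of the ring regarded as a module over itself:
  \<open>module.subspace (*)\<close> is the predicate of being an ideal and \<open>module.span (*) S\<close> is the
  ideal generated by \<open>S\<close>.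
\<close>

lemma module_self: "module ((*) :: 'a::comm_ring_1 \<Rightarrow> 'a \<Rightarrow> 'a)"
  by unfold_locales (simp_all add: algebra_simps)

definition prime_ideal :: "'a::comm_ring_1 set \<Rightarrow> bool" where
  "prime_ideal P \<longleftrightarrow> module.subspace (*) P \<and> P \<noteq> UNIV \<and>
     (\<forall>a b. a * b \<in> P \<longrightarrow> a \<in> P \<or> b \<in> P)"

definition ideal_radical :: "'a::comm_ring_1 set \<Rightarrow> 'a set" where
  "ideal_radical I = {f. \<exists>n. f ^ n \<in> I}"

definition prime_height :: "'a::comm_ring_1 set \<Rightarrow> enat" where
  "prime_height P = Sup {enat n | n. \<exists>c :: nat \<Rightarrow> 'a set.
     (\<forall>i\<le>n. prime_ideal (c i)) \<and> (\<forall>i<n. c i \<subset> c (Suc i)) \<and> c n = P}"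

definition ideal_height :: "'a::comm_ring_1 set \<Rightarrow> enat" where
  "ideal_height I = Inf {prime_height P | P. prime_ideal P \<and> I \<subseteq> P}"

definition min_number_of_generators :: "'a::comm_ring_1 set \<Rightarrow> enat" where
  "min_number_of_generators I = Inf {enat (card S) | S. finite S \<and> module.span (*) S = I}"

definition complete_intersection :: "'a::comm_ring_1 set \<Rightarrow> bool" where
  "complete_intersection I \<longleftrightarrow> min_number_of_generators I = ideal_height I"


subsection \<open>Lattice ideals\<close>

text \<open>
  With variables indexed by a finite type \<open>'m\<close>, the group \<open>\<int>\<^sup>m\<close> is \<open>'m \<Rightarrow>\<^sub>0 int\<close>, exponent vectors
  are elements of \<open>'m \<Rightarrow>\<^sub>0 nat\<close>, and the polynomial ring over \<open>'k\<close> is \<open>('m \<Rightarrow>\<^sub>0 nat) \<Rightarrow>\<^sub>0 'k\<close> with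
  the convolution product; \<open>Poly_Mapping.single u c\<close> is the term \<open>c x\<^sup>u\<close>.
\<close>

text \<open>At most two terms, following Eisenbud and Sturmfels.\<close>

definition is_binomial :: "(('m \<Rightarrow>\<^sub>0 nat) \<Rightarrow>\<^sub>0 'k::zero) \<Rightarrow> bool" where
  "is_binomial f \<longleftrightarrow> card (Poly_Mapping.keys f) \<le> 2"

text \<open>The \<open>F\<^sub>i\<close> form a family, so repetitions in \<open>Fs\<close> are allowed.\<close>

definition stci_on_binomials :: "(('m \<Rightarrow>\<^sub>0 nat) \<Rightarrow>\<^sub>0 'k::comm_ring_1) set \<Rightarrow> bool" where
  "stci_on_binomials I \<longleftrightarrow>
     (\<exists>Fs. enat (length Fs) = ideal_height I \<and> (\<forall>F\<in>set Fs. is_binomial F) \<and>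
        ideal_radical I = ideal_radical (module.span (*) (set Fs)))"

definition positive_lattice :: "('m \<Rightarrow>\<^sub>0 int) set \<Rightarrow> bool" where
  "positive_lattice L \<longleftrightarrow>
     L \<inter> {\<alpha>. \<forall>i. 0 \<le> Poly_Mapping.lookup \<alpha> i} = {0}"

definition partial_character ::
  "('m \<Rightarrow>\<^sub>0 int) set \<Rightarrow> (('m \<Rightarrow>\<^sub>0 int) \<Rightarrow> 'k::field) \<Rightarrow> bool" where
  "partial_character L \<rho> \<longleftrightarrow>
     subgroup L (free_Abelian_group UNIV) \<and> (\<forall>\<alpha>\<in>L. \<rho> \<alpha> \<noteq> 0) \<and>
     (\<forall>\<alpha>\<in>L. \<forall>\<beta>\<in>L. \<rho> (\<alpha> + \<beta>) = \<rho> \<alpha> * \<rho> \<beta>)"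

text \<open>Truncation by \<^const>\<open>nat\<close> takes the positive part of each coordinate.\<close>

definition pos_part :: "('m \<Rightarrow>\<^sub>0 int) \<Rightarrow> ('m \<Rightarrow>\<^sub>0 nat)" where
  "pos_part \<alpha> = Poly_Mapping.map nat \<alpha>"

definition neg_part :: "('m \<Rightarrow>\<^sub>0 int) \<Rightarrow> ('m \<Rightarrow>\<^sub>0 nat)" where
  "neg_part \<alpha> = pos_part (- \<alpha>)"

definition lattice_ideal ::
  "('m \<Rightarrow>\<^sub>0 int) set \<Rightarrow> (('m \<Rightarrow>\<^sub>0 int) \<Rightarrow> 'k::comm_ring_1) \<Rightarrow> (('m \<Rightarrow>\<^sub>0 nat) \<Rightarrow>\<^sub>0 'k) set" where
  "lattice_ideal L \<rho> = module.span (*)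
     {Poly_Mapping.single (pos_part \<alpha>) 1 - Poly_Mapping.single (neg_part \<alpha>) (\<rho> \<alpha>) | \<alpha>. \<alpha> \<in> L}"


subsection \<open>Gluings of semigroups\<close>

text \<open>
  Semigroups are subsets of a commutative group \<open>G\<close>, written multiplicatively: the combination
  \<open>\<Sum>\<^sub>i n\<^sub>i a\<^sub>i\<close> is \<open>\<Otimes>\<^bsub>G\<^esub>i\<in>E. A i [^]\<^bsub>G\<^esub> n i\<close>, and the element \<open>0\<close> is \<open>\<one>\<^bsub>G\<^esub>\<close>.
  The subgroup generated by the family is \<open>generate G (A ` E)\<close>.
\<close>

definition nat_span :: "('g, 'z) monoid_scheme \<Rightarrow> ('i \<Rightarrow> 'g) \<Rightarrow> 'i set \<Rightarrow> 'g set" where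
  "nat_span G A E = {(\<Otimes>\<^bsub>G\<^esub>i\<in>E. A i [^]\<^bsub>G\<^esub> n i) | n :: 'i \<Rightarrow> nat. True}"

definition lin_independent :: "('g, 'z) monoid_scheme \<Rightarrow> ('i \<Rightarrow> 'g) \<Rightarrow> 'i set \<Rightarrow> bool" where
  "lin_independent G A E \<longleftrightarrow>
     (\<forall>n :: 'i \<Rightarrow> int. (\<Otimes>\<^bsub>G\<^esub>i\<in>E. A i [^]\<^bsub>G\<^esub> n i) = \<one>\<^bsub>G\<^esub> \<longrightarrow> (\<forall>i\<in>E. n i = 0))"

definition no_invertibles :: "('g, 'z) monoid_scheme \<Rightarrow> 'g set \<Rightarrow> bool" where
  "no_invertibles G S \<longleftrightarrow> S \<inter> (m_inv G ` S) = {\<one>\<^bsub>G\<^esub>}"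

definition p_closure :: "('g, 'z) monoid_scheme \<Rightarrow> nat \<Rightarrow> 'g set \<Rightarrow> 'g set" where
  "p_closure G p S = {b \<in> carrier G. \<exists>k :: nat. b [^]\<^bsub>G\<^esub> (p ^ k) \<in> S}"

definition splitting :: "nat \<Rightarrow> nat set \<Rightarrow> nat set \<Rightarrow> bool" where
  "splitting m E1 E2 \<longleftrightarrow> E1 \<noteq> {} \<and> E2 \<noteq> {} \<and> E1 \<inter> E2 = {} \<and> E1 \<union> E2 = {1..m}"

definition is_gluing ::
  "('g, 'z) monoid_scheme \<Rightarrow> (nat \<Rightarrow> 'g) \<Rightarrow> nat set \<Rightarrow> nat set \<Rightarrow> bool" where
  "is_gluing G A E1 E2 \<longleftrightarrow>
     (\<exists>a \<in> nat_span G A E1 \<inter> nat_span G A E2. a \<noteq> \<one>\<^bsub>G\<^esub> \<and>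
        generate G {a} = generate G (A ` E1) \<inter> generate G (A ` E2))"

definition is_p_gluing ::
  "('g, 'z) monoid_scheme \<Rightarrow> nat \<Rightarrow> (nat \<Rightarrow> 'g) \<Rightarrow> nat set \<Rightarrow> nat set \<Rightarrow> bool" where
  "is_p_gluing G p A E1 E2 \<longleftrightarrow>
     (\<exists>a \<in> p_closure G p (nat_span G A E1 \<inter> nat_span G A E2). a \<noteq> \<one>\<^bsub>G\<^esub> \<and>
        generate G {a} = generate G (A ` E1) \<inter> generate G (A ` E2))"

text \<open>
  The two classes consist of semigroups, not of generating families: the families exhibiting
  \<open>S\<close>, \<open>S\<^sub>1\<close>, \<open>S\<^sub>2\<close> as a gluing need not be the ones used in earlier steps.  It suffices to form the
  classes inside one group \<open>G\<close>, since both parts of a gluing are contained in the glued semigroup.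
\<close>

inductive completely_glued :: "('g, 'z) monoid_scheme \<Rightarrow> 'g set \<Rightarrow> bool"
  for G (structure) where
  independent:
    "A \<in> {1..s::nat} \<rightarrow> carrier G \<Longrightarrow> lin_independent G A {1..s} \<Longrightarrow>
     completely_glued G (nat_span G A {1..s})"
| glue:
    "A \<in> {1..m} \<rightarrow> carrier G \<Longrightarrow> no_invertibles G (nat_span G A {1..m}) \<Longrightarrow>
     splitting m E1 E2 \<Longrightarrow>
     completely_glued G (nat_span G A E1) \<Longrightarrow> completely_glued G (nat_span G A E2) \<Longrightarrow>
     is_gluing G A E1 E2 \<Longrightarrow> completely_glued G (nat_span G A {1..m})"

inductive completely_p_glued :: "('g, 'z) monoid_scheme \<Rightarrow> nat \<Rightarrow> 'g set \<Rightarrow> bool"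
  for G (structure) and p where
  independent:
    "A \<in> {1..s::nat} \<rightarrow> carrier G \<Longrightarrow> lin_independent G A {1..s} \<Longrightarrow>
     completely_p_glued G p (nat_span G A {1..s})"
| glue:
    "A \<in> {1..m} \<rightarrow> carrier G \<Longrightarrow> no_invertibles G (nat_span G A {1..m}) \<Longrightarrow>
     splitting m E1 E2 \<Longrightarrow>
     completely_p_glued G p (nat_span G A E1) \<Longrightarrow> completely_p_glued G p (nat_span G A E2) \<Longrightarrow>
     is_p_gluing G p A E1 E2 \<Longrightarrow> completely_p_glued G p (nat_span G A {1..m})"


subsection \<open>The semigroup of a lattice\<close>

abbreviation lattice_quotient :: "('m \<Rightarrow>\<^sub>0 int) set \<Rightarrow> ('m \<Rightarrow>\<^sub>0 int) set monoid" where
  "lattice_quotient L \<equiv> free_Abelian_group UNIV Mod L"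

text \<open>\<^term>\<open>frag_of i\<close> is the canonical basis vector \<open>\<^bold>e\<^sub>i\<close>.\<close>

definition lattice_semigroup :: "('m::finite \<Rightarrow>\<^sub>0 int) set \<Rightarrow> ('m \<Rightarrow>\<^sub>0 int) set set" where
  "lattice_semigroup L =
     nat_span (lattice_quotient L) (\<lambda>i. L #>\<^bsub>free_Abelian_group UNIV\<^esub> frag_of i) UNIV"

definition completely_glued_lattice :: "('m::finite \<Rightarrow>\<^sub>0 int) set \<Rightarrow> bool" where
  "completely_glued_lattice L \<longleftrightarrow> completely_glued (lattice_quotient L) (lattice_semigroup L)"

definition completely_p_glued_lattice :: "nat \<Rightarrow> ('m::finite \<Rightarrow>\<^sub>0 int) set \<Rightarrow> bool" where
  "completely_p_glued_lattice p L \<longleftrightarrow>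
     completely_p_glued (lattice_quotient L) p (lattice_semigroup L)"

end

theory Submission
  imports Defs "HOL-Library.Cardinality"
begin

text \<open>
  Let \<open>q = 1\<close> for (a) and (b), and \<open>q = p\<close> for (c).  Everything is expressed through \<^emph>\<open>connecting\<close> bases: linearly
  independent finite sets \<open>B \<subseteq> L\<close> such that any two points of \<open>\<nat>\<^sup>m\<close> that are congruent modulo \<open>L\<close> are joined, after
  multiplication by a power of \<open>q\<close>, by a path in \<open>\<nat>\<^sup>m\<close> whose steps are elements of \<open>\<plusminus>B\<close>.

  If \<open>B\<close> is connecting, telescoping along the paths puts a \<open>q\<^sup>k\<close>-th power of every binomial
  \<open>f\<^sub>\<alpha> = x\<^sup>\<alpha>\<^sup>+ - \<rho>(\<alpha>) x\<^sup>\<alpha>\<^sup>-\<close> into the ideal generated by the \<open>f\<^sub>b\<close>, \<open>b \<in> B\<close>, and \<open>B\<close> has as many elements as the rank of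
  \<open>L\<close>, which is the height of the lattice ideal.  Conversely, suppose that \<open>f\<^sub>b\<close>, \<open>b \<in> B\<close>, generate the lattice ideal up
  to radical and that \<open>B\<close> has at most \<open>rank L\<close> elements.  Setting the variables of a set \<open>J\<close> to zero in an equation
  expressing a power of \<open>f\<^sub>\<alpha>\<close>, and comparing ranks, shows that no set \<open>J\<close> is crossed by \<open>|J|\<close> elements of \<open>B\<close>.
  A family with this property splits: one element has its positive part on one side and its negative part on the
  other side of a partition of the variables, and each remaining element lies on one side.  By recursion this is a tree of
  (\<open>p\<close>-)gluings, and every such tree has a connecting basis.

  A semigroup may be presented by different families at different stages of gluing, so one also has to see that
  the existence of a connecting basis depends only on the semigroup; it suffices to add or remove one redundant
  generator.
\<close>

subsection \<open>Families of pairs of sets with Hall-type crossing bounds\<close>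

text \<open>Two mismatches shape the proof. First, a splitting controls relations only up to
  multiplication by powers of \<open>q\<close>, while a \<open>p\<close>-gluing asks for an exact
  equality of groups. Therefore the generators are first raised to a power of \<open>q\<close> so
  large that the relation lattice becomes saturated, where the equality is exact; the original
  generators are then restored one at a time, each by a \<open>p\<close>-gluing with a free
  semigroup of rank one. Second, removing a redundant generator \<open>a\<close> is easy for
  \<open>q = 1\<close>, because a path starting at \<open>a\<close> must at once use a step that
  eliminates \<open>a\<close>. For larger \<open>q\<close> the path starts at a multiple of
  \<open>a\<close> and need not do so. There \<open>a\<close> is removed from the gluing tree of the
  smallest face containing it: inside this face a multiple of \<open>a\<close> is congruent to a
  vector with all coordinates positive, and large multiples of such a vector turn integer vectors
  into nonnegative ones.\<close>

definition crosses :: "('b \<Rightarrow> 'i set) \<Rightarrow> ('b \<Rightarrow> 'i set) \<Rightarrow> 'i set \<Rightarrow> 'b \<Rightarrow> bool" where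
  "crosses p n J b \<longleftrightarrow> p b \<inter> J \<noteq> {} \<and> n b \<inter> J \<noteq> {}"

text \<open>The sign condition of Fischer and Shapiro for mixed dominating matrices: no square submatrix has
  entries of both signs in every row.\<close>

definition dominating :: "('b \<Rightarrow> 'i set) \<Rightarrow> ('b \<Rightarrow> 'i set) \<Rightarrow> 'i set \<Rightarrow> 'b set \<Rightarrow> bool" where
  "dominating p n E B \<longleftrightarrow> finite E \<and> finite B \<and>
     (\<forall>b\<in>B. p b \<union> n b \<subseteq> E \<and> p b \<noteq> {} \<and> n b \<noteq> {}) \<and>
     (\<forall>J\<subseteq>E. J \<noteq> {} \<longrightarrow> card {b\<in>B. crosses p n J b} < card J)"

text \<open>The obstruction to adding a row with positive part \<open>P\<close> and negative part
  \<open>N\<close>: it would cross \<open>J\<close>, and then at least \<open>card J\<close> rows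
  would cross \<open>J\<close>.\<close>

definition linked ::
  "('b \<Rightarrow> 'i set) \<Rightarrow> ('b \<Rightarrow> 'i set) \<Rightarrow> 'i set \<Rightarrow> 'b set \<Rightarrow> 'i set \<Rightarrow> 'i set \<Rightarrow> bool" where
  "linked p n E B P N \<longleftrightarrow>
     (\<exists>J\<subseteq>E. J \<inter> P \<noteq> {} \<and> J \<inter> N \<noteq> {} \<and> card J \<le> Suc (card {b\<in>B. crosses p n J b}))"

definition splits_at ::
  "('b \<Rightarrow> 'i set) \<Rightarrow> ('b \<Rightarrow> 'i set) \<Rightarrow> 'i set \<Rightarrow> 'b set \<Rightarrow> 'b \<Rightarrow> 'i set \<Rightarrow> 'i set \<Rightarrow> bool" where
  "splits_at p n E B \<beta> E1 E2 \<longleftrightarrow> \<beta> \<in> B \<and> E1 \<union> E2 = E \<and> E1 \<inter> E2 = {} \<and>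
     (p \<beta> \<subseteq> E1 \<and> n \<beta> \<subseteq> E2 \<or> n \<beta> \<subseteq> E1 \<and> p \<beta> \<subseteq> E2) \<and>
     (\<forall>b\<in>B - {\<beta>}. p b \<union> n b \<subseteq> E1 \<or> p b \<union> n b \<subseteq> E2)"

text \<open>The two ways in which a new row with parts \<open>P\<close> and \<open>N\<close> fits a
  splitting: it becomes the splitting row of a partition that cuts no old row, or it lies on one
  side of a splitting at an old row.\<close>

definition separated ::
  "('b \<Rightarrow> 'i set) \<Rightarrow> ('b \<Rightarrow> 'i set) \<Rightarrow> 'i set \<Rightarrow> 'b set \<Rightarrow> 'i set \<Rightarrow> 'i set \<Rightarrow> bool" where
  "separated p n E B P N \<longleftrightarrow>
     (\<exists>E1 E2. E1 \<union> E2 = E \<and> E1 \<inter> E2 = {} \<and> (\<forall>b\<in>B. p b \<union> n b \<subseteq> E1 \<or> p b \<union> n b \<subseteq> E2) \<and>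
        P \<subseteq> E1 \<and> N \<subseteq> E2) \<or>
     (\<exists>\<beta> E1 E2. splits_at p n E B \<beta> E1 E2 \<and> P \<union> N \<subseteq> E1)"

lemma separatedI1:
  assumes "\<And>b. b \<in> B \<Longrightarrow> p b \<union> n b \<subseteq> E1 \<or> p b \<union> n b \<subseteq> E2" "P \<subseteq> E1" "N \<subseteq> E2"
    "E1 \<union> E2 = E" "E1 \<inter> E2 = {}"
  shows "separated p n E B P N"
  unfolding separated_def using assms by (intro disjI1 exI conjI) auto

lemma splits_at_subset: "splits_at p n E B \<beta> E1 E2 \<Longrightarrow> E1 \<subseteq> E"
  by (auto simp: splits_at_def)

lemma splits_at_sym: "splits_at p n E B \<beta> E1 E2 \<Longrightarrow> splits_at p n E B \<beta> E2 E1"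
  by (auto simp: splits_at_def)

lemma separated_sym: "separated p n E B P N \<Longrightarrow> separated p n E B N P"
  unfolding separated_def by (metis Int_commute Un_commute)

lemma linkedE:
  assumes "linked p n E B P N"
  obtains J where "J \<subseteq> E" "J \<inter> P \<noteq> {}" "J \<inter> N \<noteq> {}"
    "card J \<le> Suc (card {b\<in>B. crosses p n J b})"
  using assms unfolding linked_def by (elim exE conjE)

lemma linkedI:
  assumes "J \<subseteq> E" "J \<inter> P \<noteq> {}" "J \<inter> N \<noteq> {}"
    "card J \<le> Suc (card {b\<in>B. crosses p n J b})"
  shows "linked p n E B P N"
  unfolding linked_def using assms by (intro exI[of _ J] conjI)

lemma linked_sym: "linked p n E B P N \<Longrightarrow> linked p n E B N P"
  unfolding linked_def by blast

lemma dominating_sub: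
  assumes "dominating p n E B" "E' \<subseteq> E"
  shows "dominating p n E' {b\<in>B. b \<noteq> \<beta> \<and> p b \<union> n b \<subseteq> E'}"
proof -
  have fin: "finite E" "finite B" using assms by (auto simp: dominating_def)
  have "card {b\<in>{b\<in>B. b \<noteq> \<beta> \<and> p b \<union> n b \<subseteq> E'}. crosses p n J b} < card J" if "J \<subseteq> E'" "J \<noteq> {}" for J
  proof -
    have "card {b\<in>{b\<in>B. b \<noteq> \<beta> \<and> p b \<union> n b \<subseteq> E'}. crosses p n J b} \<le> card {b\<in>B. crosses p n J b}"
      by (rule card_mono) (use fin in auto)
    also have "\<dots> < card J" using assms that by (auto simp: dominating_def)
    finally show ?thesis .
  qed
  then show ?thesis using assms fin finite_subset unfolding dominating_def by auto
qed

text \<open>Only one of the two parts of \<open>\<beta>\<close> lies in \<open>E1\<close>, and by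
  the last assumption it lies in \<open>F1\<close>. Hence all of \<open>E2\<close> can join
  \<open>F1\<close> without cutting \<open>\<beta>\<close>.\<close>

lemma splits_at_lift:
  assumes s: "splits_at p n E B \<beta> E1 E2" and B1: "B1 = {b\<in>B. b \<noteq> \<beta> \<and> p b \<union> n b \<subseteq> E1}"
    and t: "splits_at p n E1 B1 \<gamma> F1 F2" and X: "(p \<beta> \<union> n \<beta>) \<inter> E1 \<subseteq> F1"
  shows "splits_at p n E B \<gamma> (F1 \<union> E2) F2"
proof -
  have "\<gamma> \<in> B" "F1 \<union> E2 \<union> F2 = E" "(F1 \<union> E2) \<inter> F2 = {}"
    using s t B1 by (auto simp: splits_at_def)
  moreover have "p \<gamma> \<subseteq> F1 \<union> E2 \<and> n \<gamma> \<subseteq> F2 \<or> n \<gamma> \<subseteq> F1 \<union> E2 \<and> p \<gamma> \<subseteq> F2"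
    using t by (auto simp: splits_at_def)
  moreover have "p b \<union> n b \<subseteq> F1 \<union> E2 \<or> p b \<union> n b \<subseteq> F2" if "b \<in> B - {\<gamma>}" for b
  proof (cases "b = \<beta>")
    case True
    then show ?thesis using X s by (auto simp: splits_at_def)
  next
    case False
    then have "p b \<union> n b \<subseteq> E1 \<or> p b \<union> n b \<subseteq> E2" using s that by (auto simp: splits_at_def)
    then show ?thesis using that False B1 t by (auto simp: splits_at_def)
  qed
  ultimately show ?thesis unfolding splits_at_def by blast
qed

text \<open>The union of the two witnesses is crossed by \<open>\<beta>\<close> in addition to the
  rows crossing either of them. This extra row pays for one of the two units by which the witnesses
  may exceed their numbers of crossing rows.\<close>

lemma linked_compose:
  assumes d: "dominating p n E B" and s: "splits_at p n E B \<beta> E1 E2"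
    and 1: "linked p n E1 {b\<in>B. b \<noteq> \<beta> \<and> p b \<union> n b \<subseteq> E1} P ((p \<beta> \<union> n \<beta>) \<inter> E1)"
    and 2: "linked p n E2 {b\<in>B. b \<noteq> \<beta> \<and> p b \<union> n b \<subseteq> E2} N ((p \<beta> \<union> n \<beta>) \<inter> E2)"
  shows "linked p n E B P N"
proof -
  let ?B = "\<lambda>F. {b\<in>B. b \<noteq> \<beta> \<and> p b \<union> n b \<subseteq> F}"
  have fin: "finite E" "finite B" using d by (auto simp: dominating_def)
  obtain J1 where J1: "J1 \<subseteq> E1" "J1 \<inter> P \<noteq> {}" "J1 \<inter> ((p \<beta> \<union> n \<beta>) \<inter> E1) \<noteq> {}"
    "card J1 \<le> Suc (card {b\<in>?B E1. crosses p n J1 b})" using 1 unfolding linked_def by blast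
  obtain J2 where J2: "J2 \<subseteq> E2" "J2 \<inter> N \<noteq> {}" "J2 \<inter> ((p \<beta> \<union> n \<beta>) \<inter> E2) \<noteq> {}"
    "card J2 \<le> Suc (card {b\<in>?B E2. crosses p n J2 b})" using 2 unfolding linked_def by blast
  let ?M1 = "{b\<in>?B E1. crosses p n J1 b}" and ?M2 = "{b\<in>?B E2. crosses p n J2 b}"
  have E: "E1 \<inter> E2 = {}" "E1 \<union> E2 = E" "\<beta> \<in> B" using s by (auto simp: splits_at_def)
  have disj: "?M1 \<inter> ?M2 = {}" using E by (auto simp: crosses_def)
  have "crosses p n (J1 \<union> J2) \<beta>"
    using J1(3) J2(3) s E unfolding splits_at_def crosses_def by blast
  then have sub: "insert \<beta> (?M1 \<union> ?M2) \<subseteq> {b\<in>B. crosses p n (J1 \<union> J2) b}"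
    using E by (auto simp: crosses_def)
  have "card (J1 \<union> J2) \<le> card J1 + card J2" by (rule card_Un_le)
  also have "\<dots> \<le> Suc (Suc (card ?M1 + card ?M2))" using J1(4) J2(4) by linarith
  also have "card ?M1 + card ?M2 = card (?M1 \<union> ?M2)"
    using disj fin by (subst card_Un_disjoint) auto
  also have "Suc (card (?M1 \<union> ?M2)) = card (insert \<beta> (?M1 \<union> ?M2))"
    using fin by (subst card_insert_disjoint) auto
  also have "\<dots> \<le> card {b\<in>B. crosses p n (J1 \<union> J2) b}" by (rule card_mono[OF _ sub]) (use fin in auto)
  finally have "card (J1 \<union> J2) \<le> Suc (card {b\<in>B. crosses p n (J1 \<union> J2) b})" by simp
  then show ?thesis unfolding linked_def using J1 J2 E by (intro exI[of _ "J1 \<union> J2"]) auto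
qed

text \<open>If the part of \<open>\<beta>\<close> in \<open>E1\<close> can be cut off from
  \<open>P\<close> and \<open>N\<close>, then \<open>E2\<close> is moved to the side of
  \<open>P\<close> and \<open>N\<close>, and \<open>\<beta>\<close> remains the splitting
  row.\<close>

lemma separated_via_side:
  assumes s: "splits_at p n E B \<beta> E1 E2" and PN: "P \<subseteq> E" "N \<subseteq> E"
    and sep: "separated p n E1 {b\<in>B. b \<noteq> \<beta> \<and> p b \<union> n b \<subseteq> E1}
      ((P \<union> N) \<inter> E1) ((p \<beta> \<union> n \<beta>) \<inter> E1)"
  shows "separated p n E B P N"
proof -
  have E: "E1 \<inter> E2 = {}" "E1 \<union> E2 = E" "\<beta> \<in> B" using s by (auto simp: splits_at_def)
  from sep consider
    (a) F1 F2 where "F1 \<union> F2 = E1" "F1 \<inter> F2 = {}"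
      "\<forall>b\<in>{b\<in>B. b \<noteq> \<beta> \<and> p b \<union> n b \<subseteq> E1}. p b \<union> n b \<subseteq> F1 \<or> p b \<union> n b \<subseteq> F2"
      "(P \<union> N) \<inter> E1 \<subseteq> F1" "(p \<beta> \<union> n \<beta>) \<inter> E1 \<subseteq> F2"
    | (b) \<gamma> F1 F2 where "splits_at p n E1 {b\<in>B. b \<noteq> \<beta> \<and> p b \<union> n b \<subseteq> E1} \<gamma> F1 F2"
       "(P \<union> N) \<inter> E1 \<union> (p \<beta> \<union> n \<beta>) \<inter> E1 \<subseteq> F1"
    unfolding separated_def by blast
  then show ?thesis
  proof cases
    case a
    have "p b \<union> n b \<subseteq> F1 \<union> E2 \<or> p b \<union> n b \<subseteq> F2" if "b \<in> B - {\<beta>}" for b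
      using s that a(3) unfolding splits_at_def by blast
    moreover have "p \<beta> \<subseteq> F1 \<union> E2 \<and> n \<beta> \<subseteq> F2 \<or> n \<beta> \<subseteq> F1 \<union> E2 \<and> p \<beta> \<subseteq> F2"
    proof -
      have "p \<beta> \<subseteq> E1 \<and> n \<beta> \<subseteq> E2 \<or> n \<beta> \<subseteq> E1 \<and> p \<beta> \<subseteq> E2"
        using s by (simp add: splits_at_def)
      then show ?thesis using a(5) by blast
    qed
    ultimately have "splits_at p n E B \<beta> (F1 \<union> E2) F2"
      unfolding splits_at_def using E a(1,2) by blast
    moreover have "P \<union> N \<subseteq> F1 \<union> E2" using PN a(4) E by blast
    ultimately show ?thesis unfolding separated_def by blast
  next
    case b
    then have "splits_at p n E B \<gamma> (F1 \<union> E2) F2" using splits_at_lift[OF s refl] by blast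
    moreover have "P \<union> N \<subseteq> F1 \<union> E2" using PN b E by blast
    ultimately show ?thesis unfolding separated_def by blast
  qed
qed

text \<open>If on both sides \<open>N\<close> is cut off from \<open>P\<close> and from
  \<open>\<beta>\<close>, the two cuts combine to one of \<open>E\<close> that leaves
  \<open>\<beta>\<close> whole on the side of \<open>P\<close>. If on one side the cut is instead a
  splitting at another row, it extends to \<open>E\<close> directly.\<close>

lemma separated_via_both:
  assumes s: "splits_at p n E B \<beta> E1 E2" and PN: "P \<subseteq> E" "N \<subseteq> E"
    and 1: "separated p n E1 {b\<in>B. b \<noteq> \<beta> \<and> p b \<union> n b \<subseteq> E1}
      (N \<inter> E1) ((P \<union> (p \<beta> \<union> n \<beta>)) \<inter> E1)"
    and 2: "separated p n E2 {b\<in>B. b \<noteq> \<beta> \<and> p b \<union> n b \<subseteq> E2}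
      (N \<inter> E2) ((P \<union> (p \<beta> \<union> n \<beta>)) \<inter> E2)"
  shows "separated p n E B P N"
proof -
  have E: "E1 \<inter> E2 = {}" "E1 \<union> E2 = E" "\<beta> \<in> B" using s by (auto simp: splits_at_def)
  have side: "separated p n E B P N" if s: "splits_at p n E B \<beta> F1 F2"
    and t: "splits_at p n F1 {b\<in>B. b \<noteq> \<beta> \<and> p b \<union> n b \<subseteq> F1} \<gamma> G1 G2"
       "N \<inter> F1 \<union> (P \<union> (p \<beta> \<union> n \<beta>)) \<inter> F1 \<subseteq> G1" for F1 F2 \<gamma> G1 G2
  proof -
    have "splits_at p n E B \<gamma> (G1 \<union> F2) G2" using splits_at_lift[OF s refl t(1)] t(2) by blast
    moreover have "P \<union> N \<subseteq> G1 \<union> F2" using s PN t(2) unfolding splits_at_def by blast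
    ultimately show ?thesis unfolding separated_def by blast
  qed
  show ?thesis
  proof (cases "(\<exists>\<gamma> G1 G2. splits_at p n E1 {b\<in>B. b \<noteq> \<beta> \<and> p b \<union> n b \<subseteq> E1} \<gamma> G1 G2 \<and>
       N \<inter> E1 \<union> (P \<union> (p \<beta> \<union> n \<beta>)) \<inter> E1 \<subseteq> G1) \<or>
       (\<exists>\<gamma> G1 G2. splits_at p n E2 {b\<in>B. b \<noteq> \<beta> \<and> p b \<union> n b \<subseteq> E2} \<gamma> G1 G2 \<and>
       N \<inter> E2 \<union> (P \<union> (p \<beta> \<union> n \<beta>)) \<inter> E2 \<subseteq> G1)")
    case True
    then show ?thesis using side[OF s] side[OF splits_at_sym[OF s]] by blast
  next
    case False
    obtain F1 F2 where F: "F1 \<union> F2 = E1" "F1 \<inter> F2 = {}"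
      "\<forall>b\<in>{b\<in>B. b \<noteq> \<beta> \<and> p b \<union> n b \<subseteq> E1}. p b \<union> n b \<subseteq> F1 \<or> p b \<union> n b \<subseteq> F2"
      "N \<inter> E1 \<subseteq> F1" "(P \<union> (p \<beta> \<union> n \<beta>)) \<inter> E1 \<subseteq> F2"
      using 1 False unfolding separated_def by blast
    obtain G1 G2 where G: "G1 \<union> G2 = E2" "G1 \<inter> G2 = {}"
      "\<forall>b\<in>{b\<in>B. b \<noteq> \<beta> \<and> p b \<union> n b \<subseteq> E2}. p b \<union> n b \<subseteq> G1 \<or> p b \<union> n b \<subseteq> G2"
      "N \<inter> E2 \<subseteq> G1" "(P \<union> (p \<beta> \<union> n \<beta>)) \<inter> E2 \<subseteq> G2"
      using 2 False unfolding separated_def by blast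
    have "p b \<union> n b \<subseteq> F2 \<union> G2 \<or> p b \<union> n b \<subseteq> F1 \<union> G1" if "b \<in> B" for b
    proof (cases "b = \<beta>")
      case True
      then show ?thesis using F(5) G(5) s unfolding splits_at_def by blast
    next
      case False
      then have "p b \<union> n b \<subseteq> E1 \<or> p b \<union> n b \<subseteq> E2" using s that unfolding splits_at_def by blast
      then have "p b \<union> n b \<subseteq> F1 \<or> p b \<union> n b \<subseteq> F2 \<or> p b \<union> n b \<subseteq> G1 \<or> p b \<union> n b \<subseteq> G2"
        using F(3) G(3) that False by blast
      then show ?thesis by blast
    qed
    moreover have "P \<subseteq> F2 \<union> G2" "N \<subseteq> F1 \<union> G1" using PN E F(4,5) G(4,5) by blast+
    moreover have "F2 \<union> G2 \<union> (F1 \<union> G1) = E" "(F2 \<union> G2) \<inter> (F1 \<union> G1) = {}" using E F(1,2) G(1,2) by blast+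
    ultimately show ?thesis by (intro separatedI1)
  qed
qed

lemma linked_Un: "linked p n E B P (N \<union> N') \<Longrightarrow> linked p n E B P N \<or> linked p n E B P N'"
  unfolding linked_def by blast

lemma linked_mono: "linked p n E B P N \<Longrightarrow> P \<subseteq> P' \<Longrightarrow> N \<subseteq> N' \<Longrightarrow> linked p n E B P' N'"
  unfolding linked_def by (elim exE conjE, intro exI conjI) auto

text \<open>Induction on the number of rows. A row of \<open>B\<close> cannot be linked over the
  remaining rows, since this would violate the crossing bound, so the first claim for the remaining
  rows yields a splitting. For the first claim, a splitting row \<open>\<beta>\<close> reduces the
  question to its two sides, where links between \<open>P\<close>, \<open>N\<close> and the parts of
  \<open>\<beta>\<close> are compared.\<close>

lemma dominating_separated_and_split:
  assumes "dominating p n E B"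
  shows "(\<forall>P N. P \<subseteq> E \<longrightarrow> N \<subseteq> E \<longrightarrow> \<not> linked p n E B P N \<longrightarrow> separated p n E B P N) \<and>
    (B \<noteq> {} \<longrightarrow> (\<exists>\<beta> E1 E2. splits_at p n E B \<beta> E1 E2))"
  using assms
proof (induction "card B" arbitrary: E B rule: less_induct)
  case less
  note d = less.prems
  have IH: "separated p n E' B' P N" if "card B' < card B" "P \<subseteq> E'" "N \<subseteq> E'"
    "\<not> linked p n E' B' P N" "dominating p n E' B'" for E' B' P N
    using less.hyps[OF that(1,5)] that(2-4) by blast
  have fin: "finite E" "finite B" using d by (auto simp: dominating_def)
  have split: "\<exists>\<beta> E1 E2. splits_at p n E B \<beta> E1 E2" if ne: "B \<noteq> {}"
  proof -
    obtain \<beta> where \<beta>: "\<beta> \<in> B" using ne by blast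
    let ?B = "B - {\<beta>}"
    have c: "card ?B < card B" using fin \<beta> by (meson card_Diff1_less)
    have d': "dominating p n E ?B"
    proof -
      have "{b\<in>B. b \<noteq> \<beta> \<and> p b \<union> n b \<subseteq> E} = ?B" using d unfolding dominating_def by blast
      then show ?thesis using dominating_sub[OF d subset_refl, of \<beta>] by simp
    qed
    have sub: "p \<beta> \<subseteq> E" "n \<beta> \<subseteq> E" using d \<beta> by (auto simp: dominating_def)
    have "\<not> linked p n E ?B (p \<beta>) (n \<beta>)"
    proof
      assume "linked p n E ?B (p \<beta>) (n \<beta>)"
      then obtain J where J: "J \<subseteq> E" "J \<inter> p \<beta> \<noteq> {}" "J \<inter> n \<beta> \<noteq> {}"
        "card J \<le> Suc (card {b\<in>?B. crosses p n J b})" unfolding linked_def by blast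
      have "{b\<in>B. crosses p n J b} = insert \<beta> {b\<in>?B. crosses p n J b}"
        using \<beta> J(2,3) by (auto simp: crosses_def)
      then have "card {b\<in>B. crosses p n J b} = Suc (card {b\<in>?B. crosses p n J b})"
        using fin by simp
      moreover have "J \<noteq> {}" using J(2) by blast
      then have "card {b\<in>B. crosses p n J b} < card J"
        using J(1) d unfolding dominating_def by blast
      ultimately show False using J(4) by linarith
    qed
    from IH[OF c sub this d'] show ?thesis
    proof (unfold separated_def, elim disjE exE conjE)
      fix E1 E2 assume "E1 \<union> E2 = E" "E1 \<inter> E2 = {}" "\<forall>b\<in>?B. p b \<union> n b \<subseteq> E1 \<or> p b \<union> n b \<subseteq> E2"
        "p \<beta> \<subseteq> E1" "n \<beta> \<subseteq> E2"
      then have "splits_at p n E B \<beta> E1 E2" using \<beta> unfolding splits_at_def by blast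
      then show ?thesis by blast
    next
      fix \<gamma> E1 E2 assume "splits_at p n E ?B \<gamma> E1 E2" "p \<beta> \<union> n \<beta> \<subseteq> E1"
      then have "splits_at p n E B \<gamma> E1 E2" unfolding splits_at_def by blast
      then show ?thesis by blast
    qed
  qed
  have "separated p n E B P N" if 1: "P \<subseteq> E" "N \<subseteq> E" "\<not> linked p n E B P N" for P N
  proof -
    show ?thesis
    proof (cases "B = {}")
      case True
      have "P \<inter> N = {}"
      proof (rule ccontr)
        assume "P \<inter> N \<noteq> {}"
        then obtain c where "c \<in> P" "c \<in> N" by blast
        then have "linked p n E B P N"
          unfolding linked_def using 1 by (intro exI[of _ "{c}"]) auto
        then show False using 1 by blast
      qed
      then show ?thesis unfolding separated_def using True 1 by (intro disjI1 exI[of _ P] exI[of _ "E - P"]) auto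
    next
      case False
      then obtain \<beta> E1 E2 where s: "splits_at p n E B \<beta> E1 E2" using split by blast
      have E: "E1 \<inter> E2 = {}" "E1 \<union> E2 = E" "\<beta> \<in> B" using s by (auto simp: splits_at_def)
      let ?B = "\<lambda>F. {b\<in>B. b \<noteq> \<beta> \<and> p b \<union> n b \<subseteq> F}" and ?X = "p \<beta> \<union> n \<beta>"
      let ?l = "\<lambda>F Q. linked p n F (?B F) (Q \<inter> F) (?X \<inter> F)"
      have c: "card (?B F) < card B" for F
        by (rule psubset_card_mono) (use fin E in auto)
      have sep: "separated p n F (?B F) Q R"
        if "F \<subseteq> E" "Q \<subseteq> F" "R \<subseteq> F" "\<not> linked p n F (?B F) Q R" for F Q R
        using IH[OF c that(2-4) dominating_sub[OF d that(1)]] .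
      have mono: "linked p n E B P' N'" if l: "linked p n F (?B F) P' N'" "F \<subseteq> E" for F P' N'
      proof -
        obtain J where J: "J \<subseteq> F" "J \<inter> P' \<noteq> {}" "J \<inter> N' \<noteq> {}"
          "card J \<le> Suc (card {b\<in>?B F. crosses p n J b})"
          using l(1) by (rule linkedE)
        have "card {b\<in>?B F. crosses p n J b} \<le> card {b\<in>B. crosses p n J b}"
          by (rule card_mono) (use fin in auto)
        then show ?thesis using J l(2) by (intro linkedI[of J]) auto
      qed
      have sub: "linked p n E B P N" if "linked p n E B (P \<inter> F) (N \<inter> F')" for F F'
        by (rule linked_mono[OF that]) auto
      have noPN: "\<not> linked p n F (?B F) (N \<inter> F) (P \<inter> F)" if "F \<subseteq> E" for F
      proof
        assume "linked p n F (?B F) (N \<inter> F) (P \<inter> F)"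
        then have "linked p n E B (P \<inter> F) (N \<inter> F)" using mono that linked_sym by blast
        then show False using sub 1 by blast
      qed
      have comp: "\<not> (?l E1 P \<and> ?l E2 N)" "\<not> (?l E1 N \<and> ?l E2 P)"
      proof -
        show "\<not> (?l E1 P \<and> ?l E2 N)" using linked_compose[OF d s] sub 1(3) by blast
        show "\<not> (?l E1 N \<and> ?l E2 P)" using linked_compose[OF d splits_at_sym[OF s]] sub 1(3) by blast
      qed
      have caseA: "separated p n E B P N" if s: "splits_at p n E B \<beta> F F'"
        and no: "\<not> ?l F P" "\<not> ?l F N" for F F'
      proof (rule separated_via_side[OF s])
        show "P \<subseteq> E" "N \<subseteq> E" using 1 by auto
        have FE: "F \<subseteq> E" by (rule splits_at_subset[OF s])
        have "\<not> linked p n F (?B F) ((P \<union> N) \<inter> F) (?X \<inter> F)"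
        proof
          assume "linked p n F (?B F) ((P \<union> N) \<inter> F) (?X \<inter> F)"
          then have "linked p n F (?B F) (P \<inter> F \<union> N \<inter> F) (?X \<inter> F)"
            by (simp only: Int_Un_distrib2)
          from linked_Un[OF linked_sym[OF this]] show False using no linked_sym by blast
        qed
        then show "separated p n F (?B F) ((P \<union> N) \<inter> F) (?X \<inter> F)"
          by (intro sep FE Int_lower2)
      qed
      have caseB: "separated p n E B P' N'"
        if no: "\<not> ?l E1 N'" "\<not> ?l E2 N'" and PN: "P' \<subseteq> E" "N' \<subseteq> E"
          and un: "\<And>F. F \<subseteq> E \<Longrightarrow> \<not> linked p n F (?B F) (N' \<inter> F) (P' \<inter> F)" for P' N'
      proof (rule separated_via_both[OF s PN])
        have *: "separated p n F (?B F) (N' \<inter> F) ((P' \<union> ?X) \<inter> F)" if FE: "F \<subseteq> E" and l: "\<not> ?l F N'" for F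
        proof -
          have "\<not> linked p n F (?B F) (N' \<inter> F) ((P' \<union> ?X) \<inter> F)"
          proof
            assume "linked p n F (?B F) (N' \<inter> F) ((P' \<union> ?X) \<inter> F)"
            then have "linked p n F (?B F) (N' \<inter> F) (P' \<inter> F \<union> ?X \<inter> F)"
              by (simp only: Int_Un_distrib2)
            then show False using linked_Un un[OF FE] l by blast
          qed
          then show ?thesis by (intro sep FE Int_lower2)
        qed
        show "separated p n E1 (?B E1) (N' \<inter> E1) ((P' \<union> ?X) \<inter> E1)"
          "separated p n E2 (?B E2) (N' \<inter> E2) ((P' \<union> ?X) \<inter> E2)"
          using E no by (intro *; blast)+
      qed
      show ?thesis
      proof (cases "?l E1 P \<or> ?l E1 N")
        case False
        then show ?thesis using caseA[OF s] by blast
      next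
        case T1: True
        show ?thesis
        proof (cases "?l E2 P \<or> ?l E2 N")
          case False
          then show ?thesis using caseA[OF splits_at_sym[OF s]] by blast
        next
          case True
          \<comment> \<open>Both sides carry a link to \<open>\<beta>\<close>, and
            \<open>comp\<close> excludes \<open>P\<close> on one side together with \<open>N\<close>
            on the other. So one of \<open>P\<close> and \<open>N\<close> is linked on both sides
            and the other on neither.\<close>
          then consider "\<not> ?l E1 N" "\<not> ?l E2 N" | "\<not> ?l E1 P" "\<not> ?l E2 P" using T1 comp by blast
          then show ?thesis
          proof cases
            case 1
            show ?thesis by (rule caseB[OF 1 \<open>P \<subseteq> E\<close> \<open>N \<subseteq> E\<close> noPN])
          next
            case 2
            have "separated p n E B N P"
              by (rule caseB[OF 2 \<open>N \<subseteq> E\<close> \<open>P \<subseteq> E\<close> contrapos_nn[OF noPN linked_sym]])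
            then show ?thesis by (rule separated_sym)
          qed
        qed
      qed
    qed
  qed
  then show ?case using split by (intro conjI allI impI)
qed

subsection \<open>Lattices and mixed bases\<close>

text \<open>Gaussian elimination without division, hence over any integral domain; it serves both
  for integers and for the coefficient field.\<close>

lemma homogeneous_system_nontrivial:
  fixes f :: "'x \<Rightarrow> 'j \<Rightarrow> 'a::idom"
  assumes "finite J" "finite X" "card J < card X"
  shows "\<exists>c. (\<exists>x\<in>X. c x \<noteq> 0) \<and> (\<forall>j\<in>J. (\<Sum>x\<in>X. c x * f x j) = 0)"
  using assms
proof (induction J arbitrary: X f rule: finite_induct)
  case empty
  then obtain x where "x \<in> X" by fastforce
  then show ?case by (intro exI[of _ "\<lambda>_. 1"]) auto
next
  case (insert j J)
  show ?case
  proof (cases "\<forall>x\<in>X. f x j = 0")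
    case True
    have "card J < card X" using insert by simp
    then obtain c where "\<exists>x\<in>X. c x \<noteq> 0" "\<forall>j\<in>J. (\<Sum>x\<in>X. c x * f x j) = 0"
      using insert.IH[OF insert.prems(1)] by blast
    with True show ?thesis by (intro exI[of _ c]) simp
  next
    case False
    then obtain x0 where x0: "x0 \<in> X" "f x0 j \<noteq> 0" by blast
    let ?X = "X - {x0}"
    have "card J < card ?X" using insert x0 by simp
    then obtain c where c: "\<exists>x\<in>?X. c x \<noteq> 0"
      "\<forall>i\<in>J. (\<Sum>x\<in>?X. c x * (f x0 j * f x i - f x j * f x0 i)) = 0"
      using insert.IH[of ?X "\<lambda>x i. f x0 j * f x i - f x j * f x0 i"] insert.prems(1) by auto
    \<comment> \<open>Scaling the other unknowns by the pivot \<open>f x0 j\<close> allows the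
      equation for \<open>j\<close> to be solved for the unknown \<open>x0\<close> inside the
      ring.\<close>
    define d where "d = (\<lambda>x. if x = x0 then - (\<Sum>x\<in>?X. c x * f x j) else f x0 j * c x)"
    have d: "(\<Sum>x\<in>X. d x * f x i) = (\<Sum>x\<in>?X. c x * (f x0 j * f x i - f x j * f x0 i))" for i
    proof -
      have "(\<Sum>x\<in>X. d x * f x i) = d x0 * f x0 i + (\<Sum>x\<in>?X. d x * f x i)"
        using insert.prems(1) x0(1) by (rule sum.remove)
      also have "(\<Sum>x\<in>?X. d x * f x i) = (\<Sum>x\<in>?X. f x0 j * c x * f x i)"
        by (rule sum.cong) (auto simp: d_def)
      finally show ?thesis
        by (simp only: d_def if_True simp_thms)
          (simp add: sum_distrib_right sum_distrib_left sum_subtractf right_diff_distrib sum_negf mult_ac)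
    qed
    have "(\<Sum>x\<in>X. d x * f x j) = 0" unfolding d by (simp add: mult_ac)
    moreover have "\<exists>x\<in>X. d x \<noteq> 0" using c(1) x0 by (auto simp: d_def)
    ultimately show ?thesis using c(2) d by (intro exI[of _ d]) auto
  qed
qed

section \<open>Integer vectors, lattices and signs\<close>

abbreviation lookup :: "('a \<Rightarrow>\<^sub>0 'b::zero) \<Rightarrow> 'a \<Rightarrow> 'b" where "lookup \<equiv> Poly_Mapping.lookup"
abbreviation keys :: "('a \<Rightarrow>\<^sub>0 'b::zero) \<Rightarrow> 'a set" where "keys \<equiv> Poly_Mapping.keys"

definition is_lattice :: "('i \<Rightarrow>\<^sub>0 int) set \<Rightarrow> bool" where
  "is_lattice L \<longleftrightarrow> 0 \<in> L \<and> (\<forall>\<alpha>\<in>L. \<forall>\<beta>\<in>L. \<alpha> - \<beta> \<in> L)"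

lemma is_lattice_zero: "is_lattice L \<Longrightarrow> 0 \<in> L"
  and is_lattice_diff: "is_lattice L \<Longrightarrow> \<alpha> \<in> L \<Longrightarrow> \<beta> \<in> L \<Longrightarrow> \<alpha> - \<beta> \<in> L"
  by (auto simp: is_lattice_def)

lemma is_lattice_uminus: "is_lattice L \<Longrightarrow> \<alpha> \<in> L \<Longrightarrow> - \<alpha> \<in> L"
  using is_lattice_diff[of L 0 \<alpha>] is_lattice_zero by force

lemma is_lattice_add: "is_lattice L \<Longrightarrow> \<alpha> \<in> L \<Longrightarrow> \<beta> \<in> L \<Longrightarrow> \<alpha> + \<beta> \<in> L"
  using is_lattice_diff[of L \<alpha> "- \<beta>"] is_lattice_uminus by force

lemma is_lattice_cmul:
  assumes "is_lattice L" "\<alpha> \<in> L"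
  shows "frag_cmul c \<alpha> \<in> L"
proof -
  have n: "frag_cmul (int n) \<alpha> \<in> L" for n
    by (induction n) (auto simp: frag_cmul_distrib is_lattice_zero is_lattice_add assms)
  show ?thesis
    using n[of "nat c"] is_lattice_uminus[OF assms(1) n[of "nat (- c)"]] by (cases "c \<ge> 0") auto
qed

lemma is_lattice_sum:
  "is_lattice L \<Longrightarrow> (\<And>x. x \<in> X \<Longrightarrow> f x \<in> L) \<Longrightarrow> sum f X \<in> L"
  by (induction X rule: infinite_finite_induct) (auto intro: is_lattice_add is_lattice_zero)

definition nonneg :: "('i \<Rightarrow>\<^sub>0 int) \<Rightarrow> bool" where
  "nonneg u \<longleftrightarrow> (\<forall>i. 0 \<le> lookup u i)"

lemma nonneg_add: "nonneg u \<Longrightarrow> nonneg v \<Longrightarrow> nonneg (u + v)"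
  and nonneg_cmul: "0 \<le> c \<Longrightarrow> nonneg u \<Longrightarrow> nonneg (frag_cmul c u)"
  and nonneg_zero: "nonneg 0"
  and nonneg_frag_of: "nonneg (frag_of i)"
  by (simp_all add: nonneg_def lookup_add)

lemma nonneg_sum: "(\<And>x. x \<in> X \<Longrightarrow> nonneg (f x)) \<Longrightarrow> nonneg (sum f X)"
  by (auto simp: nonneg_def lookup_sum intro: sum_nonneg)

lemma keys_add_subset: "keys a \<subseteq> E \<Longrightarrow> keys b \<subseteq> E \<Longrightarrow> keys (a + b) \<subseteq> E"
  and keys_diff_subset: "keys (a' :: 'i \<Rightarrow>\<^sub>0 int) \<subseteq> E \<Longrightarrow> keys b' \<subseteq> E \<Longrightarrow> keys (a' - b') \<subseteq> E"
  and keys_cmul_subset: "keys a'' \<subseteq> E \<Longrightarrow> keys (frag_cmul c a'') \<subseteq> E"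
  using keys_add[of a b] keys_diff[of a' b'] keys_cmul[of c a''] by blast+

lemma keys_sum_subset: "(\<And>x. x \<in> X \<Longrightarrow> keys (f x) \<subseteq> E) \<Longrightarrow> keys (sum f X) \<subseteq> E"
  using keys_sum[of f X] by blast

lemma keys_subset_iff: "keys a \<subseteq> E \<longleftrightarrow> (\<forall>i. i \<notin> E \<longrightarrow> lookup a i = 0)"
  by (auto simp: in_keys_iff)

definition positive_on :: "('i \<Rightarrow>\<^sub>0 int) set \<Rightarrow> 'i set \<Rightarrow> bool" where
  "positive_on L E \<longleftrightarrow> (\<forall>\<alpha>\<in>L. keys \<alpha> \<subseteq> E \<longrightarrow> nonneg \<alpha> \<longrightarrow> \<alpha> = 0)"

lemma positive_onD: "positive_on L E \<Longrightarrow> \<alpha> \<in> L \<Longrightarrow> keys \<alpha> \<subseteq> E \<Longrightarrow> nonneg \<alpha> \<Longrightarrow> \<alpha> = 0"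
  by (simp add: positive_on_def)

lemma positive_on_mono: "positive_on L E \<Longrightarrow> E' \<subseteq> E \<Longrightarrow> positive_on L E'"
  by (auto simp: positive_on_def)

definition restr :: "'i set \<Rightarrow> ('i \<Rightarrow>\<^sub>0 int) \<Rightarrow> ('i \<Rightarrow>\<^sub>0 int)" where
  "restr E \<alpha> = Abs_poly_mapping (\<lambda>i. if i \<in> E then lookup \<alpha> i else 0)"

lemma lookup_restr: "lookup (restr E \<alpha>) i = (if i \<in> E then lookup \<alpha> i else 0)"
proof -
  have "finite {i. (if i \<in> E then lookup \<alpha> i else 0) \<noteq> 0}"
    by (rule finite_subset[OF _ finite_keys[of \<alpha>]]) (auto simp: in_keys_iff)
  then show ?thesis unfolding restr_def by simp
qed

lemma keys_restr: "keys (restr E \<alpha>) \<subseteq> E"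
  by (simp add: keys_subset_iff lookup_restr)

lemma nonneg_restr: "nonneg \<alpha> \<Longrightarrow> nonneg (restr E \<alpha>)"
  by (simp add: nonneg_def lookup_restr)

lemma restr_split: "keys \<alpha> \<subseteq> E1 \<union> E2 \<Longrightarrow> E1 \<inter> E2 = {} \<Longrightarrow> restr E1 \<alpha> + restr E2 \<alpha> = \<alpha>"
  by (rule poly_mapping_eqI) (auto simp: lookup_add lookup_restr keys_subset_iff)

lemma restr_add: "restr E (\<alpha> + \<beta>) = restr E \<alpha> + restr E \<beta>"
  and restr_diff: "restr E (\<alpha> - \<beta>) = restr E \<alpha> - restr E \<beta>"
  and restr_cmul: "restr E (frag_cmul c \<alpha>) = frag_cmul c (restr E \<alpha>)"
  by (auto intro!: poly_mapping_eqI simp: lookup_restr lookup_add lookup_minus)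

lemma restr_id: "keys \<alpha> \<subseteq> E \<Longrightarrow> restr E \<alpha> = \<alpha>"
  and restr_disjoint: "keys \<alpha> \<inter> E = {} \<Longrightarrow> restr E \<alpha> = 0"
  by (rule poly_mapping_eqI; force simp: lookup_restr in_keys_iff)+

definition pos_keys :: "('i \<Rightarrow>\<^sub>0 int) \<Rightarrow> 'i set" where "pos_keys \<alpha> = {i. 0 < lookup \<alpha> i}"
definition neg_keys :: "('i \<Rightarrow>\<^sub>0 int) \<Rightarrow> 'i set" where "neg_keys \<alpha> = {i. lookup \<alpha> i < 0}"

lemma keys_eq_pos_neg: "keys \<alpha> = pos_keys \<alpha> \<union> neg_keys \<alpha>"
  by (auto simp: pos_keys_def neg_keys_def in_keys_iff)

lemma pos_neg_keys_uminus: "pos_keys (- \<alpha>) = neg_keys \<alpha>" "neg_keys (- \<alpha>) = pos_keys \<alpha>"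
  by (simp_all add: pos_keys_def neg_keys_def)

lemma neg_keys_empty_iff: "neg_keys \<alpha> = {} \<longleftrightarrow> nonneg \<alpha>"
  by (auto simp: neg_keys_def nonneg_def not_less[symmetric])

lemma pos_neg_keys_ne:
  assumes "is_lattice L" "positive_on L E" "\<alpha> \<in> L" "keys \<alpha> \<subseteq> E" "\<alpha> \<noteq> 0"
  shows "pos_keys \<alpha> \<noteq> {}" "neg_keys \<alpha> \<noteq> {}"
proof -
  show "neg_keys \<alpha> \<noteq> {}"
    using assms positive_onD neg_keys_empty_iff by blast
  have "neg_keys (- \<alpha>) \<noteq> {}"
    using assms positive_onD[OF assms(2) is_lattice_uminus[OF assms(1,3)]] neg_keys_empty_iff[of "-\<alpha>"] by auto
  then show "pos_keys \<alpha> \<noteq> {}" by (simp add: pos_neg_keys_uminus)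
qed

definition indep :: "('i \<Rightarrow>\<^sub>0 int) set \<Rightarrow> bool" where
  "indep B \<longleftrightarrow> (\<forall>c. (\<Sum>b\<in>B. frag_cmul (c b) b) = 0 \<longrightarrow> (\<forall>b\<in>B. c b = 0))"

definition zspan :: "('i \<Rightarrow>\<^sub>0 int) set \<Rightarrow> ('i \<Rightarrow>\<^sub>0 int) set" where
  "zspan B = range (\<lambda>c. \<Sum>b\<in>B. frag_cmul (c b) b)"

lemma indepD: "indep B \<Longrightarrow> (\<Sum>b\<in>B. frag_cmul (c b) b) = 0 \<Longrightarrow> b \<in> B \<Longrightarrow> c b = 0"
  by (auto simp: indep_def)

lemma indep_subset:
  assumes "indep B" "finite B" "A \<subseteq> B"
  shows "indep A"
  unfolding indep_def
proof (intro allI impI ballI)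
  fix c b assume c: "(\<Sum>b\<in>A. frag_cmul (c b) b) = 0" and b: "b \<in> A"
  let ?c = "\<lambda>b. if b \<in> A then c b else 0"
  have "(\<Sum>b\<in>B. frag_cmul (?c b) b) = (\<Sum>b\<in>A. frag_cmul (?c b) b)"
    by (rule sum.mono_neutral_right) (use assms in auto)
  also have "\<dots> = 0" using c by simp
  finally have "?c b = 0" using indepD[OF assms(1), of ?c b] b assms by blast
  then show "c b = 0" using b by simp
qed

lemma indep_nonzero: "indep B \<Longrightarrow> finite B \<Longrightarrow> b \<in> B \<Longrightarrow> b \<noteq> 0"
  using indepD[of B "\<lambda>x. if x = 0 then 1 else 0" b]
  by (auto simp: sum.neutral)

lemma zspan_subset: "is_lattice L \<Longrightarrow> B \<subseteq> L \<Longrightarrow> zspan B \<subseteq> L"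
  unfolding zspan_def by (auto intro!: is_lattice_sum is_lattice_cmul)

lemma is_lattice_zspan: "is_lattice (zspan B)"
  unfolding is_lattice_def zspan_def
proof (intro conjI ballI)
  show "0 \<in> range (\<lambda>c. \<Sum>b\<in>B. frag_cmul (c b) b)" by (intro range_eqI[of _ _ "\<lambda>_. 0"]) simp
  fix a a' assume "a \<in> range (\<lambda>c. \<Sum>b\<in>B. frag_cmul (c b) b)" "a' \<in> range (\<lambda>c. \<Sum>b\<in>B. frag_cmul (c b) b)"
  then obtain c c' where "a = (\<Sum>b\<in>B. frag_cmul (c b) b)" "a' = (\<Sum>b\<in>B. frag_cmul (c' b) b)" by blast
  then have "a - a' = (\<Sum>b\<in>B. frag_cmul (c b - c' b) b)"
    by (simp add: frag_cmul_diff_distrib sum_subtractf)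
  then show "a - a' \<in> range (\<lambda>c. \<Sum>b\<in>B. frag_cmul (c b) b)"
    by (intro range_eqI[of _ _ "\<lambda>b. c b - c' b"])
qed

lemma zspan_base: "finite B \<Longrightarrow> b \<in> B \<Longrightarrow> b \<in> zspan B"
  unfolding zspan_def
  by (intro range_eqI[of _ _ "\<lambda>x. if x = b then 1 else 0"])
    (simp add: if_distrib[of "\<lambda>c. frag_cmul c _"] cong: if_cong)

section \<open>Mixed bases\<close>

definition zero_on :: "'i set \<Rightarrow> ('i \<Rightarrow>\<^sub>0 int) \<Rightarrow> bool" where
  "zero_on J \<alpha> \<longleftrightarrow> (\<forall>i\<in>J. lookup \<alpha> i = 0)"

text \<open>When the variables in \<open>J\<close> are set to zero, the binomial of \<open>b\<close> survives if \<open>b\<close> vanishes on \<open>J\<close> and becomes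
  zero if \<open>b\<close> crosses \<open>J\<close>.  The two conclusions on \<open>\<alpha>\<close> say that no monomial arises from \<open>L\<close>, and that the surviving
  relations come from the surviving part of \<open>B\<close>.\<close>

definition mixed_basis :: "('i \<Rightarrow>\<^sub>0 int) set \<Rightarrow> nat \<Rightarrow> 'i set \<Rightarrow> ('i \<Rightarrow>\<^sub>0 int) set \<Rightarrow> bool" where
  "mixed_basis L q E B \<longleftrightarrow> finite B \<and> B \<subseteq> L \<and> (\<forall>b\<in>B. keys b \<subseteq> E) \<and> indep B \<and>
     (\<forall>J\<subseteq>E. (\<forall>b\<in>B. zero_on J b \<or> crosses pos_keys neg_keys J b) \<longrightarrow>
        (\<forall>\<alpha>\<in>L. keys \<alpha> \<subseteq> E \<longrightarrow> (zero_on J \<alpha> \<or> neg_keys \<alpha> \<inter> J \<noteq> {}) \<and>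
           (zero_on J \<alpha> \<longrightarrow> (\<exists>k. frag_cmul (int q ^ k) \<alpha> \<in> zspan {b\<in>B. zero_on J b}))))"

text \<open>In an inclusion-maximal violating set \<open>K\<close> every row vanishes or crosses,
  for otherwise one more index of the missing sign would add a crossing row. So the basis property
  applies to \<open>K\<close>. The rows crossing \<open>K\<close> and the constant vector together
  outnumber the coordinates in \<open>K\<close>, hence some combination \<open>\<alpha>\<close> of
  these rows is constant on \<open>K\<close>.\<close>

lemma mixed_basis_dominating:
  assumes lat: "is_lattice L" and pos: "positive_on L E" and q: "q > 0" and fE: "finite E"
    and W: "mixed_basis L q E B"
  shows "dominating pos_keys neg_keys E B"
proof -
  have fB: "finite B" and BL: "B \<subseteq> L" and ind: "indep B" and kB: "\<And>b. b \<in> B \<Longrightarrow> keys b \<subseteq> E"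
    and strat: "\<And>J \<alpha>. J \<subseteq> E \<Longrightarrow> (\<forall>b\<in>B. zero_on J b \<or> crosses pos_keys neg_keys J b) \<Longrightarrow> \<alpha> \<in> L \<Longrightarrow>
      keys \<alpha> \<subseteq> E \<Longrightarrow> (zero_on J \<alpha> \<or> neg_keys \<alpha> \<inter> J \<noteq> {}) \<and>
           (zero_on J \<alpha> \<longrightarrow> (\<exists>k. frag_cmul (int q ^ k) \<alpha> \<in> zspan {b\<in>B. zero_on J b}))"
    using W unfolding mixed_basis_def by blast+
  have ne: "pos_keys b \<noteq> {}" "neg_keys b \<noteq> {}" if "b \<in> B" for b
    using pos_neg_keys_ne[OF lat pos _ kB[OF that]] indep_nonzero[OF ind fB that] BL that by auto
  have rows: "\<forall>b\<in>B. pos_keys b \<union> neg_keys b \<subseteq> E \<and> pos_keys b \<noteq> {} \<and> neg_keys b \<noteq> {}"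
    using ne kB by (simp add: keys_eq_pos_neg)
  let ?M = "\<lambda>J. {b\<in>B. crosses pos_keys neg_keys J b}"
  have "card (?M J) < card J" if "J \<subseteq> E" "J \<noteq> {}" for J
  proof (rule ccontr)
    assume c: "\<not> card (?M J) < card J"
    define S where "S = {J. J \<subseteq> E \<and> J \<noteq> {} \<and> card J \<le> card (?M J)}"
    have "S \<subseteq> Pow E" by (auto simp: S_def)
    then have "finite S" using fE finite_subset by blast
    moreover have "J \<in> S" using that c by (auto simp: S_def)
    ultimately obtain K where K: "K \<in> S" "\<And>K'. K' \<in> S \<Longrightarrow> K \<subseteq> K' \<Longrightarrow> K' = K"
      using finite_has_maximal[of S] by (metis empty_iff)
    have KE: "K \<subseteq> E" "K \<noteq> {}" "card K \<le> card (?M K)" using K(1) by (auto simp: S_def)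
    have enlarge: False if b: "b \<in> B" "\<not> crosses pos_keys neg_keys K b" and j: "j \<in> E" "j \<notin> K"
      "crosses pos_keys neg_keys (insert j K) b" for b j
    proof -
      have "insert b (?M K) \<subseteq> ?M (insert j K)" using b j(3) by (auto simp: crosses_def)
      then have "card (insert b (?M K)) \<le> card (?M (insert j K))" by (rule card_mono[rotated]) (use fB in auto)
      moreover have "card (insert b (?M K)) = Suc (card (?M K))" using b fB by simp
      moreover have "card (insert j K) = Suc (card K)" using j KE fE by (simp add: finite_subset)
      ultimately have "insert j K \<in> S" using KE j by (simp add: S_def)
      then show False using K(2)[of "insert j K"] j by blast
    qed
    have all: "\<forall>b\<in>B. zero_on K b \<or> crosses pos_keys neg_keys K b"
    proof (intro ballI, rule ccontr)
      fix b assume b: "b \<in> B" and n: "\<not> (zero_on K b \<or> crosses pos_keys neg_keys K b)"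
      then have "keys b \<inter> K \<noteq> {}" by (auto simp: zero_on_def in_keys_iff)
      then consider "pos_keys b \<inter> K \<noteq> {}" "neg_keys b \<inter> K = {}" | "pos_keys b \<inter> K = {}" "neg_keys b \<inter> K \<noteq> {}"
        using n by (auto simp: crosses_def keys_eq_pos_neg)
      then show False
      proof cases
        case 1
        obtain j where "j \<in> neg_keys b" using ne b by blast
        then show False using 1 enlarge[of b j] b n rows by (auto simp: crosses_def)
      next
        case 2
        obtain j where "j \<in> pos_keys b" using ne b by blast
        then show False using 2 enlarge[of b j] b n rows by (auto simp: crosses_def)
      qed
    qed
    note st = strat[OF KE(1) all]
    \<comment> \<open>\<open>None\<close> stands for the constant vector 1, which gives
      \<open>Suc (card (?M K))\<close> unknowns against \<open>card K\<close> equations.\<close>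
    let ?X = "insert None (Some ` ?M K)" and ?f = "\<lambda>x j. case x of None \<Rightarrow> 1 | Some b \<Rightarrow> lookup b j"
    have fM: "finite (?M K)" using fB by simp
    have "card ?X = Suc (card (?M K))" using fM by (subst card_insert_disjoint) (auto simp: card_image)
    then have "card K < card ?X" using KE by simp
    then obtain c where c: "\<exists>x\<in>?X. c x \<noteq> (0::int)" "\<forall>j\<in>K. (\<Sum>x\<in>?X. c x * ?f x j) = 0"
      using homogeneous_system_nontrivial[of K ?X ?f] fM KE fE finite_subset by blast
    define \<alpha> where "\<alpha> = (\<Sum>b\<in>?M K. frag_cmul (c (Some b)) b)"
    have \<alpha>L: "\<alpha> \<in> L" unfolding \<alpha>_def using BL lat by (auto intro!: is_lattice_sum is_lattice_cmul)
    have \<alpha>E: "keys \<alpha> \<subseteq> E" unfolding \<alpha>_def using kB by (auto intro!: keys_sum_subset keys_cmul_subset)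
    have \<alpha>K: "lookup \<alpha> j = - c None" if "j \<in> K" for j
    proof -
      have "(\<Sum>x\<in>?X. c x * ?f x j) = c None + (\<Sum>x\<in>Some ` ?M K. c x * ?f x j)"
        using fM by (subst sum.insert) auto
      also have "(\<Sum>x\<in>Some ` ?M K. c x * ?f x j) = lookup \<alpha> j"
        by (subst sum.reindex) (auto simp: \<alpha>_def lookup_sum)
      finally show ?thesis using c(2) that by simp
    qed
    show False
    proof (cases "c None = 0")
      case True
      \<comment> \<open>Constant zero: up to a power of \<open>q\<close>, the combination
        \<open>\<alpha>\<close> of crossing rows is also one of rows vanishing on \<open>K\<close>,
        against independence.\<close>
      then have "zero_on K \<alpha>" using \<alpha>K by (simp add: zero_on_def)
      then obtain k d where kd: "frag_cmul (int q ^ k) \<alpha> = (\<Sum>b\<in>{b\<in>B. zero_on K b}. frag_cmul (d b) b)"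
        using st[OF \<alpha>L \<alpha>E] unfolding zspan_def by blast
      define e where "e = (\<lambda>b. if zero_on K b then - d b else int q ^ k * c (Some b))"
      have dis: "?M K \<inter> {b\<in>B. zero_on K b} = {}" 
        by (auto simp: crosses_def zero_on_def pos_keys_def)
      have "B = ?M K \<union> {b\<in>B. zero_on K b}" using all by blast
      then have "(\<Sum>b\<in>B. frag_cmul (e b) b) = (\<Sum>b\<in>?M K \<union> {b\<in>B. zero_on K b}. frag_cmul (e b) b)" by simp
      also have "\<dots> = (\<Sum>b\<in>?M K. frag_cmul (e b) b) + (\<Sum>b\<in>{b\<in>B. zero_on K b}. frag_cmul (e b) b)"
        by (rule sum.union_disjoint) (use fB dis in auto)
      also have "(\<Sum>b\<in>?M K. frag_cmul (e b) b) = frag_cmul (int q ^ k) \<alpha>"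
        unfolding \<alpha>_def frag_cmul_sum using dis by (intro sum.cong) (auto simp: e_def)
      also have "(\<Sum>b\<in>{b\<in>B. zero_on K b}. frag_cmul (e b) b) = - frag_cmul (int q ^ k) \<alpha>"
        unfolding kd sum_negf[symmetric] by (intro sum.cong) (auto simp: e_def)
      finally have "(\<Sum>b\<in>B. frag_cmul (e b) b) = 0" by (simp only: add.right_inverse)
      then have e0: "e b = 0" if "b \<in> B" for b using indepD[OF ind] that by blast
      obtain x where x: "x \<in> ?X" "c x \<noteq> 0" using c(1) by blast
      then obtain b where b: "x = Some b" "b \<in> ?M K" using True by auto
      then have "e b = int q ^ k * c x" using dis by (auto simp: e_def)
      then show False using e0[of b] b x q by auto
    next
      case False
      \<comment> \<open>Nonzero constant: both \<open>\<alpha>\<close> and its negative would need a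
        negative entry in \<open>K\<close>.\<close>
      obtain j where j: "j \<in> K" using KE by blast
      then have nz: "\<not> zero_on K \<alpha>" "\<not> zero_on K (- \<alpha>)" using False \<alpha>K by (auto simp: zero_on_def)
      have "neg_keys \<alpha> \<inter> K \<noteq> {}" using st[OF \<alpha>L \<alpha>E] nz by blast
      moreover have "neg_keys (- \<alpha>) \<inter> K \<noteq> {}"
        using st[OF is_lattice_uminus[OF lat \<alpha>L]] \<alpha>E nz by simp
      ultimately show False using \<alpha>K by (force simp: neg_keys_def)
    qed
  qed
  then show ?thesis using fE fB rows unfolding dominating_def by blast
qed

lemma sum_split_rows:
  assumes "finite B" "\<beta> \<in> B" "B1 = {b\<in>B. b \<noteq> \<beta> \<and> keys b \<subseteq> E1}" "B2 = {b\<in>B. b \<noteq> \<beta> \<and> keys b \<subseteq> E2}"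
    "E1 \<inter> E2 = {}" "0 \<notin> B" "\<forall>b\<in>B - {\<beta>}. keys b \<subseteq> E1 \<or> keys b \<subseteq> E2"
  shows "(\<Sum>b\<in>B. frag_cmul (c b) b) =
    frag_cmul (c \<beta>) \<beta> + (\<Sum>b\<in>B1. frag_cmul (c b) b) + (\<Sum>b\<in>B2. frag_cmul (c b) b)"
proof -
  have "B1 \<inter> B2 = {}" using assms(3-6) by (auto simp: subset_iff) (metis IntI all_not_in_conv keys_eq_empty)
  have "(\<Sum>b\<in>B. frag_cmul (c b) b) = frag_cmul (c \<beta>) \<beta> + (\<Sum>b\<in>B - {\<beta>}. frag_cmul (c b) b)"
    using assms by (intro sum.remove)
  also have "B - {\<beta>} = B1 \<union> B2" using assms(3,4,7) by blast
  also have "(\<Sum>b\<in>B1 \<union> B2. frag_cmul (c b) b) = (\<Sum>b\<in>B1. frag_cmul (c b) b) + (\<Sum>b\<in>B2. frag_cmul (c b) b)"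
    by (rule sum.union_disjoint) (use assms \<open>B1 \<inter> B2 = {}\<close> in auto)
  finally show ?thesis by (simp add: add.assoc)
qed

text \<open>A subset \<open>J\<close> of \<open>E1\<close> is enlarged by all of \<open>E2\<close>
  unless \<open>\<beta>\<close> vanishes on \<open>J\<close>. The enlarged set is crossed by
  \<open>\<beta>\<close>, whose other sign lies in \<open>E2\<close>, and by the rows inside
  \<open>E2\<close>, which have both signs by positivity. So the property of \<open>B\<close>
  applies to it.\<close>

lemma mixed_basis_restrict:
  assumes lat: "is_lattice L" and pos: "positive_on L E"
    and W: "mixed_basis L q E B" and s: "splits_at pos_keys neg_keys E B \<beta> E1 E2"
  shows "mixed_basis L q E1 {b\<in>B. b \<noteq> \<beta> \<and> keys b \<subseteq> E1}"
proof -
  have fB: "finite B" and BL: "B \<subseteq> L" and ind: "indep B" and kB: "\<And>b. b \<in> B \<Longrightarrow> keys b \<subseteq> E"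
    and strat: "\<And>J \<alpha>. J \<subseteq> E \<Longrightarrow> (\<forall>b\<in>B. zero_on J b \<or> crosses pos_keys neg_keys J b) \<Longrightarrow> \<alpha> \<in> L \<Longrightarrow>
      keys \<alpha> \<subseteq> E \<Longrightarrow> (zero_on J \<alpha> \<or> neg_keys \<alpha> \<inter> J \<noteq> {}) \<and>
           (zero_on J \<alpha> \<longrightarrow> (\<exists>k. frag_cmul (int q ^ k) \<alpha> \<in> zspan {b\<in>B. zero_on J b}))"
    using W unfolding mixed_basis_def by blast+
  have s': "\<beta> \<in> B" "E1 \<union> E2 = E" "E1 \<inter> E2 = {}"
    "pos_keys \<beta> \<subseteq> E1 \<and> neg_keys \<beta> \<subseteq> E2 \<or> neg_keys \<beta> \<subseteq> E1 \<and> pos_keys \<beta> \<subseteq> E2"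
    "\<forall>b\<in>B - {\<beta>}. keys b \<subseteq> E1 \<or> keys b \<subseteq> E2"
    using s by (simp_all add: splits_at_def keys_eq_pos_neg)
  have nz: "0 \<notin> B" using indep_nonzero[OF ind fB] by blast
  have ne: "pos_keys b \<noteq> {}" "neg_keys b \<noteq> {}" if "b \<in> B" for b
    using pos_neg_keys_ne[OF lat pos _ kB[OF that]] indep_nonzero[OF ind fB that] BL that by auto
  let ?B1 = "{b\<in>B. b \<noteq> \<beta> \<and> keys b \<subseteq> E1}" and ?B2 = "{b\<in>B. b \<noteq> \<beta> \<and> keys b \<subseteq> E2}"
  note split = sum_split_rows[OF fB s'(1) refl refl s'(3) nz s'(5)]
  have "(zero_on J \<alpha> \<or> neg_keys \<alpha> \<inter> J \<noteq> {}) \<and>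
      (zero_on J \<alpha> \<longrightarrow> (\<exists>k. frag_cmul (int q ^ k) \<alpha> \<in> zspan {b\<in>?B1. zero_on J b}))"
    if J: "J \<subseteq> E1" and allJ: "\<forall>b\<in>?B1. zero_on J b \<or> crosses pos_keys neg_keys J b"
      and \<alpha>: "\<alpha> \<in> L" "keys \<alpha> \<subseteq> E1" for J \<alpha>
  proof -
    define J' where "J' = (if zero_on J \<beta> then J else J \<union> E2)"
    have J'E: "J' \<subseteq> E" using J s' by (auto simp: J'_def)
    have J'1: "J' \<inter> E1 = J" using J s' by (auto simp: J'_def)
    have zero': "zero_on J' x \<longleftrightarrow> zero_on J x" if "keys x \<subseteq> E1" for x
    proof -
      have "lookup x i = 0" if "i \<in> E2" for i
        using that \<open>keys x \<subseteq> E1\<close> s'(3) by (auto simp: keys_subset_iff)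
      then show ?thesis by (auto simp: J'_def zero_on_def)
    qed
    have "zero_on J' b \<or> crosses pos_keys neg_keys J' b" if b: "b \<in> B" for b
    proof -
      consider "b = \<beta>" | "b \<in> ?B1" | "b \<noteq> \<beta>" "keys b \<subseteq> E2" using s'(5) b by blast
      then show ?thesis
      proof cases
        case 1
        show ?thesis
        proof (cases "zero_on J \<beta>")
          case True
          then show ?thesis using 1 by (simp add: J'_def)
        next
          case False
          then have "keys \<beta> \<inter> J \<noteq> {}" by (auto simp: zero_on_def in_keys_iff)
          then have "crosses pos_keys neg_keys (J \<union> E2) \<beta>"
            using s'(3,4) J ne[OF s'(1)] unfolding crosses_def keys_eq_pos_neg by auto
          then show ?thesis using 1 False by (simp add: J'_def)
        qed
      next
        case 2
        then have "zero_on J b \<or> crosses pos_keys neg_keys J b" using allJ by blast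
        moreover have "crosses pos_keys neg_keys J b \<Longrightarrow> crosses pos_keys neg_keys J' b"
          by (auto simp: crosses_def J'_def)
        ultimately show ?thesis using zero' 2 by blast
      next
        case 3
        show ?thesis
        proof (cases "zero_on J \<beta>")
          case True
          have "zero_on J b" using 3 J s'(3) by (auto simp: zero_on_def keys_subset_iff)
          then show ?thesis using True by (simp add: J'_def)
        next
          case False
          then show ?thesis using ne[OF b] 3 by (auto simp: J'_def crosses_def keys_eq_pos_neg)
        qed
      qed
    qed
    then have "\<forall>b\<in>B. zero_on J' b \<or> crosses pos_keys neg_keys J' b" by blast
    note st = strat[OF J'E this \<alpha>(1)]
    have \<alpha>E: "keys \<alpha> \<subseteq> E" using \<alpha> s' by blast
    have "neg_keys \<alpha> \<inter> J' = neg_keys \<alpha> \<inter> J" using J'1 \<alpha>(2) by (auto simp: keys_eq_pos_neg)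
    then have 1: "zero_on J \<alpha> \<or> neg_keys \<alpha> \<inter> J \<noteq> {}" using st[OF \<alpha>E] zero'[OF \<alpha>(2)] by auto
    have "\<exists>k. frag_cmul (int q ^ k) \<alpha> \<in> zspan {b\<in>?B1. zero_on J b}" if z: "zero_on J \<alpha>"
    proof -
      obtain k c where kc: "frag_cmul (int q ^ k) \<alpha> = (\<Sum>b\<in>{b\<in>B. zero_on J' b}. frag_cmul (c b) b)"
        using st[OF \<alpha>E] z zero'[OF \<alpha>(2)] unfolding zspan_def by blast
      define d where "d = (\<lambda>b. if zero_on J' b then c b else 0)"
      have "frag_cmul (int q ^ k) \<alpha> = (\<Sum>b\<in>{b\<in>B. zero_on J' b}. frag_cmul (d b) b)"
        unfolding kc by (rule sum.cong) (auto simp: d_def)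
      also have "\<dots> = (\<Sum>b\<in>B. frag_cmul (d b) b)"
        by (rule sum.mono_neutral_left) (use fB in \<open>auto simp: d_def\<close>)
      finally have e: "frag_cmul (int q ^ k) \<alpha> = (\<Sum>b\<in>B. frag_cmul (d b) b)" .
      \<comment> \<open>\<open>v\<close> collects what \<open>\<beta>\<close> and the rows of
        \<open>E2\<close> contribute. It is supported in \<open>E1\<close>, where it equals a
        multiple of \<open>\<beta>\<close> and therefore does not change sign; positivity makes it
        vanish.\<close>
      define v where "v = frag_cmul (d \<beta>) \<beta> + (\<Sum>b\<in>?B2. frag_cmul (d b) b)"
      have e2: "frag_cmul (int q ^ k) \<alpha> = v + (\<Sum>b\<in>?B1. frag_cmul (d b) b)"
        unfolding e split v_def by (simp add: add_ac)
      then have v: "v = frag_cmul (int q ^ k) \<alpha> - (\<Sum>b\<in>?B1. frag_cmul (d b) b)" by simp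
      have vE1: "keys v \<subseteq> E1" unfolding v
        by (intro keys_diff_subset keys_cmul_subset \<alpha> keys_sum_subset) auto
      have vL: "v \<in> L" unfolding v_def using BL s'(1) lat
        by (intro is_lattice_add is_lattice_cmul is_lattice_sum) auto
      have v1: "lookup v i = d \<beta> * lookup \<beta> i" if "i \<in> E1" for i
      proof -
        have "keys (\<Sum>b\<in>?B2. frag_cmul (d b) b) \<subseteq> E2" by (intro keys_sum_subset keys_cmul_subset) auto
        then have "lookup (\<Sum>b\<in>?B2. frag_cmul (d b) b) i = 0" using that s'(3) by (auto simp: keys_subset_iff)
        then show ?thesis by (simp add: v_def lookup_add)
      qed
      have v2: "lookup v i = 0" if "i \<notin> E1" for i using vE1 that by (simp add: keys_subset_iff)
      have sign: "(\<forall>i\<in>E1. 0 \<le> lookup \<beta> i) \<or> (\<forall>i\<in>E1. lookup \<beta> i \<le> 0)"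
        using s'(3,4) by (auto simp: pos_keys_def neg_keys_def not_less[symmetric])
      have "nonneg v \<or> nonneg (- v)"
      proof -
        have "(\<forall>i\<in>E1. 0 \<le> d \<beta> * lookup \<beta> i) \<or> (\<forall>i\<in>E1. d \<beta> * lookup \<beta> i \<le> 0)"
          using sign by (cases "d \<beta> \<ge> 0") (auto simp: mult_nonneg_nonneg mult_nonneg_nonpos mult_nonpos_nonneg mult_nonpos_nonpos)
        then show ?thesis using v1 v2 by (auto simp: nonneg_def) (metis order_refl)+
      qed
      moreover have "keys v \<subseteq> E" using vE1 s' by blast
      ultimately have "v = 0"
        using positive_onD[OF pos vL] positive_onD[OF pos is_lattice_uminus[OF lat vL]] by auto
      have "frag_cmul (int q ^ k) \<alpha> = (\<Sum>b\<in>?B1. frag_cmul (d b) b)" using e2 \<open>v = 0\<close> by simp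
      also have "\<dots> = (\<Sum>b\<in>{b\<in>?B1. zero_on J b}. frag_cmul (d b) b)"
        by (rule sum.mono_neutral_right) (use fB zero' in \<open>auto simp: d_def\<close>)
      finally show ?thesis unfolding zspan_def by blast
    qed
    then show ?thesis using 1 by blast
  qed
  then show ?thesis
    unfolding mixed_basis_def using fB BL indep_subset[OF ind fB] by auto
qed

text \<open>Without the flag \<open>s\<close> degenerate nodes are allowed; they appear on passing to a face.\<close>

inductive glue_tree :: "('i \<Rightarrow>\<^sub>0 int) set \<Rightarrow> nat \<Rightarrow> bool \<Rightarrow> 'i set \<Rightarrow> bool" for L q s where
  leaf: "finite E \<Longrightarrow> (\<And>\<alpha>. \<alpha> \<in> L \<Longrightarrow> keys \<alpha> \<subseteq> E \<Longrightarrow> \<alpha> = 0) \<Longrightarrow> glue_tree L q s E"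
| node: "glue_tree L q s E1 \<Longrightarrow> glue_tree L q s E2 \<Longrightarrow> E1 \<inter> E2 = {} \<Longrightarrow>
    nonneg b1 \<Longrightarrow> nonneg b2 \<Longrightarrow> keys b1 \<subseteq> E1 \<Longrightarrow> keys b2 \<subseteq> E2 \<Longrightarrow> b1 - b2 \<in> L \<Longrightarrow>
    (s \<Longrightarrow> b1 \<noteq> 0 \<and> b2 \<noteq> 0) \<Longrightarrow>
    (\<And>\<alpha>. \<alpha> \<in> L \<Longrightarrow> keys \<alpha> \<subseteq> E1 \<union> E2 \<Longrightarrow>
       \<exists>k c l1 l2. l1 \<in> L \<and> l2 \<in> L \<and> keys l1 \<subseteq> E1 \<and> keys l2 \<subseteq> E2 \<and>
         frag_cmul (int q ^ k) \<alpha> = frag_cmul c (b1 - b2) + l1 + l2) \<Longrightarrow>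
    glue_tree L q s (E1 \<union> E2)"

lemma glue_tree_finite: "glue_tree L q s E \<Longrightarrow> finite E"
  by (induction rule: glue_tree.induct) auto

text \<open>The splitting row provides the gluing relation. The expansion of a
  \<open>q\<close>-power multiple of a relation in terms of \<open>B\<close> is already the
  decomposition required at a node, because every other row lies on one side.\<close>

lemma mixed_basis_imp_glue_tree:
  assumes lat: "is_lattice L" and q: "q > 0"
  shows "positive_on L E \<Longrightarrow> finite E \<Longrightarrow> mixed_basis L q E B \<Longrightarrow> glue_tree L q s E"
proof (induction "card B" arbitrary: E B rule: less_induct)
  case less
  note pos = less.prems(1) and fE = less.prems(2) and W = less.prems(3)
  have fB: "finite B" and BL: "B \<subseteq> L" and ind: "indep B" and kB: "\<And>b. b \<in> B \<Longrightarrow> keys b \<subseteq> E"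
    using W unfolding mixed_basis_def by blast+
  have span: "\<exists>k. frag_cmul (int q ^ k) \<alpha> \<in> zspan B" if "\<alpha> \<in> L" "keys \<alpha> \<subseteq> E" for \<alpha>
  proof -
    have "\<forall>J\<subseteq>E. (\<forall>b\<in>B. zero_on J b \<or> crosses pos_keys neg_keys J b) \<longrightarrow>
        (\<forall>\<alpha>\<in>L. keys \<alpha> \<subseteq> E \<longrightarrow> (zero_on J \<alpha> \<or> neg_keys \<alpha> \<inter> J \<noteq> {}) \<and>
           (zero_on J \<alpha> \<longrightarrow> (\<exists>k. frag_cmul (int q ^ k) \<alpha> \<in> zspan {b\<in>B. zero_on J b})))"
      using W unfolding mixed_basis_def by blast
    \<comment> \<open>On the empty set all rows vanish, so the basis property there is generation up
      to powers of \<open>q\<close>.\<close>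
    from this[rule_format, of "{}" \<alpha>] show ?thesis using that by (simp add: zero_on_def)
  qed
  show ?case
  proof (cases "B = {}")
    case True
    show ?thesis
    proof (rule glue_tree.leaf[OF fE])
      fix \<alpha> assume "\<alpha> \<in> L" "keys \<alpha> \<subseteq> E"
      then obtain k where "frag_cmul (int q ^ k) \<alpha> \<in> zspan B" using span by blast
      then show "\<alpha> = 0" using True q by (auto simp: zspan_def)
    qed
  next
    case False
    have "dominating pos_keys neg_keys E B" by (rule mixed_basis_dominating[OF lat pos q fE W])
    then obtain \<beta> E1 E2 where "splits_at pos_keys neg_keys E B \<beta> E1 E2"
      using dominating_separated_and_split False by blast
    then obtain E1 E2 where s: "splits_at pos_keys neg_keys E B \<beta> E1 E2"
      and sg: "pos_keys \<beta> \<subseteq> E1" "neg_keys \<beta> \<subseteq> E2"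
      using splits_at_sym unfolding splits_at_def by metis
    have s': "\<beta> \<in> B" "E1 \<union> E2 = E" "E1 \<inter> E2 = {}" "\<forall>b\<in>B - {\<beta>}. keys b \<subseteq> E1 \<or> keys b \<subseteq> E2"
      using s by (simp_all add: splits_at_def keys_eq_pos_neg)
    have nz: "0 \<notin> B" using indep_nonzero[OF ind fB] by blast
    let ?B1 = "{b\<in>B. b \<noteq> \<beta> \<and> keys b \<subseteq> E1}" and ?B2 = "{b\<in>B. b \<noteq> \<beta> \<and> keys b \<subseteq> E2}"
    note split = sum_split_rows[OF fB s'(1) refl refl s'(3) nz s'(4)]
    have c: "card ?B1 < card B" "card ?B2 < card B"
      by (rule psubset_card_mono; use fB s'(1) in auto)+
    have E12: "E1 \<subseteq> E" "E2 \<subseteq> E" using s' by auto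
    have t1: "glue_tree L q s E1"
      by (rule less.hyps[OF c(1) positive_on_mono[OF pos E12(1)] finite_subset[OF E12(1) fE] mixed_basis_restrict[OF lat pos W s]])
    have t2: "glue_tree L q s E2"
      by (rule less.hyps[OF c(2) positive_on_mono[OF pos E12(2)] finite_subset[OF E12(2) fE] mixed_basis_restrict[OF lat pos W splits_at_sym[OF s]]])
    have \<beta>L: "\<beta> \<in> L" using BL s' by auto
    have ne: "pos_keys \<beta> \<noteq> {}" "neg_keys \<beta> \<noteq> {}"
      using pos_neg_keys_ne[OF lat pos \<beta>L kB[OF s'(1)]] nz s'(1) by auto
    have dec: "restr E1 \<beta> - (- restr E2 \<beta>) = \<beta>"
      using restr_split[OF _ s'(3), of \<beta>] kB[OF s'(1)] s'(2) by simp
    have "glue_tree L q s (E1 \<union> E2)"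
    proof (rule glue_tree.node[OF t1 t2 s'(3), of "restr E1 \<beta>" "- restr E2 \<beta>"])
      show "nonneg (restr E1 \<beta>)" "nonneg (- restr E2 \<beta>)"
        using sg s'(3) by (auto simp: nonneg_def lookup_restr pos_keys_def neg_keys_def not_less[symmetric])
      show "keys (restr E1 \<beta>) \<subseteq> E1" "keys (- restr E2 \<beta>) \<subseteq> E2" by (simp_all add: keys_restr)
      show "restr E1 \<beta> - (- restr E2 \<beta>) \<in> L" using \<beta>L unfolding dec .
      show "restr E1 \<beta> \<noteq> 0 \<and> - restr E2 \<beta> \<noteq> 0"
      proof -
        obtain i j where "i \<in> pos_keys \<beta>" "j \<in> neg_keys \<beta>" using ne by blast
        then have "lookup (restr E1 \<beta>) i \<noteq> 0" "lookup (restr E2 \<beta>) j \<noteq> 0"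
          using sg by (auto simp: lookup_restr pos_keys_def neg_keys_def)
        then show ?thesis by auto
      qed
      fix \<alpha> assume "\<alpha> \<in> L" "keys \<alpha> \<subseteq> E1 \<union> E2"
      then obtain k d where kd: "frag_cmul (int q ^ k) \<alpha> = (\<Sum>b\<in>B. frag_cmul (d b) b)"
        using span s'(2) unfolding zspan_def by blast
      show "\<exists>k c l1 l2. l1 \<in> L \<and> l2 \<in> L \<and> keys l1 \<subseteq> E1 \<and> keys l2 \<subseteq> E2 \<and>
         frag_cmul (int q ^ k) \<alpha> = frag_cmul c (restr E1 \<beta> - (- restr E2 \<beta>)) + l1 + l2"
      proof (intro exI conjI)
        show "frag_cmul (int q ^ k) \<alpha> = frag_cmul (d \<beta>) (restr E1 \<beta> - (- restr E2 \<beta>)) +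
          (\<Sum>b\<in>?B1. frag_cmul (d b) b) + (\<Sum>b\<in>?B2. frag_cmul (d b) b)"
          unfolding dec kd split ..
      qed (use BL lat in \<open>auto intro!: is_lattice_sum is_lattice_cmul keys_sum_subset keys_cmul_subset\<close>)
    qed
    then show ?thesis using s'(2) by simp
  qed
qed

subsection \<open>Connecting bases and gluing trees\<close>

definition move :: "('i \<Rightarrow>\<^sub>0 int) set \<Rightarrow> ('i \<Rightarrow>\<^sub>0 int) \<Rightarrow> ('i \<Rightarrow>\<^sub>0 int) \<Rightarrow> bool" where
  "move B u v \<longleftrightarrow> nonneg u \<and> nonneg v \<and> (u - v \<in> B \<or> v - u \<in> B)"

definition qconn :: "nat \<Rightarrow> ('i \<Rightarrow>\<^sub>0 int) set \<Rightarrow> ('i \<Rightarrow>\<^sub>0 int) \<Rightarrow> ('i \<Rightarrow>\<^sub>0 int) \<Rightarrow> bool" where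
  "qconn q B u v \<longleftrightarrow> (\<exists>k. (move B)\<^sup>*\<^sup>* (frag_cmul (int q ^ k) u) (frag_cmul (int q ^ k) v))"

definition connecting :: "('i \<Rightarrow>\<^sub>0 int) set \<Rightarrow> nat \<Rightarrow> 'i set \<Rightarrow> ('i \<Rightarrow>\<^sub>0 int) set \<Rightarrow> bool" where
  "connecting L q E B \<longleftrightarrow> finite B \<and> B \<subseteq> L \<and> (\<forall>b\<in>B. keys b \<subseteq> E) \<and> indep B \<and>
     (\<forall>u v. nonneg u \<longrightarrow> nonneg v \<longrightarrow> keys u \<subseteq> E \<longrightarrow> keys v \<subseteq> E \<longrightarrow> u - v \<in> L \<longrightarrow> qconn q B u v)"

lemma conn_add: "(move B)\<^sup>*\<^sup>* u v \<Longrightarrow> nonneg w \<Longrightarrow> (move B)\<^sup>*\<^sup>* (u + w) (v + w)"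
proof (induction rule: rtranclp_induct)
  case (step y z)
  then have "move B (y + w) (z + w)" by (auto simp: move_def nonneg_add)
  then show ?case using step by (meson rtranclp.rtrancl_into_rtrancl)
qed simp

lemma conn_sym: "(move B)\<^sup>*\<^sup>* u v \<Longrightarrow> (move B)\<^sup>*\<^sup>* v u"
  by (rule sympD[OF symp_rtranclp]) (auto simp: symp_def move_def)

lemma conn_mono: "(move B)\<^sup>*\<^sup>* u v \<Longrightarrow> B \<subseteq> B' \<Longrightarrow> (move B')\<^sup>*\<^sup>* u v"
  by (erule rtranclp_mono[THEN predicate2D, rotated]) (auto simp: move_def)

text \<open>A step from \<open>y\<close> to \<open>z\<close> is performed \<open>n\<close> times:
  the copies of \<open>y\<close> are exchanged one after the other while the remaining copies are
  carried along.\<close>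

lemma conn_cmul:
  assumes "(move B)\<^sup>*\<^sup>* u v" shows "(move B)\<^sup>*\<^sup>* (frag_cmul (int n) u) (frag_cmul (int n) v)"
  using assms
proof (induction rule: rtranclp_induct)
  case (step y z)
  have "(move B)\<^sup>*\<^sup>* (frag_cmul (int n) y) (frag_cmul (int n) z)"
  proof (induction n)
    case (Suc n)
    have y: "nonneg y" "nonneg z" using step by (auto simp: move_def)
    have "(move B)\<^sup>*\<^sup>* (frag_cmul (int n) y + y) (frag_cmul (int n) z + y)"
      by (rule conn_add[OF Suc y(1)])
    moreover have "(move B)\<^sup>*\<^sup>* (y + frag_cmul (int n) z) (z + frag_cmul (int n) z)"
      by (rule conn_add) (use step y in \<open>auto intro: nonneg_cmul\<close>)
    ultimately show ?case by (simp add: frag_cmul_distrib add.commute)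
  qed simp
  then show ?case using step by (meson rtranclp_trans)
qed simp

lemma conn_cmul_power:
  "(move B)\<^sup>*\<^sup>* u v \<Longrightarrow> (move B)\<^sup>*\<^sup>* (frag_cmul (int q ^ k) u) (frag_cmul (int q ^ k) v)"
  using conn_cmul[of B u v "q ^ k"] by simp

lemma conn_qconn: "(move B)\<^sup>*\<^sup>* u v \<Longrightarrow> qconn q B u v"
  unfolding qconn_def by (intro exI[of _ 0]) simp

lemma qconn_sym: "qconn q B u v \<Longrightarrow> qconn q B v u"
  unfolding qconn_def using conn_sym by blast

lemma qconn_mono: "qconn q B u v \<Longrightarrow> B \<subseteq> B' \<Longrightarrow> qconn q B' u v"
  unfolding qconn_def using conn_mono by blast

lemma qconn_trans:
  assumes "qconn q B u v" "qconn q B v w" shows "qconn q B u w"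
proof -
  obtain k l where "(move B)\<^sup>*\<^sup>* (frag_cmul (int q ^ k) u) (frag_cmul (int q ^ k) v)"
    "(move B)\<^sup>*\<^sup>* (frag_cmul (int q ^ l) v) (frag_cmul (int q ^ l) w)" using assms unfolding qconn_def by blast
  from conn_cmul_power[OF this(1), of q l] conn_cmul_power[OF this(2), of q k]
  have "(move B)\<^sup>*\<^sup>* (frag_cmul (int q ^ (k + l)) u) (frag_cmul (int q ^ (k + l)) w)"
    by (simp add: power_add mult.commute)
  then show ?thesis unfolding qconn_def by blast
qed

lemma qconn_add:
  assumes "qconn q B u v" "nonneg w" shows "qconn q B (u + w) (v + w)"
proof -
  obtain k where "(move B)\<^sup>*\<^sup>* (frag_cmul (int q ^ k) u) (frag_cmul (int q ^ k) v)"
    using assms unfolding qconn_def by blast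
  from conn_add[OF this nonneg_cmul[of "int q ^ k", OF _ assms(2)]]
  show ?thesis unfolding qconn_def frag_cmul_distrib2[symmetric] by auto
qed

lemma qconn_descale: "qconn q B (frag_cmul (int q ^ j) u) (frag_cmul (int q ^ j) v) \<Longrightarrow> qconn q B u v"
  unfolding qconn_def by (auto simp flip: power_add)

lemma conn_diff_in:
  assumes "is_lattice L" "B \<subseteq> L" "(move B)\<^sup>*\<^sup>* u v" shows "u - v \<in> L"
  using assms(3)
proof (induction rule: rtranclp_induct)
  case base
  then show ?case using is_lattice_zero[OF assms(1)] by simp
next
  case (step y z)
  then have "y - z \<in> L" using assms(2) is_lattice_uminus[OF assms(1), of "z - y"]
    by (auto simp: move_def)
  then have "(u - y) + (y - z) \<in> L" using step is_lattice_add[OF assms(1)] by blast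
  then show ?case by simp
qed

lemma connectingD:
  assumes "connecting L q E B"
  shows "finite B" "B \<subseteq> L" "b \<in> B \<Longrightarrow> keys b \<subseteq> E" "indep B"
    "nonneg u \<Longrightarrow> nonneg v \<Longrightarrow> keys u \<subseteq> E \<Longrightarrow> keys v \<subseteq> E \<Longrightarrow> u - v \<in> L \<Longrightarrow> qconn q B u v"
  using assms unfolding connecting_def by blast+

definition vpos :: "('i \<Rightarrow>\<^sub>0 int) \<Rightarrow> ('i \<Rightarrow>\<^sub>0 int)" where "vpos \<alpha> = restr (pos_keys \<alpha>) \<alpha>"
definition vneg :: "('i \<Rightarrow>\<^sub>0 int) \<Rightarrow> ('i \<Rightarrow>\<^sub>0 int)" where "vneg \<alpha> = vpos (- \<alpha>)"

lemma lookup_vpos: "lookup (vpos \<alpha>) i = max 0 (lookup \<alpha> i)"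
  and lookup_vneg: "lookup (vneg \<alpha>) i = max 0 (- lookup \<alpha> i)"
  by (auto simp: vpos_def vneg_def lookup_restr pos_keys_def)

lemma vpos_minus_vneg: "vpos \<alpha> - vneg \<alpha> = \<alpha>"
  by (rule poly_mapping_eqI) (simp add: lookup_minus lookup_vpos lookup_vneg)

lemma nonneg_vpos: "nonneg (vpos \<alpha>)" and nonneg_vneg: "nonneg (vneg \<alpha>)"
  by (simp_all add: nonneg_def lookup_vpos lookup_vneg)

lemma keys_vpos: "keys \<alpha> \<subseteq> E \<Longrightarrow> keys (vpos \<alpha>) \<subseteq> E" and keys_vneg: "keys \<alpha> \<subseteq> E \<Longrightarrow> keys (vneg \<alpha>) \<subseteq> E"
  by (simp_all add: keys_subset_iff lookup_vpos lookup_vneg)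

text \<open>Restriction to \<open>E1\<close> gives \<open>frag_cmul c b1 + x1 = 0\<close>, so a
  multiple of the nonnegative vector \<open>b1\<close> lies in \<open>L\<close>, and positivity
  leaves only the zero multiple.\<close>

lemma glue_sum_zero:
  assumes lat: "is_lattice L" and pos: "positive_on L (E1 \<union> E2)" and dis: "E1 \<inter> E2 = {}"
    and b: "nonneg b1" "keys b1 \<subseteq> E1" "keys b2 \<subseteq> E2" "b1 \<noteq> 0"
    and x: "x1 \<in> L" "keys x1 \<subseteq> E1" "keys x2 \<subseteq> E2"
    and e: "frag_cmul c (b1 - b2) + x1 + x2 = 0"
  shows "c = 0"
proof -
  have "lookup (frag_cmul c b1 + x1) i = 0" for i
  proof (cases "i \<in> E1")
    case True
    then have "lookup b2 i = 0" "lookup x2 i = 0" using b x dis by (auto simp: keys_subset_iff)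
    moreover have "lookup (frag_cmul c (b1 - b2) + x1 + x2) i = 0" by (simp add: e)
    ultimately show ?thesis by (simp add: lookup_add lookup_minus)
  next
    case False
    then show ?thesis using b x by (simp add: keys_subset_iff lookup_add)
  qed
  then have "frag_cmul c b1 + x1 = 0" by (intro poly_mapping_eqI) simp
  then have c: "frag_cmul c b1 = - x1" by (simp add: add_eq_0_iff2)
  have cL: "frag_cmul c b1 \<in> L" unfolding c by (rule is_lattice_uminus[OF lat x(1)])
  have k: "keys (frag_cmul d b1) \<subseteq> E1 \<union> E2" for d using b(2) by (auto intro!: keys_cmul_subset)
  show "c = 0"
  proof (cases "c \<ge> 0")
    case True
    then show ?thesis using positive_onD[OF pos cL k nonneg_cmul[OF True b(1)]] b(4) by simp
  next
    case False
    have "frag_cmul (- c) b1 \<in> L" using is_lattice_uminus[OF lat cL] by simp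
    then show ?thesis using positive_onD[OF pos _ k, of "-c"] nonneg_cmul[of "-c" b1] False b by simp
  qed
qed

lemma restr_sum_eqs:
  assumes dis: "E1 \<inter> E2 = {}" and k: "keys a1 \<subseteq> E1" "keys a2 \<subseteq> E2"
  shows "restr E1 (a1 + a2) = a1" "restr E2 (a1 + a2) = a2"
proof -
  have "keys a1 \<inter> E2 = {}" "keys a2 \<inter> E1 = {}" using dis k by blast+
  then show "restr E1 (a1 + a2) = a1" "restr E2 (a1 + a2) = a2"
    using k by (simp_all add: restr_add restr_id restr_disjoint)
qed

text \<open>At a node the bases of the two sides are completed by \<open>b1 - b2\<close>. Two
  congruent vectors are connected by decomposing a \<open>q\<close>-power multiple of their
  difference: inside \<open>E1\<close> one moves to a vector containing
  \<open>frag_cmul c b1\<close>, exchanges this summand for \<open>frag_cmul c b2\<close>, and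
  finishes inside \<open>E2\<close>. A negative \<open>c\<close> is handled by exchanging the two
  end points.\<close>

lemma glue_tree_imp_connecting:
  assumes lat: "is_lattice L"
  shows "glue_tree L q s E \<Longrightarrow> positive_on L E \<Longrightarrow> \<exists>B. connecting L q E B"
proof (induction rule: glue_tree.induct)
  case (leaf E)
  have "connecting L q E {}"
    unfolding connecting_def
  proof (intro conjI allI impI)
    fix u v assume "keys u \<subseteq> E" "keys v \<subseteq> E" "u - v \<in> L"
    then have "u - v = 0" using leaf keys_diff_subset by blast
    then show "qconn q {} u v" using conn_qconn[of "{}" u u] by simp
  qed (auto simp: indep_def)
  then show ?case by blast
next
  case (node E1 E2 b1 b2)
  have dis: "E1 \<inter> E2 = {}" by fact
  obtain B1 B2 where B1: "connecting L q E1 B1" and B2: "connecting L q E2 B2"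
    using node.IH positive_on_mono[OF node.prems] by (metis Un_upper1 Un_upper2)
  note C1 = connectingD[OF B1] and C2 = connectingD[OF B2]
  let ?\<beta> = "b1 - b2"
  have b10: "b1 = 0 \<longleftrightarrow> b2 = 0"
  proof
    assume "b1 = 0"
    then have "b2 \<in> L" using node is_lattice_uminus[OF lat, of "b1 - b2"] by simp
    then show "b2 = 0" using positive_onD[OF node.prems] node by blast
  next
    assume "b2 = 0"
    then show "b1 = 0" using positive_onD[OF node.prems, of b1] node by auto
  qed
  \<comment> \<open>At a degenerate node the gluing relation is zero and must not enter an
    independent set.\<close>
  define B0 where "B0 = (if b1 = 0 then {} else {?\<beta>})"
  define B where "B = B0 \<union> (B1 \<union> B2)"
  have fin: "finite B0" "finite B1" "finite B2" using C1(1) C2(1) by (auto simp: B0_def)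
  have nz: "0 \<notin> B1" "0 \<notin> B2" using indep_nonzero C1 C2 by blast+
  have d12: "B1 \<inter> B2 = {}" 
  proof (rule ccontr)
    assume "B1 \<inter> B2 \<noteq> {}"
    then obtain b where "b \<in> B1" "b \<in> B2" by blast
    then have "keys b \<subseteq> E1 \<inter> E2" "b \<noteq> 0" using C1 C2 nz by blast+
    then show False using dis by (metis keys_eq_empty subset_empty)
  qed
  have d0: "B0 \<inter> (B1 \<union> B2) = {}"
  proof (rule ccontr)
    assume "B0 \<inter> (B1 \<union> B2) \<noteq> {}"
    then have nz: "b1 \<noteq> 0" "b2 \<noteq> 0" and "?\<beta> \<in> B1 \<union> B2" using b10 by (auto simp: B0_def split: if_splits)
    then have "keys ?\<beta> \<subseteq> E1 \<or> keys ?\<beta> \<subseteq> E2" using C1 C2 by blast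
    moreover obtain i j where ij: "i \<in> keys b1" "j \<in> keys b2" using nz by (metis all_not_in_conv keys_eq_empty)
    moreover have ijE: "i \<in> E1" "j \<in> E2" using ij node.hyps(6,7) by blast+
    moreover have "i \<notin> E2" "j \<notin> E1" using ijE dis by blast+
    moreover have "lookup b2 i = 0" "lookup b1 j = 0"
      using \<open>i \<notin> E2\<close> \<open>j \<notin> E1\<close> node.hyps(6,7) unfolding keys_subset_iff by blast+
    then have "i \<in> keys ?\<beta>" "j \<in> keys ?\<beta>" using ij by (simp_all add: in_keys_iff lookup_minus)
    ultimately show False by blast
  qed
  have "indep B" unfolding indep_def
  proof (intro allI impI)
    fix c assume z: "(\<Sum>b\<in>B. frag_cmul (c b) b) = 0"
    define e where "e = (if b1 = 0 then 0 else c ?\<beta>)"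
    define x1 where "x1 = (\<Sum>b\<in>B1. frag_cmul (c b) b)"
    define x2 where "x2 = (\<Sum>b\<in>B2. frag_cmul (c b) b)"
    have xL: "x1 \<in> L" "x2 \<in> L" unfolding x1_def x2_def using C1 C2 lat by (auto intro!: is_lattice_sum is_lattice_cmul)
    have xE: "keys x1 \<subseteq> E1" "keys x2 \<subseteq> E2" unfolding x1_def x2_def
      by (intro keys_sum_subset keys_cmul_subset C1(3) C2(3); assumption)+
    have "(\<Sum>b\<in>B. frag_cmul (c b) b) = frag_cmul e ?\<beta> + x1 + x2"
      unfolding B_def x1_def x2_def using fin d0 d12
      by (subst sum.union_disjoint, simp, simp, simp, subst sum.union_disjoint, simp_all)
        (simp add: B0_def e_def add.assoc)
    then have s: "frag_cmul e ?\<beta> + x1 + x2 = 0" using z by simp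
    have e0: "e = 0"
    proof (cases "b1 = 0")
      case False
      then show ?thesis using glue_sum_zero[OF lat node.prems dis] s xL xE node by blast
    qed (simp add: e_def)
    then have "x1 = 0" "x2 = 0" using s restr_sum_eqs[OF dis xE] restr_id[of 0] by auto
    then show "\<forall>b\<in>B. c b = 0"
      using e0 indepD[OF C1(4), of c] indepD[OF C2(4), of c]
      by (auto simp: B_def B0_def e_def x1_def x2_def split: if_splits)
  qed
  moreover have "qconn q B u v" if uv: "nonneg u" "nonneg v" "keys u \<subseteq> E1 \<union> E2" "keys v \<subseteq> E1 \<union> E2" "u - v \<in> L" for u v
  proof -
    have main: "qconn q B u v" if uv: "nonneg u" "nonneg v" "keys u \<subseteq> E1 \<union> E2" "keys v \<subseteq> E1 \<union> E2"
      and l: "l1 \<in> L" "l2 \<in> L" "keys l1 \<subseteq> E1" "keys l2 \<subseteq> E2" and c: "c \<ge> 0"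
      and e: "frag_cmul (int q ^ k) (u - v) = frag_cmul c ?\<beta> + l1 + l2" for u v k c l1 l2
    proof -
      let ?Q = "frag_cmul (int q ^ k)" and ?r1 = "restr E1" and ?r2 = "restr E2"
      have eq: "frag_cmul c ?\<beta> + l1 + l2 = (frag_cmul c b1 + l1) + (- frag_cmul c b2 + l2)"
        by (rule poly_mapping_eqI) (simp add: lookup_add lookup_minus algebra_simps)
      have kk: "keys (frag_cmul c b1 + l1) \<subseteq> E1" "keys (- frag_cmul c b2 + l2) \<subseteq> E2"
        unfolding minus_frag_cmul by (intro keys_add_subset keys_cmul_subset node.hyps(6,7) l)+
      have 1: "?Q (?r1 u) - ?Q (?r1 v) = frag_cmul c b1 + l1"
        using arg_cong[OF e, of ?r1] restr_sum_eqs(1)[OF dis kk] unfolding eq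
        by (simp only: restr_cmul restr_diff frag_cmul_distrib2 flip: frag_cmul_diff_distrib)
          (auto intro!: poly_mapping_eqI simp: poly_mapping_eq_iff fun_eq_iff lookup_minus lookup_add algebra_simps)
      have 2: "?Q (?r2 u) - ?Q (?r2 v) = - frag_cmul c b2 + l2"
        using arg_cong[OF e, of ?r2] restr_sum_eqs(2)[OF dis kk] unfolding eq
        by (simp only: restr_cmul restr_diff frag_cmul_distrib2 flip: frag_cmul_diff_distrib)
          (auto intro!: poly_mapping_eqI simp: poly_mapping_eq_iff fun_eq_iff lookup_minus lookup_add algebra_simps)
      have nn: "nonneg (?Q (?r1 u))" "nonneg (?Q (?r1 v))" "nonneg (?Q (?r2 u))" "nonneg (?Q (?r2 v))"
        "nonneg (frag_cmul c b1)" "nonneg (frag_cmul c b2)"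
        using uv c node by (auto intro!: nonneg_cmul nonneg_restr)
      have "qconn q B1 (?Q (?r1 u)) (?Q (?r1 v) + frag_cmul c b1)"
      proof (rule C1(5))
        have "?Q (?r1 u) - (?Q (?r1 v) + frag_cmul c b1) = l1" using 1 by (simp add: algebra_simps)
        then show "?Q (?r1 u) - (?Q (?r1 v) + frag_cmul c b1) \<in> L" using l by simp
      qed (intro nn nonneg_add keys_add_subset keys_cmul_subset keys_restr node.hyps(6))+
      then have s1: "qconn q B (?Q (?r1 u) + ?Q (?r2 u)) ((?Q (?r1 v) + frag_cmul c b1) + ?Q (?r2 u))"
        by (intro qconn_add[OF qconn_mono] nn) (auto simp: B_def)
      have "qconn q B (frag_cmul c b1) (frag_cmul c b2)"
      proof (cases "b1 = 0")
        case True
        then show ?thesis using b10 conn_qconn[of B 0 0] by simp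
      next
        case False
        then have "move B b1 b2" using node by (auto simp: move_def B_def B0_def)
        then have "(move B)\<^sup>*\<^sup>* (frag_cmul (int (nat c)) b1) (frag_cmul (int (nat c)) b2)"
          by (intro conn_cmul) auto
        then show ?thesis using c conn_qconn by simp
      qed
      from qconn_add[OF this nonneg_add[OF nn(2,3)]]
      have s2: "qconn q B ((?Q (?r1 v) + frag_cmul c b1) + ?Q (?r2 u)) (?Q (?r1 v) + (?Q (?r2 u) + frag_cmul c b2))"
        by (simp add: add_ac)
      have "qconn q B2 (?Q (?r2 u) + frag_cmul c b2) (?Q (?r2 v))"
      proof (rule C2(5))
        have "?Q (?r2 u) + frag_cmul c b2 - ?Q (?r2 v) = l2" using 2 
          by (simp add: algebra_simps del: minus_frag_cmul)
        then show "?Q (?r2 u) + frag_cmul c b2 - ?Q (?r2 v) \<in> L" using l by simp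
      qed (intro nn nonneg_add keys_add_subset keys_cmul_subset keys_restr node.hyps(7))+
      then have "qconn q B ((?Q (?r2 u) + frag_cmul c b2) + ?Q (?r1 v)) (?Q (?r2 v) + ?Q (?r1 v))"
        by (intro qconn_add[OF qconn_mono] nn) (auto simp: B_def)
      then have s3: "qconn q B (?Q (?r1 v) + (?Q (?r2 u) + frag_cmul c b2)) (?Q (?r1 v) + ?Q (?r2 v))"
        by (simp add: add_ac)
      have "?Q (?r1 x) + ?Q (?r2 x) = ?Q x" if "keys x \<subseteq> E1 \<union> E2" for x
        using restr_split[OF that dis] by (simp flip: frag_cmul_distrib2)
      then have "qconn q B (?Q u) (?Q v)" using qconn_trans[OF qconn_trans[OF s1 s2] s3] uv by simp
      then show ?thesis by (rule qconn_descale)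
    qed
    have "keys (u - v) \<subseteq> E1 \<union> E2" using uv keys_diff_subset by blast
    then obtain k c l1 l2 where l: "l1 \<in> L" "l2 \<in> L" "keys l1 \<subseteq> E1" "keys l2 \<subseteq> E2"
      "frag_cmul (int q ^ k) (u - v) = frag_cmul c ?\<beta> + l1 + l2"
      using node.hyps(10)[OF uv(5)] by blast
    show ?thesis
    proof (cases "c \<ge> 0")
      case True
      then show ?thesis using main[OF uv(1-4) l(1-4) _ l(5)] by blast
    next
      case False
      have "frag_cmul (int q ^ k) (v - u) = - frag_cmul (int q ^ k) (u - v)"
        by (rule poly_mapping_eqI) (simp add: lookup_minus algebra_simps)
      also have "\<dots> = frag_cmul (- c) ?\<beta> + (- l1) + (- l2)" unfolding l(5) by simp
      finally have "qconn q B v u" using False l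
        by (intro main[OF uv(2,1,4,3), of "-l1" "-l2" "-c"]) (auto intro: is_lattice_uminus[OF lat])
      then show ?thesis by (rule qconn_sym)
    qed
  qed
  moreover have "b \<in> L \<and> keys b \<subseteq> E1 \<union> E2" if "b \<in> B" for b
  proof -
    consider "b = ?\<beta>" | "b \<in> B1" | "b \<in> B2" using \<open>b \<in> B\<close> by (auto simp: B_def B0_def split: if_splits)
    then show ?thesis
    proof cases
      case 1
      have "keys b1 \<subseteq> E1 \<union> E2" "keys b2 \<subseteq> E1 \<union> E2" using node.hyps(6,7) by blast+
      then show ?thesis using 1 node.hyps(8) keys_diff_subset by blast
    next
      case 2
      then show ?thesis using C1(2,3) by blast
    next
      case 3
      then show ?thesis using C2(2,3) by blast
    qed
  qed
  moreover have "finite B" using fin by (simp add: B_def)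
  ultimately have "connecting L q (E1 \<union> E2) B" unfolding connecting_def by blast
  then show ?case by blast
qed

text \<open>Starting from a vector that vanishes on \<open>J\<close>, a step along a vector with
  both signs on \<open>J\<close> would produce a negative coordinate. So only basis vectors
  vanishing on \<open>J\<close> can be used.\<close>

lemma conn_zero_on:
  assumes all: "\<forall>b\<in>B. zero_on J b \<or> crosses pos_keys neg_keys J b" and fB: "finite B"
    and c: "(move B)\<^sup>*\<^sup>* u v" and z: "zero_on J u"
  shows "zero_on J v \<and> u - v \<in> zspan {b\<in>B. zero_on J b}"
  using c
proof (induction rule: rtranclp_induct)
  case base
  then show ?case using z is_lattice_zero[OF is_lattice_zspan] by simp
next
  case (step y w)
  note lat = is_lattice_zspan[of "{b\<in>B. zero_on J b}"]
  have nn: "nonneg w" and yz: "zero_on J y" using step by (auto simp: move_def)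
  obtain b where b: "b \<in> B" "w = y + b \<or> w = y - b" using step(2) unfolding move_def by (metis add.commute diff_add_cancel minus_diff_eq uminus_add_conv_diff)
  have zb: "zero_on J b"
  proof (rule ccontr)
    assume "\<not> zero_on J b"
    then have "crosses pos_keys neg_keys J b" using all b by blast
    then obtain i j where "i \<in> J" "j \<in> J" "0 < lookup b i" "lookup b j < 0"
      by (auto simp: crosses_def pos_keys_def neg_keys_def)
    moreover have "lookup y i = 0" "lookup y j = 0" using yz \<open>i \<in> J\<close> \<open>j \<in> J\<close> by (auto simp: zero_on_def)
    moreover have "0 \<le> lookup w i" "0 \<le> lookup w j" using nn by (auto simp: nonneg_def)
    ultimately show False using b(2) by (auto simp: lookup_add lookup_minus)
  qed
  then have bs: "b \<in> zspan {b\<in>B. zero_on J b}" using b fB by (intro zspan_base) auto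
  have "zero_on J w" using b(2) yz zb by (auto simp: zero_on_def lookup_add lookup_minus)
  moreover have "u - w = (u - y) - b \<or> u - w = (u - y) + b" using b(2) by (auto simp: algebra_simps)
  moreover have "(u - y) - b \<in> zspan {b\<in>B. zero_on J b}" "(u - y) + b \<in> zspan {b\<in>B. zero_on J b}"
    using step bs is_lattice_add[OF lat] is_lattice_diff[OF lat] by blast+
  ultimately show ?case by metis
qed

text \<open>\<open>conn_zero_on\<close> is applied to a path between multiples of the positive and
  the negative part of \<open>\<alpha>\<close>. If the negative part misses \<open>J\<close>, the
  reversed path shows that the positive part misses it as well.\<close>

lemma connecting_imp_mixed_basis:
  assumes q: "q > 0" and C: "connecting L q E B"
  shows "mixed_basis L q E B"
proof -
  note C' = connectingD[OF C]
  have "(zero_on J \<alpha> \<or> neg_keys \<alpha> \<inter> J \<noteq> {}) \<and>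
      (zero_on J \<alpha> \<longrightarrow> (\<exists>k. frag_cmul (int q ^ k) \<alpha> \<in> zspan {b\<in>B. zero_on J b}))"
    if J: "J \<subseteq> E" "\<forall>b\<in>B. zero_on J b \<or> crosses pos_keys neg_keys J b" and \<alpha>: "\<alpha> \<in> L" "keys \<alpha> \<subseteq> E" for J \<alpha>
  proof -
    have "qconn q B (vpos \<alpha>) (vneg \<alpha>)"
      by (rule C'(5)) (use \<alpha> in \<open>auto intro!: nonneg_vpos nonneg_vneg keys_vpos keys_vneg simp: vpos_minus_vneg\<close>)
    then obtain k where k: "(move B)\<^sup>*\<^sup>* (frag_cmul (int q ^ k) (vpos \<alpha>)) (frag_cmul (int q ^ k) (vneg \<alpha>))"
      unfolding qconn_def by blast
    have zQ: "zero_on J (frag_cmul (int q ^ k) x) \<longleftrightarrow> zero_on J x" for x using q by (simp add: zero_on_def)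
    have "zero_on J \<alpha>" if "neg_keys \<alpha> \<inter> J = {}"
    proof -
      have "zero_on J (vneg \<alpha>)" using that by (force simp: zero_on_def lookup_vneg neg_keys_def)
      then have "zero_on J (vpos \<alpha>)" using conn_zero_on[OF J(2) C'(1) conn_sym[OF k]] zQ by blast
      with \<open>zero_on J (vneg \<alpha>)\<close> have "zero_on J (vpos \<alpha> - vneg \<alpha>)" by (simp add: zero_on_def lookup_minus)
      then show ?thesis by (simp add: vpos_minus_vneg)
    qed
    moreover have "frag_cmul (int q ^ k) \<alpha> \<in> zspan {b\<in>B. zero_on J b}" if "zero_on J \<alpha>"
    proof -
      have "zero_on J (vpos \<alpha>)" using that by (simp add: zero_on_def lookup_vpos)
      then have "frag_cmul (int q ^ k) (vpos \<alpha>) - frag_cmul (int q ^ k) (vneg \<alpha>) \<in> zspan {b\<in>B. zero_on J b}"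
        using conn_zero_on[OF J(2) C'(1) k] zQ by blast
      moreover have "frag_cmul (int q ^ k) (vpos \<alpha>) - frag_cmul (int q ^ k) (vneg \<alpha>) = frag_cmul (int q ^ k) (vpos \<alpha> - vneg \<alpha>)"
        by (rule poly_mapping_eqI) (simp add: lookup_minus algebra_simps)
      ultimately show ?thesis by (simp add: vpos_minus_vneg)
    qed
    ultimately show ?thesis by blast
  qed
  then show ?thesis unfolding mixed_basis_def using C' by blast
qed

text \<open>In the semigroup of combinations modulo \<open>L\<close> this is a face: whatever equals
  a combination of generators in \<open>F\<close> involves no other generators.\<close>

definition is_face :: "('i \<Rightarrow>\<^sub>0 int) set \<Rightarrow> 'i set \<Rightarrow> 'i set \<Rightarrow> bool" where
  "is_face L E F \<longleftrightarrow> (\<forall>u v. nonneg u \<longrightarrow> nonneg v \<longrightarrow> keys u \<subseteq> E \<longrightarrow> keys v \<subseteq> E \<longrightarrow> u - v \<in> L \<longrightarrow>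
     keys u \<subseteq> F \<longrightarrow> keys v \<subseteq> F)"

lemma is_faceD:
  "is_face L E F \<Longrightarrow> nonneg u \<Longrightarrow> nonneg v \<Longrightarrow> keys u \<subseteq> E \<Longrightarrow> keys v \<subseteq> E \<Longrightarrow> u - v \<in> L \<Longrightarrow>
     keys u \<subseteq> F \<Longrightarrow> keys v \<subseteq> F"
  unfolding is_face_def by blast

lemma is_face_mono: "is_face L E F \<Longrightarrow> E' \<subseteq> E \<Longrightarrow> is_face L E' F"
  unfolding is_face_def by (meson order_trans)

lemma keys_nonneg_add: "nonneg u \<Longrightarrow> nonneg v \<Longrightarrow> keys (u + v) = keys u \<union> keys v"
  by (auto simp: in_keys_iff nonneg_def lookup_add add_nonneg_eq_0_iff)

text \<open>The two halves of a gluing relation are congruent, so both are supported in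
  \<open>F\<close> or neither is. In the second case the relation has coefficient zero in every
  relation supported in \<open>F\<close>, and the node may become degenerate.\<close>

lemma glue_tree_face:
  assumes lat: "is_lattice L"
  shows "glue_tree L q s E \<Longrightarrow> is_face L E F \<Longrightarrow> glue_tree L q False (E \<inter> F)"
proof (induction rule: glue_tree.induct)
  case (leaf E)
  then show ?case by (intro glue_tree.leaf) auto
next
  case (node E1 E2 b1 b2)
  have dis: "E1 \<inter> E2 = {}" by fact
  have t: "glue_tree L q False (E1 \<inter> F)" "glue_tree L q False (E2 \<inter> F)"
    using node.IH is_face_mono[OF node.prems] by simp_all
  have sym: "keys b1 \<subseteq> F \<longleftrightarrow> keys b2 \<subseteq> F"
  proof
    show "keys b2 \<subseteq> F" if "keys b1 \<subseteq> F"
      by (rule is_faceD[OF node.prems _ _ _ _ _ that]) (use node in auto)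
    show "keys b1 \<subseteq> F" if "keys b2 \<subseteq> F"
      by (rule is_faceD[OF node.prems _ _ _ _ _ that]) (use node is_lattice_uminus[OF lat, of "b1 - b2"] in auto)
  qed
  define d1 where "d1 = (if keys b1 \<subseteq> F then b1 else 0)"
  define d2 where "d2 = (if keys b1 \<subseteq> F then b2 else 0)"
  have "glue_tree L q False ((E1 \<inter> F) \<union> (E2 \<inter> F))"
  proof (rule glue_tree.node[OF t, of d1 d2])
    fix \<alpha> assume \<alpha>: "\<alpha> \<in> L" "keys \<alpha> \<subseteq> E1 \<inter> F \<union> E2 \<inter> F"
    then have "keys \<alpha> \<subseteq> E1 \<union> E2" by blast
    then obtain k c l1 l2 where l: "l1 \<in> L" "l2 \<in> L" "keys l1 \<subseteq> E1" "keys l2 \<subseteq> E2"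
      and e: "frag_cmul (int q ^ k) \<alpha> = frag_cmul c (b1 - b2) + l1 + l2"
      using node.hyps(10)[OF \<alpha>(1)] by blast
    have r1: "lookup l1 i = int q ^ k * lookup \<alpha> i - c * lookup b1 i" if "i \<in> E1" for i
    proof -
      have "lookup b2 i = 0" "lookup l2 i = 0"
        using that node.hyps(7) l(4) dis unfolding keys_subset_iff by blast+
      then show ?thesis using arg_cong[OF e, of "\<lambda>x. lookup x i"] by (simp add: lookup_add lookup_minus)
    qed
    have r2: "lookup l2 i = int q ^ k * lookup \<alpha> i + c * lookup b2 i" if "i \<in> E2" for i
    proof -
      have "lookup b1 i = 0" "lookup l1 i = 0"
        using that node.hyps(6) l(3) dis unfolding keys_subset_iff by blast+
      then show ?thesis using arg_cong[OF e, of "\<lambda>x. lookup x i"]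
        by (simp add: lookup_add lookup_minus algebra_simps)
    qed
    \<comment> \<open>With a nonzero coefficient, a nonnegative vector supported in \<open>F\<close>
      would be congruent to one containing a positive multiple of \<open>b1\<close>, up to replacing
      the restriction of \<open>\<alpha>\<close> by its negative.\<close>
    have c0: "c = 0" if nF: "\<not> keys b1 \<subseteq> F"
    proof (rule ccontr)
      assume c: "c \<noteq> 0"
      let ?a = "restr E1 \<alpha>"
      have kF: "keys ?a \<subseteq> F" "keys ?a \<subseteq> E1 \<union> E2" using \<alpha>(2) by (auto simp: keys_subset_iff lookup_restr)
      have main: "keys (frag_cmul (int q ^ k) (vneg a') + frag_cmul c' b1) \<subseteq> F" if a': "keys a' \<subseteq> F" "keys a' \<subseteq> E1 \<union> E2" and c': "c' > 0" 
        and L': "frag_cmul (int q ^ k) a' - frag_cmul c' b1 \<in> L" for a' c'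
      proof (rule is_faceD[OF node.prems, of "frag_cmul (int q ^ k) (vpos a')"])
        have "frag_cmul (int q ^ k) (vpos a') - (frag_cmul (int q ^ k) (vneg a') + frag_cmul c' b1) =
           frag_cmul (int q ^ k) (vpos a' - vneg a') - frag_cmul c' b1"
          by (rule poly_mapping_eqI) (simp add: lookup_minus lookup_add algebra_simps)
        then show "frag_cmul (int q ^ k) (vpos a') - (frag_cmul (int q ^ k) (vneg a') + frag_cmul c' b1) \<in> L"
          using L' by (simp only: vpos_minus_vneg)
        have kb: "keys b1 \<subseteq> E1 \<union> E2" using node.hyps(6) by blast
        show "nonneg (frag_cmul (int q ^ k) (vpos a'))"
          "nonneg (frag_cmul (int q ^ k) (vneg a') + frag_cmul c' b1)"
          using c' node.hyps(4) by (auto intro!: nonneg_cmul nonneg_add nonneg_vpos nonneg_vneg)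
        show "keys (frag_cmul (int q ^ k) (vpos a')) \<subseteq> E1 \<union> E2" "keys (frag_cmul (int q ^ k) (vpos a')) \<subseteq> F"
          by (intro keys_cmul_subset keys_vpos a')+
        show "keys (frag_cmul (int q ^ k) (vneg a') + frag_cmul c' b1) \<subseteq> E1 \<union> E2"
          by (intro keys_add_subset keys_cmul_subset keys_vneg a' kb)
      qed
      have f: "keys b1 \<subseteq> F" if "keys (frag_cmul (int q ^ k) (vneg a') + frag_cmul c' b1) \<subseteq> F" "c' > 0" for a' c'
        using that by (subst (asm) keys_nonneg_add) (use node in \<open>auto intro!: nonneg_cmul nonneg_vneg\<close>)
      have e1: "frag_cmul (int q ^ k) ?a - frag_cmul c b1 = l1"
        using r1 l node by (intro poly_mapping_eqI) (auto simp: lookup_minus lookup_restr keys_subset_iff)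
      show False
      proof (cases "c > 0")
        case True
        then show False using main[OF kF True] f nF e1 l by blast
      next
        case False
        then have c': "- c > 0" using c by simp
        have "frag_cmul (int q ^ k) (- ?a) - frag_cmul (- c) b1 = - l1"
          unfolding e1[symmetric] by (rule poly_mapping_eqI) (simp add: lookup_minus)
        then have "frag_cmul (int q ^ k) (- ?a) - frag_cmul (- c) b1 \<in> L" using is_lattice_uminus[OF lat l(1)] by simp
        then show False using main[of "- ?a", OF _ _ c'] kF f[OF _ c'] nF by simp
      qed
    qed
    have cb: "frag_cmul c (b1 - b2) = frag_cmul c (d1 - d2)" using c0 by (auto simp: d1_def d2_def)
    have cz: "c * lookup b1 i = 0 \<and> c * lookup b2 i = 0" if "i \<notin> F" for i
      using that c0 sym by (cases "keys b1 \<subseteq> F") (auto simp: keys_subset_iff)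
    have \<alpha>0: "lookup \<alpha> i = 0" if "i \<notin> F" for i using \<alpha>(2) that by (auto simp: keys_subset_iff)
    have "lookup l1 i = 0" if "i \<notin> E1 \<inter> F" for i
    proof (cases "i \<in> E1")
      case True
      then show ?thesis using r1[OF True] cz[of i] \<alpha>0[of i] that by simp
    next
      case False
      then show ?thesis using l(3) unfolding keys_subset_iff by blast
    qed
    moreover have "lookup l2 i = 0" if "i \<notin> E2 \<inter> F" for i
    proof (cases "i \<in> E2")
      case True
      then show ?thesis using r2[OF True] cz[of i] \<alpha>0[of i] that by simp
    next
      case False
      then show ?thesis using l(4) unfolding keys_subset_iff by blast
    qed
    ultimately have "keys l1 \<subseteq> E1 \<inter> F" "keys l2 \<subseteq> E2 \<inter> F"
      unfolding keys_subset_iff by blast+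
    then show "\<exists>k c l1 l2. l1 \<in> L \<and> l2 \<in> L \<and> keys l1 \<subseteq> E1 \<inter> F \<and> keys l2 \<subseteq> E2 \<inter> F \<and>
         frag_cmul (int q ^ k) \<alpha> = frag_cmul c (d1 - d2) + l1 + l2"
      using l e cb by metis
  qed (use node sym dis is_lattice_zero[OF lat] in \<open>auto simp: d1_def d2_def nonneg_zero\<close>)
  then show ?case by (simp add: Int_Un_distrib2)
qed

text \<open>The new generator forms a side of its own, glued along its expression \<open>u\<close>.
  Subtracting the multiple given by the coordinate at \<open>e\<close> leaves a relation on
  \<open>E\<close>.\<close>

lemma glue_tree_insert:
  assumes lat: "is_lattice L" and t: "glue_tree L q s E" and e: "e \<notin> E"
    and pos: "positive_on L (insert e E)" and u: "nonneg u" "keys u \<subseteq> E" "frag_of e - u \<in> L"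
  shows "glue_tree L q s (insert e E)"
proof -
  have single: "\<alpha> = 0" if "\<alpha> \<in> L" "keys \<alpha> \<subseteq> {e}" for \<alpha>
  proof (cases "lookup \<alpha> e \<ge> 0")
    case True
    have "0 \<le> lookup \<alpha> i" for i using True that(2) by (cases "i = e") (auto simp: keys_subset_iff)
    then have "nonneg \<alpha>" by (simp add: nonneg_def)
    then show ?thesis using positive_onD[OF pos that(1)] that(2) by auto
  next
    case False
    have "lookup \<alpha> i \<le> 0" for i using False that(2) by (cases "i = e") (auto simp: keys_subset_iff)
    then have "nonneg (- \<alpha>)" by (simp add: nonneg_def)
    then show ?thesis using positive_onD[OF pos is_lattice_uminus[OF lat that(1)]] that(2) by auto
  qed
  have "glue_tree L q s ({e} \<union> E)"
  proof (rule glue_tree.node[of L q s "{e}" E "frag_of e" u])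
    show "glue_tree L q s {e}" by (rule glue_tree.leaf) (use single in auto)
    show "frag_of e \<noteq> 0 \<and> u \<noteq> 0"
      using positive_onD[OF pos, of "frag_of e"] u(3) nonneg_frag_of[of e]
      by (auto simp: keys_frag_of)
    fix \<alpha> assume \<alpha>: "\<alpha> \<in> L" "keys \<alpha> \<subseteq> {e} \<union> E"
    let ?l = "\<alpha> - frag_cmul (lookup \<alpha> e) (frag_of e - u)"
    have "lookup u e = 0" using u e by (auto simp: keys_subset_iff)
    then have "keys ?l \<subseteq> E"
      using \<alpha>(2) u(2) by (auto simp: keys_subset_iff lookup_minus)
    moreover have "?l \<in> L" using \<alpha> u lat by (auto intro!: is_lattice_diff is_lattice_cmul)
    ultimately show "\<exists>k c l1 l2. l1 \<in> L \<and> l2 \<in> L \<and> keys l1 \<subseteq> {e} \<and> keys l2 \<subseteq> E \<and>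
         frag_cmul (int q ^ k) \<alpha> = frag_cmul c (frag_of e - u) + l1 + l2"
      using is_lattice_zero[OF lat]
      by (intro exI[of _ 0] exI[of _ "lookup \<alpha> e"] exI[of _ "0 :: _ \<Rightarrow>\<^sub>0 int"] exI[of _ ?l]) auto
  qed (use t e u nonneg_frag_of in \<open>auto simp: keys_frag_of\<close>)
  then show ?thesis by simp
qed

subsection \<open>Adding and removing a generator\<close>

lemma int_subgroup_principal:
  fixes H :: "int set"
  assumes diff: "\<And>x y. x \<in> H \<Longrightarrow> y \<in> H \<Longrightarrow> x - y \<in> H" and N: "N \<in> H" "N > 0"
  shows "\<exists>d>0. d \<in> H \<and> (\<forall>c\<in>H. d dvd c)"
proof -
  have 0: "0 \<in> H" using diff[OF N(1) N(1)] by simp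
  have neg: "- x \<in> H" if "x \<in> H" for x using diff[OF 0 that] by simp
  have add: "x + y \<in> H" if "x \<in> H" "y \<in> H" for x y using diff[OF that(1) neg[OF that(2)]] by simp
  have natmult: "int n * x \<in> H" if "x \<in> H" for n x
    by (induction n) (use 0 add that in \<open>auto simp: algebra_simps\<close>)
  have mult: "k * x \<in> H" if "x \<in> H" for k x
    using natmult[OF that, of "nat k"] neg[OF natmult[OF that, of "nat (- k)"]] by (cases "k \<ge> 0") auto
  define m where "m = (LEAST n. n > 0 \<and> int n \<in> H)"
  have "nat N > 0 \<and> int (nat N) \<in> H" using N by simp
  then have m: "m > 0" "int m \<in> H" and least: "\<And>n. n > 0 \<Longrightarrow> int n \<in> H \<Longrightarrow> m \<le> n"
    unfolding m_def by (metis (mono_tags, lifting) LeastI, metis (mono_tags, lifting) LeastI, metis (mono_tags, lifting) Least_le)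
  have "int m dvd c" if c: "c \<in> H" for c
  proof -
    have "c mod int m = c - (c div int m) * int m" by (simp add: minus_div_mult_eq_mod)
    also have "\<dots> \<in> H" by (intro diff c mult m)
    finally have r: "c mod int m \<in> H" .
    have "c mod int m = 0"
    proof (rule ccontr)
      assume "c mod int m \<noteq> 0"
      then have "0 < c mod int m" using m pos_mod_sign[of "int m" c] by linarith
      then have "m \<le> nat (c mod int m)" using least[of "nat (c mod int m)"] r by simp
      moreover have "c mod int m < int m" using m pos_mod_bound[of "int m" c] by linarith
      ultimately show False using \<open>0 < c mod int m\<close> by linarith
    qed
    then show ?thesis by auto
  qed
  then show ?thesis using m by (intro exI[of _ "int m"]) auto
qed

text \<open>Division of \<open>q ^ l\<close> by \<open>M\<close> leaves a bounded coefficient for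
  \<open>z\<close>, while the quotient grows with \<open>l\<close> and multiplies a vector that is
  strictly positive on \<open>E\<close>.\<close>

lemma large_power_combination:
  assumes q: "q \<ge> 2" and fE: "finite E" and y: "\<And>i. i \<in> E \<Longrightarrow> 0 < lookup y i" "keys y \<subseteq> E"
    and z: "keys z \<subseteq> E" and M: "M > (0::int)"
  shows "\<exists>l a r. int q ^ l = a * M + r \<and> nonneg (frag_cmul a y + frag_cmul r z)"
proof -
  define K where "K = (\<Sum>i\<in>E. M * \<bar>lookup z i\<bar>)"
  have K: "M * \<bar>lookup z i\<bar> \<le> K" if "i \<in> E" for i
    unfolding K_def using member_le_sum[of i E "\<lambda>i. M * \<bar>lookup z i\<bar>"] that M fE by simp
  have K0: "0 \<le> K" unfolding K_def using M by (intro sum_nonneg) auto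
  \<comment> \<open>Any exponent with \<open>M * K \<le> int q ^ l\<close> would do; this one works
    because \<open>l < 2 ^ l\<close>.\<close>
  define l where "l = nat (M * K)"
  have "int l < int (2 ^ l)" by (simp only: of_nat_less_iff less_exp)
  also have "\<dots> \<le> int q ^ l" using power_mono[OF q, of l] by (simp flip: of_nat_power)
  finally have "M * K \<le> int q ^ l" using M K0 by (simp add: l_def)
  define a where "a = int q ^ l div M"
  define r where "r = int q ^ l mod M"
  have aK: "K \<le> a" unfolding a_def using zdiv_mono1[OF \<open>M * K \<le> int q ^ l\<close> M] M by simp
  have r: "0 \<le> r" "r < M" using M by (auto simp: r_def)
  have "0 \<le> a * lookup y i + r * lookup z i" for i
  proof (cases "i \<in> E")
    case True
    have "\<bar>r * lookup z i\<bar> \<le> M * \<bar>lookup z i\<bar>" using r by (simp add: abs_mult mult_right_mono)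
    also have "\<dots> \<le> a" using K[OF True] aK by simp
    also have "a \<le> a * lookup y i" using y(1)[OF True] aK K0 mult_left_mono[of 1 "lookup y i" a] by simp
    finally show ?thesis by linarith
  next
    case False
    then have "lookup y i = 0" "lookup z i = 0" using y z by (auto simp: keys_subset_iff)
    then show ?thesis by simp
  qed
  then have "nonneg (frag_cmul a y + frag_cmul r z)" by (simp add: nonneg_def lookup_add)
  moreover have "int q ^ l = a * M + r" by (simp add: a_def r_def)
  ultimately show ?thesis by blast
qed

text \<open>The assumptions on \<open>w\<close> place \<open>a\<close> in the interior: a positive
  multiple of it is congruent to a vector positive on all other generators. Split along the node,
  this congruence yields one of the same kind inside \<open>E1\<close>, which is what
  \<open>IH\<close> needs. It remains to replace \<open>b1\<close>, which may involve
  \<open>a\<close>. Some multiple of \<open>b1\<close> is congruent to an integer vector on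
  \<open>E1\<close>, and the interior vector makes this nonnegative after multiplication by a large
  power of \<open>q\<close>.\<close>

lemma glue_tree_drop_step:
  assumes lat: "is_lattice L" and q: "q \<ge> 2" and pos: "positive_on L (insert a E1 \<union> E2)"
    and a: "a \<notin> E1 \<union> E2" and t1: "glue_tree L q False (insert a E1)" and t2: "glue_tree L q False E2"
    and dis: "insert a E1 \<inter> E2 = {}"
    and b: "nonneg b1" "nonneg b2" "keys b1 \<subseteq> insert a E1" "keys b2 \<subseteq> E2" "b1 - b2 \<in> L"
    and main: "\<And>\<alpha>. \<alpha> \<in> L \<Longrightarrow> keys \<alpha> \<subseteq> insert a E1 \<union> E2 \<Longrightarrow>
       \<exists>k c l1 l2. l1 \<in> L \<and> l2 \<in> L \<and> keys l1 \<subseteq> insert a E1 \<and> keys l2 \<subseteq> E2 \<and>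
         frag_cmul (int q ^ k) \<alpha> = frag_cmul c (b1 - b2) + l1 + l2"
    and IH: "\<And>N w. N > 0 \<Longrightarrow> nonneg w \<Longrightarrow> keys w \<subseteq> E1 \<Longrightarrow> (\<And>i. i \<in> E1 \<Longrightarrow> 0 < lookup w i) \<Longrightarrow>
       frag_cmul N (frag_of a) - w \<in> L \<Longrightarrow> glue_tree L q False E1"
    and w: "N > 0" "nonneg w" "keys w \<subseteq> E1 \<union> E2" "\<And>i. i \<in> E1 \<union> E2 \<Longrightarrow> 0 < lookup w i"
       "frag_cmul N (frag_of a) - w \<in> L"
  shows "glue_tree L q False (E1 \<union> E2)"
proof (cases "E2 = {}")
  case True
  then show ?thesis using IH[OF w(1,2)] w by simp
next
  case False
  have fE: "finite E1" "finite E2" using glue_tree_finite[OF t1] glue_tree_finite[OF t2] by auto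
  have q0: "int q ^ k > 0" for k using q by simp
  have dis': "E1 \<inter> E2 = {}" "a \<notin> E1" "a \<notin> E2" using dis a by auto
  have "keys (frag_cmul N (frag_of a) - w) \<subseteq> insert a E1 \<union> E2"
    using w(3) a by (auto simp: keys_subset_iff lookup_minus)
  then obtain k c l1 l2 where l: "l1 \<in> L" "l2 \<in> L" "keys l1 \<subseteq> insert a E1" "keys l2 \<subseteq> E2"
    and e: "frag_cmul (int q ^ k) (frag_cmul N (frag_of a) - w) = frag_cmul c (b1 - b2) + l1 + l2"
    using main[OF w(5)] by blast
  have e': "int q ^ k * ((if i = a then N else 0) - lookup w i) =
     c * (lookup b1 i - lookup b2 i) + lookup l1 i + lookup l2 i" for i
    using arg_cong[OF e, of "\<lambda>x. lookup x i"] by (cases "i = a") (simp_all add: lookup_add lookup_minus)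
  have outE1: "lookup b1 i = 0" "lookup l1 i = 0" if "i \<notin> insert a E1" for i
    using b l that by (auto simp: keys_subset_iff)
  have outE2: "lookup b2 i = 0" "lookup l2 i = 0" if "i \<notin> E2" for i
    using b l that by (auto simp: keys_subset_iff)
  have outw: "lookup w i = 0" if "i \<notin> E1 \<union> E2" for i using w(3) that by (auto simp: keys_subset_iff)
  have wnn: "0 \<le> lookup w i" for i using w(2) by (simp add: nonneg_def)
  have bnn: "0 \<le> lookup b1 i" "0 \<le> lookup b2 i" for i using b by (simp_all add: nonneg_def)
  define w1 where "w1 = restr E1 w"
  define w2 where "w2 = restr E2 w"
  have l2eq: "- l2 = frag_cmul (int q ^ k) w2 + frag_cmul (- c) b2"
  proof (rule poly_mapping_eqI)
    fix i show "lookup (- l2) i = lookup (frag_cmul (int q ^ k) w2 + frag_cmul (- c) b2) i"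
    proof (cases "i \<in> E2")
      case True
      then have "i \<noteq> a" "i \<notin> insert a E1" using dis by auto
      then show ?thesis using e'[of i] outE1[of i] True by (simp add: w2_def lookup_restr lookup_add)
    qed (simp add: outE2 w2_def lookup_restr lookup_add)
  qed
  \<comment> \<open>By \<open>l2eq\<close>, a coefficient \<open>c \<le> 0\<close> would make
    \<open>- l2\<close> a nonzero nonnegative element of the lattice, as \<open>w\<close> is
    positive on \<open>E2\<close>.\<close>
  have c: "c > 0"
  proof (rule ccontr)
    assume "\<not> c > 0"
    then have "nonneg (- l2)" unfolding l2eq w2_def using w(2) b(2)
      by (intro nonneg_add nonneg_cmul nonneg_restr) auto
    then have "- l2 = 0" using positive_onD[OF pos is_lattice_uminus[OF lat l(2)]] l(4) by auto
    moreover obtain i where "i \<in> E2" using False by blast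
    moreover have "lookup (- l2) i > 0"
    proof -
      have "0 < int q ^ k * lookup w i" using \<open>i \<in> E2\<close> w(4)[of i] q0[of k] by (intro mult_pos_pos) auto
      moreover have "c * lookup b2 i \<le> 0" using \<open>\<not> c > 0\<close> bnn(2)[of i] by (intro mult_nonpos_nonneg) auto
      ultimately show ?thesis unfolding l2eq using \<open>i \<in> E2\<close> by (simp add: lookup_add w2_def lookup_restr)
    qed
    ultimately show False by simp
  qed
  define j where "j = lookup b1 a"
  define v where "v = restr E1 b1"
  have j0: "j \<ge> 0" using bnn by (simp add: j_def)
  have b1: "b1 = v + frag_cmul j (frag_of a)"
    by (rule poly_mapping_eqI) (use dis' outE1 in \<open>auto simp: v_def j_def lookup_add lookup_restr\<close>)
  \<comment> \<open>Read on \<open>insert a E1\<close>, the congruence says that \<open>D\<close>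
    times \<open>a\<close> is congruent to \<open>W\<close>, and \<open>W\<close> is positive on
    \<open>E1\<close>.\<close>
  define D where "D = int q ^ k * N - c * j"
  define W where "W = frag_cmul (int q ^ k) w1 + frag_cmul c v"
  have WE: "keys W \<subseteq> E1" unfolding W_def w1_def v_def
    by (intro keys_add_subset keys_cmul_subset keys_restr)
  have Wnn: "nonneg W" unfolding W_def w1_def v_def using w b c
    by (intro nonneg_add nonneg_cmul nonneg_restr) auto
  have Wpos: "0 < lookup W i" if "i \<in> E1" for i
    using that w(4)[of i] q0[of k] c bnn(1)[of i]
    by (auto simp: W_def w1_def v_def lookup_add lookup_restr intro!: add_pos_nonneg)
  have Wa: "lookup W a = 0" using WE dis' by (auto simp: keys_subset_iff)
  have rel: "frag_cmul D (frag_of a) - W = l1"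
  proof (rule poly_mapping_eqI)
    fix i show "lookup (frag_cmul D (frag_of a) - W) i = lookup l1 i"
    proof (cases "i \<in> insert a E1")
      case True
      then have "i \<notin> E2" using dis by auto
      then show ?thesis using e'[of i] outE2[of i] True dis' outw[of a]
        by (auto simp: lookup_minus lookup_add D_def W_def w1_def v_def j_def lookup_restr algebra_simps)
    next
      case False
      then show ?thesis using outE1 by (auto simp: lookup_minus lookup_add W_def w1_def v_def lookup_restr)
    qed
  qed
  have kaE: "keys (frag_cmul x (frag_of a) + W) \<subseteq> insert a E1 \<union> E2" for x
    using WE by (auto simp: keys_subset_iff lookup_add)
  have D0: "D \<ge> 0"
  proof (rule ccontr)
    assume n: "\<not> D \<ge> 0"
    have "frag_cmul (- D) (frag_of a) + W = - l1" unfolding rel[symmetric] by simp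
    then have "frag_cmul (- D) (frag_of a) + W \<in> L" using is_lattice_uminus[OF lat l(1)] by simp
    moreover have "nonneg (frag_cmul (- D) (frag_of a) + W)"
      using n Wnn by (intro nonneg_add nonneg_cmul nonneg_frag_of) auto
    ultimately have "frag_cmul (- D) (frag_of a) + W = 0" using positive_onD[OF pos _ kaE] by blast
    then have "lookup (frag_cmul (- D) (frag_of a) + W) a = 0" by simp
    then show False using n Wa by (simp add: lookup_add)
  qed
  show ?thesis
  proof (cases "D = 0")
    case True
    then have "W = - l1" using rel by (auto simp: algebra_simps)
    then have "W \<in> L" using is_lattice_uminus[OF lat l(1)] by simp
    then have "W = 0" using positive_onD[OF pos _ _ Wnn] WE by blast
    then have "E1 = {}" using Wpos by fastforce
    then show ?thesis using t2 by simp
  next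
    case Dn: False
    then have D: "D > 0" using D0 by simp
    have t1': "glue_tree L q False E1" using IH[OF D Wnn WE Wpos] rel l(1) by simp
    \<comment> \<open>\<open>D\<close> times \<open>b1\<close> with \<open>a\<close> eliminated: the
      summand \<open>D j\<close> times \<open>a\<close> is replaced by \<open>j\<close> times
      \<open>W\<close>.\<close>
    define y where "y = frag_cmul D v + frag_cmul j W"
    have yE: "keys y \<subseteq> E1" unfolding y_def v_def by (intro keys_add_subset keys_cmul_subset keys_restr WE)
    have yL: "frag_cmul D b1 - y \<in> L"
    proof -
      have "frag_cmul D b1 - y = frag_cmul j (frag_cmul D (frag_of a) - W)"
        unfolding b1 y_def by (rule poly_mapping_eqI) (simp add: lookup_add lookup_minus algebra_simps)
      then show ?thesis unfolding rel using is_lattice_cmul[OF lat l(1)] by (simp only:)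
    qed
    define H where "H = {x. \<exists>\<alpha>. keys \<alpha> \<subseteq> E1 \<and> frag_cmul x b1 - \<alpha> \<in> L}"
    have "x - x' \<in> H" if x: "x \<in> H" "x' \<in> H" for x x'
    proof -
      obtain \<alpha> \<alpha>' where "keys \<alpha> \<subseteq> E1" "frag_cmul x b1 - \<alpha> \<in> L" "keys \<alpha>' \<subseteq> E1" "frag_cmul x' b1 - \<alpha>' \<in> L"
        using x unfolding H_def by blast
      moreover have eq: "frag_cmul (x - x') b1 - (\<alpha> - \<alpha>') = (frag_cmul x b1 - \<alpha>) - (frag_cmul x' b1 - \<alpha>')"
        by (rule poly_mapping_eqI) (simp add: lookup_add lookup_minus algebra_simps)
      ultimately have "frag_cmul (x - x') b1 - (\<alpha> - \<alpha>') \<in> L" "keys (\<alpha> - \<alpha>') \<subseteq> E1"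
        unfolding eq by (simp_all only: is_lattice_diff[OF lat] keys_diff_subset)
      then show ?thesis unfolding H_def by blast
    qed
    moreover have "D \<in> H" unfolding H_def using yE yL by blast
    ultimately obtain d where d: "d > 0" "d \<in> H" "\<And>c. c \<in> H \<Longrightarrow> d dvd c"
      using int_subgroup_principal[of H D] D by blast
    obtain z where z: "keys z \<subseteq> E1" "frag_cmul d b1 - z \<in> L" using d(2) unfolding H_def by blast
    \<comment> \<open>For \<open>j = 0\<close> the vector \<open>b1\<close> does not involve
      \<open>a\<close>. Otherwise \<open>y\<close> is positive on \<open>E1\<close> and represents
      \<open>D\<close> times \<open>b1\<close>, so that it can absorb the negative entries of the
      representative \<open>z\<close> of \<open>d\<close> times \<open>b1\<close>.\<close>
    have "\<exists>l \<beta>. nonneg \<beta> \<and> keys \<beta> \<subseteq> E1 \<and> frag_cmul (int q ^ l * d) b1 - \<beta> \<in> L"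
    proof (cases "j = 0")
      case True
      then have "b1 = v" using b1 by simp
      then have "keys (frag_cmul d b1) \<subseteq> E1" unfolding v_def by (intro keys_cmul_subset) (metis keys_restr)
      then show ?thesis using d b is_lattice_zero[OF lat] by (intro exI[of _ 0] exI[of _ "frag_cmul d b1"]) (auto intro: nonneg_cmul)
    next
      case False
      have "0 < lookup y i" if "i \<in> E1" for i
        using Wpos[OF that] False j0 D bnn(1)[of i] by (auto simp: y_def v_def lookup_add lookup_restr that intro!: add_nonneg_pos)
      moreover have "D div d > 0" using d(1) d(3)[OF \<open>D \<in> H\<close>] D by (auto elim!: dvdE simp: zero_less_mult_iff)
      ultimately obtain l x r where x: "int q ^ l = x * (D div d) + r" "nonneg (frag_cmul x y + frag_cmul r z)"
        using large_power_combination[OF q fE(1) _ yE z(1)] by blast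
      have "int q ^ l * d = x * D + r * d" unfolding x(1) using d(3)[OF \<open>D \<in> H\<close>] by (simp add: algebra_simps)
      then have "frag_cmul (int q ^ l * d) b1 - (frag_cmul x y + frag_cmul r z) =
          frag_cmul x (frag_cmul D b1 - y) + frag_cmul r (frag_cmul d b1 - z)"
        by (intro poly_mapping_eqI) (simp add: lookup_add lookup_minus algebra_simps)
      also have "\<dots> \<in> L" by (intro is_lattice_add[OF lat] is_lattice_cmul[OF lat] yL z(2))
      finally have "frag_cmul (int q ^ l * d) b1 - (frag_cmul x y + frag_cmul r z) \<in> L" .
      moreover have "keys (frag_cmul x y + frag_cmul r z) \<subseteq> E1" by (intro keys_add_subset keys_cmul_subset yE z)
      ultimately show ?thesis using x(2) by blast
    qed
    then obtain l \<beta> where \<beta>: "nonneg \<beta>" "keys \<beta> \<subseteq> E1" "frag_cmul (int q ^ l * d) b1 - \<beta> \<in> L" by blast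
    let ?\<beta>2 = "frag_cmul (int q ^ l * d) b2"
    show ?thesis
    proof (rule glue_tree.node[OF t1' t2 dis'(1) \<beta>(1) _ \<beta>(2), of ?\<beta>2])
      show "nonneg ?\<beta>2" using b d by (intro nonneg_cmul) auto
      show "keys ?\<beta>2 \<subseteq> E2" by (intro keys_cmul_subset b)
      have "\<beta> - ?\<beta>2 = frag_cmul (int q ^ l * d) (b1 - b2) - (frag_cmul (int q ^ l * d) b1 - \<beta>)"
        by (rule poly_mapping_eqI) (simp add: lookup_add lookup_minus algebra_simps)
      then show "\<beta> - ?\<beta>2 \<in> L" using is_lattice_diff[OF lat is_lattice_cmul[OF lat b(5)] \<beta>(3)] by (simp only:)
      fix \<alpha> assume \<alpha>: "\<alpha> \<in> L" "keys \<alpha> \<subseteq> E1 \<union> E2"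
      then have "keys \<alpha> \<subseteq> insert a E1 \<union> E2" by blast
      then obtain k' c' m1 m2 where m: "m1 \<in> L" "m2 \<in> L" "keys m1 \<subseteq> insert a E1" "keys m2 \<subseteq> E2"
        and em: "frag_cmul (int q ^ k') \<alpha> = frag_cmul c' (b1 - b2) + m1 + m2"
        using main[OF \<alpha>(1)] by blast
      have em': "int q ^ k' * lookup \<alpha> i = c' * (lookup b1 i - lookup b2 i) + lookup m1 i + lookup m2 i" for i
        using arg_cong[OF em, of "\<lambda>x. lookup x i"] by (simp add: lookup_add lookup_minus)
      have m1out: "lookup m1 i = 0" if "i \<notin> insert a E1" for i using m that by (auto simp: keys_subset_iff)
      have m2out: "lookup m2 i = 0" if "i \<notin> E2" for i using m that by (auto simp: keys_subset_iff)
      have m1eq: "frag_cmul c' b1 - frag_cmul (int q ^ k') (restr E1 \<alpha>) = - m1"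
      proof (rule poly_mapping_eqI)
        fix i
        show "lookup (frag_cmul c' b1 - frag_cmul (int q ^ k') (restr E1 \<alpha>)) i = lookup (- m1) i"
        proof (cases "i \<in> insert a E1")
          case True
          then have n2: "i \<notin> E2" using dis by auto
          have "lookup \<alpha> i = 0" if "i \<notin> E1" using \<alpha>(2) that n2 by (auto simp: keys_subset_iff)
          then show ?thesis using em'[of i] n2 outE2[of i] m2out[of i]
            by (auto simp: lookup_minus lookup_restr)
        next
          case False
          then show ?thesis using outE1[of i] m1out[of i] by (auto simp: lookup_minus lookup_restr)
        qed
      qed
      have m2eq: "frag_cmul (int q ^ k') (restr E2 \<alpha>) + frag_cmul c' b2 = m2"
      proof (rule poly_mapping_eqI)
        fix i
        show "lookup (frag_cmul (int q ^ k') (restr E2 \<alpha>) + frag_cmul c' b2) i = lookup m2 i"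
        proof (cases "i \<in> E2")
          case True
          then have "i \<notin> insert a E1" using dis by auto
          then show ?thesis using em'[of i] outE1[of i] m1out[of i] True
            by (simp add: lookup_add lookup_restr)
        next
          case False
          then show ?thesis using outE2[of i] m2out[of i] by (auto simp: lookup_add lookup_restr)
        qed
      qed
      \<comment> \<open>On \<open>insert a E1\<close> the decomposition makes \<open>c'\<close>
        times \<open>b1\<close> congruent to a vector without \<open>a\<close>, so \<open>c'\<close>
        is a multiple of \<open>d\<close>. This is why the new relation with factor \<open>d\<close>
        still generates, up to powers of \<open>q\<close>.\<close>
      have "c' \<in> H" unfolding H_def
        by (rule CollectI, rule exI[of _ "frag_cmul (int q ^ k') (restr E1 \<alpha>)"])
          (unfold m1eq, intro conjI keys_cmul_subset keys_restr is_lattice_uminus[OF lat m(1)])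
      then obtain x where x: "c' = d * x" using d(3) by (auto elim: dvdE)
      let ?k = "k' + l"
      let ?l1 = "frag_cmul (int q ^ ?k) (restr E1 \<alpha>) - frag_cmul x \<beta>"
      let ?l2 = "frag_cmul (int q ^ ?k) (restr E2 \<alpha>) + frag_cmul x ?\<beta>2"
      have "?l1 = frag_cmul x (frag_cmul (int q ^ l * d) b1 - \<beta>) -
          frag_cmul (int q ^ l) (frag_cmul c' b1 - frag_cmul (int q ^ k') (restr E1 \<alpha>))"
        unfolding x by (rule poly_mapping_eqI) (simp add: lookup_add lookup_minus algebra_simps power_add)
      then have l1L: "?l1 \<in> L" unfolding m1eq
        using is_lattice_diff[OF lat is_lattice_cmul[OF lat \<beta>(3)] is_lattice_cmul[OF lat is_lattice_uminus[OF lat m(1)]]] by (simp only:)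
      have "?l2 = frag_cmul (int q ^ l) (frag_cmul (int q ^ k') (restr E2 \<alpha>) + frag_cmul c' b2)"
        unfolding x by (rule poly_mapping_eqI) (simp add: lookup_add lookup_minus algebra_simps power_add)
      then have l2L: "?l2 \<in> L" unfolding m2eq using is_lattice_cmul[OF lat m(2)] by (simp only:)
      have "frag_cmul (int q ^ ?k) \<alpha> = frag_cmul (int q ^ ?k) (restr E1 \<alpha> + restr E2 \<alpha>)"
        using restr_split[OF \<alpha>(2) dis'(1)] by simp
      also have "\<dots> = frag_cmul x (\<beta> - ?\<beta>2) + ?l1 + ?l2"
        by (rule poly_mapping_eqI) (simp add: lookup_add lookup_minus algebra_simps)
      finally show "\<exists>k c l1 l2. l1 \<in> L \<and> l2 \<in> L \<and> keys l1 \<subseteq> E1 \<and> keys l2 \<subseteq> E2 \<and>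
         frag_cmul (int q ^ k) \<alpha> = frag_cmul c (\<beta> - ?\<beta>2) + l1 + l2"
        by (intro exI conjI) (assumption | rule l1L l2L keys_diff_subset keys_add_subset keys_cmul_subset keys_restr \<beta> b)+
    qed simp
  qed
qed

text \<open>The multiple \<open>N\<close> and the interior vector \<open>w\<close> vary in the
  induction, since both change when the congruence is split at a node.\<close>

lemma glue_tree_drop_interior:
  assumes lat: "is_lattice L" and q: "q \<ge> 2"
  shows "glue_tree L q False E' \<Longrightarrow> positive_on L E' \<Longrightarrow> E' = insert a E \<Longrightarrow> a \<notin> E \<Longrightarrow> N > 0 \<Longrightarrow> nonneg w \<Longrightarrow>
    keys w \<subseteq> E \<Longrightarrow> (\<And>i. i \<in> E \<Longrightarrow> 0 < lookup w i) \<Longrightarrow> frag_cmul N (frag_of a) - w \<in> L \<Longrightarrow>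
    glue_tree L q False E"
proof (induction E' arbitrary: E N w rule: glue_tree.induct)
  case (leaf E')
  then show ?case by (intro glue_tree.leaf) auto
next
  case (node E1 E2 b1 b2)
  have pos: "positive_on L E1" "positive_on L E2" using node.prems(1) positive_on_mono by blast+
  have dis: "E1 \<inter> E2 = {}" by fact
  show ?case
  proof (cases "a \<in> E1")
    case True
    let ?E1 = "E1 - {a}"
    have E1: "insert a ?E1 = E1" using True by auto
    have "E = (E1 \<union> E2) - {a}" using node.prems(2,3) by simp
    then have E: "E = ?E1 \<union> E2" using dis True by auto
    have "glue_tree L q False (?E1 \<union> E2)"
    proof (rule glue_tree_drop_step[OF lat q, of a ?E1 E2 b1 b2 N w])
      fix M u assume u: "0 < M" "nonneg u" "keys u \<subseteq> ?E1" "\<And>i. i \<in> ?E1 \<Longrightarrow> 0 < lookup u i"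
        "frag_cmul M (frag_of a) - u \<in> L"
      show "glue_tree L q False ?E1" by (rule node.IH(1)[OF pos(1) _ _ u(1-3) u(4,5)]) (use True in auto)
    next
      fix \<alpha> assume "\<alpha> \<in> L" "keys \<alpha> \<subseteq> insert a ?E1 \<union> E2"
      then show "\<exists>k c l1 l2. l1 \<in> L \<and> l2 \<in> L \<and> keys l1 \<subseteq> insert a ?E1 \<and> keys l2 \<subseteq> E2 \<and>
         frag_cmul (int q ^ k) \<alpha> = frag_cmul c (b1 - b2) + l1 + l2"
        unfolding E1 by (rule node.hyps(10))
    next
      show "keys w \<subseteq> ?E1 \<union> E2" "\<And>i. i \<in> ?E1 \<union> E2 \<Longrightarrow> 0 < lookup w i" "a \<notin> ?E1 \<union> E2"
        using node.prems unfolding E by blast+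
    qed (use node.prems node.hyps in \<open>simp_all only: E1\<close>)
    then show ?thesis unfolding E .
  next
    case False
    let ?E2 = "E2 - {a}"
    have a2: "a \<in> E2" using False node.prems(2) by blast
    have E2: "insert a ?E2 = E2" using a2 by auto
    have "E = (E1 \<union> E2) - {a}" using node.prems(2,3) by simp
    then have E: "E = ?E2 \<union> E1" using dis a2 by auto
    have "glue_tree L q False (?E2 \<union> E1)"
    proof (rule glue_tree_drop_step[OF lat q, of a ?E2 E1 b2 b1 N w])
      fix M u assume u: "0 < M" "nonneg u" "keys u \<subseteq> ?E2" "\<And>i. i \<in> ?E2 \<Longrightarrow> 0 < lookup u i"
        "frag_cmul M (frag_of a) - u \<in> L"
      show "glue_tree L q False ?E2" by (rule node.IH(2)[OF pos(2) _ _ u(1-3) u(4,5)]) (use a2 in auto)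
    next
      fix \<alpha> assume "\<alpha> \<in> L" "keys \<alpha> \<subseteq> insert a ?E2 \<union> E1"
      then have \<alpha>: "\<alpha> \<in> L" "keys \<alpha> \<subseteq> E1 \<union> E2" using a2 by auto
      obtain k c l1 l2 where l: "l1 \<in> L" "l2 \<in> L" "keys l1 \<subseteq> E1" "keys l2 \<subseteq> E2"
         "frag_cmul (int q ^ k) \<alpha> = frag_cmul c (b1 - b2) + l1 + l2" using node.hyps(10)[OF \<alpha>] by blast
      have "frag_cmul c (b1 - b2) + l1 + l2 = frag_cmul (- c) (b2 - b1) + l2 + l1"
        by (rule poly_mapping_eqI) (simp add: lookup_add lookup_minus algebra_simps)
      then show "\<exists>k c l1 l2. l1 \<in> L \<and> l2 \<in> L \<and> keys l1 \<subseteq> insert a ?E2 \<and> keys l2 \<subseteq> E1 \<and>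
         frag_cmul (int q ^ k) \<alpha> = frag_cmul c (b2 - b1) + l1 + l2"
        using l unfolding E2 by metis
    next
      show "b2 - b1 \<in> L" using is_lattice_uminus[OF lat node.hyps(8)] by simp
      show "keys w \<subseteq> ?E2 \<union> E1" "\<And>i. i \<in> ?E2 \<union> E1 \<Longrightarrow> 0 < lookup w i" "a \<notin> ?E2 \<union> E1"
        using node.prems unfolding E by blast+
      show "positive_on L (insert a ?E2 \<union> E1)" "insert a ?E2 \<inter> E1 = {}"
        using node.prems(1) dis unfolding E2 by (simp_all add: Un_commute Int_commute)
    qed (use node.prems node.hyps in \<open>simp_all only: E2\<close>)
    then show ?thesis unfolding E .
  qed
qed

lemma indep_image:
  assumes fX: "finite X" and z: "\<And>c. (\<Sum>x\<in>X. frag_cmul (c x) (f x)) = 0 \<Longrightarrow> \<forall>x\<in>X. c x = 0"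
  shows "inj_on f X" "indep (f ` X)"
proof -
  show inj: "inj_on f X"
  proof (rule inj_onI, rule ccontr)
    fix x y assume xy: "x \<in> X" "y \<in> X" "f x = f y" "x \<noteq> y"
    let ?c = "\<lambda>z. if z = x then 1 else if z = y then - 1 else (0::int)"
    have "(\<Sum>z\<in>X. frag_cmul (?c z) (f z)) = (\<Sum>z\<in>{x, y}. frag_cmul (?c z) (f z))"
      by (rule sum.mono_neutral_right) (use fX xy in auto)
    also have "\<dots> = 0" using xy by simp
    finally have "?c x = 0" using z[of ?c] xy(1) by blast
    then show False by simp
  qed
  show "indep (f ` X)" unfolding indep_def
  proof (intro allI impI)
    fix c assume "(\<Sum>b\<in>f ` X. frag_cmul (c b) b) = 0"
    then have "(\<Sum>x\<in>X. frag_cmul (c (f x)) (f x)) = 0" by (simp add: sum.reindex[OF inj])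
    then show "\<forall>b\<in>f ` X. c b = 0" using z[of "\<lambda>x. c (f x)"] by blast
  qed
qed

text \<open>The substitution of \<open>w\<close> for the basis vector at \<open>a\<close>. Modulo a
  lattice containing \<open>frag_of a - w\<close> it changes nothing.\<close>

definition elim_var :: "'i \<Rightarrow> ('i \<Rightarrow>\<^sub>0 int) \<Rightarrow> ('i \<Rightarrow>\<^sub>0 int) \<Rightarrow> ('i \<Rightarrow>\<^sub>0 int)" where
  "elim_var a w x = x - frag_cmul (lookup x a) (frag_of a - w)"

lemma lookup_elim_var:
  "lookup (elim_var a w x) i = (if i = a then 0 else lookup x i) + lookup x a * lookup w i"
  by (auto simp: elim_var_def lookup_minus algebra_simps)

lemma elim_var_diff: "elim_var a w (x - y) = elim_var a w x - elim_var a w y"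
  by (rule poly_mapping_eqI) (simp add: lookup_elim_var lookup_minus algebra_simps)

lemma elim_var_id: "lookup x a = 0 \<Longrightarrow> elim_var a w x = x"
  by (simp add: elim_var_def)

lemma nonneg_elim_var: "nonneg x \<Longrightarrow> nonneg w \<Longrightarrow> nonneg (elim_var a w x)"
  by (simp add: nonneg_def lookup_elim_var)

lemma keys_elim_var:
  assumes "keys x \<subseteq> insert a E" "keys w \<subseteq> E" "a \<notin> E" shows "keys (elim_var a w x) \<subseteq> E"
proof -
  have "lookup w a = 0" using assms by (auto simp: keys_subset_iff)
  then show ?thesis using assms(1,2) by (auto simp: keys_subset_iff lookup_elim_var)
qed

lemma elim_var_in: "is_lattice L \<Longrightarrow> frag_of a - w \<in> L \<Longrightarrow> x \<in> L \<Longrightarrow> elim_var a w x \<in> L"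
  unfolding elim_var_def by (rule is_lattice_diff[OF _ _ is_lattice_cmul])

lemma sum_elim_var:
  "(\<Sum>b\<in>X. frag_cmul (c b) (elim_var a w b)) =
     (\<Sum>b\<in>X. frag_cmul (c b) b) - frag_cmul (\<Sum>b\<in>X. c b * lookup b a) (frag_of a - w)"
  by (rule poly_mapping_eqI)
    (simp only: lookup_sum lookup_minus elim_var_def lookup_frag_cmul right_diff_distrib sum_subtractf
      sum_distrib_right mult.assoc)

lemma mixed_basis_stratum:
  assumes "mixed_basis L q E B" "J \<subseteq> E" "\<forall>b\<in>B. zero_on J b \<or> crosses pos_keys neg_keys J b"
    "\<alpha> \<in> L" "keys \<alpha> \<subseteq> E" "zero_on J \<alpha>"
  shows "\<exists>k. frag_cmul (int q ^ k) \<alpha> \<in> zspan {b\<in>B. zero_on J b}"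
  using assms by (simp add: mixed_basis_def)

text \<open>A path from \<open>frag_of a\<close> to \<open>u\<close> begins with a step to some
  \<open>w\<close> that no longer involves \<open>a\<close>; so \<open>frag_of a - w\<close> is a
  basis vector up to sign. Substituting \<open>w\<close> for \<open>a\<close> annihilates this
  vector, maps paths to paths and keeps the other basis vectors independent.\<close>

lemma connecting_remove_1:
  assumes lat: "is_lattice L" and a: "a \<notin> E" and pos: "positive_on L (insert a E)"
    and C: "connecting L 1 (insert a E) B" and u: "nonneg u" "keys u \<subseteq> E" "frag_of a - u \<in> L"
  shows "\<exists>B. connecting L 1 E B"
proof -
  note C' = connectingD[OF C]
  have conn: "(move B)\<^sup>*\<^sup>* x y" if "nonneg x" "nonneg y" "keys x \<subseteq> insert a E" "keys y \<subseteq> insert a E" "x - y \<in> L" for x y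
    using C'(5)[OF that] by (simp add: qconn_def)
  have uE: "keys u \<subseteq> insert a E" using u by blast
  have ua: "lookup u a = 0" using u a by (auto simp: keys_subset_iff)
  have "(move B)\<^sup>*\<^sup>* (frag_of a) u" by (rule conn) (use u uE in \<open>auto simp: nonneg_frag_of keys_frag_of\<close>)
  then obtain w where mv: "move B (frag_of a) w"
  proof (cases rule: converse_rtranclpE)
    case base
    then have "lookup u a = 1" by auto
    then show ?thesis using ua by simp
  qed blast
  obtain b where b: "b \<in> B" "w - frag_of a = b \<or> frag_of a - w = b" using mv by (auto simp: move_def)
  have wL: "w - frag_of a \<in> L" "frag_of a - w \<in> L" using b C'(2) is_lattice_uminus[OF lat, of b] by auto
  have bE: "keys b \<subseteq> insert a E" using C'(3) b by blast
  have wE': "keys w \<subseteq> insert a E"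
    using bE b(2) by (auto simp: keys_subset_iff lookup_minus)
  have wnn: "nonneg w" using mv by (simp add: move_def)
  \<comment> \<open>If \<open>a\<close> still occurred in \<open>w\<close>, the difference
    \<open>w - frag_of a\<close> would be a nonnegative element of \<open>L\<close>, hence zero, and
    zero is not in an independent set.\<close>
  have wa: "lookup w a = 0"
  proof (rule ccontr)
    assume "lookup w a \<noteq> 0"
    then have "lookup w a \<ge> 1" using wnn by (metis int_one_le_iff_zero_less nonneg_def order_less_le)
    then have "nonneg (w - frag_of a)" using wnn by (auto simp: nonneg_def lookup_minus)
    moreover have "keys (w - frag_of a) \<subseteq> insert a E" using wE' by (intro keys_diff_subset) (auto simp: keys_frag_of)
    ultimately have "w - frag_of a = 0" using positive_onD[OF pos wL(1)] by blast
    then have "b = 0" using b by auto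
    then show False using indep_nonzero[OF C'(4,1) b(1)] by simp
  qed
  have wE: "keys w \<subseteq> E" using wE' wa by (auto simp: in_keys_iff)
  let ?\<pi> = "elim_var a w"
  have pb: "?\<pi> b = 0"
    using b(2) wa by (auto intro!: poly_mapping_eqI simp: lookup_elim_var lookup_minus)
  have fin: "finite (B - {b})" using C'(1) by simp
  have ind: "indep (?\<pi> ` (B - {b}))"
  proof (rule indep_image[OF fin])
    fix c assume z: "(\<Sum>x\<in>B - {b}. frag_cmul (c x) (?\<pi> x)) = 0"
    define s where "s = (\<Sum>x\<in>B - {b}. c x * lookup x a)"
    obtain t where t: "frag_cmul s (frag_of a - w) = frag_cmul t b"
    proof (cases "w - frag_of a = b")
      case True
      then have "frag_cmul s (frag_of a - w) = frag_cmul (- s) b"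
        by (intro poly_mapping_eqI) (auto simp: lookup_minus algebra_simps)
      then show ?thesis using that by blast
    next
      case False
      then show ?thesis using that b by blast
    qed
    let ?c = "\<lambda>x. if x = b then - t else c x"
    have "(\<Sum>x\<in>B. frag_cmul (?c x) x) = frag_cmul (- t) b + (\<Sum>x\<in>B - {b}. frag_cmul (?c x) x)"
      using C'(1) b(1) by (subst sum.remove[of B b]) auto
    also have "(\<Sum>x\<in>B - {b}. frag_cmul (?c x) x) = (\<Sum>x\<in>B - {b}. frag_cmul (c x) x)" by (rule sum.cong) auto
    also have "\<dots> = frag_cmul t b" using z unfolding sum_elim_var s_def[symmetric] t by simp
    finally have "(\<Sum>x\<in>B. frag_cmul (?c x) x) = 0" by (simp flip: frag_cmul_distrib)
    from indepD[OF C'(4) this] have c0: "?c x = 0" if "x \<in> B" for x using that .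
    show "\<forall>x\<in>B - {b}. c x = 0"
    proof
      fix x assume "x \<in> B - {b}"
      then show "c x = 0" using c0[of x] by simp
    qed
  qed
  have path: "(move (?\<pi> ` (B - {b})))\<^sup>*\<^sup>* (?\<pi> x) (?\<pi> y)" if "(move B)\<^sup>*\<^sup>* x y" for x y
    using that
  proof (induction rule: rtranclp_induct)
    case (step y z)
    have nn: "nonneg (?\<pi> y)" "nonneg (?\<pi> z)" using step by (auto simp: move_def intro!: nonneg_elim_var wnn)
    obtain b' where b': "b' \<in> B" "y - z = b' \<or> z - y = b'" using step by (auto simp: move_def)
    then have e: "?\<pi> y - ?\<pi> z = ?\<pi> b' \<or> ?\<pi> z - ?\<pi> y = ?\<pi> b'" by (auto simp: elim_var_diff)
    show ?case
    proof (cases "b' = b")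
      case True
      then have "?\<pi> y = ?\<pi> z" using e pb by auto
      then show ?thesis using step by simp
    next
      case False
      then have "move (?\<pi> ` (B - {b})) (?\<pi> y) (?\<pi> z)" using nn e b'(1) unfolding move_def by auto
      then show ?thesis using step.IH by (rule rtranclp.rtrancl_into_rtrancl[rotated])
    qed
  qed simp
  have "connecting L 1 E (?\<pi> ` (B - {b}))" unfolding connecting_def
  proof (intro conjI allI impI ballI)
    show "?\<pi> ` (B - {b}) \<subseteq> L" using C'(2) elim_var_in[OF lat wL(2)] by blast
    show "keys x \<subseteq> E" if "x \<in> ?\<pi> ` (B - {b})" for x using that C'(3) keys_elim_var[OF _ wE a] by blast
    fix x y assume xy: "nonneg x" "nonneg y" "keys x \<subseteq> E" "keys y \<subseteq> E" "x - y \<in> L"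
    then have "(move B)\<^sup>*\<^sup>* x y" by (intro conn) auto
    from path[OF this] have "(move (?\<pi> ` (B - {b})))\<^sup>*\<^sup>* x y"
      using xy a by (subst (asm) (1 2) elim_var_id) (auto simp: keys_subset_iff)
    then show "qconn 1 (?\<pi> ` (B - {b})) x y" by (rule conn_qconn)
  qed (use fin ind in auto)
  then show ?thesis by blast
qed

text \<open>\<open>F\<close> is the union of the supports of all vectors congruent to multiples of
  \<open>a\<close>, which is the smallest face containing \<open>a\<close>. Adding finitely many
  such congruences produces a vector whose support is all of \<open>F\<close>.\<close>

lemma face_of_point:
  assumes lat: "is_lattice L" and fE: "finite E'" and a: "a \<in> E'"
  obtains F N W where "F \<subseteq> E'" "a \<in> F" "is_face L E' F" "nonneg W" "keys W \<subseteq> F"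
    "\<And>i. i \<in> F \<Longrightarrow> 0 < lookup W i" "N \<ge> 0" "frag_cmul N (frag_of a) - W \<in> L"
    "\<And>M w. nonneg w \<Longrightarrow> keys w \<subseteq> E' \<Longrightarrow> M \<ge> 0 \<Longrightarrow> frag_cmul M (frag_of a) - w \<in> L \<Longrightarrow> keys w \<subseteq> F"
proof -
  define R where "R = (\<lambda>M w. M \<ge> 0 \<and> nonneg w \<and> keys w \<subseteq> E' \<and> frag_cmul M (frag_of a) - w \<in> L)"
  define F where "F = {i. \<exists>M w. R M w \<and> i \<in> keys w}"
  have FE: "F \<subseteq> E'" unfolding F_def R_def by blast
  have Radd: "R (M + M') (w + w')" if "R M w" "R M' w'" for M M' w w'
  proof -
    have eq: "frag_cmul (M + M') (frag_of a) - (w + w') = (frag_cmul M (frag_of a) - w) + (frag_cmul M' (frag_of a) - w')"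
      by (rule poly_mapping_eqI) (simp add: lookup_add lookup_minus algebra_simps)
    have "frag_cmul (M + M') (frag_of a) - (w + w') \<in> L"
      unfolding eq using that by (intro is_lattice_add[OF lat]) (auto simp: R_def)
    then show ?thesis using that unfolding R_def by (simp add: nonneg_add keys_add_subset)
  qed
  have posk: "i \<in> keys w \<Longrightarrow> 0 < lookup w i" if "R M w" for M w i
    using that by (metis R_def in_keys_iff nonneg_def order_less_le)
  have "\<exists>M w. R M w \<and> (\<forall>i\<in>G. 0 < lookup w i)" if "finite G" "G \<subseteq> F" for G
    using that
  proof (induction G rule: finite_induct)
    case empty
    have "R 0 0" unfolding R_def using is_lattice_zero[OF lat] by (simp add: nonneg_zero)
    then show ?case by blast
  next
    case (insert i G)
    then obtain M w where Mw: "R M w" "\<forall>i\<in>G. 0 < lookup w i" by auto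
    obtain M' w' where Mw': "R M' w'" "i \<in> keys w'" using insert.prems unfolding F_def by blast
    have nn: "0 \<le> lookup w j" "0 \<le> lookup w' j" for j using Mw Mw' by (auto simp: R_def nonneg_def)
    have "0 < lookup (w + w') j" if "j \<in> insert i G" for j
      using that Mw(2) posk[OF Mw'] nn[of j] by (auto simp: lookup_add intro: add_pos_nonneg add_nonneg_pos)
    then show ?case using Radd[OF Mw(1) Mw'(1)] by blast
  qed
  then obtain N W where NW: "R N W" "\<forall>i\<in>F. 0 < lookup W i" using finite_subset[OF FE fE] by blast
  have WF: "keys w \<subseteq> F" if "R M w" for M w using that unfolding F_def by blast
  have "R 1 (frag_of a)" unfolding R_def using a is_lattice_zero[OF lat] by (simp add: nonneg_frag_of keys_frag_of)
  then have aF: "a \<in> F" using WF by (fastforce simp: keys_frag_of)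
  have face: "is_face L E' F" unfolding is_face_def
  proof (intro allI impI)
    fix u v assume u: "nonneg u" "nonneg v" "keys u \<subseteq> E'" "keys v \<subseteq> E'" "u - v \<in> L" "keys u \<subseteq> F"
    \<comment> \<open>The factor \<open>m\<close> makes \<open>frag_cmul m W\<close> at least
      \<open>u\<close> in every coordinate, so that \<open>u\<close> can be exchanged for
      \<open>v\<close> inside it.\<close>
    define m where "m = (\<Sum>i\<in>keys u. lookup u i)"
    have m0: "m \<ge> 0" unfolding m_def using u(1) by (intro sum_nonneg) (simp add: nonneg_def)
    have um: "lookup u i \<le> m * lookup W i" for i
    proof (cases "i \<in> keys u")
      case True
      then have "lookup u i \<le> m" unfolding m_def using u(1) by (intro member_le_sum) (auto simp: nonneg_def)
      also have "m \<le> m * lookup W i" using True u(6) NW(2) m0 mult_left_mono[of 1 "lookup W i" m] by force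
      finally show ?thesis .
    next
      case False
      then show ?thesis using m0 NW(1) by (simp add: in_keys_iff R_def nonneg_def)
    qed
    let ?w = "frag_cmul m W - u + v"
    have "R (m * N) ?w" unfolding R_def
    proof (intro conjI)
      show "0 \<le> m * N" using m0 NW by (simp add: R_def)
      show "nonneg ?w" using um u(2) by (auto simp: nonneg_def lookup_add lookup_minus)
      show "keys ?w \<subseteq> E'" by (intro keys_add_subset keys_diff_subset keys_cmul_subset u) (use NW in \<open>simp add: R_def\<close>)
      have eq: "frag_cmul (m * N) (frag_of a) - ?w = frag_cmul m (frag_cmul N (frag_of a) - W) + (u - v)"
        by (rule poly_mapping_eqI) (simp add: lookup_add lookup_minus algebra_simps)
      show "frag_cmul (m * N) (frag_of a) - ?w \<in> L"
        unfolding eq by (intro is_lattice_add[OF lat] is_lattice_cmul[OF lat] u(5)) (use NW in \<open>simp add: R_def\<close>)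
    qed
    then have "keys ?w \<subseteq> F" by (rule WF)
    moreover have "keys v \<subseteq> keys ?w"
    proof
      fix i assume "i \<in> keys v"
      then have "lookup v i > 0" using u(2) by (metis in_keys_iff nonneg_def order_less_le)
      then have "lookup ?w i > 0" using um[of i] by (simp add: lookup_add lookup_minus)
      then show "i \<in> keys ?w" by (simp add: in_keys_iff)
    qed
    ultimately show "keys v \<subseteq> F" by blast
  qed
  show ?thesis
  proof (rule that[OF FE aF face])
    show "nonneg W" "N \<ge> 0" "frag_cmul N (frag_of a) - W \<in> L" using NW by (auto simp: R_def)
    show "keys W \<subseteq> F" using WF NW by blast
    show "0 < lookup W i" if "i \<in> F" for i using NW that by blast
    show "keys w \<subseteq> F" if "nonneg w" "keys w \<subseteq> E'" "M \<ge> 0" "frag_cmul M (frag_of a) - w \<in> L" for M w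
      by (rule WF[of M]) (use that in \<open>simp add: R_def\<close>)
  qed
qed

text \<open>For \<open>q \<ge> 2\<close>, basis vectors inside the smallest face \<open>F\<close> of
  \<open>a\<close> are replaced by a connecting basis of \<open>F - {a}\<close>, obtained by
  dropping \<open>a\<close> from the gluing tree of \<open>F\<close>; those leaving the face are
  kept after the substitution of \<open>u\<close> for \<open>a\<close>. The image of a path is then
  connected: a kept vector still gives a step, and a discarded one is replaced by a path inside the
  face.\<close>

lemma connecting_remove:
  assumes lat: "is_lattice L" and q: "q > 0" and a: "a \<notin> E" and fE: "finite E" and pos: "positive_on L (insert a E)"
    and C: "connecting L q (insert a E) B" and u: "nonneg u" "keys u \<subseteq> E" "frag_of a - u \<in> L"
  shows "\<exists>B. connecting L q E B"
proof (cases "q = 1")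
  case True
  then show ?thesis using connecting_remove_1[OF lat a pos _ u] C by simp
next
  case False
  then have q2: "q \<ge> 2" using q by simp
  have q0: "int q ^ k \<noteq> 0" for k using q by simp
  note C' = connectingD[OF C]
  have W: "mixed_basis L q (insert a E) B" by (rule connecting_imp_mixed_basis[OF q C])
  have fE': "finite (insert a E)" using fE by simp
  obtain F N X where F: "F \<subseteq> insert a E" "a \<in> F" "is_face L (insert a E) F" "nonneg X" "keys X \<subseteq> F"
    "\<And>i. i \<in> F \<Longrightarrow> 0 < lookup X i" "N \<ge> 0" "frag_cmul N (frag_of a) - X \<in> L"
    "\<And>M w. nonneg w \<Longrightarrow> keys w \<subseteq> insert a E \<Longrightarrow> M \<ge> 0 \<Longrightarrow> frag_cmul M (frag_of a) - w \<in> L \<Longrightarrow> keys w \<subseteq> F"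
    using face_of_point[OF lat fE', of a] by (metis insertI1)
  define F0 where "F0 = F - {a}"
  have Fa: "F = insert a F0" "a \<notin> F0" using F(2) by (auto simp: F0_def)
  have F0E: "F0 \<subseteq> E" using F(1) by (auto simp: F0_def)
  have "keys u \<subseteq> F" using F(9)[of u 1] u by auto
  then have uF: "keys u \<subseteq> F0" using u(2) a by (auto simp: F0_def)
  have "glue_tree L q False (insert a E \<inter> F)"
    by (rule glue_tree_face[OF lat mixed_basis_imp_glue_tree[OF lat q pos fE' W] F(3)])
  then have tF: "glue_tree L q False F" using F(1) by (simp add: Int_absorb1)
  have posF: "positive_on L F" by (rule positive_on_mono[OF pos F(1)])
  let ?\<pi> = "elim_var a u"
  \<comment> \<open>For \<open>N = 0\<close> the nonzero nonnegative vector \<open>X\<close> would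
    itself lie in \<open>L\<close>.\<close>
  have XN: "N > 0"
  proof (rule ccontr)
    assume "\<not> N > 0"
    then have "- X \<in> L" using F(7,8) by simp
    then have "X \<in> L" using is_lattice_uminus[OF lat, of "- X"] by simp
    then have "X = 0" using positive_onD[OF posF _ F(5,4)] by blast
    then show False using F(6)[OF F(2)] by simp
  qed
  have "glue_tree L q False F0"
  proof (rule glue_tree_drop_interior[OF lat q2 tF posF Fa XN, of "?\<pi> X"])
    show "nonneg (?\<pi> X)" by (rule nonneg_elim_var[OF F(4) u(1)])
    show "keys (?\<pi> X) \<subseteq> F0" by (rule keys_elim_var[OF _ uF Fa(2)]) (use F(5) Fa in simp)
    show "0 < lookup (?\<pi> X) i" if "i \<in> F0" for i
    proof -
      have "0 < lookup X i" "0 < lookup X a" "0 \<le> lookup u i" "i \<noteq> a"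
        using F(6) that F(2) u(1) by (auto simp: F0_def nonneg_def)
      then show ?thesis by (simp add: lookup_elim_var add_pos_nonneg)
    qed
    have eq: "frag_cmul N (frag_of a) - ?\<pi> X = (frag_cmul N (frag_of a) - X) + frag_cmul (lookup X a) (frag_of a - u)"
      by (simp add: elim_var_def)
    show "frag_cmul N (frag_of a) - ?\<pi> X \<in> L"
      unfolding eq by (rule is_lattice_add[OF lat F(8) is_lattice_cmul[OF lat u(3)]])
  qed
  then obtain BF where BF: "connecting L q F0 BF"
    using glue_tree_imp_connecting[OF lat] positive_on_mono[OF posF] Fa by (metis subset_insertI)
  note CF = connectingD[OF BF]
  define Bo where "Bo = {b\<in>B. \<not> keys b \<subseteq> F}"
  have fBo: "finite Bo" "Bo \<subseteq> B" using C'(1) by (auto simp: Bo_def)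
  let ?J = "insert a E - F"
  \<comment> \<open>The positive and negative parts of a basis vector are congruent, so by the face
    property either both stay in \<open>F\<close> or both leave it.\<close>
  have rows: "\<forall>b\<in>B. zero_on ?J b \<or> crosses pos_keys neg_keys ?J b"
  proof
    fix b assume b: "b \<in> B"
    have bL: "vpos b - vneg b \<in> L" using C'(2) b by (auto simp: vpos_minus_vneg)
    then have bL': "vneg b - vpos b \<in> L" using is_lattice_uminus[OF lat bL] by simp
    have bE: "keys (vpos b) \<subseteq> insert a E" "keys (vneg b) \<subseteq> insert a E"
      using C'(3)[OF b] keys_vpos keys_vneg by blast+
    have iff: "keys (vpos b) \<subseteq> F \<longleftrightarrow> keys (vneg b) \<subseteq> F"
      using is_faceD[OF F(3) nonneg_vpos nonneg_vneg bE bL] is_faceD[OF F(3) nonneg_vneg nonneg_vpos bE(2,1) bL'] by blast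
    have kp: "keys (vpos b) = pos_keys b" "keys (vneg b) = neg_keys b"
      by (auto simp: in_keys_iff lookup_vpos lookup_vneg pos_keys_def neg_keys_def max_def split: if_splits)
    show "zero_on ?J b \<or> crosses pos_keys neg_keys ?J b"
    proof (cases "keys b \<subseteq> F")
      case True
      then show ?thesis by (auto simp: zero_on_def keys_subset_iff)
    next
      case False
      then have "\<not> pos_keys b \<subseteq> F \<and> \<not> neg_keys b \<subseteq> F" using iff kp keys_eq_pos_neg[of b] by auto
      then have "pos_keys b \<inter> ?J \<noteq> {} \<and> neg_keys b \<inter> ?J \<noteq> {}" using bE kp by blast
      then show ?thesis by (simp add: crosses_def)
    qed
  qed
  \<comment> \<open>The substitution changes a combination by a multiple of
    \<open>frag_of a - u\<close>, which lives on \<open>F\<close>. So a dependency would give a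
    combination of vectors outside the face that is supported in \<open>F\<close>, hence spanned up
    to a power of \<open>q\<close> by the basis vectors inside \<open>F\<close>.\<close>
  have key: "\<forall>b\<in>Bo. c b = 0" if x: "x \<in> L" "keys x \<subseteq> F0"
    and z: "(\<Sum>b\<in>Bo. frag_cmul (c b) (?\<pi> b)) + x = 0" for c x
  proof -
    define y where "y = (\<Sum>b\<in>Bo. frag_cmul (c b) b)"
    have y: "y = frag_cmul (\<Sum>b\<in>Bo. c b * lookup b a) (frag_of a - u) - x"
      using z unfolding sum_elim_var y_def[symmetric] by (simp add: algebra_simps)
    have yF: "keys y \<subseteq> F" unfolding y
      by (intro keys_diff_subset keys_cmul_subset) (use x(2) uF F(2) in \<open>auto simp: keys_frag_of F0_def\<close>)
    have yL: "y \<in> L" unfolding y by (intro is_lattice_diff[OF lat] is_lattice_cmul[OF lat] u x)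
    have "zero_on ?J y" using yF by (auto simp: zero_on_def keys_subset_iff)
    moreover have "keys y \<subseteq> insert a E" using yF F(1) by blast
    ultimately obtain k where "frag_cmul (int q ^ k) y \<in> zspan {b\<in>B. zero_on ?J b}"
      using mixed_basis_stratum[OF W Diff_subset rows yL] by blast
    then obtain d where d: "frag_cmul (int q ^ k) y = (\<Sum>b\<in>{b\<in>B. zero_on ?J b}. frag_cmul (d b) b)"
      unfolding zspan_def by blast
    have zJ: "zero_on ?J b \<longleftrightarrow> keys b \<subseteq> F" if "b \<in> B" for b
      using C'(3)[OF that] by (auto simp: zero_on_def keys_subset_iff)
    have dis: "Bo \<inter> {b\<in>B. zero_on ?J b} = {}" and un: "B = Bo \<union> {b\<in>B. zero_on ?J b}"
      using zJ by (auto simp: Bo_def)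
    define e where "e = (\<lambda>b. if zero_on ?J b then - d b else int q ^ k * c b)"
    have "(\<Sum>b\<in>B. frag_cmul (e b) b) = (\<Sum>b\<in>Bo \<union> {b\<in>B. zero_on ?J b}. frag_cmul (e b) b)" using un by simp
    also have "\<dots> = (\<Sum>b\<in>Bo. frag_cmul (e b) b) + (\<Sum>b\<in>{b\<in>B. zero_on ?J b}. frag_cmul (e b) b)"
      by (rule sum.union_disjoint) (use C'(1) fBo dis in auto)
    also have "(\<Sum>b\<in>Bo. frag_cmul (e b) b) = frag_cmul (int q ^ k) y"
      unfolding y_def frag_cmul_sum using dis fBo by (intro sum.cong) (auto simp: e_def)
    also have "(\<Sum>b\<in>{b\<in>B. zero_on ?J b}. frag_cmul (e b) b) = - frag_cmul (int q ^ k) y"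
      unfolding d sum_negf[symmetric] by (intro sum.cong) (auto simp: e_def)
    finally have "(\<Sum>b\<in>B. frag_cmul (e b) b) = 0" by (simp only: add.right_inverse)
    from indepD[OF C'(4) this] have e0: "e b = 0" if "b \<in> B" for b using that .
    show ?thesis
    proof
      fix b assume b: "b \<in> Bo"
      then have "\<not> zero_on ?J b" "b \<in> B" using dis fBo by blast+
      then have "int q ^ k * c b = 0" using e0[of b] by (simp add: e_def)
      then show "c b = 0" using q by simp
    qed
  qed
  have inj: "inj_on ?\<pi> Bo"
    by (rule indep_image(1)[OF fBo(1)]) (use key[of 0] is_lattice_zero[OF lat] in auto)
  have disj: "BF \<inter> ?\<pi> ` Bo = {}"
  proof (rule ccontr)
    assume "BF \<inter> ?\<pi> ` Bo \<noteq> {}"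
    then obtain b where b: "b \<in> Bo" "?\<pi> b \<in> BF" by blast
    let ?c = "\<lambda>x. if x = b then 1 else (0::int)"
    have "(\<Sum>x\<in>Bo. frag_cmul (?c x) (?\<pi> x)) = (\<Sum>x\<in>{b}. frag_cmul (?c x) (?\<pi> x))"
      by (rule sum.mono_neutral_right) (use fBo b in auto)
    then have z: "(\<Sum>x\<in>Bo. frag_cmul (?c x) (?\<pi> x)) + - ?\<pi> b = 0" by simp
    have "?\<pi> b \<in> L" "keys (?\<pi> b) \<subseteq> F0" using b(2) CF(2,3) by blast+
    then have "- ?\<pi> b \<in> L" "keys (- ?\<pi> b) \<subseteq> F0" using is_lattice_uminus[OF lat] by simp_all
    from key[OF this z] b(1) have "?c b = 0" by (rule bspec)
    then show False by simp
  qed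
  let ?B = "BF \<union> ?\<pi> ` Bo"
  have "indep ?B" unfolding indep_def
  proof (intro allI impI)
    fix c assume z: "(\<Sum>b\<in>?B. frag_cmul (c b) b) = 0"
    have "(\<Sum>b\<in>?B. frag_cmul (c b) b) = (\<Sum>b\<in>BF. frag_cmul (c b) b) + (\<Sum>b\<in>?\<pi> ` Bo. frag_cmul (c b) b)"
      by (rule sum.union_disjoint) (use CF(1) fBo disj in auto)
    also have "(\<Sum>b\<in>?\<pi> ` Bo. frag_cmul (c b) b) = (\<Sum>b\<in>Bo. frag_cmul (c (?\<pi> b)) (?\<pi> b))"
      by (simp add: sum.reindex[OF inj])
    finally have z': "(\<Sum>b\<in>Bo. frag_cmul (c (?\<pi> b)) (?\<pi> b)) + (\<Sum>b\<in>BF. frag_cmul (c b) b) = 0"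
      using z by (simp add: add.commute)
    have xL: "(\<Sum>b\<in>BF. frag_cmul (c b) b) \<in> L" using CF(2) by (intro is_lattice_sum[OF lat] is_lattice_cmul[OF lat]) blast
    have xF: "keys (\<Sum>b\<in>BF. frag_cmul (c b) b) \<subseteq> F0" by (intro keys_sum_subset keys_cmul_subset CF(3))
    have o: "\<forall>b\<in>Bo. c (?\<pi> b) = 0" by (rule key[OF xL xF z'])
    then have "(\<Sum>b\<in>BF. frag_cmul (c b) b) = 0" using z' by simp
    then show "\<forall>b\<in>?B. c b = 0" using o indepD[OF CF(4)] by blast
  qed
  moreover have "?B \<subseteq> L" using CF(2) fBo(2) C'(2) elim_var_in[OF lat u(3)] by blast
  moreover have "keys b \<subseteq> E" if "b \<in> ?B" for b
    using that CF(3) F0E fBo(2) C'(3) keys_elim_var[OF _ u(2) a] by blast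
  moreover have "qconn q ?B x y" if xy: "nonneg x" "nonneg y" "keys x \<subseteq> E" "keys y \<subseteq> E" "x - y \<in> L" for x y
  proof -
    have "keys x \<subseteq> insert a E" "keys y \<subseteq> insert a E" using xy by blast+
    then obtain k where k: "(move B)\<^sup>*\<^sup>* (frag_cmul (int q ^ k) x) (frag_cmul (int q ^ k) y)"
      using C'(5)[OF xy(1,2) _ _ xy(5)] unfolding qconn_def by blast
    have path: "qconn q ?B (?\<pi> s) (?\<pi> t)" if "(move B)\<^sup>*\<^sup>* s t" for s t
      using that
    proof (induction rule: rtranclp_induct)
      case base
      show ?case by (rule conn_qconn) simp
    next
      case (step y z)
      have nn: "nonneg (?\<pi> y)" "nonneg (?\<pi> z)" using step by (auto simp: move_def intro!: nonneg_elim_var u)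
      obtain b where b: "b \<in> B" "y - z = b \<or> z - y = b" using step by (auto simp: move_def)
      then have e: "?\<pi> y - ?\<pi> z = ?\<pi> b \<or> ?\<pi> z - ?\<pi> y = ?\<pi> b" by (auto simp: elim_var_diff)
      have "qconn q ?B (?\<pi> y) (?\<pi> z)"
      proof (cases "b \<in> Bo")
        case True
        then have "move ?B (?\<pi> y) (?\<pi> z)" using nn e unfolding move_def by auto
        then show ?thesis by (intro conn_qconn) blast
      next
        case False
        \<comment> \<open>After substitution the two end points of the step differ only on
          \<open>F0\<close>: they are connected there, with the common remainder carried
          along.\<close>
        then have bF: "keys b \<subseteq> F" using b by (auto simp: Bo_def)
        have pbF: "keys (?\<pi> b) \<subseteq> F0" by (rule keys_elim_var[OF _ uF Fa(2)]) (use bF Fa in simp)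
        have pbL: "?\<pi> b \<in> L" using b C'(2) elim_var_in[OF lat u(3)] by blast
        have dF: "keys (?\<pi> y - ?\<pi> z) \<subseteq> F0"
          using e pbF by (metis keys_minus minus_diff_eq)
        have dL: "?\<pi> y - ?\<pi> z \<in> L" using e pbL is_lattice_uminus[OF lat pbL] by (metis minus_diff_eq)
        have eq: "restr (- F0) (?\<pi> y) = restr (- F0) (?\<pi> z)"
          using dF by (intro poly_mapping_eqI) (auto simp: lookup_restr keys_subset_iff lookup_minus)
        have dec: "restr F0 s + restr (- F0) s = s" for s :: "'a \<Rightarrow>\<^sub>0 int"
          by (rule restr_split) auto
        have "restr F0 (?\<pi> y) - restr F0 (?\<pi> z) = ?\<pi> y - ?\<pi> z"
          using restr_id[OF dF] by (simp add: restr_diff)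
        then have "qconn q BF (restr F0 (?\<pi> y)) (restr F0 (?\<pi> z))"
          using dL by (intro CF(5) nonneg_restr nn keys_restr) simp
        then have "qconn q ?B (restr F0 (?\<pi> y) + restr (- F0) (?\<pi> y)) (restr F0 (?\<pi> z) + restr (- F0) (?\<pi> y))"
          by (intro qconn_add[OF qconn_mono] nonneg_restr nn) auto
        then show ?thesis by (subst (asm) (2) eq) (simp only: dec)
      qed
      then show ?case using qconn_trans step.IH by blast
    qed
    have "lookup (frag_cmul c x) a = 0" "lookup (frag_cmul c y) a = 0" for c
      using xy a by (auto simp: keys_subset_iff)
    then have "qconn q ?B (frag_cmul (int q ^ k) x) (frag_cmul (int q ^ k) y)"
      using path[OF k] by (simp only: elim_var_id)
    then show ?thesis by (rule qconn_descale)
  qed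
  ultimately have "connecting L q E ?B" unfolding connecting_def using CF(1) fBo(1) by blast
  then show ?thesis by blast
qed

lemma connecting_insert:
  assumes lat: "is_lattice L" and q: "q > 0" and e: "e \<notin> E" and fE: "finite E" and pos: "positive_on L (insert e E)"
    and C: "connecting L q E B" and u: "nonneg u" "keys u \<subseteq> E" "frag_of e - u \<in> L"
  shows "\<exists>B. connecting L q (insert e E) B"
proof -
  have posE: "positive_on L E" using pos positive_on_mono by blast
  have "glue_tree L q True E"
    using mixed_basis_imp_glue_tree[OF lat q posE fE connecting_imp_mixed_basis[OF q C]] .
  from glue_tree_insert[OF lat this e pos u] show ?thesis
    using glue_tree_imp_connecting[OF lat _ pos] by blast
qed

subsection \<open>Changing the generating family\<close>

lemma connecting_iso:
  fixes f :: "('i \<Rightarrow>\<^sub>0 int) \<Rightarrow> ('k \<Rightarrow>\<^sub>0 int)" and g :: "('k \<Rightarrow>\<^sub>0 int) \<Rightarrow> ('i \<Rightarrow>\<^sub>0 int)"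
  assumes C: "connecting L q E B"
    and fdiff: "\<And>x y. f (x - y) = f x - f y" and fcmul: "\<And>c x. f (frag_cmul c x) = frag_cmul c (f x)"
    and gdiff: "\<And>x y. g (x - y) = g x - g y"
    and fnn: "\<And>x. nonneg x \<Longrightarrow> nonneg (f x)" and gnn: "\<And>x. nonneg x \<Longrightarrow> nonneg (g x)"
    and fE: "\<And>x. keys x \<subseteq> E \<Longrightarrow> keys (f x) \<subseteq> E'" and gE: "\<And>x. keys x \<subseteq> E' \<Longrightarrow> keys (g x) \<subseteq> E"
    and gf: "\<And>x. keys x \<subseteq> E \<Longrightarrow> g (f x) = x" and fg: "\<And>x. keys x \<subseteq> E' \<Longrightarrow> f (g x) = x"
    and fL: "\<And>x. x \<in> L \<Longrightarrow> keys x \<subseteq> E \<Longrightarrow> f x \<in> L'" and gL: "\<And>x. x \<in> L' \<Longrightarrow> keys x \<subseteq> E' \<Longrightarrow> g x \<in> L"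
  shows "connecting L' q E' (f ` B)"
proof -
  note C' = connectingD[OF C]
  have f0: "f 0 = 0" using fdiff[of 0 0] by simp
  have fneg: "f (- x) = - f x" for x using fdiff[of 0 x] f0 by simp
  have fadd: "f (x + y) = f x + f y" for x y using fdiff[of x "- y"] fneg[of y] by simp
  have fsum: "f (sum h X) = (\<Sum>x\<in>X. f (h x))" for h :: "('i \<Rightarrow>\<^sub>0 int) \<Rightarrow> ('i \<Rightarrow>\<^sub>0 int)" and X
    by (induction X rule: infinite_finite_induct) (auto simp: f0 fadd)
  have ind: "indep (f ` B)"
  proof (rule indep_image(2)[OF C'(1)])
    fix c assume "(\<Sum>x\<in>B. frag_cmul (c x) (f x)) = 0"
    then have z: "f (\<Sum>x\<in>B. frag_cmul (c x) x) = 0" by (simp add: fsum fcmul)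
    have "keys (\<Sum>x\<in>B. frag_cmul (c x) x) \<subseteq> E" by (intro keys_sum_subset keys_cmul_subset C'(3))
    then have "(\<Sum>x\<in>B. frag_cmul (c x) x) = g 0" using gf z by metis
    also have "g 0 = 0" using gdiff[of 0 0] by simp
    finally show "\<forall>x\<in>B. c x = 0" using indepD[OF C'(4)] by blast
  qed
  have path: "(move (f ` B))\<^sup>*\<^sup>* (f x) (f y)" if "(move B)\<^sup>*\<^sup>* x y" for x y
    using that
  proof (induction rule: rtranclp_induct)
    case (step y z)
    then have "move (f ` B) (f y) (f z)" by (auto simp: move_def fnn simp flip: fdiff)
    then show ?case using step.IH by (rule rtranclp.rtrancl_into_rtrancl[rotated])
  qed simp
  have qc: "qconn q (f ` B) u v" if uv: "nonneg u" "nonneg v" "keys u \<subseteq> E'" "keys v \<subseteq> E'" "u - v \<in> L'" for u v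
  proof -
    have "g u - g v \<in> L" using gL[OF uv(5)] keys_diff_subset[OF uv(3,4)] gdiff by simp
    then have "qconn q B (g u) (g v)" by (intro C'(5) gnn gE uv)
    then obtain k where "(move B)\<^sup>*\<^sup>* (frag_cmul (int q ^ k) (g u)) (frag_cmul (int q ^ k) (g v))"
      unfolding qconn_def by blast
    from path[OF this] show ?thesis unfolding qconn_def fcmul fg[OF uv(3)] fg[OF uv(4)] by blast
  qed
  have "f ` B \<subseteq> L'" using fL C'(2,3) by blast
  moreover have "\<forall>b\<in>f ` B. keys b \<subseteq> E'" using C'(3) fE by blast
  ultimately show ?thesis unfolding connecting_def using C'(1) ind qc by (intro conjI allI impI) auto
qed

section \<open>Reindexing of integer vectors\<close>

definition push :: "('i \<Rightarrow> 'k) \<Rightarrow> ('i \<Rightarrow>\<^sub>0 int) \<Rightarrow> ('k \<Rightarrow>\<^sub>0 int)" where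
  "push h \<alpha> = frag_extend (\<lambda>i. frag_of (h i)) \<alpha>"

lemma lookup_push:
  assumes "inj h" shows "lookup (push h \<alpha>) (h i) = lookup \<alpha> i"
proof -
  have "lookup (push h \<alpha>) (h i) = (\<Sum>j\<in>keys \<alpha>. lookup \<alpha> j * lookup (frag_of (h j)) (h i))"
    by (simp add: push_def frag_extend_def lookup_sum)
  also have "\<dots> = (\<Sum>j\<in>keys \<alpha>. if j = i then lookup \<alpha> i else 0)"
    by (rule sum.cong) (use assms in \<open>auto simp: inj_eq\<close>)
  also have "\<dots> = lookup \<alpha> i" by (auto simp: in_keys_iff)
  finally show ?thesis .
qed

lemma lookup_push_out: "k \<notin> h ` keys \<alpha> \<Longrightarrow> lookup (push h \<alpha>) k = 0"
  by (auto simp: push_def frag_extend_def lookup_sum intro!: sum.neutral)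

lemma lookup_push_out': "k \<notin> range h \<Longrightarrow> lookup (push h \<alpha>) k = 0"
  by (rule lookup_push_out) auto

lemma lookup_map_key: "inj h \<Longrightarrow> lookup (Poly_Mapping.map_key h \<beta>) i = lookup \<beta> (h i)"
  by (simp add: Poly_Mapping.map_key.rep_eq)

lemma push_map_key:
  assumes "inj h" "keys \<beta> \<subseteq> range h" shows "push h (Poly_Mapping.map_key h \<beta>) = \<beta>"
proof (rule poly_mapping_eqI)
  fix k show "lookup (push h (Poly_Mapping.map_key h \<beta>)) k = lookup \<beta> k"
  proof (cases "k \<in> range h")
    case True
    then obtain i where "k = h i" by blast
    then show ?thesis by (simp only: lookup_push[OF assms(1)] lookup_map_key[OF assms(1)])
  next
    case False
    then have "lookup \<beta> k = 0" using assms(2) unfolding keys_subset_iff by blast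
    then show ?thesis using lookup_push_out'[OF False] by (simp only:)
  qed
qed

lemma map_key_push: "inj h \<Longrightarrow> Poly_Mapping.map_key h (push h \<alpha>) = \<alpha>"
  by (rule poly_mapping_eqI) (simp add: lookup_map_key lookup_push)

lemma keys_push: "keys (push h \<alpha>) \<subseteq> h ` keys \<alpha>"
  by (simp add: keys_subset_iff lookup_push_out)

lemma push_diff: "push h (x - y) = push h x - push h y"
  and push_cmul: "push h (frag_cmul c x) = frag_cmul c (push h x)"
  by (simp_all add: push_def frag_extend_diff frag_extend_cmul)

lemma nonneg_push:
  assumes "nonneg x" shows "nonneg (push h x)"
  unfolding push_def frag_extend_def
  by (rule nonneg_sum) (use assms in \<open>auto simp: nonneg_def intro!: nonneg_cmul[unfolded nonneg_def, rule_format]\<close>)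

lemma nonneg_map_key: "inj h \<Longrightarrow> nonneg x \<Longrightarrow> nonneg (Poly_Mapping.map_key h x)"
  by (simp add: nonneg_def lookup_map_key)

lemma map_key_diff: "inj h \<Longrightarrow> Poly_Mapping.map_key h (x - y) = Poly_Mapping.map_key h x - Poly_Mapping.map_key h (y :: _ \<Rightarrow>\<^sub>0 int)"
  and map_key_cmul: "inj h \<Longrightarrow> Poly_Mapping.map_key h (frag_cmul c x') = frag_cmul c (Poly_Mapping.map_key h x')"
  by (rule poly_mapping_eqI; simp add: lookup_map_key lookup_minus)+

lemma keys_push_image: "keys x \<subseteq> E \<Longrightarrow> keys (push h x) \<subseteq> h ` E"
  using keys_push[of h x] by blast

lemma keys_map_key_image: "inj h \<Longrightarrow> keys x \<subseteq> h ` E \<Longrightarrow> keys (Poly_Mapping.map_key h x) \<subseteq> E"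
  by (auto simp: keys_subset_iff lookup_map_key inj_image_mem_iff)

lemma connecting_push:
  assumes h: "inj h" and L: "\<And>x. keys x \<subseteq> E \<Longrightarrow> push h x \<in> L' \<longleftrightarrow> x \<in> L"
    and C: "connecting L q E B"
  shows "connecting L' q (h ` E) (push h ` B)"
proof (rule connecting_iso[OF C, where g = "Poly_Mapping.map_key h"])
  fix x :: "'b \<Rightarrow>\<^sub>0 int" assume x: "keys x \<subseteq> h ` E"
  show p: "push h (Poly_Mapping.map_key h x) = x" by (rule push_map_key[OF h]) (use x in auto)
  show "Poly_Mapping.map_key h x \<in> L" if "x \<in> L'"
    using L[OF keys_map_key_image[OF h x]] p that by simp
qed (rule push_diff push_cmul map_key_diff[OF h] nonneg_push nonneg_map_key[OF h] keys_push_image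
    keys_map_key_image[OF h] map_key_push[OF h] L[THEN iffD2] | assumption)+

lemma connecting_pull:
  assumes h: "inj h" and L: "\<And>x. keys x \<subseteq> E \<Longrightarrow> push h x \<in> L' \<longleftrightarrow> x \<in> L"
    and C: "connecting L' q (h ` E) B"
  shows "connecting L q E (Poly_Mapping.map_key h ` B)"
proof (rule connecting_iso[OF C, where g = "push h"])
  fix x :: "'b \<Rightarrow>\<^sub>0 int" assume x: "keys x \<subseteq> h ` E"
  show p: "push h (Poly_Mapping.map_key h x) = x" by (rule push_map_key[OF h]) (use x in auto)
  show "Poly_Mapping.map_key h x \<in> L" if "x \<in> L'"
    using L[OF keys_map_key_image[OF h x]] p that by simp
qed (rule push_diff map_key_cmul[OF h] map_key_diff[OF h] nonneg_push nonneg_map_key[OF h] keys_push_image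
    keys_map_key_image[OF h] map_key_push[OF h] L[THEN iffD2] | assumption)+

section \<open>Families in a commutative group and their relation lattices\<close>

definition fam_val :: "('g, 'z) monoid_scheme \<Rightarrow> ('i \<Rightarrow> 'g) \<Rightarrow> ('i \<Rightarrow>\<^sub>0 int) \<Rightarrow> 'g" where
  "fam_val G A \<alpha> = (\<Otimes>\<^bsub>G\<^esub>i\<in>keys \<alpha>. A i [^]\<^bsub>G\<^esub> lookup \<alpha> i)"

definition rel_lattice :: "('g, 'z) monoid_scheme \<Rightarrow> ('i \<Rightarrow> 'g) \<Rightarrow> ('i \<Rightarrow>\<^sub>0 int) set" where
  "rel_lattice G A = {\<alpha>. fam_val G A \<alpha> = \<one>\<^bsub>G\<^esub>}"

context comm_group
begin

lemma fam_val_eq: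
  assumes A: "\<And>i. A i \<in> carrier G" and E: "finite E" "keys \<alpha> \<subseteq> E"
  shows "fam_val G A \<alpha> = (\<Otimes>i\<in>E. A i [^] lookup \<alpha> i)"
  unfolding fam_val_def
  by (rule finprod_mono_neutral_cong_left) (use A E in \<open>auto simp: in_keys_iff\<close>)

lemma fam_val_closed [simp]: "(\<And>i. A i \<in> carrier G) \<Longrightarrow> fam_val G A \<alpha> \<in> carrier G"
  unfolding fam_val_def by (rule finprod_closed) auto

lemma fam_val_zero [simp]: "fam_val G A 0 = \<one>"
  by (simp add: fam_val_def)

lemma fam_val_frag_of: "(\<And>i. A i \<in> carrier G) \<Longrightarrow> fam_val G A (frag_of i) = A i"
  by (simp add: fam_val_eq[of A "{i}"] keys_frag_of)

lemma fam_val_add: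
  assumes A: "\<And>i. A i \<in> carrier G"
  shows "fam_val G A (\<alpha> + \<beta>) = fam_val G A \<alpha> \<otimes> fam_val G A \<beta>"
proof -
  let ?E = "keys \<alpha> \<union> keys \<beta>"
  have "fam_val G A (\<alpha> + \<beta>) = (\<Otimes>i\<in>?E. A i [^] lookup \<alpha> i \<otimes> A i [^] lookup \<beta> i)"
    by (subst fam_val_eq[of A ?E]) (use A keys_add[of \<alpha> \<beta>] in \<open>auto simp: lookup_add int_pow_mult intro!: finprod_cong\<close>)
  also have "\<dots> = (\<Otimes>i\<in>?E. A i [^] lookup \<alpha> i) \<otimes> (\<Otimes>i\<in>?E. A i [^] lookup \<beta> i)"
    by (rule finprod_multf) (use A in auto)
  also have "\<dots> = fam_val G A \<alpha> \<otimes> fam_val G A \<beta>"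
    by (subst (1 2) fam_val_eq[of A ?E]) (use A in auto)
  finally show ?thesis .
qed

lemma fam_val_minus:
  assumes A: "\<And>i. A i \<in> carrier G"
  shows "fam_val G A (- \<alpha>) = inv (fam_val G A \<alpha>)"
  using fam_val_add[where A = A, OF A, of "- \<alpha>" \<alpha>] by (intro inv_equality[symmetric]) (auto simp: A)

lemma fam_val_diff:
  assumes A: "\<And>i. A i \<in> carrier G"
  shows "fam_val G A (\<alpha> - \<beta>) = fam_val G A \<alpha> \<otimes> inv (fam_val G A \<beta>)"
  using fam_val_add[where A = A, OF A, of \<alpha> "- \<beta>"] fam_val_minus[where A = A, OF A] by simp

lemma fam_val_eq_iff:
  assumes A: "\<And>i. A i \<in> carrier G"
  shows "fam_val G A \<alpha> = fam_val G A \<beta> \<longleftrightarrow> \<alpha> - \<beta> \<in> rel_lattice G A"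
proof -
  have c: "fam_val G A \<alpha> \<in> carrier G" "fam_val G A \<beta> \<in> carrier G" using A by simp_all
  then have "\<one> = fam_val G A \<alpha> \<otimes> inv (fam_val G A \<beta>) \<longleftrightarrow> fam_val G A \<alpha> = \<one> \<otimes> fam_val G A \<beta>"
    by (intro inv_solve_right) auto
  then show ?thesis using c by (auto simp: rel_lattice_def fam_val_diff[where A = A, OF A])
qed

lemma fam_val_cmul:
  assumes A: "\<And>i. A i \<in> carrier G"
  shows "fam_val G A (frag_cmul c \<alpha>) = fam_val G A \<alpha> [^] c"
proof -
  have n: "fam_val G A (frag_cmul (int n) \<alpha>) = fam_val G A \<alpha> [^] int n" for n
    by (induction n) (auto simp: frag_cmul_distrib fam_val_add A int_pow_mult)
  show ?thesis
  proof (cases "c \<ge> 0")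
    case True
    then show ?thesis using n[of "nat c"] by simp
  next
    case False
    then have "frag_cmul c \<alpha> = - frag_cmul (int (nat (- c))) \<alpha>" by simp
    then show ?thesis using n[of "nat (- c)"] False
      by (simp only: fam_val_minus[where A = A, OF A]) (simp add: int_pow_neg A del: minus_frag_cmul)
  qed
qed

lemma is_lattice_rel: "(\<And>i. A i \<in> carrier G) \<Longrightarrow> is_lattice (rel_lattice G A)"
  by (auto simp: is_lattice_def rel_lattice_def fam_val_diff)

lemma fam_val_restr:
  assumes A: "\<And>i. A i \<in> carrier G" and one: "\<And>i. i \<in> keys \<alpha> \<Longrightarrow> i \<notin> F \<Longrightarrow> A i = \<one>"
  shows "fam_val G A (restr F \<alpha>) = fam_val G A \<alpha>"
proof -
  have "keys (restr F \<alpha>) \<subseteq> keys \<alpha>" by (auto simp: in_keys_iff lookup_restr split: if_splits)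
  then have "fam_val G A (restr F \<alpha>) = (\<Otimes>i\<in>keys \<alpha>. A i [^] lookup (restr F \<alpha>) i)"
    by (intro fam_val_eq A) auto
  also have "\<dots> = fam_val G A \<alpha>" unfolding fam_val_def
    by (rule finprod_cong) (use A one in \<open>auto simp: lookup_restr simp_implies_def\<close>)
  finally show ?thesis .
qed

lemma nat_span_eq:
  fixes A :: "'i \<Rightarrow> 'a"
  assumes A: "\<And>i. A i \<in> carrier G" and E: "finite E"
  shows "nat_span G A E = fam_val G A ` {u. nonneg u \<and> keys u \<subseteq> E}"
proof (intro equalityI subsetI)
  fix x assume "x \<in> nat_span G A E"
  then obtain n :: "'i \<Rightarrow> nat" where n: "x = (\<Otimes>i\<in>E. A i [^] n i)" unfolding nat_span_def by blast
  define u where "u = Abs_poly_mapping (\<lambda>i. if i \<in> E then int (n i) else 0)"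
  have "finite {i. (if i \<in> E then int (n i) else 0) \<noteq> 0}" by (rule finite_subset[OF _ E]) auto
  then have u: "lookup u i = (if i \<in> E then int (n i) else 0)" for i unfolding u_def by simp
  have "keys u \<subseteq> E" "nonneg u" by (auto simp: keys_subset_iff nonneg_def u)
  moreover have "fam_val G A u = x"
    unfolding n by (subst fam_val_eq[where A = A, OF A E \<open>keys u \<subseteq> E\<close>]) (auto simp: u A int_pow_int intro!: finprod_cong)
  ultimately show "x \<in> fam_val G A ` {u. nonneg u \<and> keys u \<subseteq> E}" by blast
next
  fix x assume "x \<in> fam_val G A ` {u. nonneg u \<and> keys u \<subseteq> E}"
  then obtain u where u: "nonneg u" "keys u \<subseteq> E" "x = fam_val G A u" by blast
  have "x = (\<Otimes>i\<in>E. A i [^] nat (lookup u i))"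
    unfolding u(3) by (subst fam_val_eq[where A = A, OF A E u(2)])
      (use u(1) A in \<open>auto simp: nonneg_def int_pow_int[symmetric] intro!: finprod_cong\<close>)
  then show "x \<in> nat_span G A E" unfolding nat_span_def by (auto intro!: exI[of _ "\<lambda>i. nat (lookup u i)"])
qed

lemma generate_eq:
  assumes A: "\<And>i. A i \<in> carrier G" and E: "finite E"
  shows "generate G (A ` E) = fam_val G A ` {u. keys u \<subseteq> E}"
proof
  let ?S = "fam_val G A ` {u. keys u \<subseteq> E}"
  have "subgroup ?S G"
  proof (rule subgroupI)
    show "?S \<subseteq> carrier G" using A by auto
    show "?S \<noteq> {}" by auto
    show "inv x \<in> ?S" if x: "x \<in> ?S" for x
    proof -
      obtain u where "keys u \<subseteq> E" "x = fam_val G A u" using x by blast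
      then show ?thesis by (intro image_eqI[of _ _ "- u"]) (auto simp: fam_val_minus A)
    qed
    show "x \<otimes> y \<in> ?S" if xy: "x \<in> ?S" "y \<in> ?S" for x y
    proof -
      obtain u v where "keys u \<subseteq> E" "x = fam_val G A u" "keys v \<subseteq> E" "y = fam_val G A v" using xy by blast
      then have "x \<otimes> y = fam_val G A (u + v)" "keys (u + v) \<subseteq> E"
        using fam_val_add[where A = A, OF A] keys_add_subset by simp_all
      then show ?thesis by blast
    qed
  qed
  moreover have "A ` E \<subseteq> ?S"
  proof
    fix x assume "x \<in> A ` E"
    then obtain i where "i \<in> E" "x = A i" by blast
    then show "x \<in> ?S" by (intro image_eqI[of _ _ "frag_of i"]) (auto simp: fam_val_frag_of A keys_frag_of)
  qed
  ultimately show "generate G (A ` E) \<subseteq> ?S" using generate_subgroup_incl by blast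
  have sg: "subgroup (generate G (A ` E)) G" by (rule generate_is_subgroup) (use A in auto)
  have pow: "A i [^] (c::int) \<in> generate G (A ` E)" if "i \<in> E" for i c
    by (rule subgroup_int_pow_closed[OF sg]) (use that in \<open>auto intro: generate.incl\<close>)
  have "(\<Otimes>i\<in>F. A i [^] (c i :: int)) \<in> generate G (A ` E)" if "finite F" "F \<subseteq> E" for F c
    using that
  proof (induction F rule: finite_induct)
    case empty
    show ?case using subgroup.one_closed[OF sg] by simp
  next
    case (insert i F)
    have "(\<Otimes>i\<in>insert i F. A i [^] c i) = A i [^] c i \<otimes> (\<Otimes>i\<in>F. A i [^] c i)"
      by (rule finprod_insert) (use insert A in auto)
    then show ?case using insert pow subgroup.m_closed[OF sg] by simp
  qed
  then show "?S \<subseteq> generate G (A ` E)" by (auto simp: fam_val_def)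
qed

lemma fam_val_push:
  assumes h: "inj h" and C: "\<And>k. C k \<in> carrier G"
  shows "fam_val G C (push h \<alpha>) = fam_val G (\<lambda>i. C (h i)) \<alpha>"
proof -
  have "fam_val G C (push h \<alpha>) = (\<Otimes>k\<in>h ` keys \<alpha>. C k [^] lookup (push h \<alpha>) k)"
    by (rule fam_val_eq[where A = C, OF C _ keys_push]) simp
  also have "\<dots> = (\<Otimes>i\<in>keys \<alpha>. C (h i) [^] lookup (push h \<alpha>) (h i))"
    by (rule finprod_reindex) (use C inj_on_subset[OF h] in auto)
  finally show ?thesis by (simp add: fam_val_def lookup_push[OF h])
qed

lemma nat_span_pos_add:
  assumes A: "\<And>i. A i \<in> carrier G" and E: "finite E" and "x \<in> nat_span G A E" "y \<in> nat_span G A E"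
  shows "x \<otimes> y \<in> nat_span G A E"
proof -
  obtain u v where "nonneg u" "keys u \<subseteq> E" "x = fam_val G A u" "nonneg v" "keys v \<subseteq> E" "y = fam_val G A v"
    using assms(3,4) unfolding nat_span_eq[where A = A, OF A E] by blast
  then have "x \<otimes> y = fam_val G A (u + v)" "nonneg (u + v)" "keys (u + v) \<subseteq> E"
    using fam_val_add[where A = A, OF A] nonneg_add keys_add_subset by simp_all
  then show ?thesis unfolding nat_span_eq[where A = A, OF A E] by blast
qed

text \<open>Both families are compared with their disjoint union, whose generators are redundant over either of them.\<close>

lemma change_family:
  fixes A :: "'i \<Rightarrow> 'a" and A' :: "'j \<Rightarrow> 'a"
  assumes A: "\<And>i. A i \<in> carrier G" and A': "\<And>i. A' i \<in> carrier G" and q: "q > 0"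
    and E: "finite E" and E': "finite E'" and eq: "nat_span G A E = nat_span G A' E'"
    and pos: "positive_on (rel_lattice G A) E" and pos': "positive_on (rel_lattice G A') E'"
    and conn: "connecting (rel_lattice G A) q E B"
  shows "\<exists>B'. connecting (rel_lattice G A') q E' B'"
proof -
  define C where "C = case_sum A A'"
  have C: "C k \<in> carrier G" for k using A A' by (cases k) (auto simp: C_def)
  let ?L = "rel_lattice G C"
  let ?l = "Inl :: 'i \<Rightarrow> 'i + 'j" and ?r = "Inr :: 'j \<Rightarrow> 'i + 'j"
  have lat: "is_lattice ?L" by (rule is_lattice_rel[where A = C, OF C])
  have vl: "fam_val G C (push ?l \<alpha>) = fam_val G A \<alpha>" for \<alpha> using fam_val_push[of ?l C] C by (simp add: C_def)
  have vr: "fam_val G C (push ?r \<alpha>) = fam_val G A' \<alpha>" for \<alpha> using fam_val_push[of ?r C] C by (simp add: C_def)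
  have Ll: "push ?l x \<in> ?L \<longleftrightarrow> x \<in> rel_lattice G A" for x by (simp add: rel_lattice_def vl)
  have Lr: "push ?r x \<in> ?L \<longleftrightarrow> x \<in> rel_lattice G A'" for x by (simp add: rel_lattice_def vr)
  have split: "u = push ?l (Poly_Mapping.map_key ?l u) + push ?r (Poly_Mapping.map_key ?r u)" for u :: "'i + 'j \<Rightarrow>\<^sub>0 int"
  proof (rule poly_mapping_eqI)
    fix k show "lookup u k = lookup (push ?l (Poly_Mapping.map_key ?l u) + push ?r (Poly_Mapping.map_key ?r u)) k"
      by (cases k) (auto simp: lookup_add lookup_push lookup_map_key image_iff intro!: lookup_push_out'[symmetric] lookup_push_out')
  qed
  have pos_add: "positive_on ?L (?l ` E \<union> ?r ` E')" unfolding positive_on_def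
  proof (intro ballI impI)
    fix u assume u: "u \<in> ?L" "keys u \<subseteq> ?l ` E \<union> ?r ` E'" "nonneg u"
    let ?a = "Poly_Mapping.map_key ?l u" and ?b = "Poly_Mapping.map_key ?r u"
    have aE: "keys ?a \<subseteq> E" "nonneg ?a" "keys ?b \<subseteq> E'" "nonneg ?b"
      using u by (auto simp: keys_subset_iff lookup_map_key nonneg_def)
    have "fam_val G C u = \<one>" using u by (simp add: rel_lattice_def)
    then have one: "fam_val G A ?a \<otimes> fam_val G A' ?b = \<one>"
      using split[of u] fam_val_add[where A = C, OF C] vl vr by metis
    have a0: "?a = 0"
    proof -
      \<comment> \<open>Rewriting the second part through the first family turns the relation into a
        nonnegative element of the first relation lattice.\<close>
      have "fam_val G A' ?b \<in> nat_span G A E" unfolding eq nat_span_eq[where A = A', OF A' E'] using aE by blast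
      then obtain v where v: "nonneg v" "keys v \<subseteq> E" "fam_val G A v = fam_val G A' ?b"
        unfolding nat_span_eq[where A = A, OF A E] by auto
      have "?a + v \<in> rel_lattice G A" using one v by (simp add: rel_lattice_def fam_val_add A)
      then have "?a + v = 0" by (rule positive_onD[OF pos]) (use aE v in \<open>simp_all add: nonneg_add keys_add_subset\<close>)
      then have "keys (?a + v) = {}" by simp
      then show ?thesis using keys_nonneg_add[OF aE(2) v(1)] by simp
    qed
    then have "?b \<in> rel_lattice G A'" using one A' by (simp add: rel_lattice_def)
    then have "?b = 0" using positive_onD[OF pos'] aE by blast
    then show "u = 0" using split[of u] a0 by (simp add: push_def)
  qed
  have redundant: "\<exists>u. nonneg u \<and> keys u \<subseteq> ?l ` E \<and> frag_of k - u \<in> ?L" if k: "k \<in> ?r ` E'" for k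
  proof -
    obtain j where j: "j \<in> E'" "k = ?r j" using k by blast
    have "A' j \<in> nat_span G A' E'" unfolding nat_span_eq[where A = A', OF A' E']
      using j by (intro image_eqI[of _ _ "frag_of j"]) (auto simp: fam_val_frag_of A' nonneg_frag_of keys_frag_of)
    then obtain v where v: "nonneg v" "keys v \<subseteq> E" "A' j = fam_val G A v"
      unfolding eq[symmetric] nat_span_eq[where A = A, OF A E] by blast
    have "fam_val G C (frag_of k) = fam_val G C (push ?l v)" using v j by (simp add: fam_val_frag_of C vl) (simp add: C_def)
    then have "frag_of k - push ?l v \<in> ?L" using fam_val_eq_iff[where A = C, OF C] by blast
    then show ?thesis by (intro exI[of _ "push ?l v"] conjI nonneg_push keys_push_image v)
  qed
  have redundant': "\<exists>u. nonneg u \<and> keys u \<subseteq> ?r ` E' \<and> frag_of k - u \<in> ?L" if k: "k \<in> ?l ` E" for k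
  proof -
    obtain j where j: "j \<in> E" "k = ?l j" using k by blast
    have "A j \<in> nat_span G A E" unfolding nat_span_eq[where A = A, OF A E]
      using j by (intro image_eqI[of _ _ "frag_of j"]) (auto simp: fam_val_frag_of A nonneg_frag_of keys_frag_of)
    then obtain v where v: "nonneg v" "keys v \<subseteq> E'" "A j = fam_val G A' v"
      unfolding eq nat_span_eq[where A = A', OF A' E'] by blast
    have "fam_val G C (frag_of k) = fam_val G C (push ?r v)" using v j by (simp add: fam_val_frag_of C vr) (simp add: C_def)
    then have "frag_of k - push ?r v \<in> ?L" using fam_val_eq_iff[where A = C, OF C] by blast
    then show ?thesis by (intro exI[of _ "push ?r v"] conjI nonneg_push keys_push_image v)
  qed
  have "\<exists>B. connecting ?L q (X \<union> ?l ` E) B" if "finite X" "X \<subseteq> ?r ` E'" for X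
    using that
  proof (induction X rule: finite_induct)
    case empty
    show ?case using connecting_push[of ?l E ?L, OF _ Ll conn] by auto
  next
    case (insert k X)
    then obtain B where B: "connecting ?L q (X \<union> ?l ` E) B" by auto
    have "k \<in> ?r ` E'" using insert.prems by simp
    from redundant[OF this] obtain u where u: "nonneg u" "keys u \<subseteq> ?l ` E" "frag_of k - u \<in> ?L" by blast
    have "\<exists>B. connecting ?L q (insert k (X \<union> ?l ` E)) B"
    proof (rule connecting_insert[OF lat q _ _ _ B u(1) _ u(3)])
      show "k \<notin> X \<union> ?l ` E" using insert by auto
      show "finite (X \<union> ?l ` E)" using insert E by simp
      show "positive_on ?L (insert k (X \<union> ?l ` E))" by (rule positive_on_mono[OF pos_add]) (use insert in auto)
    qed (use u in auto)
    then show ?case by simp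
  qed
  from this[of "?r ` E'"] have full: "\<exists>B. connecting ?L q (?l ` E \<union> ?r ` E') B" using E' by (simp add: Un_commute)
  have "\<exists>B. connecting ?L q (?l ` (E - X) \<union> ?r ` E') B" if "finite X" "X \<subseteq> E" for X
    using that
  proof (induction X rule: finite_induct)
    case empty
    show ?case using full by simp
  next
    case (insert i X)
    then obtain B where "connecting ?L q (?l ` (E - X) \<union> ?r ` E') B" by auto
    moreover have "?l ` (E - X) \<union> ?r ` E' = insert (?l i) (?l ` (E - insert i X) \<union> ?r ` E')" using insert by auto
    ultimately have B: "connecting ?L q (insert (?l i) (?l ` (E - insert i X) \<union> ?r ` E')) B" by simp
    have "?l i \<in> ?l ` E" using insert.prems by simp
    from redundant'[OF this] obtain u
      where u: "nonneg u" "keys u \<subseteq> ?r ` E'" "frag_of (?l i) - u \<in> ?L" by blast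
    show ?case
    proof (rule connecting_remove[OF lat q _ _ _ B u(1) _ u(3)])
      show "?l i \<notin> ?l ` (E - insert i X) \<union> ?r ` E'" by auto
      show "finite (?l ` (E - insert i X) \<union> ?r ` E')" using E E' by simp
      show "positive_on ?L (insert (?l i) (?l ` (E - insert i X) \<union> ?r ` E'))"
        by (rule positive_on_mono[OF pos_add]) (use insert in auto)
    qed (use u in auto)
  qed
  from this[of E] obtain B where "connecting ?L q (?r ` E') B" using E by auto
  from connecting_pull[of ?r E' ?L, OF _ Lr this] show ?thesis by auto
qed

text \<open>In a nonzero nonnegative relation one occurrence of a generator is inverse to the
  product of the rest, so this generator would be invertible in the semigroup and hence the
  identity.\<close>

lemma positive_on_zero_free:
  assumes A: "\<And>i. A i \<in> carrier G" and E: "finite E" and ni: "no_invertibles G (nat_span G A E)"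
    and zf: "\<And>i. i \<in> E \<Longrightarrow> A i \<noteq> \<one>"
  shows "positive_on (rel_lattice G A) E"
  unfolding positive_on_def
proof (intro ballI impI, rule ccontr)
  fix u assume u: "u \<in> rel_lattice G A" "keys u \<subseteq> E" "nonneg u" "u \<noteq> 0"
  then obtain i where i: "i \<in> keys u" by (metis all_not_in_conv keys_eq_empty)
  define v where "v = u - frag_of i"
  have ui: "lookup u i \<ge> 1" using i u(3) by (metis in_keys_iff int_one_le_iff_zero_less nonneg_def order_less_le)
  have v: "nonneg v" "keys v \<subseteq> E"
    using ui u(2,3) i by (auto simp: v_def nonneg_def lookup_minus keys_subset_iff)
  have "fam_val G A u = A i \<otimes> fam_val G A v"
    using fam_val_add[where A = A, OF A, of "frag_of i" v] fam_val_frag_of[where A = A, OF A] by (simp add: v_def)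
  then have one: "A i \<otimes> fam_val G A v = \<one>" using u(1) by (simp add: rel_lattice_def)
  then have "A i = inv (fam_val G A v)" using A by (metis fam_val_closed inv_equality)
  moreover have "fam_val G A v \<in> nat_span G A E" unfolding nat_span_eq[where A = A, OF A E] using v by blast
  moreover have "A i \<in> nat_span G A E" unfolding nat_span_eq[where A = A, OF A E]
    using i u(2) by (intro image_eqI[of _ _ "frag_of i"]) (auto simp: fam_val_frag_of A nonneg_frag_of keys_frag_of)
  ultimately have "A i \<in> nat_span G A E \<inter> m_inv G ` nat_span G A E" by blast
  then have "A i = \<one>" using ni unfolding no_invertibles_def by blast
  then show False using zf i u(2) by blast
qed

text \<open>A member equal to the identity makes a basis vector a relation and so destroys
  positivity. Families are therefore thinned out before their relation lattices are used.\<close>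

lemma nat_span_zero_free:
  assumes A: "\<And>i. A i \<in> carrier G" and E: "finite E"
  shows "nat_span G A {i\<in>E. A i \<noteq> \<one>} = nat_span G A E"
proof (intro equalityI subsetI)
  let ?F = "{i\<in>E. A i \<noteq> \<one>}"
  have fF: "finite ?F" using E by simp
  show "x \<in> nat_span G A E" if "x \<in> nat_span G A ?F" for x
    using that unfolding nat_span_eq[where A = A, OF A E] nat_span_eq[where A = A, OF A fF] by blast
  fix x assume "x \<in> nat_span G A E"
  then obtain u where u: "nonneg u" "keys u \<subseteq> E" "x = fam_val G A u" unfolding nat_span_eq[where A = A, OF A E] by blast
  have ones: "\<And>i. i \<in> keys u \<Longrightarrow> i \<notin> ?F \<Longrightarrow> A i = \<one>" using u by blast
  have "fam_val G A (restr ?F u) = fam_val G A u" by (rule fam_val_restr) (rule A, rule ones, assumption+)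
  then have "x = fam_val G A (restr ?F u)" using u by simp
  then show "x \<in> nat_span G A ?F" unfolding nat_span_eq[where A = A, OF A fF] using nonneg_restr[OF u(1), of ?F] keys_restr[of ?F u] by blast
qed

lemma generate_zero_free:
  assumes A: "\<And>i. A i \<in> carrier G" and E: "finite E"
  shows "generate G (A ` {i\<in>E. A i \<noteq> \<one>}) = generate G (A ` E)"
proof (intro equalityI subsetI)
  let ?F = "{i\<in>E. A i \<noteq> \<one>}"
  have fF: "finite ?F" using E by simp
  show "x \<in> generate G (A ` E)" if "x \<in> generate G (A ` ?F)" for x
    using that unfolding generate_eq[where A = A, OF A E] generate_eq[where A = A, OF A fF] by blast
  fix x assume "x \<in> generate G (A ` E)"
  then obtain u where u: "keys u \<subseteq> E" "x = fam_val G A u" unfolding generate_eq[where A = A, OF A E] by blast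
  have ones: "\<And>i. i \<in> keys u \<Longrightarrow> i \<notin> ?F \<Longrightarrow> A i = \<one>" using u by blast
  have "fam_val G A (restr ?F u) = fam_val G A u" by (rule fam_val_restr) (rule A, rule ones, assumption+)
  then have "x = fam_val G A (restr ?F u)" using u by simp
  then show "x \<in> generate G (A ` ?F)" unfolding generate_eq[where A = A, OF A fF] using keys_restr[of ?F u] by blast
qed

lemma nat_span_cong:
  "(\<And>i. i \<in> E \<Longrightarrow> A i = A' i) \<Longrightarrow> (\<And>i. i \<in> E \<Longrightarrow> A i \<in> carrier G) \<Longrightarrow> nat_span G A E = nat_span G A' E"
  unfolding nat_span_def by (intro Collect_cong ex_cong1 conj_cong refl arg_cong2[where f = "(=)"] finprod_cong') auto

text \<open>Every stage of gluing comes with its own family. The bases supplied by the induction for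
  the two sides are carried over by \<open>change_family\<close> to the family of the current stage,
  and only then joined in a gluing tree.\<close>

lemma completely_p_glued_imp_connecting:
  assumes q: "q > 0" and g: "completely_p_glued G q S"
  shows "\<exists>(A :: nat \<Rightarrow> 'a) E. (\<forall>i. A i \<in> carrier G) \<and> finite E \<and> nat_span G A E = S \<and>
    positive_on (rel_lattice G A) E \<and> (\<exists>B. connecting (rel_lattice G A) q E B)"
  using g
proof (induction rule: completely_p_glued.induct)
  case (independent A s)
  \<comment> \<open>The rules constrain a family only on its index range; the value outside makes it
    total in the carrier, as the lemmas on \<open>fam_val\<close> require.\<close>
  define A' where "A' = (\<lambda>i. if i \<in> {1..s} then A i else \<one>)"
  have A': "\<And>i. A' i \<in> carrier G" using independent(1) by (auto simp: A'_def)
  have 0: "\<alpha> = 0" if "\<alpha> \<in> rel_lattice G A'" "keys \<alpha> \<subseteq> {1..s}" for \<alpha>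
  proof -
    have "(\<Otimes>i\<in>{1..s}. A i [^] lookup \<alpha> i) = (\<Otimes>i\<in>{1..s}. A' i [^] lookup \<alpha> i)"
      by (rule finprod_cong') (use independent(1) A' in \<open>auto simp: A'_def\<close>)
    also have "\<dots> = fam_val G A' \<alpha>" by (rule fam_val_eq[symmetric, OF A']) (use that in auto)
    also have "\<dots> = \<one>" using that by (simp add: rel_lattice_def)
    finally have "\<forall>i\<in>{1..s}. lookup \<alpha> i = 0" using independent(2) unfolding lin_independent_def by blast
    then show ?thesis using that(2) by (intro poly_mapping_eqI) (auto simp: keys_subset_iff)
  qed
  have "glue_tree (rel_lattice G A') q False {1..s}" by (rule glue_tree.leaf) (use 0 in auto)
  moreover have pos: "positive_on (rel_lattice G A') {1..s}" using 0 by (simp add: positive_on_def)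
  ultimately have "\<exists>B. connecting (rel_lattice G A') q {1..s} B"
    using glue_tree_imp_connecting is_lattice_rel[where A = A', OF A'] by blast
  moreover have "nat_span G A' {1..s} = nat_span G A {1..s}"
    by (rule nat_span_cong) (use independent(1) in \<open>auto simp: A'_def\<close>)
  ultimately show ?case using A' pos by (intro exI[of _ A'] exI[of _ "{1..s}"]) auto
next
  case (glue A m E1 E2)
  define A' where "A' = (\<lambda>i. if i \<in> {1..m} then A i else \<one>)"
  have A': "\<And>i. A' i \<in> carrier G" using glue.hyps(1) by (auto simp: A'_def)
  have E12: "E1 \<subseteq> {1..m}" "E2 \<subseteq> {1..m}" "E1 \<inter> E2 = {}" "E1 \<union> E2 = {1..m}"
    using glue.hyps(3) by (auto simp: splitting_def)
  have fin: "finite E1" "finite E2" using E12 finite_subset by blast+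
  have sp: "nat_span G A D = nat_span G A' D" "generate G (A ` D) = generate G (A' ` D)" if "D \<subseteq> {1..m}" for D
  proof -
    show "nat_span G A D = nat_span G A' D"
      by (rule nat_span_cong) (use that glue.hyps(1) in \<open>auto simp: A'_def\<close>)
    have "A ` D = A' ` D" using that by (auto simp: A'_def)
    then show "generate G (A ` D) = generate G (A' ` D)" by simp
  qed
  let ?z = "\<lambda>D. {i\<in>D. A' i \<noteq> \<one>}"
  let ?E = "?z {1..m}" and ?F1 = "?z E1" and ?F2 = "?z E2"
  have EF: "?E = ?F1 \<union> ?F2" using E12(4) by auto
  have spE: "nat_span G A' ?E = nat_span G A {1..m}" 
    unfolding nat_span_zero_free[where A = A', OF A' finite_atLeastAtMost] by (rule sp(1)[OF subset_refl, symmetric])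
  have spF: "nat_span G A' ?F1 = nat_span G A E1" "nat_span G A' ?F2 = nat_span G A E2"
    unfolding nat_span_zero_free[where A = A', OF A' fin(1)] nat_span_zero_free[where A = A', OF A' fin(2)]
    by (rule sp(1)[OF E12(1), symmetric], rule sp(1)[OF E12(2), symmetric])
  have gF: "generate G (A' ` ?F1) = generate G (A ` E1)" "generate G (A' ` ?F2) = generate G (A ` E2)"
    unfolding generate_zero_free[where A = A', OF A' fin(1)] generate_zero_free[where A = A', OF A' fin(2)]
    by (rule sp(2)[OF E12(1), symmetric], rule sp(2)[OF E12(2), symmetric])
  let ?L = "rel_lattice G A'"
  have lat: "is_lattice ?L" by (rule is_lattice_rel[where A = A', OF A'])
  have pos: "positive_on ?L ?E"
    by (rule positive_on_zero_free[where A = A', OF A']) (use glue.hyps(2) spE in auto)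
  have pos12: "positive_on ?L ?F1" "positive_on ?L ?F2" 
    by (rule positive_on_mono[OF pos]; use EF in blast)+
  have fF: "finite ?F1" "finite ?F2" using fin by auto
  have trans: "\<exists>B. connecting ?L q F B"
    if IH: "\<exists>(A'' :: nat \<Rightarrow> 'a) D. (\<forall>i. A'' i \<in> carrier G) \<and> finite D \<and> nat_span G A'' D = nat_span G A' F \<and>
      positive_on (rel_lattice G A'') D \<and> (\<exists>B. connecting (rel_lattice G A'') q D B)"
      and F: "finite F" "positive_on ?L F" for F
  proof -
    obtain A'' :: "nat \<Rightarrow> 'a" and D B where A'': "\<And>i. A'' i \<in> carrier G" "finite D"
      "nat_span G A'' D = nat_span G A' F" "positive_on (rel_lattice G A'') D" "connecting (rel_lattice G A'') q D B"
      using IH by blast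
    show ?thesis by (rule change_family[OF A''(1) A' q A''(2) F(1) A''(3,4) F(2) A''(5)])
  qed
  obtain B1 where B1: "connecting ?L q ?F1 B1"
    using trans[OF _ fF(1) pos12(1)] glue.IH(1) unfolding spF(1) by blast
  obtain B2 where B2: "connecting ?L q ?F2 B2"
    using trans[OF _ fF(2) pos12(2)] glue.IH(2) unfolding spF(2) by blast
  have t: "glue_tree ?L q False ?F1" "glue_tree ?L q False ?F2"
    using mixed_basis_imp_glue_tree[OF lat q pos12(1) fF(1) connecting_imp_mixed_basis[OF q B1]]
      mixed_basis_imp_glue_tree[OF lat q pos12(2) fF(2) connecting_imp_mixed_basis[OF q B2]] by auto
  obtain a where a: "a \<in> p_closure G q (nat_span G A E1 \<inter> nat_span G A E2)"
    "generate G {a} = generate G (A ` E1) \<inter> generate G (A ` E2)"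
    using glue.hyps unfolding is_p_gluing_def by blast
  obtain k where ac: "a \<in> carrier G" and k: "a [^] (q ^ k) \<in> nat_span G A E1 \<inter> nat_span G A E2"
    using a(1) unfolding p_closure_def by blast
  obtain b1 where b1: "nonneg b1" "keys b1 \<subseteq> ?F1" "a [^] (q ^ k) = fam_val G A' b1"
    using k unfolding spF(1)[symmetric] nat_span_eq[where A = A', OF A' fF(1)] by blast
  obtain b2 where b2: "nonneg b2" "keys b2 \<subseteq> ?F2" "a [^] (q ^ k) = fam_val G A' b2"
    using k unfolding spF(2)[symmetric] nat_span_eq[where A = A', OF A' fF(2)] by blast
  have ak: "fam_val G A' b1 = a [^] (int q ^ k)" "fam_val G A' b2 = a [^] (int q ^ k)"
    using b1(3) b2(3) int_pow_int[of G a "q ^ k"] by simp_all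
  have dis: "?F1 \<inter> ?F2 = {}" using E12 by auto
  have "glue_tree ?L q False (?F1 \<union> ?F2)"
  proof (rule glue_tree.node[OF t dis b1(1) b2(1) b1(2) b2(2)])
    show "b1 - b2 \<in> ?L" using b1(3) b2(3) fam_val_eq_iff[where A = A', OF A'] by metis
    fix \<alpha> assume \<alpha>: "\<alpha> \<in> ?L" "keys \<alpha> \<subseteq> ?F1 \<union> ?F2"
    let ?a1 = "restr ?F1 \<alpha>" and ?a2 = "restr ?F2 \<alpha>"
    have \<alpha>12: "?a1 + ?a2 = \<alpha>" by (rule restr_split[OF \<alpha>(2) dis])
    have v1: "fam_val G A' ?a1 \<otimes> fam_val G A' ?a2 = \<one>"
      using \<alpha>(1) fam_val_add[where A = A', OF A', of ?a1 ?a2] unfolding \<alpha>12 by (simp add: rel_lattice_def)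
    have "inv (fam_val G A' ?a2) = fam_val G A' ?a1"
      by (rule inv_equality[OF v1]) (rule fam_val_closed, rule A')+
    then have v2: "fam_val G A' ?a1 = fam_val G A' (- ?a2)"
      unfolding fam_val_minus[where A = A', OF A'] by (rule sym)
    have "fam_val G A' ?a1 \<in> generate G (A' ` ?F1)" unfolding generate_eq[where A = A', OF A' fF(1)] using keys_restr[of ?F1 \<alpha>] by blast
    moreover have "keys (- ?a2) \<subseteq> ?F2" by (simp add: keys_restr)
    then have "fam_val G A' ?a1 \<in> generate G (A' ` ?F2)" unfolding generate_eq[where A = A', OF A' fF(2)] v2 by blast
    ultimately have "fam_val G A' ?a1 \<in> generate G {a}" unfolding a(2) gF by blast
    \<comment> \<open>The value of the first part of the relation lies in both groups, so it is a
      power of the gluing element \<open>a\<close>. Its power with exponent \<open>q ^ k\<close> can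
      then be expressed by \<open>b1\<close> as well as by \<open>b2\<close>.\<close>
    then obtain c :: int where c: "fam_val G A' ?a1 = a [^] c" unfolding generate_pow[OF ac] by blast
    have "fam_val G A' (frag_cmul (int q ^ k) ?a1) = fam_val G A' (frag_cmul c b1)"
      unfolding fam_val_cmul[where A = A', OF A'] c ak using ac by (simp add: int_pow_pow mult.commute)
    then have l1: "frag_cmul (int q ^ k) ?a1 - frag_cmul c b1 \<in> ?L" using fam_val_eq_iff[where A = A', OF A'] by blast
    have "fam_val G A' (frag_cmul (int q ^ k) (- ?a2)) = fam_val G A' (frag_cmul c b2)"
      unfolding fam_val_cmul[where A = A', OF A'] v2[symmetric] c ak using ac by (simp add: int_pow_pow mult.commute)
    then have "frag_cmul c b2 - frag_cmul (int q ^ k) (- ?a2) \<in> ?L" using fam_val_eq_iff[where A = A', OF A'] by metis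
    moreover have "frag_cmul c b2 - frag_cmul (int q ^ k) (- ?a2) = frag_cmul (int q ^ k) ?a2 + frag_cmul c b2"
      by (rule poly_mapping_eqI) (simp add: lookup_add lookup_minus)
    ultimately have l2: "frag_cmul (int q ^ k) ?a2 + frag_cmul c b2 \<in> ?L" by (simp only:)
    have "frag_cmul (int q ^ k) \<alpha> = frag_cmul (int q ^ k) (?a1 + ?a2)" unfolding \<alpha>12 ..
    also have "\<dots> = frag_cmul c (b1 - b2) + (frag_cmul (int q ^ k) ?a1 - frag_cmul c b1) + (frag_cmul (int q ^ k) ?a2 + frag_cmul c b2)"
      by (rule poly_mapping_eqI) (simp add: lookup_add lookup_minus algebra_simps)
    finally show "\<exists>k c l1 l2. l1 \<in> ?L \<and> l2 \<in> ?L \<and> keys l1 \<subseteq> ?F1 \<and> keys l2 \<subseteq> ?F2 \<and>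
         frag_cmul (int q ^ k) \<alpha> = frag_cmul c (b1 - b2) + l1 + l2"
      by (intro exI conjI) (assumption | rule l1 l2 keys_diff_subset keys_add_subset keys_cmul_subset keys_restr b1 b2)+
  qed simp
  then have "\<exists>B. connecting ?L q ?E B"
    using glue_tree_imp_connecting[OF lat, of q False "?F1 \<union> ?F2"] pos unfolding EF by blast
  then show ?case using A' pos spE by (intro exI[of _ A'] exI[of _ ?E]) auto
qed

end

subsection \<open>Completely glued lattices\<close>

lemma zspan_mono: "finite B \<Longrightarrow> A \<subseteq> B \<Longrightarrow> zspan A \<subseteq> zspan B"
  by (rule zspan_subset[OF is_lattice_zspan]) (use zspan_base in blast)

lemma zspan_empty: "zspan {} = {0}"
  by (simp add: zspan_def)

text \<open>Induction on the coordinates: the values of one coordinate form a cyclic group, and a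
  vector attaining a generator reduces the rest to vectors vanishing at that coordinate.\<close>

lemma lattice_finitely_generated:
  fixes M :: "('i \<Rightarrow>\<^sub>0 int) set"
  assumes "finite E"
  shows "is_lattice M \<Longrightarrow> (\<And>\<alpha>. \<alpha> \<in> M \<Longrightarrow> keys \<alpha> \<subseteq> E) \<Longrightarrow> \<exists>X. finite X \<and> X \<subseteq> M \<and> M \<subseteq> zspan X"
  using assms
proof (induction E arbitrary: M rule: finite_induct)
  case empty
  then have "M \<subseteq> {0}" using keys_eq_empty by blast
  then show ?case by (intro exI[of _ "{}"]) (simp add: zspan_empty)
next
  case (insert e E)
  note lat = insert.prems(1)
  define M0 where "M0 = {\<alpha>\<in>M. lookup \<alpha> e = 0}"
  have lat0: "is_lattice M0" using lat by (auto simp: is_lattice_def M0_def lookup_minus)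
  have k0: "keys \<alpha> \<subseteq> E" if "\<alpha> \<in> M0" for \<alpha>
  proof
    fix i assume i: "i \<in> keys \<alpha>"
    then have "i \<noteq> e" using \<open>\<alpha> \<in> M0\<close> by (auto simp: M0_def in_keys_iff)
    moreover have "i \<in> insert e E" using i \<open>\<alpha> \<in> M0\<close> insert.prems(2)[of \<alpha>] by (auto simp: M0_def)
    ultimately show "i \<in> E" by simp
  qed
  obtain X where X: "finite X" "X \<subseteq> M0" "M0 \<subseteq> zspan X" using insert.IH[OF lat0 k0] by blast
  show ?case
  proof (cases "\<forall>\<alpha>\<in>M. lookup \<alpha> e = 0")
    case True
    then have "M0 = M" by (auto simp: M0_def)
    then show ?thesis using X by blast
  next
    case False
    then obtain \<alpha>0 where \<alpha>0: "\<alpha>0 \<in> M" "lookup \<alpha>0 e \<noteq> 0" by blast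
    define H where "H = (\<lambda>\<alpha>. lookup \<alpha> e) ` M"
    have Hd: "x - y \<in> H" if xy: "x \<in> H" "y \<in> H" for x y
    proof -
      obtain \<alpha> \<beta> where "\<alpha> \<in> M" "\<beta> \<in> M" "x = lookup \<alpha> e" "y = lookup \<beta> e" using xy unfolding H_def by blast
      then show ?thesis unfolding H_def
        by (intro image_eqI[of _ _ "\<alpha> - \<beta>"]) (simp_all add: lookup_minus is_lattice_diff[OF lat])
    qed
    have "lookup \<alpha>0 e \<in> H" "lookup (- \<alpha>0) e \<in> H" unfolding H_def using \<alpha>0(1) is_lattice_uminus[OF lat \<alpha>0(1)] by blast+
    then have "\<bar>lookup \<alpha>0 e\<bar> \<in> H" by (auto simp: abs_if)
    moreover have "\<bar>lookup \<alpha>0 e\<bar> > 0" using \<alpha>0(2) by simp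
    ultimately obtain d where d: "d > 0" "d \<in> H" "\<forall>c\<in>H. d dvd c"
      using int_subgroup_principal[of H "\<bar>lookup \<alpha>0 e\<bar>"] Hd by blast
    obtain \<xi> where \<xi>: "\<xi> \<in> M" "lookup \<xi> e = d" using d(2) unfolding H_def by blast
    have fX: "finite (insert \<xi> X)" using X(1) by simp
    have "\<alpha> \<in> zspan (insert \<xi> X)" if "\<alpha> \<in> M" for \<alpha>
    proof -
      have "d dvd lookup \<alpha> e" using d(3) that by (simp add: H_def)
      then obtain t where t: "lookup \<alpha> e = d * t" by (rule dvdE)
      let ?\<beta> = "\<alpha> - frag_cmul t \<xi>"
      have "?\<beta> \<in> M0" unfolding M0_def using \<xi> t that by (simp add: lookup_minus is_lattice_diff[OF lat] is_lattice_cmul[OF lat])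
      then have "?\<beta> \<in> zspan (insert \<xi> X)" using X(3) zspan_mono[OF fX subset_insertI] by blast
      moreover have "frag_cmul t \<xi> \<in> zspan (insert \<xi> X)"
        by (intro is_lattice_cmul[OF is_lattice_zspan] zspan_base[OF fX]) simp
      ultimately have "?\<beta> + frag_cmul t \<xi> \<in> zspan (insert \<xi> X)" by (rule is_lattice_add[OF is_lattice_zspan])
      then show ?thesis by simp
    qed
    then show ?thesis using fX X(2) \<xi>(1) by (intro exI[of _ "insert \<xi> X"]) (auto simp: M0_def)
  qed
qed

lemma is_lattice_scale: "is_lattice N \<Longrightarrow> is_lattice {\<alpha>. frag_cmul m \<alpha> \<in> N}"
proof -
  assume lat: "is_lattice N"
  have "frag_cmul m (\<alpha> - \<beta>) = frag_cmul m \<alpha> - frag_cmul m \<beta>" for \<alpha> \<beta> :: "'a \<Rightarrow>\<^sub>0 int"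
    by (rule poly_mapping_eqI) (simp add: lookup_minus lookup_add algebra_simps)
  then show ?thesis using lat by (simp add: is_lattice_def)
qed

text \<open>A finite generating set needs only finitely many exponents, and their sum serves all
  elements at once.\<close>

lemma uniform_power:
  assumes lat: "is_lattice N" and M: "finite E" "is_lattice M" "\<And>\<alpha>. \<alpha> \<in> M \<Longrightarrow> keys \<alpha> \<subseteq> E"
    and p: "\<And>\<alpha>. \<alpha> \<in> M \<Longrightarrow> \<exists>k. frag_cmul (int q ^ k) \<alpha> \<in> N"
  shows "\<exists>k. \<forall>\<alpha>\<in>M. frag_cmul (int q ^ k) \<alpha> \<in> N"
proof -
  obtain X where X: "finite X" "X \<subseteq> M" "M \<subseteq> zspan X" using lattice_finitely_generated[OF M] by blast
  have "\<exists>k. \<forall>\<alpha>\<in>Y. frag_cmul (int q ^ k) \<alpha> \<in> N" if "finite Y" "Y \<subseteq> M" for Y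
    using that
  proof (induction Y rule: finite_induct)
    case (insert y Y)
    then obtain k where k: "\<forall>\<alpha>\<in>Y. frag_cmul (int q ^ k) \<alpha> \<in> N" by auto
    obtain l where l: "frag_cmul (int q ^ l) y \<in> N" using p insert.prems by blast
    have up: "frag_cmul (int q ^ (k + l)) \<alpha> = frag_cmul (int q ^ l) (frag_cmul (int q ^ k) \<alpha>)"
      "frag_cmul (int q ^ (k + l)) \<alpha> = frag_cmul (int q ^ k) (frag_cmul (int q ^ l) \<alpha>)" for \<alpha> :: "'a \<Rightarrow>\<^sub>0 int"
      by (simp_all add: power_add mult.commute)
    have "frag_cmul (int q ^ (k + l)) \<alpha> \<in> N" if "\<alpha> \<in> insert y Y" for \<alpha>
    proof (cases "\<alpha> = y")
      case True
      then show ?thesis unfolding up(2) using is_lattice_cmul[OF lat l] by simp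
    next
      case False
      then have "frag_cmul (int q ^ k) \<alpha> \<in> N" using that k by blast
      then show ?thesis unfolding up(1) by (rule is_lattice_cmul[OF lat])
    qed
    then show ?case by blast
  qed simp
  then obtain k where "\<forall>\<alpha>\<in>X. frag_cmul (int q ^ k) \<alpha> \<in> N" using X by blast
  then have "zspan X \<subseteq> {\<alpha>. frag_cmul (int q ^ k) \<alpha> \<in> N}"
    by (intro zspan_subset is_lattice_scale[OF lat]) blast
  then show ?thesis using X(3) by blast
qed

lemma glue_tree_scale:
  assumes lat: "is_lattice L" and q: "q > 0"
  shows "glue_tree L q s E \<Longrightarrow> glue_tree {\<alpha>. frag_cmul (int q ^ m) \<alpha> \<in> L} q s E"
proof (induction rule: glue_tree.induct)
  case (leaf E)
  show ?case
  proof (rule glue_tree.leaf[OF leaf(1)])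
    fix \<alpha> assume "\<alpha> \<in> {\<alpha>. frag_cmul (int q ^ m) \<alpha> \<in> L}" "keys \<alpha> \<subseteq> E"
    then have "frag_cmul (int q ^ m) \<alpha> = 0" by (intro leaf(2) keys_cmul_subset) auto
    then show "\<alpha> = 0" using q by simp
  qed
next
  case (node E1 E2 b1 b2)
  have up: "x \<in> {\<alpha>. frag_cmul (int q ^ m) \<alpha> \<in> L}" if "x \<in> L" for x using is_lattice_cmul[OF lat that] by simp
  show ?case
  proof (rule glue_tree.node[OF node.IH node.hyps(3-7) up[OF node.hyps(8)] node.hyps(9)])
    fix \<alpha> assume "\<alpha> \<in> {\<alpha>. frag_cmul (int q ^ m) \<alpha> \<in> L}" "keys \<alpha> \<subseteq> E1 \<union> E2"
    then have "frag_cmul (int q ^ m) \<alpha> \<in> L" "keys (frag_cmul (int q ^ m) \<alpha>) \<subseteq> E1 \<union> E2"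
      by (simp, intro keys_cmul_subset)
    from node.hyps(10)[OF this] obtain k c l1 l2 where l: "l1 \<in> L" "l2 \<in> L" "keys l1 \<subseteq> E1" "keys l2 \<subseteq> E2"
      "frag_cmul (int q ^ k) (frag_cmul (int q ^ m) \<alpha>) = frag_cmul c (b1 - b2) + l1 + l2" by blast
    then have "frag_cmul (int q ^ (k + m)) \<alpha> = frag_cmul c (b1 - b2) + l1 + l2" by (simp add: power_add)
    then show "\<exists>k c l1 l2. l1 \<in> {\<alpha>. frag_cmul (int q ^ m) \<alpha> \<in> L} \<and> l2 \<in> {\<alpha>. frag_cmul (int q ^ m) \<alpha> \<in> L} \<and>
      keys l1 \<subseteq> E1 \<and> keys l2 \<subseteq> E2 \<and> frag_cmul (int q ^ k) \<alpha> = frag_cmul c (b1 - b2) + l1 + l2"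
      using up[OF l(1)] up[OF l(2)] l(3,4) by (intro exI conjI)
  qed
qed

text \<open>For the relation lattice of a family this says that, in the group generated by the
  members in \<open>E\<close>, only the identity is annihilated by a power of
  \<open>q\<close>.\<close>

definition saturated :: "nat \<Rightarrow> ('i \<Rightarrow>\<^sub>0 int) set \<Rightarrow> 'i set \<Rightarrow> bool" where
  "saturated q M E \<longleftrightarrow> (\<forall>\<alpha> k. keys \<alpha> \<subseteq> E \<longrightarrow> frag_cmul (int q ^ k) \<alpha> \<in> M \<longrightarrow> \<alpha> \<in> M)"

lemma saturated_mono: "saturated q M E \<Longrightarrow> E' \<subseteq> E \<Longrightarrow> saturated q M E'"
  unfolding saturated_def by (meson order_trans)

text \<open>The vectors on \<open>E\<close> with some \<open>q\<close>-power multiple in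
  \<open>L\<close> form a lattice, so one exponent \<open>k\<close> serves for all of them and no
  further division is possible.\<close>

lemma ex_saturated_scale:
  assumes lat: "is_lattice L" and E: "finite E"
  shows "\<exists>k. saturated q {\<alpha>. frag_cmul (int q ^ k) \<alpha> \<in> L} E"
proof -
  define M where "M = {\<alpha>. keys \<alpha> \<subseteq> E \<and> (\<exists>k. frag_cmul (int q ^ k) \<alpha> \<in> L)}"
  have latM: "is_lattice M" unfolding is_lattice_def
  proof (intro conjI ballI)
    show "0 \<in> M" using is_lattice_zero[OF lat] by (simp add: M_def)
    fix \<alpha> \<beta> assume "\<alpha> \<in> M" "\<beta> \<in> M"
    then obtain k l where k: "keys \<alpha> \<subseteq> E" "frag_cmul (int q ^ k) \<alpha> \<in> L" "keys \<beta> \<subseteq> E" "frag_cmul (int q ^ l) \<beta> \<in> L"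
      unfolding M_def by blast
    have eq: "frag_cmul (int q ^ (k + l)) (\<alpha> - \<beta>) =
      frag_cmul (int q ^ l) (frag_cmul (int q ^ k) \<alpha>) - frag_cmul (int q ^ k) (frag_cmul (int q ^ l) \<beta>)"
      by (rule poly_mapping_eqI) (simp add: lookup_minus power_add algebra_simps)
    have "frag_cmul (int q ^ (k + l)) (\<alpha> - \<beta>) \<in> L"
      unfolding eq by (rule is_lattice_diff[OF lat is_lattice_cmul[OF lat k(2)] is_lattice_cmul[OF lat k(4)]])
    moreover have "keys (\<alpha> - \<beta>) \<subseteq> E" by (rule keys_diff_subset[OF k(1,3)])
    ultimately show "\<alpha> - \<beta> \<in> M" unfolding M_def by blast
  qed
  obtain k where k: "\<forall>\<alpha>\<in>M. frag_cmul (int q ^ k) \<alpha> \<in> L"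
    using uniform_power[OF lat E latM] unfolding M_def by blast
  have "saturated q {\<alpha>. frag_cmul (int q ^ k) \<alpha> \<in> L} E" unfolding saturated_def
  proof (intro allI impI)
    fix \<alpha> j assume "keys \<alpha> \<subseteq> E" "frag_cmul (int q ^ j) \<alpha> \<in> {\<alpha>. frag_cmul (int q ^ k) \<alpha> \<in> L}"
    then have "frag_cmul (int q ^ (k + j)) \<alpha> \<in> L" by (simp add: power_add)
    then have "\<alpha> \<in> M" using \<open>keys \<alpha> \<subseteq> E\<close> unfolding M_def by blast
    then show "\<alpha> \<in> {\<alpha>. frag_cmul (int q ^ k) \<alpha> \<in> L}" using k by blast
  qed
  then show ?thesis by blast
qed

context comm_group
begin

lemma nat_span_reindex:
  assumes inj: "inj_on h D" and A: "\<And>i. A i \<in> carrier G"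
  shows "nat_span G (\<lambda>i. A (h i)) D = nat_span G A (h ` D)"
proof (intro equalityI subsetI)
  fix x assume "x \<in> nat_span G (\<lambda>i. A (h i)) D"
  then obtain n :: "_ \<Rightarrow> nat" where n: "x = (\<Otimes>i\<in>D. A (h i) [^] n i)" unfolding nat_span_def by blast
  have "(\<Otimes>k\<in>h ` D. A k [^] n (the_inv_into D h k)) = (\<Otimes>i\<in>D. A (h i) [^] n (the_inv_into D h (h i)))"
    by (rule finprod_reindex[OF _ inj]) (use A in auto)
  also have "\<dots> = x" unfolding n
    by (rule finprod_cong) (use A inj in \<open>auto simp: the_inv_into_f_f simp_implies_def\<close>)
  finally show "x \<in> nat_span G A (h ` D)" unfolding nat_span_def by (auto intro!: exI[of _ "\<lambda>k. n (the_inv_into D h k)"])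
next
  fix x assume "x \<in> nat_span G A (h ` D)"
  then obtain n :: "_ \<Rightarrow> nat" where n: "x = (\<Otimes>i\<in>h ` D. A i [^] n i)" unfolding nat_span_def by blast
  have "x = (\<Otimes>i\<in>D. A (h i) [^] n (h i))" unfolding n by (rule finprod_reindex[OF _ inj]) (use A in auto)
  then show "x \<in> nat_span G (\<lambda>i. A (h i)) D" unfolding nat_span_def by (auto intro!: exI[of _ "\<lambda>i. n (h i)"])
qed

lemma completely_p_glued_independentI:
  fixes A :: "'i \<Rightarrow> 'a"
  assumes A: "\<And>i. A i \<in> carrier G" and E: "finite E"
    and 0: "\<And>\<alpha>. \<alpha> \<in> rel_lattice G A \<Longrightarrow> keys \<alpha> \<subseteq> E \<Longrightarrow> \<alpha> = 0"
  shows "completely_p_glued G q (nat_span G A E)"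
proof -
  obtain h where h: "bij_betw h {1..card E} E" using ex_bij_betw_nat_finite_1[OF E] by blast
  have inj: "inj_on h {1..card E}" and im: "h ` {1..card E} = E" using h by (auto simp: bij_betw_def)
  have "lin_independent G (\<lambda>i. A (h i)) {1..card E}" unfolding lin_independent_def
  proof (intro allI impI ballI)
    fix n :: "nat \<Rightarrow> int" and i
    assume z: "(\<Otimes>i\<in>{1..card E}. A (h i) [^] n i) = \<one>" and i: "i \<in> {1..card E}"
    define c where "c = (\<lambda>j. if j \<in> E then n (the_inv_into {1..card E} h j) else 0)"
    define \<alpha> where "\<alpha> = Abs_poly_mapping c"
    have "finite {j. c j \<noteq> 0}" by (rule finite_subset[OF _ E]) (auto simp: c_def)
    then have l: "lookup \<alpha> j = c j" for j unfolding \<alpha>_def by simp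
    have k: "keys \<alpha> \<subseteq> E" by (auto simp: keys_subset_iff l c_def)
    have ci: "c (h i) = n i" if "i \<in> {1..card E}" for i
      using that im the_inv_into_f_f[OF inj that] by (auto simp: c_def)
    have "fam_val G A \<alpha> = (\<Otimes>j\<in>h ` {1..card E}. A j [^] lookup \<alpha> j)"
      unfolding im by (rule fam_val_eq[where A = A, OF A E k])
    also have "\<dots> = (\<Otimes>i\<in>{1..card E}. A (h i) [^] lookup \<alpha> (h i))"
      by (rule finprod_reindex[OF _ inj]) (use A in auto)
    also have "\<dots> = (\<Otimes>i\<in>{1..card E}. A (h i) [^] n i)"
      by (rule finprod_cong) (use A ci in \<open>auto simp: l simp_implies_def\<close>)
    also have "\<dots> = \<one>" by (rule z)
    finally have "\<alpha> = 0" using 0 k by (simp add: rel_lattice_def)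
    then show "n i = 0" using ci[OF i] l[of "h i"] by simp
  qed
  moreover have "(\<lambda>i. A (h i)) \<in> {1..card E} \<rightarrow> carrier G" using A by simp
  ultimately have "completely_p_glued G q (nat_span G (\<lambda>i. A (h i)) {1..card E})"
    by (intro completely_p_glued.independent)
  then show ?thesis unfolding nat_span_reindex[where A = A, OF inj A] im .
qed

text \<open>An enumeration of \<open>E1 \<union> E2\<close> brings the gluing into the shape
  required by the inductive rule, whose families are indexed by \<open>{1..m}\<close>.\<close>

lemma completely_p_glued_glueI:
  fixes A :: "'i \<Rightarrow> 'a"
  assumes A: "\<And>i. A i \<in> carrier G" and E: "finite E1" "finite E2" "E1 \<noteq> {}" "E2 \<noteq> {}" "E1 \<inter> E2 = {}"
    and ni: "no_invertibles G (nat_span G A (E1 \<union> E2))"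
    and g: "completely_p_glued G q (nat_span G A E1)" "completely_p_glued G q (nat_span G A E2)"
    and a: "a \<in> p_closure G q (nat_span G A E1 \<inter> nat_span G A E2)" "a \<noteq> \<one>"
      "generate G {a} = generate G (A ` E1) \<inter> generate G (A ` E2)"
  shows "completely_p_glued G q (nat_span G A (E1 \<union> E2))"
proof -
  let ?E = "E1 \<union> E2"
  have fE: "finite ?E" using E by simp
  obtain h where h: "bij_betw h {1..card ?E} ?E" using ex_bij_betw_nat_finite_1[OF fE] by blast
  have inj: "inj_on h {1..card ?E}" and im: "h ` {1..card ?E} = ?E" using h by (auto simp: bij_betw_def)
  define D1 where "D1 = {i\<in>{1..card ?E}. h i \<in> E1}"
  define D2 where "D2 = {i\<in>{1..card ?E}. h i \<in> E2}"
  have D: "D1 \<subseteq> {1..card ?E}" "D2 \<subseteq> {1..card ?E}" by (auto simp: D1_def D2_def)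
  have hD: "h ` D1 = E1" "h ` D2 = E2"
  proof -
    show "h ` D1 = E1"
    proof
      show "E1 \<subseteq> h ` D1"
      proof
        fix x assume "x \<in> E1"
        then have "x \<in> h ` {1..card ?E}" using im by blast
        then show "x \<in> h ` D1" using \<open>x \<in> E1\<close> by (auto simp: D1_def)
      qed
    qed (auto simp: D1_def)
    show "h ` D2 = E2"
    proof
      show "E2 \<subseteq> h ` D2"
      proof
        fix x assume "x \<in> E2"
        then have "x \<in> h ` {1..card ?E}" using im by blast
        then show "x \<in> h ` D2" using \<open>x \<in> E2\<close> by (auto simp: D2_def)
      qed
    qed (auto simp: D2_def)
  qed
  let ?A = "\<lambda>i. A (h i)"
  have sp: "nat_span G ?A D1 = nat_span G A E1" "nat_span G ?A D2 = nat_span G A E2"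
    "nat_span G ?A {1..card ?E} = nat_span G A ?E"
    using nat_span_reindex[where A = A, OF inj_on_subset[OF inj D(1)] A]
      nat_span_reindex[where A = A, OF inj_on_subset[OF inj D(2)] A]
      nat_span_reindex[where A = A, OF inj A] hD im by simp_all
  have ga: "?A ` D1 = A ` E1" "?A ` D2 = A ` E2" using hD by (simp_all flip: image_image)
  have spl: "splitting (card ?E) D1 D2" unfolding splitting_def
  proof (intro conjI)
    show "D1 \<noteq> {}" "D2 \<noteq> {}" using hD E by auto
    show "D1 \<inter> D2 = {}" using E(5) by (auto simp: D1_def D2_def)
    show "D1 \<union> D2 = {1..card ?E}" using im by (auto simp: D1_def D2_def)
  qed
  have glu: "is_p_gluing G q ?A D1 D2"
    unfolding is_p_gluing_def sp ga using a by blast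
  have "?A \<in> {1..card ?E} \<rightarrow> carrier G" using A by blast
  moreover have "no_invertibles G (nat_span G ?A {1..card ?E})" unfolding sp by (rule ni)
  moreover have "completely_p_glued G q (nat_span G ?A D1)" "completely_p_glued G q (nat_span G ?A D2)"
    unfolding sp by (rule g)+
  ultimately have "completely_p_glued G q (nat_span G ?A {1..card ?E})"
    by (intro completely_p_glued.glue[OF _ _ spl _ _ glu])
  then show ?thesis unfolding sp .
qed

lemma no_invertibles_of_positive:
  assumes A: "\<And>i. A i \<in> carrier G" and E: "finite E" and pos: "positive_on (rel_lattice G A) E"
  shows "no_invertibles G (nat_span G A E)"
proof -
  have "x = \<one>" if x: "x \<in> nat_span G A E" "x \<in> m_inv G ` nat_span G A E" for x
  proof -
    obtain u where u: "nonneg u" "keys u \<subseteq> E" "x = fam_val G A u"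
      using x(1) unfolding nat_span_eq[where A = A, OF A E] by blast
    obtain v where v: "nonneg v" "keys v \<subseteq> E" "x = inv (fam_val G A v)"
      using x(2) unfolding nat_span_eq[where A = A, OF A E] by blast
    have "fam_val G A (u + v) = inv (fam_val G A v) \<otimes> fam_val G A v"
      unfolding fam_val_add[where A = A, OF A] u(3)[symmetric] v(3)[symmetric] ..
    then have "u + v \<in> rel_lattice G A" using A by (simp add: rel_lattice_def)
    then have "u + v = 0" by (rule positive_onD[OF pos _ keys_add_subset[OF u(2) v(2)] nonneg_add[OF u(1) v(1)]])
    then have "keys (u + v) = {}" by simp
    then have "u = 0" using keys_nonneg_add[OF u(1) v(1)] by simp
    then show ?thesis using u(3) by simp
  qed
  moreover have "\<one> \<in> nat_span G A E" unfolding nat_span_eq[where A = A, OF A E]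
    by (intro image_eqI[of _ _ 0]) (simp_all add: nonneg_zero)
  then have "\<one> \<in> nat_span G A E \<inter> m_inv G ` nat_span G A E"
    by (intro IntI image_eqI[of _ _ \<one>]) simp_all
  ultimately show ?thesis unfolding no_invertibles_def by blast
qed

text \<open>The difficulty is a generator of the intersection of the two groups. Coefficients of the
  gluing relation in \<open>q ^ s\<close>-multiples of relations form a group of integers; a
  relation \<open>\<gamma>\<close> attaining its generator \<open>d\<close> is chosen, and
  \<open>a\<close> is the value of its part on \<open>E1\<close>. A common element of both groups
  comes from a relation whose coefficient is \<open>d * t\<close>. After subtraction of
  \<open>t\<close> times \<open>\<gamma>\<close>, a power of \<open>q\<close> moves the
  \<open>E1\<close> part into \<open>L\<close>, so by saturation it lies there already.\<close>

lemma saturated_glue_tree_imp_completely_p_glued: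
  fixes A :: "'i \<Rightarrow> 'a"
  assumes A: "\<And>i. A i \<in> carrier G" and q: "q > 0"
  shows "glue_tree (rel_lattice G A) q True E \<Longrightarrow> positive_on (rel_lattice G A) E \<Longrightarrow>
    saturated q (rel_lattice G A) E \<Longrightarrow> completely_p_glued G q (nat_span G A E)"
proof (induction rule: glue_tree.induct)
  case (leaf E)
  then show ?case by (intro completely_p_glued_independentI A)
next
  case (node E1 E2 b1 b2)
  let ?L = "rel_lattice G A" and ?\<beta> = "b1 - b2"
  have lat: "is_lattice ?L" by (rule is_lattice_rel[where A = A, OF A])
  have dis: "E1 \<inter> E2 = {}" by fact
  have fin: "finite E1" "finite E2" using glue_tree_finite node.hyps(1,2) by blast+
  have fE: "finite (E1 \<union> E2)" using fin by simp
  have b0: "b1 \<noteq> 0" "b2 \<noteq> 0" using node.hyps(9) by blast+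
  have ne: "E1 \<noteq> {}" "E2 \<noteq> {}" using b0 node.hyps(6,7) keys_eq_empty by blast+
  have pos: "positive_on ?L E1" "positive_on ?L E2"
    by (rule positive_on_mono[OF node.prems(1)]; blast)+
  have sat: "saturated q ?L E1" "saturated q ?L E2"
    by (rule saturated_mono[OF node.prems(2)]; blast)+
  have k\<beta>: "keys ?\<beta> \<subseteq> E1 \<union> E2" using node.hyps(6,7) by (intro keys_diff_subset) blast+
  \<comment> \<open>\<open>N\<close> consists of the relations that split into relations of the two
    sides; \<open>N'\<close> below adds the multiples of the gluing relation.\<close>
  define N where "N = {l1 + l2 | l1 l2. l1 \<in> ?L \<and> l2 \<in> ?L \<and> keys l1 \<subseteq> E1 \<and> keys l2 \<subseteq> E2}"
  have latN: "is_lattice N" unfolding is_lattice_def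
  proof (intro conjI ballI)
    show "0 \<in> N" unfolding N_def using is_lattice_zero[OF lat]
      by (intro CollectI exI[of _ 0] conjI) simp_all
    fix x y assume "x \<in> N" "y \<in> N"
    then obtain l1 l2 m1 m2 where l: "l1 \<in> ?L" "l2 \<in> ?L" "keys l1 \<subseteq> E1" "keys l2 \<subseteq> E2" "x = l1 + l2"
      "m1 \<in> ?L" "m2 \<in> ?L" "keys m1 \<subseteq> E1" "keys m2 \<subseteq> E2" "y = m1 + m2" unfolding N_def by blast
    have "x - y = (l1 - m1) + (l2 - m2)" unfolding l by simp
    then show "x - y \<in> N" unfolding N_def
      using is_lattice_diff[OF lat l(1,6)] is_lattice_diff[OF lat l(2,7)] keys_diff_subset[OF l(3,8)] keys_diff_subset[OF l(4,9)]
      by blast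
  qed
  have NL: "restr E1 x \<in> ?L" "restr E2 x \<in> ?L" if "x \<in> N" for x
  proof -
    obtain l1 l2 where l: "l1 \<in> ?L" "l2 \<in> ?L" "keys l1 \<subseteq> E1" "keys l2 \<subseteq> E2" "x = l1 + l2"
      using \<open>x \<in> N\<close> unfolding N_def by blast
    show "restr E1 x \<in> ?L" "restr E2 x \<in> ?L" using restr_sum_eqs[OF dis l(3,4)] l by simp_all
  qed
  define N' where "N' = {x. \<exists>c. x - frag_cmul c ?\<beta> \<in> N}"
  have latN': "is_lattice N'" unfolding is_lattice_def
  proof (intro conjI ballI)
    show "0 \<in> N'" unfolding N'_def using is_lattice_zero[OF latN] by (intro CollectI exI[of _ 0]) simp
    fix x y assume "x \<in> N'" "y \<in> N'"
    then obtain c d where c: "x - frag_cmul c ?\<beta> \<in> N" "y - frag_cmul d ?\<beta> \<in> N" unfolding N'_def by blast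
    have "(x - y) - frag_cmul (c - d) ?\<beta> = (x - frag_cmul c ?\<beta>) - (y - frag_cmul d ?\<beta>)"
      by (simp add: frag_cmul_diff_distrib)
    then have "(x - y) - frag_cmul (c - d) ?\<beta> \<in> N" using is_lattice_diff[OF latN c] by (simp only:)
    then show "x - y \<in> N'" unfolding N'_def by blast
  qed
  define LE where "LE = {\<alpha>\<in>?L. keys \<alpha> \<subseteq> E1 \<union> E2}"
  have latLE: "is_lattice LE" unfolding LE_def using lat keys_diff_subset by (auto simp: is_lattice_def)
  have "\<exists>s. \<forall>\<alpha>\<in>LE. frag_cmul (int q ^ s) \<alpha> \<in> N'"
  proof (rule uniform_power[OF latN' fE latLE])
    show "keys \<alpha> \<subseteq> E1 \<union> E2" if "\<alpha> \<in> LE" for \<alpha> using that by (simp add: LE_def)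
    fix \<alpha> assume "\<alpha> \<in> LE"
    then have "\<alpha> \<in> ?L" "keys \<alpha> \<subseteq> E1 \<union> E2" by (simp_all add: LE_def)
    from node.hyps(10)[OF this] obtain k c l1 l2 where l: "l1 \<in> ?L" "l2 \<in> ?L" "keys l1 \<subseteq> E1" "keys l2 \<subseteq> E2"
      and e: "frag_cmul (int q ^ k) \<alpha> = frag_cmul c ?\<beta> + l1 + l2" by blast
    have "frag_cmul (int q ^ k) \<alpha> - frag_cmul c ?\<beta> = l1 + l2" unfolding e by simp
    then have "frag_cmul (int q ^ k) \<alpha> - frag_cmul c ?\<beta> \<in> N" unfolding N_def using l by blast
    then show "\<exists>k. frag_cmul (int q ^ k) \<alpha> \<in> N'" unfolding N'_def by blast
  qed
  then obtain s where s: "\<And>\<alpha>. \<alpha> \<in> LE \<Longrightarrow> frag_cmul (int q ^ s) \<alpha> \<in> N'" by blast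
  let ?Q = "int q ^ s"
  \<comment> \<open>The coefficients of \<open>?\<beta>\<close>, modulo \<open>N\<close>, in the
    \<open>q ^ s\<close>-multiples of relations. A coefficient need not be unique; only the group
    structure matters.\<close>
  define H where "H = {c. \<exists>\<alpha>\<in>LE. frag_cmul ?Q \<alpha> - frag_cmul c ?\<beta> \<in> N}"
  have Hd: "x - y \<in> H" if xy: "x \<in> H" "y \<in> H" for x y
  proof -
    obtain \<alpha> \<alpha>' where h: "\<alpha> \<in> LE" "frag_cmul ?Q \<alpha> - frag_cmul x ?\<beta> \<in> N" "\<alpha>' \<in> LE" "frag_cmul ?Q \<alpha>' - frag_cmul y ?\<beta> \<in> N"
      using xy unfolding H_def by blast
    have "frag_cmul ?Q (\<alpha> - \<alpha>') - frag_cmul (x - y) ?\<beta> =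
       (frag_cmul ?Q \<alpha> - frag_cmul x ?\<beta>) - (frag_cmul ?Q \<alpha>' - frag_cmul y ?\<beta>)"
      by (rule poly_mapping_eqI) (simp add: lookup_minus lookup_add algebra_simps)
    then have "frag_cmul ?Q (\<alpha> - \<alpha>') - frag_cmul (x - y) ?\<beta> \<in> N" using is_lattice_diff[OF latN h(2,4)] by (simp only:)
    then show ?thesis unfolding H_def using is_lattice_diff[OF latLE h(1,3)] by blast
  qed
  have \<beta>LE: "?\<beta> \<in> LE" using node.hyps(8) k\<beta> by (simp add: LE_def)
  have QH: "?Q \<in> H" unfolding H_def using \<beta>LE is_lattice_zero[OF latN] by (intro CollectI bexI[of _ ?\<beta>]) simp_all
  have Q0: "?Q > 0" using q by simp
  obtain d where d: "d > 0" "d \<in> H" "\<forall>c\<in>H. d dvd c"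
    using int_subgroup_principal[of H ?Q] Hd QH Q0 by blast
  obtain \<gamma> where \<gamma>: "\<gamma> \<in> LE" "frag_cmul ?Q \<gamma> - frag_cmul d ?\<beta> \<in> N" using d(2) unfolding H_def by blast
  have r\<beta>: "restr E1 ?\<beta> = b1" "restr E2 ?\<beta> = - b2"
    using restr_sum_eqs[OF dis, of b1 "- b2"] node.hyps(6,7) by simp_all
  let ?g1 = "restr E1 \<gamma>" and ?g2 = "restr E2 \<gamma>"
  have g1: "frag_cmul ?Q ?g1 - frag_cmul d b1 \<in> ?L" 
    using NL(1)[OF \<gamma>(2)] by (simp only: restr_diff[of E1 "frag_cmul ?Q \<gamma>"] restr_cmul r\<beta>)
  define a where "a = fam_val G A ?g1"
  have ac: "a \<in> carrier G" using A by (simp add: a_def)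
  have vb: "fam_val G A b1 = fam_val G A b2"
    using fam_val_eq_iff[where A = A, OF A] node.hyps(8) by blast
  have aQ: "a [^] ?Q = fam_val G A (frag_cmul d b1)"
    using fam_val_eq_iff[where A = A, OF A, THEN iffD2, OF g1] fam_val_cmul[where A = A, OF A, of ?Q ?g1] by (simp add: a_def)
  have aQ2: "a [^] ?Q = fam_val G A (frag_cmul d b2)"
    unfolding aQ fam_val_cmul[where A = A, OF A] vb ..
  have nd: "nonneg (frag_cmul d b1)" "nonneg (frag_cmul d b2)" "keys (frag_cmul d b1) \<subseteq> E1" "keys (frag_cmul d b2) \<subseteq> E2"
    using d(1) node.hyps(4-7) by (auto intro: nonneg_cmul keys_cmul_subset[THEN subsetD])
  have "a [^] ?Q \<in> nat_span G A E1" unfolding nat_span_eq[where A = A, OF A fin(1)] aQ using nd by blast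
  moreover have "a [^] ?Q \<in> nat_span G A E2" unfolding nat_span_eq[where A = A, OF A fin(2)] aQ2 using nd by blast
  moreover have "a [^] ?Q = a [^] (q ^ s)" using int_pow_int[of G a "q ^ s"] by simp
  ultimately have a1: "a \<in> p_closure G q (nat_span G A E1 \<inter> nat_span G A E2)"
    unfolding p_closure_def using ac by auto
  have a2: "a \<noteq> \<one>"
  proof
    assume "a = \<one>"
    then have "fam_val G A (frag_cmul d b1) = \<one>" using aQ by simp
    then have "frag_cmul d b1 \<in> ?L" by (simp add: rel_lattice_def)
    then have "frag_cmul d b1 = 0" by (rule positive_onD[OF pos(1) _ nd(3,1)])
    then show False using d(1) b0 by simp
  qed
  have dec: "restr E1 \<alpha> + restr E2 \<alpha> = \<alpha>" if "\<alpha> \<in> LE" for \<alpha>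
    by (rule restr_split[OF _ dis]) (use that in \<open>simp add: LE_def\<close>)
  have "?g1 - (- ?g2) = \<gamma>" using dec[OF \<gamma>(1)] by simp
  then have "?g1 - (- ?g2) \<in> ?L" using \<gamma>(1) by (simp add: LE_def)
  then have ag2: "a = fam_val G A (- ?g2)" unfolding a_def by (rule fam_val_eq_iff[where A = A, OF A, THEN iffD2])
  have a3: "generate G {a} = generate G (A ` E1) \<inter> generate G (A ` E2)"
  proof (intro equalityI subsetI)
    fix x assume "x \<in> generate G {a}"
    then obtain c :: int where c: "x = a [^] c" unfolding generate_pow[OF ac] by blast
    have "x = fam_val G A (frag_cmul c ?g1)" unfolding c a_def by (rule fam_val_cmul[where A = A, OF A, symmetric])
    moreover have "x = fam_val G A (frag_cmul c (- ?g2))" unfolding c ag2 by (rule fam_val_cmul[where A = A, OF A, symmetric])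
    moreover have "keys (frag_cmul c ?g1) \<subseteq> E1" "keys (frag_cmul c (- ?g2)) \<subseteq> E2"
      by (intro keys_cmul_subset keys_restr, intro keys_cmul_subset) (simp add: keys_restr)
    ultimately show "x \<in> generate G (A ` E1) \<inter> generate G (A ` E2)"
      unfolding generate_eq[where A = A, OF A fin(1)] generate_eq[where A = A, OF A fin(2)] by blast
  next
    fix x assume "x \<in> generate G (A ` E1) \<inter> generate G (A ` E2)"
    then obtain u v where u: "keys u \<subseteq> E1" "x = fam_val G A u" and v: "keys v \<subseteq> E2" "x = fam_val G A v"
      unfolding generate_eq[where A = A, OF A fin(1)] generate_eq[where A = A, OF A fin(2)] by blast
    let ?\<alpha> = "u - v"
    have "?\<alpha> \<in> ?L" using fam_val_eq_iff[where A = A, OF A] u v by metis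
    moreover have "keys ?\<alpha> \<subseteq> E1 \<union> E2" using u v by (intro keys_diff_subset) blast+
    ultimately have \<alpha>: "?\<alpha> \<in> LE" by (simp add: LE_def)
    from s[OF this] obtain c where c: "frag_cmul ?Q ?\<alpha> - frag_cmul c ?\<beta> \<in> N" unfolding N'_def by blast
    then have "c \<in> H" unfolding H_def using \<alpha> by blast
    then obtain t where t: "c = d * t" using d(3) by (auto elim: dvdE)
    let ?\<delta> = "?\<alpha> - frag_cmul t \<gamma>"
    have "frag_cmul ?Q ?\<delta> = (frag_cmul ?Q ?\<alpha> - frag_cmul c ?\<beta>) - frag_cmul t (frag_cmul ?Q \<gamma> - frag_cmul d ?\<beta>)"
      unfolding t by (rule poly_mapping_eqI) (simp add: lookup_minus lookup_add algebra_simps)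
    then have "frag_cmul ?Q ?\<delta> \<in> N" using is_lattice_diff[OF latN c is_lattice_cmul[OF latN \<gamma>(2)]] by (simp only:)
    then have "frag_cmul ?Q (restr E1 ?\<delta>) \<in> ?L" using NL(1)[of "frag_cmul ?Q ?\<delta>"] by (simp only: restr_cmul)
    then have "restr E1 ?\<delta> \<in> ?L" using sat(1) keys_restr[of E1 ?\<delta>] unfolding saturated_def by blast
    moreover have "restr E1 ?\<delta> = u - frag_cmul t ?g1"
    proof -
      have "keys v \<inter> E1 = {}" using v dis by blast
      then have "restr E1 u = u" "restr E1 v = 0" using restr_id[OF u(1)] restr_disjoint by blast+
      then show ?thesis by (simp add: restr_diff restr_cmul)
    qed
    ultimately have "u - frag_cmul t ?g1 \<in> ?L" by (simp only:)
    then have "x = fam_val G A (frag_cmul t ?g1)" unfolding u(2) by (rule fam_val_eq_iff[where A = A, OF A, THEN iffD2])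
    also have "\<dots> = a [^] t" unfolding a_def by (rule fam_val_cmul[where A = A, OF A])
    finally show "x \<in> generate G {a}" unfolding generate_pow[OF ac] by blast
  qed
  show ?case
    by (rule completely_p_glued_glueI[where A = A, OF A fin ne dis no_invertibles_of_positive[where A = A, OF A fE node.prems(1)]
          node.IH(1)[OF pos(1) sat(1)] node.IH(2)[OF pos(2) sat(2)] a1 a2 a3])
qed

lemma nat_span_pow_closed:
  assumes A: "\<And>i. A i \<in> carrier G" and E: "finite E" and x: "x \<in> nat_span G A E"
  shows "x [^] (n::nat) \<in> nat_span G A E"
proof -
  obtain u where u: "nonneg u" "keys u \<subseteq> E" "x = fam_val G A u"
    using x unfolding nat_span_eq[where A = A, OF A E] by blast
  have "x [^] n = x [^] int n" by (simp add: int_pow_int)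
  also have "\<dots> = fam_val G A (frag_cmul (int n) u)" unfolding u(3) by (rule fam_val_cmul[where A = A, OF A, symmetric])
  finally have "x [^] n = fam_val G A (frag_cmul (int n) u)" .
  moreover have "nonneg (frag_cmul (int n) u)" "keys (frag_cmul (int n) u) \<subseteq> E"
    using nonneg_cmul[of "int n" u] keys_cmul_subset[OF u(2)] u(1) by simp_all
  ultimately show ?thesis unfolding nat_span_eq[where A = A, OF A E] by blast
qed

lemma nat_span_gen:
  assumes A: "\<And>i. A i \<in> carrier G" and E: "finite E" and i: "i \<in> E"
  shows "A i \<in> nat_span G A E"
  unfolding nat_span_eq[where A = A, OF A E]
  by (intro image_eqI[of _ _ "frag_of i"]) (use i in \<open>simp_all add: fam_val_frag_of A nonneg_frag_of keys_frag_of\<close>)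

lemma nat_span_least:
  fixes A :: "'i \<Rightarrow> 'a" and A' :: "'j \<Rightarrow> 'a"
  assumes A: "\<And>i. A i \<in> carrier G" and A': "\<And>i. A' i \<in> carrier G" and E: "finite E" "finite E'"
    and sub: "\<And>i. i \<in> E \<Longrightarrow> A i \<in> nat_span G A' E'"
  shows "nat_span G A E \<subseteq> nat_span G A' E'"
proof
  fix x assume "x \<in> nat_span G A E"
  then obtain n :: "'i \<Rightarrow> nat" where n: "x = (\<Otimes>i\<in>E. A i [^] n i)" unfolding nat_span_def by blast
  have one: "\<one> \<in> nat_span G A' E'" unfolding nat_span_eq[where A = A', OF A' E(2)]
    by (intro image_eqI[of _ _ 0]) (simp_all add: nonneg_zero)
  have "(\<Otimes>i\<in>F. A i [^] n i) \<in> nat_span G A' E'" if "finite F" "F \<subseteq> E" for F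
    using that
  proof (induction F rule: finite_induct)
    case empty
    then show ?case using one by simp
  next
    case (insert i F)
    have "(\<Otimes>i\<in>insert i F. A i [^] n i) = A i [^] n i \<otimes> (\<Otimes>i\<in>F. A i [^] n i)"
      by (rule finprod_insert) (use insert A in auto)
    moreover have "A i [^] n i \<in> nat_span G A' E'"
      by (rule nat_span_pow_closed[where A = A', OF A' E(2) sub]) (use insert in auto)
    ultimately show ?case using insert nat_span_pos_add[where A = A', OF A' E(2)] by simp
  qed
  then show "x \<in> nat_span G A' E'" unfolding n using E by blast
qed

text \<open>The generators are restored one at a time. By positivity \<open>A x\<close> generates a
  free semigroup of rank one. The gluing element is its least positive power
  \<open>A x [^] d\<close> in the group of the other generators; raised to \<open>q ^ k\<close> it
  is also a power of \<open>A x [^] (q ^ k)\<close> and hence lies in both semigroups. After the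
  gluing, \<open>A x [^] (q ^ k)\<close> has become redundant.\<close>

lemma completely_p_glued_of_powers:
  fixes A :: "'i \<Rightarrow> 'a"
  assumes A: "\<And>i. A i \<in> carrier G" and q: "q > 0" and E: "finite E"
    and pos: "positive_on (rel_lattice G A) E"
    and g: "completely_p_glued G q (nat_span G (\<lambda>i. A i [^] (q ^ k)) E)"
  shows "completely_p_glued G q (nat_span G A E)"
proof -
  define AX where "AX = (\<lambda>X i. if i \<in> X then A i else A i [^] (q ^ k))"
  have AX: "AX X i \<in> carrier G" for X i using A by (simp add: AX_def)
  have "completely_p_glued G q (nat_span G (AX X) E)" if "finite X" "X \<subseteq> E" for X
    using that
  proof (induction X rule: finite_induct)
    case empty
    then show ?case using g by (simp add: AX_def)
  next
    case (insert x X)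
    then have IH: "completely_p_glued G q (nat_span G (AX X) E)" and x: "x \<in> E" "x \<notin> X" by auto
    \<comment> \<open>\<open>None\<close> carries the restored generator, while
      \<open>Some x\<close> still carries its power with exponent \<open>q ^ k\<close>.\<close>
    define C where "C = (\<lambda>z. case z of None \<Rightarrow> A x | Some i \<Rightarrow> AX X i)"
    have C: "C z \<in> carrier G" for z using A AX by (simp add: C_def split: option.split)
    have spS: "nat_span G C (Some ` E) = nat_span G (AX X) E"
      using nat_span_reindex[where A = C and h = Some and D = E, OF _ C] by (simp add: C_def)
    have imS: "C ` Some ` E = AX X ` E" by (simp add: C_def image_image)
    have fN: "finite {None :: 'i option}" "finite (Some ` E)" "finite ({None} \<union> Some ` E)" using E by simp_all
    have xp: "c = 0" if "A x [^] (c::int) = \<one>" for c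
    proof -
      have "fam_val G A (frag_cmul c (frag_of x)) = \<one>"
        using that by (simp add: fam_val_cmul[where A = A, OF A] fam_val_frag_of[where A = A, OF A])
      then have L: "frag_cmul c (frag_of x) \<in> rel_lattice G A" by (simp add: rel_lattice_def)
      have kx: "keys (frag_cmul c (frag_of x)) \<subseteq> E" for c using x by (intro keys_cmul_subset) (simp add: keys_frag_of)
      show "c = 0"
      proof (cases "c \<ge> 0")
        case True
        have "frag_cmul c (frag_of x) = 0" by (rule positive_onD[OF pos L kx nonneg_cmul[OF True nonneg_frag_of]])
        then show ?thesis by simp
      next
        case False
        have L': "frag_cmul (- c) (frag_of x) \<in> rel_lattice G A"
          using is_lattice_uminus[OF is_lattice_rel[where A = A, OF A] L] by simp
        have "frag_cmul (- c) (frag_of x) = 0"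
          by (rule positive_onD[OF pos L' kx nonneg_cmul[OF _ nonneg_frag_of]]) (use False in simp)
        then show ?thesis by simp
      qed
    qed
    have vN: "fam_val G C \<alpha> = A x [^] lookup \<alpha> None" if "keys \<alpha> \<subseteq> {None}" for \<alpha>
      using fam_val_eq[where A = C, OF C fN(1) that] A by (simp add: C_def)
    have gN: "completely_p_glued G q (nat_span G C {None})"
    proof (rule completely_p_glued_independentI[where A = C, OF C fN(1)])
      fix \<alpha> assume \<alpha>: "\<alpha> \<in> rel_lattice G C" "keys \<alpha> \<subseteq> {None}"
      then have "lookup \<alpha> None = 0" using vN[OF \<alpha>(2)] xp by (simp add: rel_lattice_def)
      then show "\<alpha> = 0" using \<alpha>(2) by (intro poly_mapping_eqI) (metis empty_iff insertE keys_subset_iff lookup_zero)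
    qed
    have spU: "nat_span G C ({None} \<union> Some ` E) = nat_span G (AX (insert x X)) E"
    proof
      let ?A = "AX (insert x X)"
      have Ax: "A x = ?A x" by (simp add: AX_def)
      show "nat_span G C ({None} \<union> Some ` E) \<subseteq> nat_span G ?A E"
      proof (rule nat_span_least[where A = C and A' = ?A, OF C AX fN(3) E])
        fix z assume z: "z \<in> {None} \<union> Some ` E"
        have xin: "A x \<in> nat_span G ?A E" unfolding Ax by (rule nat_span_gen[where A = ?A, OF AX E x(1)])
        show "C z \<in> nat_span G ?A E"
        proof (cases z)
          case None
          then show ?thesis using xin by (simp add: C_def)
        next
          case (Some i)
          then have i: "i \<in> E" using z by auto
          show ?thesis
          proof (cases "i = x")
            case True
            then show ?thesis using Some x(2) nat_span_pow_closed[where A = ?A, OF AX E xin] by (simp add: C_def AX_def)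
          next
            case False
            then have "C z = ?A i" using Some by (simp add: C_def AX_def)
            then show ?thesis using nat_span_gen[where A = ?A, OF AX E i] by simp
          qed
        qed
      qed
      show "nat_span G ?A E \<subseteq> nat_span G C ({None} \<union> Some ` E)"
      proof (rule nat_span_least[where A = ?A and A' = C, OF AX C E fN(3)])
        fix i assume i: "i \<in> E"
        have "?A i = (if i = x then C None else C (Some i))" by (simp add: C_def AX_def)
        then show "?A i \<in> nat_span G C ({None} \<union> Some ` E)"
          using nat_span_gen[where A = C, OF C fN(3)] i by simp
      qed
    qed
    have spsub: "nat_span G (AX (insert x X)) E \<subseteq> nat_span G A E"
    proof (rule nat_span_least[where A = "AX (insert x X)" and A' = A, OF AX A E E])
      fix i assume i: "i \<in> E"
      show "AX (insert x X) i \<in> nat_span G A E"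
        using nat_span_gen[where A = A, OF A E i] nat_span_pow_closed[where A = A, OF A E] by (simp add: AX_def)
    qed
    have ni: "no_invertibles G (nat_span G C ({None} \<union> Some ` E))"
    proof -
      have "no_invertibles G (nat_span G A E)" by (rule no_invertibles_of_positive[where A = A, OF A E pos])
      moreover have "\<one> \<in> nat_span G C ({None} \<union> Some ` E)" unfolding nat_span_eq[where A = C, OF C fN(3)]
        by (intro image_eqI[of _ _ 0]) (simp_all add: nonneg_zero)
      then have "\<one> \<in> nat_span G C ({None} \<union> Some ` E) \<inter> m_inv G ` nat_span G C ({None} \<union> Some ` E)"
        by (intro IntI image_eqI[of _ _ \<one>]) simp_all
      moreover have "nat_span G C ({None} \<union> Some ` E) \<subseteq> nat_span G A E" using spsub spU by simp
      ultimately show ?thesis unfolding no_invertibles_def by blast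
    qed
    have sgE: "subgroup (generate G (AX X ` E)) G" by (rule generate_is_subgroup) (use AX in auto)
    define H where "H = {c::int. A x [^] c \<in> generate G (AX X ` E)}"
    have Hd: "y - z \<in> H" if "y \<in> H" "z \<in> H" for y z
      using that A subgroup.m_closed[OF sgE] subgroup.m_inv_closed[OF sgE] by (simp add: H_def int_pow_diff)
    have Axk: "A x [^] (int (q ^ k)) = AX X x" using x(2) unfolding int_pow_int by (simp add: AX_def)
    then have QH: "int (q ^ k) \<in> H" unfolding H_def using generate.incl[of "AX X x" "AX X ` E" G] x(1) by simp
    have Q0: "int (q ^ k) > 0" using q by simp
    obtain d where d: "d > 0" "d \<in> H" "\<forall>c\<in>H. d dvd c"
      using int_subgroup_principal[of H "int (q ^ k)"] Hd QH Q0 by blast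
    define a where "a = A x [^] d"
    have ac: "a \<in> carrier G" using A by (simp add: a_def)
    have aQ: "a [^] (q ^ k) = AX X x [^] nat d" "a [^] (q ^ k) = A x [^] nat (d * int (q ^ k))"
    proof -
      have "a [^] (q ^ k) = A x [^] (d * int (q ^ k))"
        unfolding int_pow_int[symmetric] a_def using A by (simp add: int_pow_pow)
      moreover have "A x [^] (d * int (q ^ k)) = AX X x [^] d"
        unfolding Axk[symmetric] using A by (simp add: int_pow_pow mult.commute)
      ultimately show "a [^] (q ^ k) = AX X x [^] nat d" "a [^] (q ^ k) = A x [^] nat (d * int (q ^ k))"
        using d(1) Q0 by (simp_all flip: int_pow_int)
    qed
    have "a [^] (q ^ k) \<in> nat_span G C {None}"
    proof -
      have "A x \<in> nat_span G C {None}" using nat_span_gen[where A = C, OF C fN(1), of None] by (simp add: C_def)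
      then show ?thesis unfolding aQ(2) by (rule nat_span_pow_closed[where A = C, OF C fN(1)])
    qed
    moreover have "a [^] (q ^ k) \<in> nat_span G C (Some ` E)"
      unfolding spS aQ(1) by (rule nat_span_pow_closed[where A = "AX X", OF AX E nat_span_gen[where A = "AX X", OF AX E x(1)]])
    ultimately have a1: "a \<in> p_closure G q (nat_span G C {None} \<inter> nat_span G C (Some ` E))"
      unfolding p_closure_def using ac by blast
    have a2: "a \<noteq> \<one>" using xp[of d] d(1) by (auto simp: a_def)
    have CN: "C ` {None} = {A x}" by (simp add: C_def)
    have a3: "generate G {a} = generate G (C ` {None}) \<inter> generate G (C ` Some ` E)"
      unfolding CN imS
    proof (intro equalityI subsetI)
      fix y assume "y \<in> generate G {a}"
      then obtain c :: int where c: "y = a [^] c" unfolding generate_pow[OF ac] by blast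
      then have "y = A x [^] (d * c)" using A by (simp add: a_def int_pow_pow)
      then have "y \<in> generate G {A x}" unfolding generate_pow[OF A] by blast
      moreover have "y \<in> generate G (AX X ` E)"
        unfolding c by (rule subgroup_int_pow_closed[OF sgE]) (use d(2) in \<open>simp add: H_def a_def\<close>)
      ultimately show "y \<in> generate G {A x} \<inter> generate G (AX X ` E)" by blast
    next
      fix y assume y: "y \<in> generate G {A x} \<inter> generate G (AX X ` E)"
      then obtain c :: int where c: "y = A x [^] c" unfolding generate_pow[OF A] by blast
      then have "c \<in> H" using y by (simp add: H_def)
      then obtain t where "c = d * t" using d(3) by (auto elim: dvdE)
      then have "y = a [^] t" using c A by (simp add: a_def int_pow_pow)
      then show "y \<in> generate G {a}" unfolding generate_pow[OF ac] by blast
    qed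
    have "completely_p_glued G q (nat_span G C ({None} \<union> Some ` E))"
    proof (rule completely_p_glued_glueI[where A = C, OF C fN(1,2) _ _ _ ni gN _ a1 a2 a3])
      show "completely_p_glued G q (nat_span G C (Some ` E))" using IH spS by simp
    qed (use x in auto)
    then show ?case unfolding spU .
  qed
  moreover have "nat_span G (AX E) E = nat_span G A E"
    by (rule nat_span_cong) (simp_all add: AX_def A)
  ultimately show ?thesis using E by force
qed

lemma fam_val_pow:
  assumes A: "\<And>i. A i \<in> carrier G"
  shows "fam_val G (\<lambda>i. A i [^] (m::nat)) \<alpha> = fam_val G A (frag_cmul (int m) \<alpha>)"
proof -
  have "fam_val G A (frag_cmul (int m) \<alpha>) = (\<Otimes>i\<in>keys \<alpha>. A i [^] lookup (frag_cmul (int m) \<alpha>) i)"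
    by (rule fam_val_eq[where A = A, OF A _ keys_cmul]) simp
  also have "\<dots> = (\<Otimes>i\<in>keys \<alpha>. (A i [^] m) [^] lookup \<alpha> i)"
    by (rule finprod_cong) (use A in \<open>auto simp: simp_implies_def int_pow_pow simp flip: int_pow_int\<close>)
  finally show ?thesis by (simp add: fam_val_def)
qed

text \<open>Raising all generators to the power \<open>q ^ k\<close> replaces the relation lattice
  by the vectors with \<open>q ^ k\<close>-multiple in it. For suitable \<open>k\<close> this is
  saturated, and the gluing tree survives the change.\<close>

lemma connecting_imp_completely_p_glued:
  assumes A: "\<And>i. A i \<in> carrier G" and q: "q > 0" and E: "finite E" and pos: "positive_on (rel_lattice G A) E"
    and C: "connecting (rel_lattice G A) q E B"
  shows "completely_p_glued G q (nat_span G A E)"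
proof -
  let ?L = "rel_lattice G A"
  have lat: "is_lattice ?L" by (rule is_lattice_rel[where A = A, OF A])
  have t: "glue_tree ?L q True E" by (rule mixed_basis_imp_glue_tree[OF lat q pos E connecting_imp_mixed_basis[OF q C]])
  obtain k where k: "saturated q {\<alpha>. frag_cmul (int q ^ k) \<alpha> \<in> ?L} E" using ex_saturated_scale[OF lat E] by blast
  let ?A = "\<lambda>i. A i [^] (q ^ k)"
  have A': "?A i \<in> carrier G" for i using A by simp
  have rel: "rel_lattice G ?A = {\<alpha>. frag_cmul (int q ^ k) \<alpha> \<in> ?L}"
    by (simp add: rel_lattice_def fam_val_pow[where A = A, OF A])
  have "positive_on (rel_lattice G ?A) E" unfolding positive_on_def rel
  proof (intro ballI impI)
    fix \<alpha> assume "\<alpha> \<in> {\<alpha>. frag_cmul (int q ^ k) \<alpha> \<in> ?L}" "keys \<alpha> \<subseteq> E" "nonneg \<alpha>"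
    then have "frag_cmul (int q ^ k) \<alpha> = 0"
      by (intro positive_onD[OF pos] keys_cmul_subset nonneg_cmul) simp_all
    then show "\<alpha> = 0" using q by simp
  qed
  moreover have "glue_tree (rel_lattice G ?A) q True E" unfolding rel by (rule glue_tree_scale[OF lat q t])
  ultimately have "completely_p_glued G q (nat_span G ?A E)"
    using saturated_glue_tree_imp_completely_p_glued[where A = ?A, OF A' q] k unfolding rel by blast
  then show ?thesis by (rule completely_p_glued_of_powers[where A = A, OF A q E pos])
qed

end

lemma is_lattice_iff_subgroup: "is_lattice L \<longleftrightarrow> subgroup L (free_Abelian_group UNIV)"
proof
  assume lat: "is_lattice L"
  show "subgroup L (free_Abelian_group UNIV)"
    by (rule subgroup.intro) (auto intro: is_lattice_add[OF lat] is_lattice_zero[OF lat] is_lattice_uminus[OF lat])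
next
  assume sg: "subgroup L (free_Abelian_group UNIV)"
  have "0 \<in> L" using subgroup.one_closed[OF sg] by simp
  moreover have "\<alpha> - \<beta> \<in> L" if "\<alpha> \<in> L" "\<beta> \<in> L" for \<alpha> \<beta>
    using subgroup.m_closed[OF sg that(1) subgroup.m_inv_closed[OF sg that(2)]] by simp
  ultimately show "is_lattice L" by (simp add: is_lattice_def)
qed

lemma positive_lattice_imp_positive_on: "positive_lattice L \<Longrightarrow> positive_on L UNIV"
  by (auto simp: positive_lattice_def positive_on_def nonneg_def)

text \<open>The cosets of the basis vectors form a family with relation lattice exactly
  \<open>L\<close>. The family that a sequence of gluings ends with is compared to it by
  \<open>change_family\<close>.\<close>

lemma completely_p_glued_lattice_iff:
  fixes L :: "('m::finite \<Rightarrow>\<^sub>0 int) set"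
  assumes sg: "subgroup L (free_Abelian_group UNIV)" and pos: "positive_lattice L" and q: "q > 0"
  shows "completely_p_glued_lattice q L \<longleftrightarrow> (\<exists>B. connecting L q UNIV B)"
proof -
  let ?F = "free_Abelian_group (UNIV :: 'm set)" and ?G = "lattice_quotient L"
  interpret F: comm_group ?F by (rule abelian_free_Abelian_group)
  have nL: "L \<lhd> ?F" by (rule F.subgroup_imp_normal[OF sg])
  interpret N: normal L ?F by (rule nL)
  interpret G: comm_group ?G by (rule F.abelian_FactGroup[OF sg])
  let ?A = "\<lambda>i. L #>\<^bsub>?F\<^esub> frag_of i"
  have A: "?A i \<in> carrier ?G" for i by (simp add: carrier_FactGroup)
  have val: "fam_val ?G ?A \<alpha> = L #>\<^bsub>?F\<^esub> \<alpha>" for \<alpha>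
  proof -
    have "keys \<alpha> \<subseteq> UNIV" by simp
    then show ?thesis
    proof (induction \<alpha> rule: frag_induction)
      case zero
      show ?case using F.coset_join2[of 0 L, OF _ sg] subgroup.one_closed[OF sg] by simp
    next
      case (one x)
      show ?case by (rule G.fam_val_frag_of[where A = ?A, OF A])
    next
      case (diff a b)
      have "inv\<^bsub>?G\<^esub> (L #>\<^bsub>?F\<^esub> b) = L #>\<^bsub>?F\<^esub> (- b)"
        using N.inv_FactGroup[of "L #>\<^bsub>?F\<^esub> b"] N.rcos_inv[of b] by (simp add: carrier_FactGroup)
      then have "fam_val ?G ?A (a - b) = (L #>\<^bsub>?F\<^esub> a) <#>\<^bsub>?F\<^esub> (L #>\<^bsub>?F\<^esub> (- b))"
        unfolding G.fam_val_diff[where A = ?A, OF A] diff by simp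
      also have "\<dots> = L #>\<^bsub>?F\<^esub> (a - b)" using N.rcos_sum[of a "- b"] by simp
      finally show ?case .
    qed
  qed
  have rel: "rel_lattice ?G ?A = L"
  proof (intro equalityI subsetI)
    fix \<alpha> assume "\<alpha> \<in> rel_lattice ?G ?A"
    then have "L #>\<^bsub>?F\<^esub> \<alpha> = L" by (simp add: rel_lattice_def val)
    then show "\<alpha> \<in> L" by (rule F.coset_join1[OF _ _ sg]) simp
  next
    fix \<alpha> assume "\<alpha> \<in> L"
    then show "\<alpha> \<in> rel_lattice ?G ?A" using F.coset_join2[of \<alpha> L, OF _ sg] by (simp add: rel_lattice_def val)
  qed
  have posL: "positive_on (rel_lattice ?G ?A) UNIV"
    unfolding rel by (rule positive_lattice_imp_positive_on[OF pos])
  have S: "lattice_semigroup L = nat_span ?G ?A UNIV" by (simp add: lattice_semigroup_def)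
  show ?thesis
  proof
    assume "completely_p_glued_lattice q L"
    then have "completely_p_glued ?G q (nat_span ?G ?A UNIV)"
      by (simp add: completely_p_glued_lattice_def S)
    from G.completely_p_glued_imp_connecting[OF q this] obtain A' :: "nat \<Rightarrow> ('m \<Rightarrow>\<^sub>0 int) set" and E B where A': "\<And>i. A' i \<in> carrier ?G" "finite E"
      "nat_span ?G A' E = nat_span ?G ?A UNIV" "positive_on (rel_lattice ?G A') E" "connecting (rel_lattice ?G A') q E B"
      by blast
    have "\<exists>B. connecting (rel_lattice ?G ?A) q UNIV B"
      by (rule G.change_family[OF A'(1) A q A'(2) finite A'(3,4) posL A'(5)])
    then show "\<exists>B. connecting L q UNIV B" unfolding rel .
  next
    assume "\<exists>B. connecting L q UNIV B"
    then obtain B where "connecting (rel_lattice ?G ?A) q UNIV B" unfolding rel by blast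
    from G.connecting_imp_completely_p_glued[where A = ?A, OF A q finite posL this]
    show "completely_p_glued_lattice q L" by (simp add: completely_p_glued_lattice_def S)
  qed
qed

lemma p_closure_1:
  assumes "S \<subseteq> carrier G" "group G" shows "p_closure G 1 S = S"
proof -
  interpret group G by fact
  have "b [^]\<^bsub>G\<^esub> (1 ^ k :: nat) = b" if "b \<in> carrier G" for b and k :: nat
    using that by simp
  then show ?thesis using assms(1) by (auto simp: p_closure_def)
qed

lemma completely_glued_iff_p_glued_1:
  assumes "comm_group G" shows "completely_glued G S \<longleftrightarrow> completely_p_glued G 1 S"
proof -
  interpret comm_group G by (rule assms)
  have sub: "nat_span G A D \<subseteq> carrier G" if "A \<in> {1..m} \<rightarrow> carrier G" "D \<subseteq> {1..m}" for A :: "nat \<Rightarrow> 'a" and D m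
    using that unfolding nat_span_def by (auto intro!: finprod_closed)
  have eq: "is_p_gluing G 1 A E1 E2 \<longleftrightarrow> is_gluing G A E1 E2"
    if A: "A \<in> {1..m} \<rightarrow> carrier G" and s: "splitting m E1 E2" for A :: "nat \<Rightarrow> 'a" and m E1 E2
  proof -
    have "E1 \<subseteq> {1..m}" using s by (auto simp: splitting_def)
    then have "nat_span G A E1 \<inter> nat_span G A E2 \<subseteq> carrier G" using sub[OF A] by blast
    from p_closure_1[OF this is_group] show ?thesis unfolding is_p_gluing_def is_gluing_def by simp
  qed
  show ?thesis
  proof
    assume "completely_glued G S"
    then show "completely_p_glued G 1 S"
    proof (induction rule: completely_glued.induct)
      case (independent A s)
      then show ?case by (rule completely_p_glued.independent)
    next
      case (glue A m E1 E2)
      have "is_p_gluing G 1 A E1 E2" using eq[OF glue.hyps(1,3)] glue.hyps by blast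
      then show ?case by (rule completely_p_glued.glue[OF glue.hyps(1-3) glue.IH])
    qed
  next
    assume "completely_p_glued G 1 S"
    then show "completely_glued G S"
    proof (induction rule: completely_p_glued.induct)
      case (independent A s)
      then show ?case by (rule completely_glued.independent)
    next
      case (glue A m E1 E2)
      have "is_gluing G A E1 E2" using eq[OF glue.hyps(1,3)] glue.hyps by blast
      then show ?case by (rule completely_glued.glue[OF glue.hyps(1-3) glue.IH])
    qed
  qed
qed

lemma completely_glued_lattice_iff:
  fixes L :: "('m::finite \<Rightarrow>\<^sub>0 int) set"
  assumes sg: "subgroup L (free_Abelian_group UNIV)" and pos: "positive_lattice L"
  shows "completely_glued_lattice L \<longleftrightarrow> (\<exists>B. connecting L 1 UNIV B)"
proof -
  interpret F: comm_group "free_Abelian_group (UNIV :: 'm set)" by (rule abelian_free_Abelian_group)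
  have "comm_group (lattice_quotient L)" by (rule F.abelian_FactGroup[OF sg])
  then have "completely_glued_lattice L \<longleftrightarrow> completely_p_glued_lattice 1 L"
    by (simp add: completely_glued_lattice_def completely_p_glued_lattice_def completely_glued_iff_p_glued_1)
  then show ?thesis using completely_p_glued_lattice_iff[OF sg pos, of 1] by simp
qed

subsection \<open>Ranks of lattices and chains of prime ideals\<close>

definition lattice_rank :: "('m::finite \<Rightarrow>\<^sub>0 int) set \<Rightarrow> nat" where
  "lattice_rank L = Max {card B | B. finite B \<and> B \<subseteq> L \<and> indep B}"

lemma indep_card_le:
  fixes B :: "('m::finite \<Rightarrow>\<^sub>0 int) set"
  assumes "finite B" "indep B" shows "card B \<le> CARD('m)"
proof (rule ccontr)
  assume "\<not> card B \<le> CARD('m)"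
  then obtain c where c: "\<exists>x\<in>B. c x \<noteq> (0::int)" "\<forall>j\<in>UNIV. (\<Sum>x\<in>B. c x * lookup x j) = 0"
    using homogeneous_system_nontrivial[of UNIV B lookup] assms(1) by auto
  have "(\<Sum>x\<in>B. frag_cmul (c x) x) = 0" by (rule poly_mapping_eqI) (use c(2) in \<open>simp add: lookup_sum\<close>)
  then show False using indepD[OF assms(2)] c(1) by blast
qed

lemma lattice_rank_set_finite:
  "finite {card B | B. finite B \<and> B \<subseteq> (L :: ('m::finite \<Rightarrow>\<^sub>0 int) set) \<and> indep B}"
proof (rule finite_subset)
  show "{card B | B. finite B \<and> B \<subseteq> L \<and> indep B} \<subseteq> {..CARD('m)}"
  proof
    fix x assume "x \<in> {card B | B. finite B \<and> B \<subseteq> L \<and> indep B}"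
    then obtain B where B: "x = card B" "finite B" "indep B" "B \<subseteq> L" by blast
    show "x \<in> {..CARD('m)}" unfolding B(1) using indep_card_le[OF B(2,3)] by (rule atMost_iff[THEN iffD2])
  qed
qed (rule finite_atMost)

lemma card_le_lattice_rank: "finite B \<Longrightarrow> B \<subseteq> L \<Longrightarrow> indep B \<Longrightarrow> card B \<le> lattice_rank L"
  unfolding lattice_rank_def by (rule Max_ge[OF lattice_rank_set_finite]) blast

lemma indep_empty: "indep {}"
  by (simp add: indep_def)

lemma lattice_rank_basis:
  obtains B where "finite B" "B \<subseteq> L" "indep B" "card B = lattice_rank L"
proof -
  have "{card B | B. finite B \<and> B \<subseteq> L \<and> indep B} \<noteq> {}" using indep_empty by blast
  then have "lattice_rank L \<in> {card B | B. finite B \<and> B \<subseteq> L \<and> indep B}"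
    unfolding lattice_rank_def by (rule Max_in[OF lattice_rank_set_finite])
  then obtain B where "lattice_rank L = card B \<and> finite B \<and> B \<subseteq> L \<and> indep B" by (elim CollectE exE)
  then show ?thesis by (intro that[of B]) simp_all
qed

text \<open>If there were more independent vectors in \<open>L\<close> than elements of
  \<open>B'\<close>, their coefficient vectors would be dependent over the integers, and so would be
  multiples of the vectors themselves.\<close>

lemma lattice_rank_le_span:
  assumes B': "finite B'" and span: "\<And>\<alpha>. \<alpha> \<in> L \<Longrightarrow> \<exists>N. N \<noteq> 0 \<and> frag_cmul N \<alpha> \<in> zspan B'"
  shows "lattice_rank L \<le> card B'"
proof -
  obtain B where B: "finite B" "B \<subseteq> L" "indep B" "card B = lattice_rank L" by (rule lattice_rank_basis)
  have "\<exists>N d. N \<noteq> 0 \<and> frag_cmul N b = (\<Sum>x\<in>B'. frag_cmul (d x) x)" if "b \<in> B" for b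
  proof -
    have "b \<in> L" using B(2) that by blast
    from span[OF this] show ?thesis unfolding zspan_def by blast
  qed
  then obtain N d where Nd: "\<And>b. b \<in> B \<Longrightarrow> N b \<noteq> 0 \<and> frag_cmul (N b) b = (\<Sum>x\<in>B'. frag_cmul (d b x) x)"
    by metis
  show ?thesis
  proof (rule ccontr)
    assume "\<not> lattice_rank L \<le> card B'"
    then have "card B' < card B" using B(4) by simp
    then obtain c where c: "\<exists>x\<in>B. c x \<noteq> (0::int)" "\<forall>j\<in>B'. (\<Sum>x\<in>B. c x * d x j) = 0"
      using homogeneous_system_nontrivial[of B' B d] B' B(1) by auto
    have "(\<Sum>b\<in>B. frag_cmul (c b * N b) b) = (\<Sum>b\<in>B. \<Sum>x\<in>B'. frag_cmul (c b * d b x) x)"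
    proof (rule sum.cong)
      fix b assume "b \<in> B"
      then have "frag_cmul (c b * N b) b = frag_cmul (c b) (\<Sum>x\<in>B'. frag_cmul (d b x) x)"
        using Nd[of b] by (metis frag_cmul_cmul)
      then show "frag_cmul (c b * N b) b = (\<Sum>x\<in>B'. frag_cmul (c b * d b x) x)" by (simp add: frag_cmul_sum)
    qed simp
    also have "\<dots> = (\<Sum>x\<in>B'. \<Sum>b\<in>B. frag_cmul (c b * d b x) x)" by (rule sum.swap)
    also have "\<dots> = (\<Sum>x\<in>B'. frag_cmul (\<Sum>b\<in>B. c b * d b x) x)"
      by (rule sum.cong) (auto intro!: poly_mapping_eqI simp: lookup_sum sum_distrib_right)
    also have "\<dots> = 0" using c(2) by (simp add: sum.neutral)
    finally have "\<And>b. b \<in> B \<Longrightarrow> c b * N b = 0" using indepD[OF B(3), of "\<lambda>b. c b * N b"] by blast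
    then show False using c(1) Nd by (metis mult_eq_0_iff)
  qed
qed

text \<open>A dependency would make one element of \<open>B'\<close> redundant up to integer
  multiples, and the rank would be at most the number of the remaining elements.\<close>

lemma indep_of_span_card:
  assumes B': "finite B'" and span: "\<And>\<alpha>. \<alpha> \<in> L \<Longrightarrow> \<exists>N. N \<noteq> 0 \<and> frag_cmul N \<alpha> \<in> zspan B'"
    and c: "card B' \<le> lattice_rank L"
  shows "indep B'"
  unfolding indep_def
proof (intro allI impI ballI, rule ccontr)
  fix d b0 assume z: "(\<Sum>b\<in>B'. frag_cmul (d b) b) = 0" and b0: "b0 \<in> B'" "d b0 \<noteq> 0"
  let ?C = "B' - {b0}"
  have "(\<Sum>b\<in>B'. frag_cmul (d b) b) = frag_cmul (d b0) b0 + (\<Sum>b\<in>?C. frag_cmul (d b) b)"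
    using B' b0(1) by (rule sum.remove)
  then have "frag_cmul (d b0) b0 = - (\<Sum>b\<in>?C. frag_cmul (d b) b)" using z by (simp add: add_eq_0_iff2)
  moreover have "(\<Sum>b\<in>?C. frag_cmul (d b) b) \<in> zspan ?C" unfolding zspan_def by blast
  ultimately have d0: "frag_cmul (d b0) b0 \<in> zspan ?C" using is_lattice_uminus[OF is_lattice_zspan] by simp
  have fC: "finite ?C" using B' by simp
  have all: "zspan B' \<subseteq> {x. frag_cmul (d b0) x \<in> zspan ?C}"
  proof (rule zspan_subset[OF is_lattice_scale[OF is_lattice_zspan]], rule subsetI)
    fix b assume "b \<in> B'"
    then show "b \<in> {x. frag_cmul (d b0) x \<in> zspan ?C}"
      using d0 is_lattice_cmul[OF is_lattice_zspan zspan_base[OF fC, of b]] by (cases "b = b0") auto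
  qed
  have "lattice_rank L \<le> card ?C"
  proof (rule lattice_rank_le_span[OF fC])
    fix \<alpha> assume "\<alpha> \<in> L"
    then obtain N where N: "N \<noteq> 0" "frag_cmul N \<alpha> \<in> zspan B'" using span by blast
    then have "frag_cmul (d b0 * N) \<alpha> \<in> zspan ?C" using all by auto
    then show "\<exists>N. N \<noteq> 0 \<and> frag_cmul N \<alpha> \<in> zspan ?C" using N b0 by (intro exI[of _ "d b0 * N"]) simp
  qed
  moreover have "card ?C < card B'" using B' b0(1) by (meson card_Diff1_less)
  ultimately show False using c by linarith
qed

text \<open>One vector of a maximal independent set with nonzero coordinate \<open>j\<close> serves
  as pivot to clear this coordinate in the others, which stay independent.\<close>

lemma lattice_rank_coord_ge: "lattice_rank L \<le> Suc (lattice_rank {\<alpha>\<in>L. lookup \<alpha> j = 0})"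
  if lat: "is_lattice L" for L :: "('m::finite \<Rightarrow>\<^sub>0 int) set"
proof -
  let ?L0 = "{\<alpha>\<in>L. lookup \<alpha> j = 0}"
  obtain B where B: "finite B" "B \<subseteq> L" "indep B" "card B = lattice_rank L" by (rule lattice_rank_basis)
  show ?thesis
  proof (cases "\<forall>b\<in>B. lookup b j = 0")
    case True
    then have "card B \<le> lattice_rank ?L0" using B by (intro card_le_lattice_rank) auto
    then show ?thesis using B(4) by simp
  next
    case False
    then obtain b1 where b1: "b1 \<in> B" "lookup b1 j \<noteq> 0" by blast
    let ?C = "B - {b1}" and ?f = "\<lambda>b. frag_cmul (lookup b1 j) b - frag_cmul (lookup b j) b1"
    have fC: "finite ?C" using B(1) by simp
    have z: "\<forall>b\<in>?C. c b = 0" if s: "(\<Sum>b\<in>?C. frag_cmul (c b) (?f b)) = 0" for c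
    proof -
      define e where "e = (\<lambda>b. if b = b1 then - (\<Sum>b\<in>?C. c b * lookup b j) else c b * lookup b1 j)"
      have "(\<Sum>b\<in>B. frag_cmul (e b) b) = frag_cmul (e b1) b1 + (\<Sum>b\<in>?C. frag_cmul (e b) b)"
        using B(1) b1(1) by (rule sum.remove)
      also have "(\<Sum>b\<in>?C. frag_cmul (e b) b) = (\<Sum>b\<in>?C. frag_cmul (c b * lookup b1 j) b)"
        by (rule sum.cong) (auto simp: e_def)
      also have "frag_cmul (e b1) b1 + \<dots> = (\<Sum>b\<in>?C. frag_cmul (c b) (?f b))"
        by (rule poly_mapping_eqI) (simp add: e_def lookup_add lookup_sum lookup_minus sum_subtractf sum_distrib_right right_diff_distrib mult.assoc)
      finally have "(\<Sum>b\<in>B. frag_cmul (e b) b) = 0" using s by simp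
      from indepD[OF B(3) this] have e0: "e b = 0" if "b \<in> B" for b using that .
      show ?thesis
      proof
        fix b assume b: "b \<in> ?C"
        then have "c b * lookup b1 j = 0" using e0[of b] by (auto simp: e_def)
        then show "c b = 0" using b1(2) by simp
      qed
    qed
    have "card (?f ` ?C) = card ?C" by (rule card_image[OF indep_image(1)[OF fC z]])
    moreover have "card (?f ` ?C) \<le> lattice_rank ?L0"
    proof (rule card_le_lattice_rank)
      show "indep (?f ` ?C)" by (rule indep_image(2)[OF fC z])
      show "?f ` ?C \<subseteq> ?L0"
      proof
        fix y assume "y \<in> ?f ` ?C"
        then obtain b where b: "b \<in> B" "y = ?f b" by blast
        then have "y \<in> L" using B(2) b1(1) is_lattice_diff[OF lat is_lattice_cmul[OF lat] is_lattice_cmul[OF lat]] by blast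
        then show "y \<in> ?L0" using b by (simp add: lookup_minus)
      qed
    qed (use fC in simp)
    moreover have "card B = Suc (card ?C)" using B(1) b1(1) by (metis card_Suc_Diff1)
    ultimately show ?thesis using B(4) by simp
  qed
qed

lemma lattice_rank_coord_less:
  fixes L :: "('m::finite \<Rightarrow>\<^sub>0 int) set"
  assumes \<alpha>: "\<alpha> \<in> L" "lookup \<alpha> j \<noteq> 0"
  shows "Suc (lattice_rank {\<alpha>\<in>L. lookup \<alpha> j = 0}) \<le> lattice_rank L"
proof -
  let ?L0 = "{\<alpha>\<in>L. lookup \<alpha> j = 0}"
  obtain B where B: "finite B" "B \<subseteq> ?L0" "indep B" "card B = lattice_rank ?L0" by (rule lattice_rank_basis)
  have nB: "\<alpha> \<notin> B" using B(2) \<alpha>(2) by auto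
  have "indep (insert \<alpha> B)" unfolding indep_def
  proof (intro allI impI)
    fix c assume "(\<Sum>b\<in>insert \<alpha> B. frag_cmul (c b) b) = 0"
    then have s: "frag_cmul (c \<alpha>) \<alpha> + (\<Sum>b\<in>B. frag_cmul (c b) b) = 0" using B(1) nB by simp
    have "lookup (\<Sum>b\<in>B. frag_cmul (c b) b) j = 0"
      unfolding lookup_sum by (rule sum.neutral) (use B(2) in auto)
    then have "lookup (frag_cmul (c \<alpha>) \<alpha> + (\<Sum>b\<in>B. frag_cmul (c b) b)) j = c \<alpha> * lookup \<alpha> j"
      by (simp add: lookup_add)
    then have c: "c \<alpha> = 0" using s \<alpha>(2) by simp
    then have "(\<Sum>b\<in>B. frag_cmul (c b) b) = 0" using s by simp
    then show "\<forall>b\<in>insert \<alpha> B. c b = 0" using c indepD[OF B(3)] by blast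
  qed
  then have "card (insert \<alpha> B) \<le> lattice_rank L" using B \<alpha> by (intro card_le_lattice_rank) auto
  then show ?thesis using B nB by simp
qed

lemma lattice_rank_zero: "(\<And>\<alpha>. \<alpha> \<in> L \<Longrightarrow> \<alpha> = 0) \<Longrightarrow> lattice_rank L = 0"
proof -
  assume z: "\<And>\<alpha>. \<alpha> \<in> L \<Longrightarrow> \<alpha> = 0"
  obtain B where B: "finite B" "B \<subseteq> L" "indep B" "card B = lattice_rank L" by (rule lattice_rank_basis)
  have "B = {}" using indep_nonzero[OF B(3,1)] z B(2) by blast
  then show ?thesis using B(4) by simp
qed

definition zeros_in :: "('m \<Rightarrow>\<^sub>0 int) set \<Rightarrow> 'm set \<Rightarrow> ('m \<Rightarrow>\<^sub>0 int) set" where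
  "zeros_in L J = {\<alpha>\<in>L. zero_on J \<alpha>}"

lemma zeros_in_insert: "zeros_in L (insert j J) = {\<alpha>\<in>zeros_in L J. lookup \<alpha> j = 0}"
  by (auto simp: zeros_in_def zero_on_def)

lemma is_lattice_zeros_in: "is_lattice L \<Longrightarrow> is_lattice (zeros_in L J)"
  by (simp add: is_lattice_def zeros_in_def zero_on_def lookup_minus)

lemma lattice_rank_zeros_in:
  assumes lat: "is_lattice (L :: ('m::finite \<Rightarrow>\<^sub>0 int) set)"
  shows "lattice_rank L \<le> lattice_rank (zeros_in L J) + card J"
proof -
  have "finite J" by simp
  then show ?thesis
  proof (induction J rule: finite_induct)
    case empty
    show ?case by (simp add: zeros_in_def zero_on_def)
  next
    case (insert j J)
    have "lattice_rank (zeros_in L J) \<le> Suc (lattice_rank (zeros_in L (insert j J)))"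
      unfolding zeros_in_insert by (rule lattice_rank_coord_ge[OF is_lattice_zeros_in[OF lat]])
    then show ?case using insert by simp
  qed
qed

text \<open>In a maximal set whose size is covered by the loss of rank nothing of \<open>L\<close>
  is left, since a remaining nonzero vector would provide one more coordinate. The variables outside
  \<open>C\<close> are later shown to be algebraically independent modulo the lattice ideal.\<close>

lemma ex_complement_coords:
  fixes L :: "('m::finite \<Rightarrow>\<^sub>0 int) set"
  assumes lat: "is_lattice L"
  shows "\<exists>C. card C = lattice_rank L \<and> zeros_in L C \<subseteq> {0}"
proof -
  have "\<exists>C. card C + lattice_rank (zeros_in L C) \<le> lattice_rank L \<and> zeros_in L C \<subseteq> {0}"
  proof -
    define S where "S = {C. card C + lattice_rank (zeros_in L C) \<le> lattice_rank L}"
    have "{} \<in> S" by (simp add: S_def zeros_in_def zero_on_def)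
    then have "S \<noteq> {}" by blast
    moreover have "finite S" by simp
    ultimately obtain C where C: "C \<in> S" "\<And>C'. C' \<in> S \<Longrightarrow> C \<subseteq> C' \<Longrightarrow> C' = C"
      using finite_has_maximal[of S] by metis
    have "zeros_in L C \<subseteq> {0}"
    proof (rule subsetI, rule ccontr)
      fix \<alpha> assume \<alpha>: "\<alpha> \<in> zeros_in L C" "\<alpha> \<notin> {0}"
      then obtain j where j: "lookup \<alpha> j \<noteq> 0" by (metis lookup_zero poly_mapping_eqI singletonI)
      then have jC: "j \<notin> C" using \<alpha>(1) by (auto simp: zeros_in_def zero_on_def)
      have "Suc (lattice_rank (zeros_in L (insert j C))) \<le> lattice_rank (zeros_in L C)"
        unfolding zeros_in_insert by (rule lattice_rank_coord_less[OF \<alpha>(1) j])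
      then have "insert j C \<in> S" using C(1) jC by (simp add: S_def)
      then show False using C(2)[of "insert j C"] jC by blast
    qed
    then show ?thesis using C(1) by (auto simp: S_def)
  qed
  then obtain C where C: "card C + lattice_rank (zeros_in L C) \<le> lattice_rank L" "zeros_in L C \<subseteq> {0}" by blast
  have "lattice_rank L \<le> lattice_rank (zeros_in L C) + card C" by (rule lattice_rank_zeros_in[OF lat])
  moreover have "lattice_rank (zeros_in L C) = 0" by (rule lattice_rank_zero) (use C(2) in blast)
  ultimately show ?thesis using C by (intro exI[of _ C]) auto
qed

section \<open>Ideals and chains of prime ideals\<close>

abbreviation ideal_gen :: "'a::comm_ring_1 set \<Rightarrow> 'a set" where "ideal_gen \<equiv> module.span (*)"
abbreviation is_ideal :: "'a::comm_ring_1 set \<Rightarrow> bool" where "is_ideal \<equiv> module.subspace (*)"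

lemma is_ideal_zero: "is_ideal I \<Longrightarrow> 0 \<in> I"
  by (rule module.subspace_0[OF module_self])

lemma is_ideal_add: "is_ideal I \<Longrightarrow> a \<in> I \<Longrightarrow> b \<in> I \<Longrightarrow> a + b \<in> I"
  by (rule module.subspace_add[OF module_self])

lemma is_ideal_mult: "is_ideal I \<Longrightarrow> a \<in> I \<Longrightarrow> c * a \<in> I"
  by (rule module.subspace_scale[OF module_self])

lemma is_ideal_diff: "is_ideal I \<Longrightarrow> a \<in> I \<Longrightarrow> b \<in> I \<Longrightarrow> a - b \<in> I"
  by (rule module.subspace_diff[OF module_self])

lemma is_ideal_uminus: "is_ideal I \<Longrightarrow> a \<in> I \<Longrightarrow> - a \<in> I"
  by (rule module.subspace_neg[OF module_self])

lemma is_ideal_sum: "is_ideal I \<Longrightarrow> (\<And>x. x \<in> X \<Longrightarrow> f x \<in> I) \<Longrightarrow> sum f X \<in> I"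
  by (rule module.subspace_sum[OF module_self])

lemma is_idealI:
  "0 \<in> I \<Longrightarrow> (\<And>a b. a \<in> I \<Longrightarrow> b \<in> I \<Longrightarrow> a + b \<in> I) \<Longrightarrow> (\<And>a c. a \<in> I \<Longrightarrow> c * a \<in> I) \<Longrightarrow> is_ideal I"
  by (rule module.subspaceI[OF module_self])

lemma is_ideal_gen: "is_ideal (ideal_gen S)"
  by (rule module.subspace_span[OF module_self])

lemma ideal_gen_base: "x \<in> S \<Longrightarrow> x \<in> ideal_gen S"
  by (rule module.span_base[OF module_self])

lemma ideal_gen_least: "S \<subseteq> I \<Longrightarrow> is_ideal I \<Longrightarrow> ideal_gen S \<subseteq> I"
  by (rule module.span_minimal[OF module_self])

lemma prime_idealD:
  assumes "prime_ideal P"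
  shows "is_ideal P" "1 \<notin> P" "a * b \<in> P \<Longrightarrow> a \<in> P \<or> b \<in> P"
proof -
  show i: "is_ideal P" and "a * b \<in> P \<Longrightarrow> a \<in> P \<or> b \<in> P" using assms unfolding prime_ideal_def by blast+
  show "1 \<notin> P"
  proof
    assume "1 \<in> P"
    then have "x \<in> P" for x using is_ideal_mult[OF i, of 1 x] by simp
    then show False using assms unfolding prime_ideal_def by blast
  qed
qed

lemma prime_idealI:
  "is_ideal P \<Longrightarrow> 1 \<notin> P \<Longrightarrow> (\<And>a b. a * b \<in> P \<Longrightarrow> a \<in> P \<or> b \<in> P) \<Longrightarrow> prime_ideal P"
  unfolding prime_ideal_def by blast

lemma prime_ideal_power: "prime_ideal P \<Longrightarrow> f ^ n \<in> P \<Longrightarrow> f \<in> P"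
  by (induction n) (use prime_idealD in fastforce)+

definition has_chain :: "'a::comm_ring_1 set \<Rightarrow> nat \<Rightarrow> bool" where
  "has_chain P n \<longleftrightarrow> (\<exists>c :: nat \<Rightarrow> 'a set. (\<forall>i\<le>n. prime_ideal (c i)) \<and> (\<forall>i<n. c i \<subset> c (Suc i)) \<and> c n = P)"

lemma prime_height_eq: "prime_height P = Sup {enat n | n. has_chain P n}"
  by (simp add: prime_height_def has_chain_def)

lemma has_chain_0: "prime_ideal P \<Longrightarrow> has_chain P 0"
  unfolding has_chain_def by (intro exI[of _ "\<lambda>_. P"]) simp

lemma has_chain_Suc:
  assumes "has_chain P n" "P \<subset> Q" "prime_ideal Q" shows "has_chain Q (Suc n)"
proof -
  obtain c where c: "\<forall>i\<le>n. prime_ideal (c i)" "\<forall>i<n. c i \<subset> c (Suc i)" "c n = P"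
    using assms(1) unfolding has_chain_def by blast
  let ?c = "\<lambda>i. if i = Suc n then Q else c i"
  have "?c i \<subset> ?c (Suc i)" if "i < Suc n" for i
    using that c(2,3) assms(2) by (cases "i = n") auto
  then show ?thesis unfolding has_chain_def using c(1) assms(3) by (intro exI[of _ ?c]) auto
qed

lemma has_chain_pred:
  assumes "has_chain P (Suc n)" shows "has_chain P n"
proof -
  obtain c where c: "\<forall>i\<le>Suc n. prime_ideal (c i)" "\<forall>i<Suc n. c i \<subset> c (Suc i)" "c (Suc n) = P"
    using assms unfolding has_chain_def by blast
  then show ?thesis unfolding has_chain_def by (intro exI[of _ "\<lambda>i. c (Suc i)"]) auto
qed

lemma has_chain_subset:
  assumes "has_chain P n" "P \<subseteq> Q" "prime_ideal Q" shows "has_chain Q n"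
proof (cases "P = Q")
  case False
  then show ?thesis using has_chain_pred[OF has_chain_Suc[OF assms(1) _ assms(3)]] assms(2) by blast
qed (use assms in simp)

section \<open>Polynomials and their homogeneous components\<close>

type_synonym ('m, 'k) mpoly = "('m \<Rightarrow>\<^sub>0 nat) \<Rightarrow>\<^sub>0 'k"

lemma mpoly_sum_monomials: "f = (\<Sum>u\<in>keys f. Poly_Mapping.single u (lookup f u))"
  by (rule poly_mapping_eqI) (auto simp: lookup_sum lookup_single when_def in_keys_iff)

lemma mpoly_induct:
  assumes s: "\<And>u c. P (Poly_Mapping.single u c)" and a: "\<And>f g. P f \<Longrightarrow> P g \<Longrightarrow> P (f + g)"
  shows "P (f :: 'u \<Rightarrow>\<^sub>0 'k::comm_monoid_add)"
proof -
  have 0: "P 0" using s[of _ 0] by simp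
  have "P (\<Sum>u\<in>U. Poly_Mapping.single u (lookup f u))" if "finite U" for U
    using that by (induction U rule: finite_induct) (auto simp: 0 intro: s a)
  from this[OF finite_keys[of f]] show ?thesis by (simp only: mpoly_sum_monomials[symmetric])
qed

text \<open>One operation for three purposes: components of given degree in a variable, components
  of a class modulo the lattice, and the substitution of zero for variables.\<close>

definition filt :: "('u \<Rightarrow> bool) \<Rightarrow> ('u \<Rightarrow>\<^sub>0 'k::zero) \<Rightarrow> ('u \<Rightarrow>\<^sub>0 'k)" where
  "filt Q f = Abs_poly_mapping (\<lambda>u. if Q u then lookup f u else 0)"

lemma lookup_filt: "lookup (filt Q f) u = (if Q u then lookup f u else 0)"
proof -
  have "finite {u. (if Q u then lookup f u else 0) \<noteq> 0}"
    by (rule finite_subset[OF _ finite_keys[of f]]) (auto simp: in_keys_iff)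
  then show ?thesis unfolding filt_def by simp
qed

lemma filt_add: "filt Q (f + g) = filt Q f + filt Q (g :: _ \<Rightarrow>\<^sub>0 'k::monoid_add)"
  by (rule poly_mapping_eqI) (simp add: lookup_filt lookup_add)

lemma filt_diff: "filt Q (f - g) = filt Q f - filt Q (g :: _ \<Rightarrow>\<^sub>0 'k::ab_group_add)"
  by (rule poly_mapping_eqI) (simp add: lookup_filt lookup_minus)

lemma filt_zero [simp]: "filt Q 0 = 0"
  by (rule poly_mapping_eqI) (simp add: lookup_filt)

lemma filt_sum: "filt Q (sum f X) = (\<Sum>x\<in>X. filt Q (f x :: _ \<Rightarrow>\<^sub>0 'k::comm_monoid_add))"
  by (induction X rule: infinite_finite_induct) (auto simp: filt_add)

lemma filt_single: "filt Q (Poly_Mapping.single u c) = (if Q u then Poly_Mapping.single u c else 0)"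
  by (rule poly_mapping_eqI) (auto simp: lookup_filt lookup_single when_def)

lemma filt_filt: "filt Q (filt R f) = filt (\<lambda>u. Q u \<and> R u) f"
  by (rule poly_mapping_eqI) (simp add: lookup_filt)

lemma filt_False: "(\<And>u. u \<in> keys f \<Longrightarrow> \<not> Q u) \<Longrightarrow> filt Q f = 0"
  by (rule poly_mapping_eqI) (auto simp: lookup_filt in_keys_iff)

lemma filt_True: "(\<And>u. u \<in> keys f \<Longrightarrow> Q u) \<Longrightarrow> filt Q f = f"
  by (rule poly_mapping_eqI) (auto simp: lookup_filt in_keys_iff)

lemma filt_eq: "filt (\<lambda>u. u = v) f = Poly_Mapping.single v (lookup f v)"
  by (rule poly_mapping_eqI) (auto simp: lookup_filt lookup_single when_def)

lemma filt_mult_single: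
  fixes f :: "('m, 'k::comm_ring_1) mpoly"
  shows "filt Q (Poly_Mapping.single u c * f) = Poly_Mapping.single u c * filt (\<lambda>v. Q (u + v)) f"
  by (induction f rule: mpoly_induct) (auto simp: mult_single filt_single filt_add distrib_left)

definition hom_comp :: "'m \<Rightarrow> nat \<Rightarrow> ('m, 'k::comm_ring_1) mpoly \<Rightarrow> ('m, 'k) mpoly" where
  "hom_comp j n f = filt (\<lambda>u. lookup u j = n) f"

text \<open>For an ideal \<open>P\<close> this is the largest ideal inside it that is homogeneous in
  the variable \<open>j\<close>.\<close>

definition hom_part :: "'m \<Rightarrow> ('m, 'k::comm_ring_1) mpoly set \<Rightarrow> ('m, 'k) mpoly set" where
  "hom_part j P = {f. \<forall>n. hom_comp j n f \<in> P}"

lemma hom_comp_add: "hom_comp j n (f + g) = hom_comp j n f + hom_comp j n g"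
  by (simp add: hom_comp_def filt_add)

lemma hom_comp_single:
  "hom_comp j n (Poly_Mapping.single u c) = (if lookup u j = n then Poly_Mapping.single u c else 0)"
  by (simp add: hom_comp_def filt_single)

lemma hom_comp_mult: "hom_comp j N (f * g) = (\<Sum>a\<le>N. hom_comp j a f * hom_comp j (N - a) g)"
proof (induction f rule: mpoly_induct)
  case (1 u c)
  have "(\<Sum>a\<le>N. hom_comp j a (Poly_Mapping.single u c) * hom_comp j (N - a) g) =
     (\<Sum>a\<le>N. if a = lookup u j then Poly_Mapping.single u c * hom_comp j (N - lookup u j) g else 0)"
    by (rule sum.cong) (auto simp: hom_comp_single)
  also have "\<dots> = (if lookup u j \<le> N then Poly_Mapping.single u c * hom_comp j (N - lookup u j) g else 0)"
    by simp
  also have "\<dots> = hom_comp j N (Poly_Mapping.single u c * g)"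
  proof (cases "lookup u j \<le> N")
    case True
    then have "(\<lambda>v. lookup (u + v) j = N) = (\<lambda>v. lookup v j = N - lookup u j)"
      by (auto simp: lookup_add)
    then show ?thesis using True by (simp add: hom_comp_def filt_mult_single)
  next
    case False
    then have "filt (\<lambda>v. lookup (u + v) j = N) g = 0" by (intro filt_False) (auto simp: lookup_add)
    then show ?thesis using False by (simp add: hom_comp_def filt_mult_single)
  qed
  finally show ?case by simp
next
  case (2 f g')
  then show ?case by (simp add: distrib_right hom_comp_add sum.distrib)
qed

lemma hom_comp_sum: "f = (\<Sum>n\<in>(\<lambda>u. lookup u j) ` keys f. hom_comp j n f)"
proof (rule poly_mapping_eqI)
  fix u
  have "lookup (\<Sum>n\<in>(\<lambda>u. lookup u j) ` keys f. hom_comp j n f) u =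
    (\<Sum>n\<in>(\<lambda>u. lookup u j) ` keys f. if n = lookup u j then lookup f u else 0)"
    unfolding lookup_sum by (rule sum.cong) (auto simp: hom_comp_def lookup_filt)
  also have "\<dots> = lookup f u" by (auto simp: in_keys_iff)
  finally show "lookup f u = lookup (\<Sum>n\<in>(\<lambda>u. lookup u j) ` keys f. hom_comp j n f) u" by simp
qed

lemma hom_part_subset:
  assumes "is_ideal P" shows "hom_part j P \<subseteq> P"
proof
  fix f assume "f \<in> hom_part j P"
  then have "(\<Sum>n\<in>(\<lambda>u. lookup u j) ` keys f. hom_comp j n f) \<in> P"
    by (intro is_ideal_sum[OF assms]) (simp add: hom_part_def)
  then show "f \<in> P" using hom_comp_sum[of f j] by simp
qed

lemma is_ideal_hom_part:
  assumes P: "is_ideal P" shows "is_ideal (hom_part j P)"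
proof (rule is_idealI)
  show "0 \<in> hom_part j P" using is_ideal_zero[OF P] by (simp add: hom_part_def hom_comp_def)
  show "a + b \<in> hom_part j P" if "a \<in> hom_part j P" "b \<in> hom_part j P" for a b
    using that is_ideal_add[OF P] by (simp add: hom_part_def hom_comp_add)
  show "c * a \<in> hom_part j P" if "a \<in> hom_part j P" for a c
    using that by (auto simp: hom_part_def hom_comp_mult intro!: is_ideal_sum[OF P] is_ideal_mult[OF P])
qed

lemma finite_hom_comp_notin:
  assumes "is_ideal P" shows "finite {n. hom_comp j n f \<notin> P}"
proof (rule finite_subset)
  show "{n. hom_comp j n f \<notin> P} \<subseteq> (\<lambda>u. lookup u j) ` keys f"
  proof
    fix n assume n: "n \<in> {n. hom_comp j n f \<notin> P}"
    show "n \<in> (\<lambda>u. lookup u j) ` keys f"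
    proof (rule ccontr)
      assume "n \<notin> (\<lambda>u. lookup u j) ` keys f"
      then have "hom_comp j n f = 0" unfolding hom_comp_def by (intro filt_False) auto
      then show False using n is_ideal_zero[OF assms] by simp
    qed
  qed
qed simp

text \<open>Take the topmost components of \<open>f\<close> and \<open>g\<close> outside
  \<open>P\<close>, of degrees \<open>a\<close> and \<open>b\<close>. In the component of degree
  \<open>a + b\<close> of the product, every other summand has a factor in \<open>P\<close>.\<close>

lemma prime_ideal_hom_part:
  assumes P: "prime_ideal P" shows "prime_ideal (hom_part j P)"
proof (rule prime_idealI)
  note i = prime_idealD(1)[OF P]
  show "is_ideal (hom_part j P)" by (rule is_ideal_hom_part[OF i])
  show "1 \<notin> hom_part j P" using hom_part_subset[OF i] prime_idealD(2)[OF P] by blast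
  fix f g assume fg: "f * g \<in> hom_part j P"
  show "f \<in> hom_part j P \<or> g \<in> hom_part j P"
  proof (rule ccontr)
    assume n: "\<not> (f \<in> hom_part j P \<or> g \<in> hom_part j P)"
    let ?F = "{n. hom_comp j n f \<notin> P}" and ?G = "{n. hom_comp j n g \<notin> P}"
    have fin: "finite ?F" "finite ?G" by (rule finite_hom_comp_notin[OF i])+
    have ne: "?F \<noteq> {}" "?G \<noteq> {}" using n by (auto simp: hom_part_def)
    define a where "a = Max ?F"
    define b where "b = Max ?G"
    have ab: "hom_comp j a f \<notin> P" "hom_comp j b g \<notin> P"
      using Max_in[OF fin(1) ne(1)] Max_in[OF fin(2) ne(2)] by (simp_all add: a_def b_def)
    have above: "hom_comp j c f \<in> P" if "c > a" for c using Max_ge[OF fin(1), of c] that unfolding a_def by fastforce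
    have above': "hom_comp j c g \<in> P" if "c > b" for c using Max_ge[OF fin(2), of c] that unfolding b_def by fastforce
    have rest: "hom_comp j c f * hom_comp j (a + b - c) g \<in> P" if c: "c \<in> {..a + b} - {a}" for c
    proof (cases "c > a")
      case True
      then show ?thesis using is_ideal_mult[OF i above[OF True], of "hom_comp j (a + b - c) g"] by (simp add: mult.commute)
    next
      case False
      then have "a + b - c > b" using c by auto
      then show ?thesis using is_ideal_mult[OF i above'] by blast
    qed
    have "hom_comp j (a + b) (f * g) = hom_comp j a f * hom_comp j (a + b - a) g +
       (\<Sum>c\<in>{..a + b} - {a}. hom_comp j c f * hom_comp j (a + b - c) g)"
      unfolding hom_comp_mult by (rule sum.remove) auto
    then have "hom_comp j a f * hom_comp j b g = hom_comp j (a + b) (f * g) -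
       (\<Sum>c\<in>{..a + b} - {a}. hom_comp j c f * hom_comp j (a + b - c) g)" by simp
    also have "\<dots> \<in> P"
      by (rule is_ideal_diff[OF i _ is_ideal_sum[OF i rest]]) (use fg in \<open>auto simp: hom_part_def\<close>)
    finally show False using prime_idealD(3)[OF P] ab by blast
  qed
qed

definition hom_parts :: "'m list \<Rightarrow> ('m, 'k::comm_ring_1) mpoly set \<Rightarrow> ('m, 'k) mpoly set" where
  "hom_parts js P = foldr hom_part js P"

lemma hom_parts_simps [simp]: "hom_parts [] P = P" "hom_parts (j # js) P = hom_part j (hom_parts js P)"
  by (simp_all add: hom_parts_def)

lemma prime_ideal_hom_parts: "prime_ideal P \<Longrightarrow> prime_ideal (hom_parts js P)"
  by (induction js) (auto intro: prime_ideal_hom_part)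

lemma hom_parts_subset: "prime_ideal P \<Longrightarrow> hom_parts js P \<subseteq> P"
proof (induction js)
  case (Cons j js)
  then show ?case using hom_part_subset[OF prime_idealD(1)[OF prime_ideal_hom_parts[OF Cons.prems]], of j js] by auto
qed simp

lemma hom_parts_constant:
  assumes P: "prime_ideal P" and f: "f \<in> P" and z: "\<And>i u v. i \<in> set js \<Longrightarrow> u \<in> keys f \<Longrightarrow> v \<in> keys f \<Longrightarrow> lookup u i = lookup v i"
  shows "f \<in> hom_parts js P"
  using z
proof (induction js)
  case (Cons j js)
  have IH: "f \<in> hom_parts js P" by (rule Cons.IH) (rule Cons.prems, auto)
  have 0: "0 \<in> hom_parts js P" by (rule is_ideal_zero[OF prime_idealD(1)[OF prime_ideal_hom_parts[OF P]]])
  have "hom_comp j n f \<in> hom_parts js P" for n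
  proof (cases "\<exists>u\<in>keys f. lookup u j = n")
    case True
    then obtain u where u: "u \<in> keys f" "lookup u j = n" by blast
    have "lookup v j = n" if "v \<in> keys f" for v using Cons.prems[of j v u] that u by simp
    then have "hom_comp j n f = f" unfolding hom_comp_def by (rule filt_True)
    then show ?thesis using IH by simp
  next
    case False
    then have "hom_comp j n f = 0" unfolding hom_comp_def by (intro filt_False) auto
    then show ?thesis using 0 by simp
  qed
  then show ?case by (simp add: hom_part_def)
qed (use f in simp)

lemma hom_parts_filt: "f \<in> hom_parts js P \<Longrightarrow> filt (\<lambda>u. \<forall>j\<in>set js. lookup u j = lookup v j) f \<in> P"
proof (induction js arbitrary: f)
  case (Cons j js)
  then have "hom_comp j (lookup v j) f \<in> hom_parts js P" by (simp add: hom_part_def)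
  from Cons.IH[OF this] show ?case by (simp add: hom_comp_def filt_filt conj_commute)
qed (simp add: filt_True)

text \<open>Once every variable has been used, fixing all degrees singles out one exponent, so
  components are single terms.\<close>

lemma hom_parts_all:
  assumes P: "prime_ideal P" and js: "set js = UNIV"
  shows "hom_parts js P = {f. \<forall>u\<in>keys f. Poly_Mapping.single u (lookup f u) \<in> P}"
proof (intro equalityI subsetI)
  fix f assume f: "f \<in> hom_parts js P"
  have "Poly_Mapping.single u (lookup f u) \<in> P" for u
  proof -
    have "(\<lambda>u'. \<forall>j\<in>set js. lookup u' j = lookup u j) = (\<lambda>u'. u' = u)"
      using js by (auto intro!: ext poly_mapping_eqI)
    then show ?thesis using hom_parts_filt[OF f, of u] by (simp add: filt_eq)
  qed
  then show "f \<in> {f. \<forall>u\<in>keys f. Poly_Mapping.single u (lookup f u) \<in> P}" by blast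
next
  fix f assume f: "f \<in> {f. \<forall>u\<in>keys f. Poly_Mapping.single u (lookup f u) \<in> P}"
  have "Poly_Mapping.single u (lookup f u) \<in> hom_parts js P" if "u \<in> keys f" for u
  proof (rule hom_parts_constant[OF P])
    show "Poly_Mapping.single u (lookup f u) \<in> P" using f that by blast
    fix i v w assume "v \<in> keys (Poly_Mapping.single u (lookup f u))" "w \<in> keys (Poly_Mapping.single u (lookup f u))"
    then show "lookup v i = lookup w i" by (simp split: if_splits)
  qed
  then have "(\<Sum>u\<in>keys f. Poly_Mapping.single u (lookup f u)) \<in> hom_parts js P"
    by (rule is_ideal_sum[OF prime_idealD(1)[OF prime_ideal_hom_parts[OF P]]])
  then show "f \<in> hom_parts js P" using mpoly_sum_monomials[of f] by simp
qed

text \<open>The value at the point whose coordinates are 0 on \<open>J\<close> and 1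
  elsewhere.\<close>

definition eval01 :: "'m set \<Rightarrow> ('m, 'k::comm_ring_1) mpoly \<Rightarrow> 'k" where
  "eval01 J f = (\<Sum>u\<in>keys f. if keys u \<inter> J = {} then lookup f u else 0)"

lemma eval01_superset: "finite U \<Longrightarrow> keys f \<subseteq> U \<Longrightarrow> eval01 J f = (\<Sum>u\<in>U. if keys u \<inter> J = {} then lookup f u else 0)"
  unfolding eval01_def by (rule sum.mono_neutral_left) (auto simp: in_keys_iff)

lemma eval01_add: "eval01 J (f + g) = eval01 J f + eval01 J g"
proof -
  let ?U = "keys f \<union> keys g"
  have "eval01 J (f + g) = (\<Sum>u\<in>?U. if keys u \<inter> J = {} then lookup (f + g) u else 0)"
    by (rule eval01_superset) (use keys_add[of f g] in auto)
  also have "\<dots> = (\<Sum>u\<in>?U. if keys u \<inter> J = {} then lookup f u else 0) + (\<Sum>u\<in>?U. if keys u \<inter> J = {} then lookup g u else 0)"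
    by (simp add: lookup_add sum.distrib[symmetric] cong: if_cong) (rule sum.cong, auto)
  also have "\<dots> = eval01 J f + eval01 J g" by (subst (1 2) eval01_superset[of ?U]) auto
  finally show ?thesis .
qed

lemma eval01_single: "eval01 J (Poly_Mapping.single u c) = (if keys u \<inter> J = {} then c else 0)"
  by (subst eval01_superset[of "{u}"]) auto

lemma keys_add_nat: "keys (u + v :: 'm \<Rightarrow>\<^sub>0 nat) = keys u \<union> keys v"
  by (auto simp: in_keys_iff lookup_add)

lemma eval01_mult: "eval01 J (f * g) = eval01 J f * eval01 J g"
proof (induction f rule: mpoly_induct)
  case (1 u c)
  show ?case
    by (induction g rule: mpoly_induct)
      (auto simp: mult_single eval01_single eval01_add distrib_left keys_add_nat Int_Un_distrib2)
next
  case (2 f g')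
  then show ?case by (simp add: distrib_right eval01_add)
qed

text \<open>The ideal generated by the variables in \<open>J\<close>.\<close>

definition coord_ideal :: "'m set \<Rightarrow> ('m, 'k::comm_ring_1) mpoly set" where
  "coord_ideal J = {f. \<forall>u\<in>keys f. keys u \<inter> J \<noteq> {}}"

text \<open>The kernel of an evaluation is prime, and so is its homogenisation in all variables. The
  latter consists of the polynomials each of whose terms vanishes at the chosen point.\<close>

lemma prime_ideal_coord_ideal: "prime_ideal (coord_ideal J :: ('m::finite, 'k::field) mpoly set)"
proof -
  let ?P = "{f :: ('m, 'k) mpoly. eval01 J f = 0}"
  have one: "(1 :: ('m, 'k) mpoly) = Poly_Mapping.single 0 1" by simp
  have P: "prime_ideal ?P"
  proof (rule prime_idealI)
    show "is_ideal ?P" by (rule is_idealI) (auto simp: eval01_add eval01_mult, simp add: eval01_def)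
    show "1 \<notin> ?P" unfolding one by (simp only: mem_Collect_eq eval01_single) simp
    show "a \<in> ?P \<or> b \<in> ?P" if "a * b \<in> ?P" for a b using that by (simp add: eval01_mult)
  qed
  obtain js where js: "set js = (UNIV :: 'm set)" using finite_list[of "UNIV :: 'm set"] by auto
  have "hom_parts js ?P = coord_ideal J"
    unfolding hom_parts_all[OF P js] by (auto simp: coord_ideal_def eval01_single in_keys_iff)
  then show ?thesis using prime_ideal_hom_parts[OF P, of js] by simp
qed

lemma coord_ideal_empty: "coord_ideal {} = {0}"
  by (auto simp: coord_ideal_def)

lemma has_chain_coord_ideal: "has_chain (coord_ideal J :: ('m::finite, 'k::field) mpoly set) (card J)"
proof -
  have "finite J" by simp
  then show ?thesis
  proof (induction J rule: finite_induct)
    case empty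
    show ?case by (simp add: has_chain_0 prime_ideal_coord_ideal)
  next
    case (insert j J)
    let ?x = "Poly_Mapping.single (Poly_Mapping.single j 1) 1 :: ('m, 'k) mpoly"
    have "(coord_ideal J :: ('m, 'k) mpoly set) \<subseteq> coord_ideal (insert j J)" by (auto simp: coord_ideal_def)
    moreover have "?x \<in> coord_ideal (insert j J)" "?x \<notin> coord_ideal J" using insert by (auto simp: coord_ideal_def)
    ultimately have "(coord_ideal J :: ('m, 'k) mpoly set) \<subset> coord_ideal (insert j J)" by blast
    from has_chain_Suc[OF insert.IH this prime_ideal_coord_ideal] show ?case using insert by simp
  qed
qed

lemma prime_monomial:
  assumes P: "prime_ideal (P :: ('m::finite, 'k::field) mpoly set)"
  shows "Poly_Mapping.single u 1 \<in> P \<Longrightarrow> \<exists>j\<in>keys u. Poly_Mapping.single (Poly_Mapping.single j 1) 1 \<in> P"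
proof (induction "\<Sum>i\<in>UNIV. lookup u i" arbitrary: u rule: less_induct)
  case less
  show ?case
  proof (cases "u = 0")
    case True
    then show ?thesis using less.prems prime_idealD(2)[OF P] by simp
  next
    case False
    then obtain j where j: "j \<in> keys u" by (metis keys_eq_empty ex_in_conv)
    define v where "v = u - Poly_Mapping.single j 1"
    have uv: "u = Poly_Mapping.single j 1 + v"
      by (rule poly_mapping_eqI) (use j in \<open>auto simp: v_def lookup_add lookup_minus lookup_single when_def in_keys_iff\<close>)
    have "Poly_Mapping.single (Poly_Mapping.single j 1) 1 * Poly_Mapping.single v 1 = (Poly_Mapping.single u 1 :: ('m, 'k) mpoly)"
      using uv by (simp add: mult_single)
    then consider "Poly_Mapping.single (Poly_Mapping.single j 1) 1 \<in> P" | "Poly_Mapping.single v 1 \<in> P"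
      using less.prems prime_idealD(3)[OF P] by metis
    then show ?thesis
    proof cases
      case 1
      then show ?thesis using j by blast
    next
      case 2
      have "(\<Sum>i\<in>UNIV. lookup u i) = Suc (\<Sum>i\<in>UNIV. lookup v i)"
        by (subst uv) (simp add: lookup_add sum.distrib lookup_single when_def)
      then have "\<exists>j\<in>keys v. Poly_Mapping.single (Poly_Mapping.single j 1) 1 \<in> P" using less.hyps[of v] 2 by simp
      then show ?thesis using keys_add_nat[of "Poly_Mapping.single j 1" v] unfolding uv[symmetric] by blast
    qed
  qed
qed

lemma lookup_pos_part: "lookup (pos_part \<alpha>) i = nat (lookup \<alpha> i)"
  and lookup_neg_part: "lookup (neg_part \<alpha>) i = nat (- lookup \<alpha> i)"
  by (simp_all add: pos_part_def neg_part_def Poly_Mapping.map.rep_eq when_def)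

definition lattice_binomial ::
  "(('m \<Rightarrow>\<^sub>0 int) \<Rightarrow> 'k) \<Rightarrow> ('m \<Rightarrow>\<^sub>0 int) \<Rightarrow> ('m, 'k::comm_ring_1) mpoly" where
  "lattice_binomial \<rho> \<alpha> = Poly_Mapping.single (pos_part \<alpha>) 1 - Poly_Mapping.single (neg_part \<alpha>) (\<rho> \<alpha>)"

text \<open>Homogenising \<open>P\<close> in one variable after the other ends with an ideal generated by variables.  A step that
  lowers the rank of the lattice is a strict inclusion, because some \<open>f\<^sub>\<alpha>\<close> is not homogeneous in that variable.\<close>

lemma has_chain_prime_above:
  fixes P :: "('m::finite, 'k::field) mpoly set"
  assumes lat: "is_lattice L" and P: "prime_ideal P" and LP: "\<And>\<alpha>. \<alpha> \<in> L \<Longrightarrow> lattice_binomial \<rho> \<alpha> \<in> P"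
  shows "\<exists>n\<ge>lattice_rank L. has_chain P n"
proof -
  \<comment> \<open>Vectors of \<open>L\<close> vanishing on \<open>J\<close> have both monomials
    outside \<open>P\<close>, which the strictness of inclusions needs. Passing to them costs at
    most \<open>card J\<close> of the rank, and the chain below \<open>coord_ideal J\<close>, where
    the homogenisation ends, restores this amount.\<close>
  define J where "J = {j. Poly_Mapping.single (Poly_Mapping.single j 1) 1 \<in> P}"
  let ?LJ = "zeros_in L J"
  have latJ: "is_lattice ?LJ" by (rule is_lattice_zeros_in[OF lat])
  have main: "\<exists>n. has_chain P n \<and> h + lattice_rank ?LJ \<le> n + lattice_rank (zeros_in ?LJ (set js))"
    if "has_chain (hom_parts js P) h" for js h
    using that
  proof (induction js arbitrary: h)
    case Nil
    then show ?case by (intro exI[of _ h]) (simp add: zeros_in_def zero_on_def)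
  next
    case (Cons j js)
    let ?H = "hom_parts js P" and ?Z = "zeros_in ?LJ (set js)"
    have pH: "prime_ideal ?H" by (rule prime_ideal_hom_parts[OF P])
    have sub: "hom_part j ?H \<subseteq> ?H" by (rule hom_part_subset[OF prime_idealD(1)[OF pH]])
    have Z: "zeros_in ?LJ (set (j # js)) = {\<alpha>\<in>?Z. lookup \<alpha> j = 0}" by (simp add: zeros_in_insert)
    show ?case
    proof (cases "\<exists>\<alpha>\<in>?Z. lookup \<alpha> j \<noteq> 0")
      case False
      then have "zeros_in ?LJ (set (j # js)) = ?Z" unfolding Z by blast
      moreover have "has_chain ?H h" by (rule has_chain_subset[OF _ sub pH]) (use Cons.prems in simp)
      ultimately show ?thesis using Cons.IH by simp
    next
      case True
      then obtain \<alpha> where \<alpha>: "\<alpha> \<in> ?Z" "lookup \<alpha> j \<noteq> 0" by blast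
      have \<alpha>L: "\<alpha> \<in> L" and \<alpha>J: "zero_on J \<alpha>" and \<alpha>js: "zero_on (set js) \<alpha>" using \<alpha>(1) by (simp_all add: zeros_in_def)
      let ?f = "lattice_binomial \<rho> \<alpha>"
      have kf: "keys ?f \<subseteq> {pos_part \<alpha>, neg_part \<alpha>}"
        unfolding lattice_binomial_def by (auto simp: in_keys_iff lookup_minus lookup_single when_def split: if_splits)
      have "?f \<in> ?H"
      proof (rule hom_parts_constant[OF P LP[OF \<alpha>L]])
        fix i u v assume i: "i \<in> set js" and uv: "u \<in> keys ?f" "v \<in> keys ?f"
        have "lookup \<alpha> i = 0" using \<alpha>js i by (simp add: zero_on_def)
        then have "lookup (pos_part \<alpha>) i = 0" "lookup (neg_part \<alpha>) i = 0" by (simp_all add: lookup_pos_part lookup_neg_part)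
        then show "lookup u i = lookup v i" using subsetD[OF kf uv(1)] subsetD[OF kf uv(2)] by (auto simp only: insert_iff empty_iff)
      qed
      moreover have "?f \<notin> hom_part j ?H"
      proof
        assume "?f \<in> hom_part j ?H"
        then have "hom_comp j (lookup (pos_part \<alpha>) j) ?f \<in> ?H" by (simp add: hom_part_def)
        moreover have "lookup (pos_part \<alpha>) j \<noteq> lookup (neg_part \<alpha>) j"
          using \<alpha>(2) by (simp add: lookup_pos_part lookup_neg_part)
        then have "hom_comp j (lookup (pos_part \<alpha>) j) ?f = Poly_Mapping.single (pos_part \<alpha>) 1"
          by (simp add: lattice_binomial_def hom_comp_def filt_diff filt_single)
        ultimately have "Poly_Mapping.single (pos_part \<alpha>) 1 \<in> P" using hom_parts_subset[OF P, of js] by auto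
        from prime_monomial[OF P this] obtain i where i: "i \<in> keys (pos_part \<alpha>)" "i \<in> J" by (auto simp: J_def)
        then show False using \<alpha>J by (simp add: in_keys_iff lookup_pos_part zero_on_def)
      qed
      ultimately have "hom_part j ?H \<subset> ?H" using sub by blast
      then have "has_chain ?H (Suc h)" using has_chain_Suc[OF _ _ pH] Cons.prems by simp
      then obtain n where n: "has_chain P n" "Suc h + lattice_rank ?LJ \<le> n + lattice_rank ?Z" using Cons.IH by blast
      have "lattice_rank ?Z \<le> Suc (lattice_rank (zeros_in ?LJ (set (j # js))))"
        unfolding Z by (rule lattice_rank_coord_ge[OF is_lattice_zeros_in[OF latJ]])
      then show ?thesis using n by (intro exI[of _ n]) auto
    qed
  qed
  obtain js where js: "set js = (UNIV :: 'm set)" using finite_list[of "UNIV :: 'm set"] by auto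
  have "Poly_Mapping.single u c \<in> P \<longleftrightarrow> keys u \<inter> J \<noteq> {}" if c: "c \<noteq> 0" for u c
  proof
    assume "Poly_Mapping.single u c \<in> P"
    then have "Poly_Mapping.single 0 (inverse c) * Poly_Mapping.single u c \<in> P" by (rule is_ideal_mult[OF prime_idealD(1)[OF P]])
    then have "Poly_Mapping.single u 1 \<in> P" using c by (simp add: mult_single)
    from prime_monomial[OF P this] show "keys u \<inter> J \<noteq> {}" by (auto simp: J_def)
  next
    assume "keys u \<inter> J \<noteq> {}"
    then obtain j where j: "j \<in> keys u" "Poly_Mapping.single (Poly_Mapping.single j 1) 1 \<in> P" by (auto simp: J_def)
    define v where "v = u - Poly_Mapping.single j 1"
    have uv: "u = v + Poly_Mapping.single j 1"
      by (rule poly_mapping_eqI) (use j(1) in \<open>auto simp: v_def lookup_add lookup_minus lookup_single when_def in_keys_iff\<close>)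
    have "Poly_Mapping.single v c * Poly_Mapping.single (Poly_Mapping.single j 1) 1 \<in> P"
      by (rule is_ideal_mult[OF prime_idealD(1)[OF P] j(2)])
    then show "Poly_Mapping.single u c \<in> P" using uv by (simp add: mult_single)
  qed
  then have "hom_parts js P = coord_ideal J"
    unfolding hom_parts_all[OF P js] by (auto simp: coord_ideal_def in_keys_iff)
  then have "has_chain (hom_parts js P) (card J)" by (simp add: has_chain_coord_ideal)
  from main[OF this] obtain n where n: "has_chain P n" "card J + lattice_rank ?LJ \<le> n + lattice_rank (zeros_in ?LJ UNIV)"
    unfolding js by blast
  have "lattice_rank (zeros_in ?LJ UNIV) = 0"
    by (rule lattice_rank_zero) (auto simp: zeros_in_def zero_on_def intro: poly_mapping_eqI)
  moreover have "lattice_rank L \<le> lattice_rank ?LJ + card J" by (rule lattice_rank_zeros_in[OF lat])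
  ultimately show ?thesis using n by (intro exI[of _ n]) auto
qed

subsection \<open>An upper bound for heights\<close>

text \<open>Linear independence over the coefficient field of residues modulo \<open>P\<close>; the
  factor \<open>Poly_Mapping.single 0 (a y)\<close> is the constant \<open>a y\<close>.\<close>

definition indep_mod :: "('m, 'k::field) mpoly set \<Rightarrow> ('m, 'k) mpoly set \<Rightarrow> bool" where
  "indep_mod P Y \<longleftrightarrow> (\<forall>a. (\<Sum>y\<in>Y. Poly_Mapping.single 0 (a y) * y) \<in> P \<longrightarrow> (\<forall>y\<in>Y. a y = 0))"

text \<open>Modulo \<open>P'\<close> only the summand with the power zero of \<open>f\<close>
  survives, so its coefficients vanish. The rest is \<open>f\<close> times a shorter sum, and
  \<open>f\<close> can be cancelled modulo the prime \<open>P\<close>.\<close>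

lemma indep_mod_powers_aux:
  fixes P :: "('m, 'k::field) mpoly set"
  assumes P: "prime_ideal P" and P': "is_ideal P'" and PP: "P \<subseteq> P'" and f: "f \<in> P'" "f \<notin> P" and Y: "indep_mod P' Y"
  shows "(\<Sum>i<t. (\<Sum>y\<in>Y. Poly_Mapping.single 0 (a i y) * y) * f ^ i) \<in> P \<Longrightarrow> i < t \<Longrightarrow> y \<in> Y \<Longrightarrow> a i y = 0"
proof (induction t arbitrary: a i)
  case (Suc t)
  let ?g = "\<lambda>i. \<Sum>y\<in>Y. Poly_Mapping.single 0 (a i y) * y"
  let ?r = "\<Sum>i<t. ?g (Suc i) * f ^ i"
  have "(\<Sum>i<Suc t. ?g i * f ^ i) = ?g 0 * f ^ 0 + (\<Sum>i<t. ?g (Suc i) * f ^ Suc i)" by (rule sum.lessThan_Suc_shift)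
  also have "(\<Sum>i<t. ?g (Suc i) * f ^ Suc i) = f * ?r" by (simp add: sum_distrib_left mult_ac)
  finally have e: "?g 0 + f * ?r \<in> P" using Suc.prems(1) by simp
  then have "(?g 0 + f * ?r) - ?r * f \<in> P'" using PP by (intro is_ideal_diff[OF P'] is_ideal_mult[OF P' f(1)]) blast
  then have "?g 0 \<in> P'" by (simp add: mult.commute)
  then have a0: "a 0 y = 0" if "y \<in> Y" for y using Y that unfolding indep_mod_def by blast
  then have "?g 0 = 0" by (intro sum.neutral) simp
  then have "f * ?r \<in> P" using e by simp
  from prime_idealD(3)[OF P this] f(2) have r: "?r \<in> P" by (elim disjE) simp_all
  show ?case
  proof (cases i)
    case 0
    then show ?thesis using a0[OF Suc.prems(3)] by (simp only:)
  next
    case (Suc i')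
    then have "i' < t" using Suc.prems(2) by simp
    from Suc.IH[of "\<lambda>i. a (Suc i)", OF r this Suc.prems(3)] show ?thesis unfolding Suc .
  qed
qed (simp only: not_less_zero)

lemma indep_mod_powers:
  fixes P :: "('m, 'k::field) mpoly set" and t :: nat
  assumes P: "prime_ideal P" and P': "is_ideal P'" and PP: "P \<subseteq> P'" and f: "f \<in> P'" "f \<notin> P"
    and Y: "indep_mod P' Y" "finite Y"
  defines "Z \<equiv> (\<lambda>(y, i). y * f ^ i) ` (Y \<times> {..<t})"
  shows "indep_mod P Z" "card Z = card Y * t"
proof -
  let ?h = "\<lambda>(y, i). y * f ^ i"
  have fin: "finite (Y \<times> {..<t})" using Y by simp
  have key: "\<forall>p\<in>Y \<times> {..<t}. a p = 0" if s: "(\<Sum>p\<in>Y \<times> {..<t}. Poly_Mapping.single 0 (a p) * ?h p) \<in> P" for a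
  proof -
    have "(\<Sum>p\<in>Y \<times> {..<t}. Poly_Mapping.single 0 (a p) * ?h p) =
       (\<Sum>y\<in>Y. \<Sum>i<t. Poly_Mapping.single 0 (a (y, i)) * (y * f ^ i))"
      by (simp add: sum.cartesian_product split_def)
    also have "\<dots> = (\<Sum>i<t. \<Sum>y\<in>Y. Poly_Mapping.single 0 (a (y, i)) * (y * f ^ i))" by (rule sum.swap)
    also have "\<dots> = (\<Sum>i<t. (\<Sum>y\<in>Y. Poly_Mapping.single 0 (a (y, i)) * y) * f ^ i)"
      by (simp add: sum_distrib_right mult.assoc)
    finally have "(\<Sum>i<t. (\<Sum>y\<in>Y. Poly_Mapping.single 0 (a (y, i)) * y) * f ^ i) \<in> P" using s by simp
    from indep_mod_powers_aux[OF P P' PP f Y(1) this] show ?thesis by auto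
  qed
  have inj: "inj_on ?h (Y \<times> {..<t})"
  proof (rule inj_onI, rule ccontr)
    fix p p' assume p: "p \<in> Y \<times> {..<t}" "p' \<in> Y \<times> {..<t}" "?h p = ?h p'" "p \<noteq> p'"
    let ?a = "\<lambda>z. if z = p then 1 else if z = p' then - 1 else (0::'k)"
    have "(\<Sum>z\<in>Y \<times> {..<t}. Poly_Mapping.single 0 (?a z) * ?h z) = (\<Sum>z\<in>{p, p'}. Poly_Mapping.single 0 (?a z) * ?h z)"
      by (rule sum.mono_neutral_right) (use fin p in auto)
    also have "\<dots> = Poly_Mapping.single 0 1 * ?h p + Poly_Mapping.single 0 (- 1) * ?h p'" using p(4) by simp
    also have "\<dots> = 0" unfolding p(3) by (simp add: single_uminus)
    finally have "(\<Sum>z\<in>Y \<times> {..<t}. Poly_Mapping.single 0 (?a z) * ?h z) \<in> P" using is_ideal_zero[OF prime_idealD(1)[OF P]] by simp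
    from key[OF this] p(1) have "?a p = 0" by (rule bspec)
    then show False by simp
  qed
  show "card Z = card Y * t" unfolding Z_def by (simp add: card_image[OF inj] card_cartesian_product)
  show "indep_mod P Z" unfolding indep_mod_def Z_def
  proof (intro allI impI)
    fix a assume "(\<Sum>y\<in>?h ` (Y \<times> {..<t}). Poly_Mapping.single 0 (a y) * y) \<in> P"
    then have "(\<Sum>p\<in>Y \<times> {..<t}. Poly_Mapping.single 0 (a (?h p)) * ?h p) \<in> P" by (simp add: sum.reindex[OF inj])
    from key[OF this] show "\<forall>y\<in>?h ` (Y \<times> {..<t}). a y = 0" by blast
  qed
qed

definition exp_bounded :: "nat \<Rightarrow> ('m, 'k::comm_ring_1) mpoly \<Rightarrow> bool" where
  "exp_bounded N f \<longleftrightarrow> (\<forall>u\<in>keys f. \<forall>j. lookup u j \<le> N)"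

lemma exp_bounded_mult: "exp_bounded M f \<Longrightarrow> exp_bounded N g \<Longrightarrow> exp_bounded (M + N) (f * g)"
  unfolding exp_bounded_def
proof (intro ballI allI)
  fix w j assume h: "\<forall>u\<in>keys f. \<forall>j. lookup u j \<le> M" "\<forall>u\<in>keys g. \<forall>j. lookup u j \<le> N" and w: "w \<in> keys (f * g)"
  obtain u v where "u \<in> keys f" "v \<in> keys g" "w = u + v" using keys_mult[of f g] w by blast
  then show "lookup w j \<le> M + N" using h by (simp add: lookup_add add_mono)
qed

lemma exp_bounded_power: "exp_bounded M f \<Longrightarrow> exp_bounded (i * M) (f ^ i)"
proof (induction i)
  case 0
  have "(1 :: ('a, 'b) mpoly) = Poly_Mapping.single 0 1" by simp
  then show ?case by (simp add: exp_bounded_def)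
next
  case (Suc i)
  then show ?case using exp_bounded_mult[of M f "i * M" "f ^ i"] by simp
qed

lemma ex_exp_bounded: "\<exists>M. exp_bounded M (f :: ('m::finite, 'k::comm_ring_1) mpoly)"
proof -
  define M where "M = (\<Sum>u\<in>keys f. \<Sum>j\<in>UNIV. lookup u j)"
  have "lookup u j \<le> M" if "u \<in> keys f" for u j
  proof -
    have "lookup u j \<le> (\<Sum>j\<in>UNIV. lookup u j)" by (rule member_le_sum) auto
    also have "\<dots> \<le> M" unfolding M_def by (rule member_le_sum[of u]) (use that in auto)
    finally show ?thesis .
  qed
  then show ?thesis unfolding exp_bounded_def by blast
qed

lemma card_exp_box: "finite {u :: 'm::finite \<Rightarrow>\<^sub>0 nat. \<forall>j. lookup u j \<le> N}"
  "card {u :: 'm::finite \<Rightarrow>\<^sub>0 nat. \<forall>j. lookup u j \<le> N} \<le> Suc N ^ CARD('m)"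
proof -
  let ?S = "{u :: 'm \<Rightarrow>\<^sub>0 nat. \<forall>j. lookup u j \<le> N}" and ?T = "Pi\<^sub>E (UNIV :: 'm set) (\<lambda>_. {..N})"
  have inj: "inj_on lookup ?S" by (rule inj_onI) (simp only: lookup_inject)
  have im: "lookup ` ?S \<subseteq> ?T" by auto
  have fT: "finite ?T" by (rule finite_PiE) auto
  show "finite ?S" using finite_imageD[OF finite_subset[OF im fT] inj] .
  have "card ?S = card (lookup ` ?S)" by (rule card_image[OF inj, symmetric])
  also have "\<dots> \<le> card ?T" by (rule card_mono[OF fT im])
  also have "\<dots> = Suc N ^ CARD('m)" by (simp add: card_PiE)
  finally show "card ?S \<le> Suc N ^ CARD('m)" .
qed

lemma indep_mod_card_le:
  fixes Y :: "('m::finite, 'k::field) mpoly set"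
  assumes Y: "indep_mod P Y" "finite Y" and P: "0 \<in> P" and b: "\<And>y. y \<in> Y \<Longrightarrow> exp_bounded N y"
  shows "card Y \<le> Suc N ^ CARD('m)"
proof (rule ccontr)
  assume n: "\<not> card Y \<le> Suc N ^ CARD('m)"
  let ?S = "{u :: 'm \<Rightarrow>\<^sub>0 nat. \<forall>j. lookup u j \<le> N}"
  have "card ?S < card Y" using n card_exp_box(2)[where 'm = 'm, of N] by linarith
  then obtain c where c: "\<exists>y\<in>Y. c y \<noteq> (0::'k)" "\<forall>u\<in>?S. (\<Sum>y\<in>Y. c y * lookup y u) = 0"
    using homogeneous_system_nontrivial[of ?S Y lookup] card_exp_box(1) Y(2) by blast
  have l: "lookup (Poly_Mapping.single 0 a * y) u = a * lookup y u" for a :: 'k and y :: "('m, 'k) mpoly" and u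
    by (induction y rule: mpoly_induct) (auto simp: mult_single lookup_single when_def lookup_add distrib_left)
  have "(\<Sum>y\<in>Y. Poly_Mapping.single 0 (c y) * y) = 0"
  proof (rule poly_mapping_eqI)
    fix u
    have "(\<Sum>y\<in>Y. c y * lookup y u) = 0"
    proof (cases "u \<in> ?S")
      case False
      have "lookup y u = 0" if "y \<in> Y" for y
        using b[OF that] False unfolding exp_bounded_def by (auto simp: in_keys_iff)
      then show ?thesis by (intro sum.neutral) simp
    qed (use c(2) in blast)
    then show "lookup (\<Sum>y\<in>Y. Poly_Mapping.single 0 (c y) * y) u = lookup 0 u" by (simp add: lookup_sum l)
  qed
  then have "(\<Sum>y\<in>Y. Poly_Mapping.single 0 (c y) * y) \<in> P" using P by simp
  then show False using Y(1) c(1) unfolding indep_mod_def by blast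
qed

text \<open>Going down a chain of primes, multiplication by powers of one new element multiplies by \<open>t\<close> the number of
  linearly independent residues with exponents of order \<open>t\<close>, while there are only \<open>O(t\<^sup>m)\<close> monomials of this size.\<close>

lemma chain_length_bound:
  fixes P :: "('m::finite, 'k::field) mpoly set"
  assumes B: "\<And>f. f \<in> P \<Longrightarrow> (\<forall>u\<in>keys f. keys u \<subseteq> B) \<Longrightarrow> f = 0" and n: "has_chain P n"
  shows "card B + n \<le> CARD('m)"
proof -
  obtain c where c: "\<forall>i\<le>n. prime_ideal (c i)" "\<forall>i<n. c i \<subset> c (Suc i)" "c n = P"
    using n unfolding has_chain_def by blast
  have "\<exists>D. \<forall>t. \<exists>Y. finite Y \<and> indep_mod (c (n - i)) Y \<and> card Y = t ^ (card B + i) \<and> (\<forall>y\<in>Y. exp_bounded (D * t) y)"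
    if "i \<le> n" for i
    using that
  proof (induction i)
    case 0
    \<comment> \<open>The start is the set of \<open>t ^ card B\<close> monomials in the variables
      \<open>B\<close> with exponents below \<open>t\<close>, independent because \<open>P\<close>
      contains no nonzero polynomial in these variables.\<close>
    have "\<exists>Y. finite Y \<and> indep_mod P Y \<and> card Y = t ^ card B \<and> (\<forall>y\<in>Y. exp_bounded (1 * t) y)" for t
    proof -
      let ?F = "{h :: 'm \<Rightarrow> nat. (\<forall>j\<in>B. h j < t) \<and> (\<forall>j. j \<notin> B \<longrightarrow> h j = 0)}"
      let ?S = "{u :: 'm \<Rightarrow>\<^sub>0 nat. keys u \<subseteq> B \<and> (\<forall>j\<in>B. lookup u j < t)}"
      let ?x = "\<lambda>u :: 'm \<Rightarrow>\<^sub>0 nat. Poly_Mapping.single u (1::'k)"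
      have bij: "bij_betw (\<lambda>u. restrict (lookup u) B) ?S (Pi\<^sub>E B (\<lambda>_. {..<t}))"
      proof (rule bij_betwI[where g = "\<lambda>h. Abs_poly_mapping (\<lambda>j. if j \<in> B then h j else 0)"])
        have l: "lookup (Abs_poly_mapping (\<lambda>j. if j \<in> B then h j else 0)) i = (if i \<in> B then h i else 0)" for h :: "'m \<Rightarrow> nat" and i
          by simp
        show "(\<lambda>u. restrict (lookup u) B) \<in> ?S \<rightarrow> Pi\<^sub>E B (\<lambda>_. {..<t})" by auto
        show "(\<lambda>h. Abs_poly_mapping (\<lambda>j. if j \<in> B then h j else 0)) \<in> Pi\<^sub>E B (\<lambda>_. {..<t}) \<rightarrow> ?S"
          by (auto simp: in_keys_iff l split: if_splits)
        show "Abs_poly_mapping (\<lambda>j. if j \<in> B then restrict (lookup u) B j else 0) = u" if "u \<in> ?S" for u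
          by (rule poly_mapping_eqI) (use that in \<open>auto simp: l in_keys_iff\<close>)
        show "restrict (lookup (Abs_poly_mapping (\<lambda>j. if j \<in> B then h j else 0))) B = h" if "h \<in> Pi\<^sub>E B (\<lambda>_. {..<t})" for h
          using that by (auto simp: l PiE_def extensional_def restrict_def)
      qed
      have cS: "card ?S = t ^ card B" using bij_betw_same_card[OF bij] by (simp add: card_PiE)
      have fS: "finite ?S" using bij_betw_finite[OF bij] by (simp add: finite_PiE)
      have inj: "inj_on ?x ?S" by (rule inj_onI) (metis keys_single singleton_inject zero_neq_one)
      have "indep_mod P (?x ` ?S)" unfolding indep_mod_def
      proof (intro allI impI)
        fix a assume s: "(\<Sum>y\<in>?x ` ?S. Poly_Mapping.single 0 (a y) * y) \<in> P"
        have e: "(\<Sum>y\<in>?x ` ?S. Poly_Mapping.single 0 (a y) * y) = (\<Sum>u\<in>?S. Poly_Mapping.single u (a (?x u)))"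
          by (simp add: sum.reindex[OF inj] mult_single)
        have l: "lookup (\<Sum>u\<in>?S. Poly_Mapping.single u (a (?x u))) v = (if v \<in> ?S then a (?x v) else 0)" for v
        proof -
          have "lookup (\<Sum>u\<in>?S. Poly_Mapping.single u (a (?x u))) v = (\<Sum>u\<in>?S. if u = v then a (?x v) else 0)"
            unfolding lookup_sum by (rule sum.cong) (auto simp: lookup_single when_def)
          then show ?thesis using fS by (simp only: sum.delta)
        qed
        have "(\<Sum>u\<in>?S. Poly_Mapping.single u (a (?x u))) = 0"
        proof (rule B)
          show "(\<Sum>u\<in>?S. Poly_Mapping.single u (a (?x u))) \<in> P" using s unfolding e .
          show "\<forall>u\<in>keys (\<Sum>u\<in>?S. Poly_Mapping.single u (a (?x u))). keys u \<subseteq> B"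
            by (auto simp: in_keys_iff[of _ "\<Sum>u\<in>?S. Poly_Mapping.single u (a (?x u))"] l split: if_splits)
        qed
        then have "(if v \<in> ?S then a (?x v) else 0) = 0" for v using l[of v] by simp
        then show "\<forall>y\<in>?x ` ?S. a y = 0" by (metis (no_types, lifting) imageE)
      qed
      moreover have "exp_bounded (1 * t) y" if yS: "y \<in> ?x ` ?S" for y
      proof -
        obtain u where u: "u \<in> ?S" "y = ?x u" using yS by (elim imageE)
        have "lookup u j \<le> t" for j
        proof (cases "j \<in> B")
          case False
          then have "j \<notin> keys u" using u(1) by blast
          then show ?thesis by (simp add: in_keys_iff)
        qed (use u(1) in \<open>simp add: less_imp_le\<close>)
        then show ?thesis unfolding u(2) exp_bounded_def by simp
      qed
      ultimately show ?thesis using fS cS card_image[OF inj] by (intro exI[of _ "?x ` ?S"]) auto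
    qed
    then show ?case using c(3) by (intro exI[of _ 1]) simp
  next
    case (Suc i)
    then obtain D where D: "\<And>t. \<exists>Y. finite Y \<and> indep_mod (c (n - i)) Y \<and> card Y = t ^ (card B + i) \<and> (\<forall>y\<in>Y. exp_bounded (D * t) y)"
      by auto
    have ni: "Suc (n - Suc i) = n - i" "n - Suc i < n" using Suc.prems by auto
    have sub: "c (n - Suc i) \<subset> c (n - i)" using c(2) ni by metis
    have pr: "prime_ideal (c (n - Suc i))" "prime_ideal (c (n - i))" using c(1) by auto
    obtain f where f: "f \<in> c (n - i)" "f \<notin> c (n - Suc i)" using sub by blast
    obtain M where M: "exp_bounded M f" using ex_exp_bounded by blast
    have "\<exists>Y. finite Y \<and> indep_mod (c (n - Suc i)) Y \<and> card Y = t ^ (card B + Suc i) \<and> (\<forall>y\<in>Y. exp_bounded ((D + M) * t) y)" for t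
    proof -
      obtain Y where Y: "finite Y" "indep_mod (c (n - i)) Y" "card Y = t ^ (card B + i)" "\<forall>y\<in>Y. exp_bounded (D * t) y"
        using D by blast
      let ?Z = "(\<lambda>(y, i). y * f ^ i) ` (Y \<times> {..<t})"
      note Z = indep_mod_powers[OF pr(1) prime_idealD(1)[OF pr(2)] psubset_imp_subset[OF sub] f Y(2,1), of t]
      have "exp_bounded ((D + M) * t) z" if zZ: "z \<in> ?Z" for z
      proof -
        obtain y i where z: "y \<in> Y" "i < t" "z = y * f ^ i" using zZ by auto
        have "exp_bounded (D * t + i * M) z" unfolding z(3)
          by (rule exp_bounded_mult[OF _ exp_bounded_power[OF M]]) (use Y z in blast)
        moreover have "D * t + i * M \<le> (D + M) * t" using mult_le_mono1[of i t M] z(2) by (simp add: algebra_simps)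
        ultimately show ?thesis unfolding exp_bounded_def by (meson order_trans)
      qed
      then show ?thesis using Z Y(1,3) by (intro exI[of _ ?Z]) auto
    qed
    then show ?case by blast
  qed
  from this[of n] obtain D where D: "\<And>t. \<exists>Y. finite Y \<and> indep_mod (c 0) Y \<and> card Y = t ^ (card B + n) \<and> (\<forall>y\<in>Y. exp_bounded (D * t) y)"
    by auto
  have 0: "0 \<in> c 0" using c(1) is_ideal_zero[OF prime_idealD(1)] by blast
  show ?thesis
  proof (rule ccontr)
    assume nl: "\<not> card B + n \<le> CARD('m)"
    \<comment> \<open>Since \<open>Suc (D * t) \<le> Suc D * t\<close>, the number of available
      monomials is at most \<open>Suc D ^ CARD('m)\<close> times \<open>t ^ CARD('m)\<close>;
      \<open>t\<close> is chosen to exceed the first factor.\<close>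
    define t where "t = Suc (Suc D ^ CARD('m))"
    obtain Y where Y: "finite Y" "indep_mod (c 0) Y" "card Y = t ^ (card B + n)" "\<forall>y\<in>Y. exp_bounded (D * t) y"
      using D by blast
    have t1: "t \<ge> 1" by (simp add: t_def)
    have "t ^ Suc (CARD('m)) \<le> t ^ (card B + n)" by (rule power_increasing[OF _ t1]) (use nl in simp)
    also have "\<dots> \<le> Suc (D * t) ^ CARD('m)" using indep_mod_card_le[OF Y(2,1) 0] Y(3,4) by simp
    also have "\<dots> \<le> (Suc D * t) ^ CARD('m)" by (rule power_mono) (use t1 in auto)
    also have "\<dots> = Suc D ^ CARD('m) * t ^ CARD('m)" by (simp only: power_mult_distrib)
    also have "\<dots> < t * t ^ CARD('m)" using t1 by (intro mult_strict_right_mono) (auto simp: t_def)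
    finally show False by simp
  qed
qed

text \<open>Zorn's lemma gives an ideal above \<open>I\<close> that is maximal among those disjoint
  from \<open>T\<close>. Adjoining either of two outside elements meets \<open>T\<close>, and the
  product of the two resulting members of \<open>T\<close> shows that the maximal ideal is
  prime.\<close>

lemma ex_prime_avoiding:
  fixes I T :: "'a::comm_ring_1 set"
  assumes I: "is_ideal I" and T: "1 \<in> T" "\<And>a b. a \<in> T \<Longrightarrow> b \<in> T \<Longrightarrow> a * b \<in> T" and IT: "I \<inter> T = {}"
  shows "\<exists>P. prime_ideal P \<and> I \<subseteq> P \<and> P \<inter> T = {}"
proof -
  define \<A> where "\<A> = {Q. is_ideal Q \<and> I \<subseteq> Q \<and> Q \<inter> T = {}}"
  have "\<A> \<noteq> {}" using I IT by (auto simp: \<A>_def)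
  moreover have "\<Union>\<C> \<in> \<A>" if C: "\<C> \<noteq> {}" "subset.chain \<A> \<C>" for \<C>
  proof -
    have CA: "\<And>Q. Q \<in> \<C> \<Longrightarrow> is_ideal Q \<and> I \<subseteq> Q \<and> Q \<inter> T = {}" using C(2) by (auto simp: subset.chain_def \<A>_def)
    have "is_ideal (\<Union>\<C>)"
    proof (rule is_idealI)
      show "0 \<in> \<Union>\<C>" using C(1) CA is_ideal_zero by blast
      fix a b assume "a \<in> \<Union>\<C>" "b \<in> \<Union>\<C>"
      then obtain Q R where QR: "Q \<in> \<C>" "R \<in> \<C>" "a \<in> Q" "b \<in> R" by blast
      then have "Q \<subseteq> R \<or> R \<subseteq> Q" using C(2) unfolding subset.chain_def by blast
      then show "a + b \<in> \<Union>\<C>" using QR CA is_ideal_add by blast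
    next
      fix a c assume "a \<in> \<Union>\<C>"
      then show "c * a \<in> \<Union>\<C>" using CA is_ideal_mult by blast
    qed
    moreover have "I \<subseteq> \<Union>\<C>" using C(1) CA by blast
    moreover have "\<Union>\<C> \<inter> T = {}" using CA by blast
    ultimately show ?thesis by (simp add: \<A>_def)
  qed
  ultimately obtain P where P: "P \<in> \<A>" and max: "\<And>Q. Q \<in> \<A> \<Longrightarrow> P \<subseteq> Q \<Longrightarrow> Q = P"
    using subset_Zorn_nonempty[of \<A>] by metis
  have iP: "is_ideal P" "I \<subseteq> P" "P \<inter> T = {}" using P by (auto simp: \<A>_def)
  have ext: "\<exists>p r. p \<in> P \<and> p + r * a \<in> T" if a: "a \<notin> P" for a
  proof (rule ccontr)
    assume n: "\<nexists>p r. p \<in> P \<and> p + r * a \<in> T"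
    let ?Q = "{p + r * a | p r. p \<in> P}"
    have "is_ideal ?Q"
    proof (rule is_idealI)
      show "0 \<in> ?Q" using is_ideal_zero[OF iP(1)] by (intro CollectI exI[of _ 0]) simp
      fix x y assume "x \<in> ?Q" "y \<in> ?Q"
      then obtain p r p' r' where "p \<in> P" "p' \<in> P" "x = p + r * a" "y = p' + r' * a" by blast
      then have "x + y = (p + p') + (r + r') * a" "p + p' \<in> P" using is_ideal_add[OF iP(1)] by (auto simp: algebra_simps)
      then show "x + y \<in> ?Q" by blast
    next
      fix x c assume "x \<in> ?Q"
      then obtain p r where "p \<in> P" "x = p + r * a" by blast
      then have "c * x = c * p + (c * r) * a" "c * p \<in> P" using is_ideal_mult[OF iP(1), of p c] by (simp_all add: distrib_left mult.assoc)
      then show "c * x \<in> ?Q" by blast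
    qed
    moreover have PQ: "P \<subseteq> ?Q"
    proof
      fix p assume "p \<in> P"
      then show "p \<in> ?Q" by (intro CollectI exI[of _ p] exI[of _ 0]) simp
    qed
    moreover have "?Q \<inter> T = {}" using n by blast
    ultimately have "?Q = P" using iP(2) by (intro max) (auto simp: \<A>_def)
    moreover have "a \<in> ?Q" using is_ideal_zero[OF iP(1)] by (intro CollectI exI[of _ 0] exI[of _ 1]) simp
    ultimately show False using a by blast
  qed
  have "prime_ideal P"
  proof (rule prime_idealI[OF iP(1)])
    show "1 \<notin> P" using iP(3) T(1) by blast
    fix a b assume ab: "a * b \<in> P"
    show "a \<in> P \<or> b \<in> P"
    proof (rule ccontr)
      assume "\<not> (a \<in> P \<or> b \<in> P)"
      then obtain p r p' r' where h: "p \<in> P" "p + r * a \<in> T" "p' \<in> P" "p' + r' * b \<in> T" using ext by metis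
      have "(p + r * a) * (p' + r' * b) = (p' + r' * b) * p + ((r * a) * p' + (r * r') * (a * b))" by (simp add: algebra_simps)
      also have "\<dots> \<in> P" by (intro is_ideal_add[OF iP(1)] is_ideal_mult[OF iP(1)] h ab)
      finally show False using T(2)[OF h(2,4)] iP(3) by blast
    qed
  qed
  then show ?thesis using iP by blast
qed

text \<open>The nonzero polynomials in the variables \<open>B\<close> form a multiplicatively closed
  set disjoint from \<open>I\<close>. A prime above \<open>I\<close> that avoids it satisfies the
  assumption of \<open>chain_length_bound\<close>.\<close>

lemma ex_prime_height_le:
  fixes I :: "('m::finite, 'k::field) mpoly set"
  assumes I: "is_ideal I" and B: "\<And>f. f \<in> I \<Longrightarrow> (\<forall>u\<in>keys f. keys u \<subseteq> B) \<Longrightarrow> f = 0"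
  shows "\<exists>P. prime_ideal P \<and> I \<subseteq> P \<and> prime_height P \<le> enat (CARD('m) - card B)"
proof -
  define T where "T = {f :: ('m, 'k) mpoly. f \<noteq> 0 \<and> (\<forall>u\<in>keys f. keys u \<subseteq> B)}"
  have one: "(1 :: ('m, 'k) mpoly) = Poly_Mapping.single 0 1" by simp
  have "\<exists>P. prime_ideal P \<and> I \<subseteq> P \<and> P \<inter> T = {}"
  proof (rule ex_prime_avoiding[OF I])
    have "keys (1 :: ('m, 'k) mpoly) = {0}" by (simp add: one del: single_one)
    then show "1 \<in> T" by (simp add: T_def)
    show "f * g \<in> T" if fg: "f \<in> T" "g \<in> T" for f g
    proof -
      have "prime_ideal ({0} :: ('m, 'k) mpoly set)" using prime_ideal_coord_ideal[of "{}"] by (simp add: coord_ideal_empty)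
      then have "f * g \<noteq> 0" using prime_idealD(3)[of "{0}" f g] fg by (auto simp: T_def)
      moreover have "keys u \<subseteq> B" if u: "u \<in> keys (f * g)" for u
      proof -
        obtain v w where vw: "v \<in> keys f" "w \<in> keys g" "u = v + w" using keys_mult[of f g] u by blast
        then have "keys v \<subseteq> B" "keys w \<subseteq> B" using fg by (auto simp: T_def)
        then show ?thesis unfolding vw(3) keys_add_nat by blast
      qed
      ultimately show ?thesis by (simp add: T_def)
    qed
    show "I \<inter> T = {}" using B by (auto simp: T_def)
  qed
  then obtain P where P: "prime_ideal P" "I \<subseteq> P" "P \<inter> T = {}" by blast
  have "n \<le> CARD('m) - card B" if "has_chain P n" for n
  proof -
    have "card B + n \<le> CARD('m)" by (rule chain_length_bound[OF _ that]) (use P(3) in \<open>auto simp: T_def\<close>)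
    then show ?thesis by simp
  qed
  then have "prime_height P \<le> enat (CARD('m) - card B)" unfolding prime_height_eq by (intro Sup_least) auto
  then show ?thesis using P by blast
qed

subsection \<open>Lattice ideals\<close>

definition of_nat_vec :: "('m \<Rightarrow>\<^sub>0 nat) \<Rightarrow> ('m \<Rightarrow>\<^sub>0 int)" where
  "of_nat_vec u = Poly_Mapping.map int u"

lemma lookup_of_nat_vec [simp]: "lookup (of_nat_vec u) i = int (lookup u i)"
  by (simp add: of_nat_vec_def Poly_Mapping.map.rep_eq when_def)

lemma of_nat_vec_0 [simp]: "of_nat_vec 0 = 0"
  by (rule poly_mapping_eqI) simp

lemma of_nat_vec_add: "of_nat_vec (u + v) = of_nat_vec u + of_nat_vec v"
  by (rule poly_mapping_eqI) (simp add: lookup_add)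

lemma of_nat_vec_inj: "of_nat_vec u = of_nat_vec v \<longleftrightarrow> u = v"
proof
  assume e: "of_nat_vec u = of_nat_vec v"
  show "u = v"
  proof (rule poly_mapping_eqI)
    fix i show "lookup u i = lookup v i" using arg_cong[OF e, of "\<lambda>x. lookup x i"] by simp
  qed
qed simp

lemma nonneg_of_nat_vec: "nonneg (of_nat_vec u)"
  by (simp add: nonneg_def)

lemma of_nat_vec_pos_part: "nonneg x \<Longrightarrow> of_nat_vec (pos_part x) = x"
  by (rule poly_mapping_eqI) (simp add: nonneg_def lookup_pos_part)

lemma pos_minus_neg_part: "of_nat_vec (pos_part \<alpha>) - of_nat_vec (neg_part \<alpha>) = \<alpha>"
  by (rule poly_mapping_eqI) (simp add: lookup_minus lookup_pos_part lookup_neg_part)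

lemma keys_pos_part: "keys (pos_part \<alpha>) = pos_keys \<alpha>"
  by (auto simp: in_keys_iff lookup_pos_part pos_keys_def)

lemma keys_neg_part: "keys (neg_part \<alpha>) = neg_keys \<alpha>"
  by (auto simp: in_keys_iff lookup_neg_part neg_keys_def)

lemma pos_part_scale:
  "pos_part (frag_cmul (int n) (of_nat_vec (pos_part \<alpha>))) = pos_part (frag_cmul (int n) \<alpha>)"
  "pos_part (frag_cmul (int n) (of_nat_vec (neg_part \<alpha>))) = neg_part (frag_cmul (int n) \<alpha>)"
  by (rule poly_mapping_eqI, simp add: lookup_pos_part lookup_neg_part nat_mult_distrib flip: mult_minus_right)+

lemma single_power:
  "(Poly_Mapping.single u c :: ('m, 'k::comm_ring_1) mpoly) ^ n =
    Poly_Mapping.single (pos_part (frag_cmul (int n) (of_nat_vec u))) (c ^ n)"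
proof (induction n)
  case 0
  have "pos_part 0 = (0 :: 'm \<Rightarrow>\<^sub>0 nat)" by (rule poly_mapping_eqI) (simp add: lookup_pos_part)
  then show ?case by simp
next
  case (Suc i)
  have "u + pos_part (frag_cmul (int i) (of_nat_vec u)) = pos_part (frag_cmul (int (Suc i)) (of_nat_vec u))"
    by (rule poly_mapping_eqI) (simp add: lookup_add lookup_pos_part nat_mult_distrib flip: of_nat_mult of_nat_Suc)
  then show ?case by (simp add: Suc mult_single)
qed

text \<open>The truncated subtraction of exponents is exact, because the positive part of
  \<open>\<alpha>\<close> is at most \<open>u\<close>.\<close>

lemma lattice_binomial_shift:
  assumes "\<alpha> = of_nat_vec u - of_nat_vec v"
  shows "Poly_Mapping.single (u - pos_part \<alpha>) c * lattice_binomial \<rho> \<alpha> =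
    Poly_Mapping.single u c - Poly_Mapping.single v (c * \<rho> \<alpha>)"
proof -
  have "u - pos_part \<alpha> + pos_part \<alpha> = u" "u - pos_part \<alpha> + neg_part \<alpha> = v"
    by (rule poly_mapping_eqI, simp add: assms lookup_add lookup_minus lookup_pos_part lookup_neg_part)+
  then show ?thesis by (simp add: lattice_binomial_def right_diff_distrib mult_single)
qed

lemma keys_lattice_binomial: "keys (lattice_binomial \<rho> \<alpha>) \<subseteq> {pos_part \<alpha>, neg_part \<alpha>}"
  unfolding lattice_binomial_def by (auto simp: in_keys_iff lookup_minus lookup_single when_def split: if_splits)

lemma ideal_gen_mono: "S \<subseteq> T \<Longrightarrow> ideal_gen S \<subseteq> ideal_gen T"
  by (rule module.span_mono[OF module_self])

lemma ideal_gen_image_sum: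
  assumes "finite B" "x \<in> ideal_gen (f ` B)"
  shows "\<exists>g. x = (\<Sum>b\<in>B. g b * f b)"
proof -
  have "is_ideal {x. \<exists>g. x = (\<Sum>b\<in>B. g b * f b)}"
  proof (rule is_idealI)
    show "0 \<in> {x. \<exists>g. x = (\<Sum>b\<in>B. g b * f b)}" by (intro CollectI exI[of _ "\<lambda>_. 0"]) simp
    fix a b assume "a \<in> {x. \<exists>g. x = (\<Sum>b\<in>B. g b * f b)}" "b \<in> {x. \<exists>g. x = (\<Sum>b\<in>B. g b * f b)}"
    then obtain g h where "a = (\<Sum>b\<in>B. g b * f b)" "b = (\<Sum>b\<in>B. h b * f b)" by blast
    then have "a + b = (\<Sum>b\<in>B. (g b + h b) * f b)" by (simp add: distrib_right sum.distrib)
    then show "a + b \<in> {x. \<exists>g. x = (\<Sum>b\<in>B. g b * f b)}" by (intro CollectI exI)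
  next
    fix a c assume "a \<in> {x. \<exists>g. x = (\<Sum>b\<in>B. g b * f b)}"
    then obtain g where "a = (\<Sum>b\<in>B. g b * f b)" by blast
    then have "c * a = (\<Sum>b\<in>B. (c * g b) * f b)" by (simp add: sum_distrib_left mult.assoc)
    then show "c * a \<in> {x. \<exists>g. x = (\<Sum>b\<in>B. g b * f b)}" by (intro CollectI exI)
  qed
  moreover have "f ` B \<subseteq> {x. \<exists>g. x = (\<Sum>b\<in>B. g b * f b)}"
  proof
    fix y assume "y \<in> f ` B"
    then obtain b where b: "b \<in> B" "y = f b" by blast
    have "(\<Sum>x\<in>B. (if x = b then 1 else 0) * f x) = (\<Sum>x\<in>B. if x = b then f x else 0)" by (rule sum.cong) auto
    also have "\<dots> = f b" using assms(1) b(1) by simp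
    finally show "y \<in> {x. \<exists>g. x = (\<Sum>b\<in>B. g b * f b)}" using b(2) by (intro CollectI exI[of _ "\<lambda>x. if x = b then 1 else 0"]) simp
  qed
  ultimately have "ideal_gen (f ` B) \<subseteq> {x. \<exists>g. x = (\<Sum>b\<in>B. g b * f b)}" by (intro ideal_gen_least)
  then show ?thesis using assms(2) by blast
qed

text \<open>If no power of \<open>g\<close> lay in \<open>J\<close>, some prime above
  \<open>J\<close> would avoid all powers of \<open>g\<close>.\<close>

lemma ideal_radicalI:
  fixes J :: "'a::comm_ring_1 set"
  assumes J: "is_ideal J" and g: "\<And>P. prime_ideal P \<Longrightarrow> J \<subseteq> P \<Longrightarrow> g \<in> P"
  shows "g \<in> ideal_radical J"
proof (rule ccontr)
  assume n: "g \<notin> ideal_radical J"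
  have "\<exists>P. prime_ideal P \<and> J \<subseteq> P \<and> P \<inter> range (\<lambda>n. g ^ n) = {}"
  proof (rule ex_prime_avoiding[OF J])
    show "1 \<in> range (\<lambda>n. g ^ n)" by (rule range_eqI[of _ _ 0]) simp
    show "a * b \<in> range (\<lambda>n. g ^ n)" if "a \<in> range (\<lambda>n. g ^ n)" "b \<in> range (\<lambda>n. g ^ n)" for a b
      using that by (auto simp flip: power_add)
    show "J \<inter> range (\<lambda>n. g ^ n) = {}" using n by (auto simp: ideal_radical_def)
  qed
  then obtain P where P: "prime_ideal P" "J \<subseteq> P" "P \<inter> range (\<lambda>n. g ^ n) = {}" by blast
  have "g \<in> range (\<lambda>n. g ^ n)" by (rule range_eqI[of _ _ 1]) simp
  then show False using P(3) g[OF P(1,2)] by blast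
qed

lemma ideal_radical_in_prime: "prime_ideal P \<Longrightarrow> J \<subseteq> P \<Longrightarrow> g \<in> ideal_radical J \<Longrightarrow> g \<in> P"
  unfolding ideal_radical_def by (auto intro: prime_ideal_power)

lemma subset_ideal_radical: "J \<subseteq> ideal_radical J"
proof
  fix x assume "x \<in> J"
  then show "x \<in> ideal_radical J" unfolding ideal_radical_def by (intro CollectI exI[of _ 1]) simp
qed

section \<open>Lattices with a partial character\<close>

locale lattice_char =
  fixes L :: "('m::finite \<Rightarrow>\<^sub>0 int) set" and \<rho> :: "('m \<Rightarrow>\<^sub>0 int) \<Rightarrow> 'k::field"
  assumes lat: "is_lattice L" and nz: "\<alpha> \<in> L \<Longrightarrow> \<rho> \<alpha> \<noteq> 0"
    and mult: "\<alpha> \<in> L \<Longrightarrow> \<beta> \<in> L \<Longrightarrow> \<rho> (\<alpha> + \<beta>) = \<rho> \<alpha> * \<rho> \<beta>"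
begin

lemma sublattice:
  assumes l: "is_lattice L0" and s: "L0 \<subseteq> L" shows "lattice_char L0 \<rho>"
proof (rule lattice_char.intro[OF l])
  show "\<rho> \<alpha> \<noteq> 0" if "\<alpha> \<in> L0" for \<alpha> by (rule nz[OF subsetD[OF s that]])
  show "\<rho> (\<alpha> + \<beta>) = \<rho> \<alpha> * \<rho> \<beta>" if "\<alpha> \<in> L0" "\<beta> \<in> L0" for \<alpha> \<beta>
    by (rule mult[OF subsetD[OF s that(1)] subsetD[OF s that(2)]])
qed

lemma rho_0: "\<rho> 0 = 1"
  using mult[of 0 0] nz[of 0] is_lattice_zero[OF lat] by simp

lemma rho_cmul: "\<alpha> \<in> L \<Longrightarrow> \<rho> (frag_cmul (int n) \<alpha>) = \<rho> \<alpha> ^ n"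
proof (induction n)
  case (Suc n)
  have "frag_cmul (int (Suc n)) \<alpha> = \<alpha> + frag_cmul (int n) \<alpha>"
    by (rule poly_mapping_eqI) (simp add: lookup_add algebra_simps)
  then show ?case using Suc mult[OF Suc.prems is_lattice_cmul[OF lat Suc.prems, of "int n"]] by simp
qed (simp add: rho_0)

lemma rho_uminus: "\<alpha> \<in> L \<Longrightarrow> \<rho> (- \<alpha>) * \<rho> \<alpha> = 1"
  using mult[of "- \<alpha>" \<alpha>] is_lattice_uminus[OF lat, of \<alpha>] by (simp add: rho_0)

abbreviation "F \<equiv> lattice_binomial \<rho>"

lemma lattice_ideal_eq: "L0 \<subseteq> L \<Longrightarrow> lattice_ideal L0 \<rho> = ideal_gen (F ` L0)"
  unfolding lattice_ideal_def lattice_binomial_def by (simp add: setcompr_eq_image)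

text \<open>The linear functionals \<open>x\<^sup>u \<mapsto> \<rho>(u - w)\<close> on the span of the monomials in the class of \<open>w\<close>
  vanish on the lattice ideal.\<close>

definition class_sum :: "('m \<Rightarrow>\<^sub>0 int) \<Rightarrow> ('m, 'k) mpoly \<Rightarrow> 'k" where
  "class_sum w f = (\<Sum>u\<in>keys f. if of_nat_vec u - w \<in> L then lookup f u * \<rho> (of_nat_vec u - w) else 0)"

lemma class_sum_superset:
  "finite U \<Longrightarrow> keys f \<subseteq> U \<Longrightarrow>
   class_sum w f = (\<Sum>u\<in>U. if of_nat_vec u - w \<in> L then lookup f u * \<rho> (of_nat_vec u - w) else 0)"
  unfolding class_sum_def by (rule sum.mono_neutral_left) (auto simp: in_keys_iff)

lemma class_sum_add: "class_sum w (f + g) = class_sum w f + class_sum w g"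
proof -
  let ?U = "keys f \<union> keys g" and ?t = "\<lambda>f u. if of_nat_vec u - w \<in> L then lookup f u * \<rho> (of_nat_vec u - w) else 0"
  have "class_sum w (f + g) = (\<Sum>u\<in>?U. ?t (f + g) u)"
    by (rule class_sum_superset) (use keys_add[of f g] in auto)
  also have "\<dots> = (\<Sum>u\<in>?U. ?t f u + ?t g u)" by (rule sum.cong) (simp_all add: lookup_add distrib_right)
  also have "\<dots> = class_sum w f + class_sum w g"
    unfolding sum.distrib by (subst (1 2) class_sum_superset[of ?U]) auto
  finally show ?thesis .
qed

lemma class_sum_single:
  "class_sum w (Poly_Mapping.single u c) = (if of_nat_vec u - w \<in> L then c * \<rho> (of_nat_vec u - w) else 0)"
  by (subst class_sum_superset[of "{u}"]) auto

lemma class_sum_0: "class_sum w 0 = 0"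
  by (simp add: class_sum_def)

lemma class_sum_single_mult: "class_sum w (Poly_Mapping.single u c * f) = c * class_sum (w - of_nat_vec u) f"
proof (induction f rule: mpoly_induct)
  case (1 v d)
  have "of_nat_vec (u + v) - w = of_nat_vec v - (w - of_nat_vec u)" by (simp add: of_nat_vec_add)
  then show ?case by (simp only: mult_single class_sum_single) simp
qed (simp add: distrib_left class_sum_add)

text \<open>An ideal containing the lattice ideal whose membership is tested by linear functionals.
  This makes it possible to cancel monomials and to read off the vector of a binomial.\<close>

definition closed_ideal :: "('m, 'k) mpoly set" where
  "closed_ideal = {f. \<forall>w. class_sum w f = 0}"

lemma is_ideal_closed_ideal: "is_ideal closed_ideal"
proof (rule is_idealI)
  show "c * a \<in> closed_ideal" if a: "a \<in> closed_ideal" for a c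
    by (induction c rule: mpoly_induct)
      (use a in \<open>auto simp: closed_ideal_def class_sum_single_mult class_sum_add distrib_right\<close>)
qed (auto simp: closed_ideal_def class_sum_add class_sum_0)

lemma single_mult_closed_ideal: "c \<noteq> 0 \<Longrightarrow> Poly_Mapping.single u c * f \<in> closed_ideal \<Longrightarrow> f \<in> closed_ideal"
proof -
  assume c: "c \<noteq> 0" and f: "Poly_Mapping.single u c * f \<in> closed_ideal"
  have "class_sum w f = 0" for w
  proof -
    have "class_sum (w + of_nat_vec u) (Poly_Mapping.single u c * f) = 0" using f by (simp add: closed_ideal_def)
    then show ?thesis using c by (simp add: class_sum_single_mult)
  qed
  then show "f \<in> closed_ideal" by (simp add: closed_ideal_def)
qed

lemma single_in_closed_ideal: "Poly_Mapping.single u c \<in> closed_ideal \<Longrightarrow> c = 0"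
proof -
  assume "Poly_Mapping.single u c \<in> closed_ideal"
  then have "class_sum (of_nat_vec u) (Poly_Mapping.single u c) = 0" by (simp add: closed_ideal_def)
  then show ?thesis using is_lattice_zero[OF lat] by (simp add: class_sum_single rho_0)
qed

text \<open>The functional of the class of \<open>v\<close> does not vanish on the second term, so
  it must see the first one too, with the opposite value.\<close>

lemma binomial_in_closed_ideal:
  assumes "Poly_Mapping.single u c + Poly_Mapping.single v d \<in> closed_ideal" "d \<noteq> 0"
  shows "of_nat_vec u - of_nat_vec v \<in> L \<and> c * \<rho> (of_nat_vec u - of_nat_vec v) + d = 0"
proof -
  have "class_sum (of_nat_vec v) (Poly_Mapping.single u c + Poly_Mapping.single v d) = 0"
    using assms(1) by (simp add: closed_ideal_def)
  then show ?thesis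
    using assms(2) is_lattice_zero[OF lat] by (auto simp: class_sum_add class_sum_single rho_0 split: if_splits)
qed

lemma binomial_closed_ideal:
  assumes "of_nat_vec u - of_nat_vec v \<in> L"
  shows "Poly_Mapping.single u 1 - Poly_Mapping.single v (\<rho> (of_nat_vec u - of_nat_vec v)) \<in> closed_ideal"
  unfolding closed_ideal_def
proof (intro CollectI allI)
  fix w
  let ?g = "of_nat_vec u - of_nat_vec v"
  have e: "Poly_Mapping.single u (1::'k) - Poly_Mapping.single v (\<rho> ?g) =
      Poly_Mapping.single u 1 + Poly_Mapping.single v (- \<rho> ?g)" by (simp add: single_uminus)
  have s: "of_nat_vec u - w = ?g + (of_nat_vec v - w)" by simp
  have iff: "of_nat_vec u - w \<in> L \<longleftrightarrow> of_nat_vec v - w \<in> L"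
  proof
    assume "of_nat_vec u - w \<in> L"
    from is_lattice_diff[OF lat this assms] have "(of_nat_vec u - w) - ?g \<in> L" .
    then show "of_nat_vec v - w \<in> L" by simp
  next
    assume "of_nat_vec v - w \<in> L"
    from is_lattice_add[OF lat assms this] show "of_nat_vec u - w \<in> L" by simp
  qed
  show "class_sum w (Poly_Mapping.single u 1 - Poly_Mapping.single v (\<rho> ?g)) = 0"
  proof (cases "of_nat_vec v - w \<in> L")
    case True
    from mult[OF assms True] have "\<rho> (of_nat_vec u - w) = \<rho> ?g * \<rho> (of_nat_vec v - w)" by simp
    then show ?thesis unfolding e class_sum_add class_sum_single iff by simp
  next
    case False
    then show ?thesis unfolding e class_sum_add class_sum_single iff by simp
  qed
qed

lemma lattice_ideal_subset_closed: "lattice_ideal L \<rho> \<subseteq> closed_ideal"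
  unfolding lattice_ideal_eq[OF subset_refl]
proof (rule ideal_gen_least[OF _ is_ideal_closed_ideal], rule subsetI)
  fix g assume "g \<in> F ` L"
  then obtain \<alpha> where \<alpha>: "\<alpha> \<in> L" "g = F \<alpha>" by blast
  show "g \<in> closed_ideal"
    using binomial_closed_ideal[of "pos_part \<alpha>" "neg_part \<alpha>"] \<alpha>
    by (simp add: pos_minus_neg_part lattice_binomial_def)
qed

lemma lattice_binomial_closed: "F \<alpha> \<in> closed_ideal \<Longrightarrow> \<rho> \<alpha> \<noteq> 0 \<Longrightarrow> \<alpha> \<in> L"
  using binomial_in_closed_ideal[of "pos_part \<alpha>" 1 "neg_part \<alpha>" "- \<rho> \<alpha>"]
  by (simp add: lattice_binomial_def single_uminus pos_minus_neg_part)

lemma is_ideal_lattice_ideal: "is_ideal (lattice_ideal L \<rho>)"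
  unfolding lattice_ideal_def by (rule is_ideal_gen)

lemma lattice_binomial_in: "\<alpha> \<in> L \<Longrightarrow> F \<alpha> \<in> lattice_ideal L \<rho>"
  unfolding lattice_ideal_eq[OF subset_refl] by (intro ideal_gen_base imageI)

text \<open>For the upper bound, the coordinates in \<open>C\<close> determine the vectors of
  \<open>L\<close>. Hence congruent monomials in the variables outside \<open>C\<close> coincide,
  the functionals read off single coefficients, and no nonzero polynomial in these variables lies in
  the lattice ideal. The lower bound holds for every prime above the ideal by
  \<open>has_chain_prime_above\<close>.\<close>

lemma ideal_height_lattice_ideal: "ideal_height (lattice_ideal L \<rho>) = enat (lattice_rank L)"
  unfolding ideal_height_def
proof (rule antisym)
  obtain C where C: "card C = lattice_rank L" "zeros_in L C \<subseteq> {0}" using ex_complement_coords[OF lat] by blast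
  have "f = 0" if f: "f \<in> lattice_ideal L \<rho>" and k: "\<forall>u\<in>keys f. keys u \<subseteq> - C" for f
  proof (rule ccontr)
    assume "f \<noteq> 0"
    then obtain u where u: "u \<in> keys f" by (metis keys_eq_empty ex_in_conv)
    have same: "v = u" if v: "v \<in> keys f" and vL: "of_nat_vec v - of_nat_vec u \<in> L" for v
    proof -
      have "zero_on C (of_nat_vec v - of_nat_vec u)" unfolding zero_on_def
      proof
        fix i assume "i \<in> C"
        then have "i \<notin> keys v" "i \<notin> keys u" using k v u by blast+
        then show "lookup (of_nat_vec v - of_nat_vec u) i = 0" by (simp add: lookup_minus in_keys_iff)
      qed
      then have "of_nat_vec v - of_nat_vec u = 0" using C(2) vL unfolding zeros_in_def by blast
      then show ?thesis by (simp add: of_nat_vec_inj)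
    qed
    have "class_sum (of_nat_vec u) f = (\<Sum>v\<in>keys f. if v = u then lookup f u else 0)"
      unfolding class_sum_def
    proof (rule sum.cong)
      fix v assume "v \<in> keys f"
      then show "(if of_nat_vec v - of_nat_vec u \<in> L then lookup f v * \<rho> (of_nat_vec v - of_nat_vec u) else 0) =
        (if v = u then lookup f u else 0)"
        using same is_lattice_zero[OF lat] by (auto simp: rho_0)
    qed simp
    then have "class_sum (of_nat_vec u) f = lookup f u" using u by simp
    then show False using lattice_ideal_subset_closed f u by (auto simp: closed_ideal_def in_keys_iff)
  qed
  from ex_prime_height_le[OF is_ideal_lattice_ideal this]
  obtain P where P: "prime_ideal P" "lattice_ideal L \<rho> \<subseteq> P" "prime_height P \<le> enat (CARD('m) - card (- C))" by blast
  have "CARD('m) - card (- C) = lattice_rank L"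
    using C(1) card_mono[of UNIV C] by (simp add: Compl_eq_Diff_UNIV card_Diff_subset)
  then have "prime_height P \<le> enat (lattice_rank L)" using P(3) by simp
  moreover have "Inf {prime_height P | P. prime_ideal P \<and> lattice_ideal L \<rho> \<subseteq> P} \<le> prime_height P"
    by (rule Inf_lower) (use P in blast)
  ultimately show "Inf {prime_height P | P. prime_ideal P \<and> lattice_ideal L \<rho> \<subseteq> P} \<le> enat (lattice_rank L)" by simp
  show "enat (lattice_rank L) \<le> Inf {prime_height P | P. prime_ideal P \<and> lattice_ideal L \<rho> \<subseteq> P}"
  proof (rule Inf_greatest)
    fix h assume "h \<in> {prime_height P | P. prime_ideal P \<and> lattice_ideal L \<rho> \<subseteq> P}"
    then obtain P where P: "prime_ideal P" "lattice_ideal L \<rho> \<subseteq> P" "h = prime_height P" by blast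
    have "F \<alpha> \<in> P" if "\<alpha> \<in> L" for \<alpha> using P(2) lattice_binomial_in[OF that] by blast
    from has_chain_prime_above[OF lat P(1) this] obtain n where n: "lattice_rank L \<le> n" "has_chain P n" by blast
    have "enat n \<le> prime_height P" unfolding prime_height_eq by (rule Sup_upper) (use n(2) in blast)
    then show "enat (lattice_rank L) \<le> h" using n(1) P(3) by (meson enat_ord_simps(1) order_trans)
  qed
qed

text \<open>The exponents in \<open>G ^ n\<close> are \<open>n\<close> times \<open>u\<close> minus
  multiples of \<open>\<gamma>\<close>, pairwise incongruent here, so the functional sees at most
  the leading term. Thus no power of \<open>G\<close> lies in the ideal when \<open>\<gamma>\<close>
  has infinite order modulo \<open>L\<close>. The shift by \<open>j\<close> makes the induction on
  \<open>n\<close> possible.\<close>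

lemma power_class_sum:
  fixes c d :: 'k and u v :: "'m \<Rightarrow>\<^sub>0 nat"
  defines "\<gamma> \<equiv> of_nat_vec u - of_nat_vec v" and "G \<equiv> Poly_Mapping.single u c + Poly_Mapping.single v d"
  assumes nk: "\<And>k::nat. k > 0 \<Longrightarrow> frag_cmul (int k) \<gamma> \<notin> L"
  shows "class_sum (frag_cmul (int n) (of_nat_vec u) + frag_cmul (int j) \<gamma>) (G ^ n) = (if j = 0 then c ^ n else 0)"
proof (induction n arbitrary: j)
  case 0
  have one: "(G ^ 0) = Poly_Mapping.single 0 1" by simp
  have "- frag_cmul (int j) \<gamma> \<in> L \<longleftrightarrow> j = 0"
    using nk[of j] is_lattice_uminus[OF lat, of "- frag_cmul (int j) \<gamma>"] is_lattice_zero[OF lat] by (cases "j = 0") auto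
  then show ?case unfolding one class_sum_single by (cases "j = 0") (simp_all add: rho_0)
next
  case (Suc n)
  let ?w = "frag_cmul (int (Suc n)) (of_nat_vec u) + frag_cmul (int j) \<gamma>"
  have w: "?w - of_nat_vec u = frag_cmul (int n) (of_nat_vec u) + frag_cmul (int j) \<gamma>"
    "?w - of_nat_vec v = frag_cmul (int n) (of_nat_vec u) + frag_cmul (int (Suc j)) \<gamma>"
    by (rule poly_mapping_eqI, simp add: \<gamma>_def lookup_add lookup_minus algebra_simps)+
  have "class_sum ?w (G ^ Suc n) = c * class_sum (?w - of_nat_vec u) (G ^ n) + d * class_sum (?w - of_nat_vec v) (G ^ n)"
    by (simp only: power_Suc G_def distrib_right class_sum_add class_sum_single_mult)
  then show ?case unfolding w Suc.IH by simp
qed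

text \<open>For the least \<open>N\<close> with \<open>G\<^sup>N\<close> in the ideal: if \<open>k > 0\<close> and \<open>k \<gamma> \<in> L\<close>, then \<open>G\<close> divides
  \<open>(c x\<^sup>u)\<^sup>k - (- d x\<^sup>v)\<^sup>k\<close>, which is nilpotent and a monomial modulo the ideal, hence in it; modulo \<open>G\<close> the cofactor is
  \<open>k\<close> times a monomial, so \<open>N > 1\<close> would put \<open>G\<close> to the power \<open>N - 1\<close> into the ideal.\<close>

lemma binomial_power_closed_ideal:
  fixes c d :: 'k and u v :: "'m \<Rightarrow>\<^sub>0 nat"
  assumes ch: "CHAR('k) = 0" and cd: "c \<noteq> 0" "d \<noteq> 0"
    and G: "(Poly_Mapping.single u c + Poly_Mapping.single v d) ^ n \<in> closed_ideal"
  shows "Poly_Mapping.single u c + Poly_Mapping.single v d \<in> closed_ideal"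
proof -
  define G where "G = Poly_Mapping.single u c + Poly_Mapping.single v d"
  define \<gamma> where "\<gamma> = of_nat_vec u - of_nat_vec v"
  define N where "N = (LEAST n. G ^ n \<in> closed_ideal)"
  have N: "G ^ N \<in> closed_ideal" unfolding N_def by (rule LeastI[of _ n]) (use G in \<open>simp add: G_def\<close>)
  have min: "m < N \<Longrightarrow> G ^ m \<notin> closed_ideal" for m unfolding N_def by (rule not_less_Least)
  note I = is_ideal_closed_ideal
  obtain k :: nat where k: "k > 0" "frag_cmul (int k) \<gamma> \<in> L"
  proof (rule ccontr)
    assume nt: "\<not> thesis"
    have nk: "\<And>k::nat. k > 0 \<Longrightarrow> frag_cmul (int k) \<gamma> \<notin> L" using nt that by blast
    have "class_sum (frag_cmul (int N) (of_nat_vec u) + frag_cmul (int 0) \<gamma>) (G ^ N) = c ^ N"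
      using power_class_sum[where u = u and v = v and c = c and d = d and n = N and j = 0] nk unfolding \<gamma>_def G_def by simp
    then show False using N cd(1) by (simp add: closed_ideal_def)
  qed
  define X where "X = (Poly_Mapping.single u c :: ('m, 'k) mpoly)"
  define Y where "Y = (Poly_Mapping.single v (- d) :: ('m, 'k) mpoly)"
  have GXY: "G = X - Y" by (simp add: G_def X_def Y_def single_uminus)
  let ?u = "pos_part (frag_cmul (int k) (of_nat_vec u))" and ?v = "pos_part (frag_cmul (int k) (of_nat_vec v))"
  have uvk: "of_nat_vec ?u - of_nat_vec ?v = frag_cmul (int k) \<gamma>"
    by (rule poly_mapping_eqI) (simp add: \<gamma>_def lookup_minus lookup_pos_part algebra_simps flip: of_nat_mult)
  define \<theta> where "\<theta> = \<rho> (frag_cmul (int k) \<gamma>)"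
  define e where "e = c ^ k * \<theta> - (- d) ^ k"
  have rel: "Poly_Mapping.single ?u 1 - Poly_Mapping.single ?v \<theta> \<in> closed_ideal"
    using binomial_closed_ideal[of ?u ?v] k(2) unfolding uvk \<theta>_def by simp
  define H where "H = (\<Sum>i<k. Y ^ (k - Suc i) * X ^ i)"
  have XYk: "X ^ k - Y ^ k = G * H" unfolding GXY H_def by (rule power_diff_sumr2)
  have "X ^ k - Y ^ k = Poly_Mapping.single 0 (c ^ k) * (Poly_Mapping.single ?u 1 - Poly_Mapping.single ?v \<theta>) + Poly_Mapping.single ?v e"
    unfolding X_def Y_def single_power e_def by (simp add: right_diff_distrib mult_single single_diff)
  then have sv: "Poly_Mapping.single ?v e = G * H - Poly_Mapping.single 0 (c ^ k) * (Poly_Mapping.single ?u 1 - Poly_Mapping.single ?v \<theta>)"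
    unfolding XYk by simp
  have pd: "\<exists>q. x ^ i - y ^ i = (x - y) * q" for x y :: "('m, 'k) mpoly" and i
    using power_diff_sumr2[of x i y] by blast
  have e0: "e = 0"
  proof -
    let ?R = "Poly_Mapping.single 0 (c ^ k) * (Poly_Mapping.single ?u 1 - Poly_Mapping.single ?v \<theta>)"
    obtain q where q: "(G * H) ^ N - (Poly_Mapping.single ?v e) ^ N = (G * H - Poly_Mapping.single ?v e) * q" using pd by blast
    have R: "G * H - Poly_Mapping.single ?v e = ?R" unfolding sv by simp
    have "(Poly_Mapping.single ?v e) ^ N = H ^ N * G ^ N - q * ?R" using q unfolding R by (simp add: power_mult_distrib algebra_simps)
    also have "\<dots> \<in> closed_ideal" by (intro is_ideal_diff[OF I] is_ideal_mult[OF I] N rel)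
    finally have "(Poly_Mapping.single ?v e) ^ N \<in> closed_ideal" .
    then have "e ^ N = 0" unfolding single_power by (rule single_in_closed_ideal)
    then show ?thesis by simp
  qed
  then have GH: "G * H \<in> closed_ideal"
    using is_ideal_mult[OF I rel, of "Poly_Mapping.single 0 (c ^ k)"] sv by simp
  have N0: "N > 0"
  proof (rule ccontr)
    assume "\<not> N > 0"
    then have "Poly_Mapping.single 0 (1::'k) \<in> closed_ideal" using N by simp
    then show False using single_in_closed_ideal by fastforce
  qed
  have "N = 1"
  proof (rule ccontr)
    assume "N \<noteq> 1"
    then have M: "N = Suc (Suc (N - 2))" using N0 by arith
    define M where "M = N - 2"
    note M = M[folded M_def]
    define Q where "Q = (\<lambda>i. SOME q. Y ^ i - X ^ i = (Y - X) * q)"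
    have Q: "Y ^ i - X ^ i = (Y - X) * Q i" for i unfolding Q_def by (rule someI_ex) (rule pd)
    have Y: "Y ^ i = X ^ i - G * Q i" for i using Q[of i] by (simp add: GXY algebra_simps)
    have "H = (\<Sum>i<k. X ^ (k - 1) - G * (Q (k - Suc i) * X ^ i))" unfolding H_def
    proof (rule sum.cong)
      fix i assume "i \<in> {..<k}"
      then have "X ^ (k - Suc i) * X ^ i = X ^ (k - 1)" by (simp flip: power_add)
      then show "Y ^ (k - Suc i) * X ^ i = X ^ (k - 1) - G * (Q (k - Suc i) * X ^ i)"
        unfolding Y by (simp add: left_diff_distrib mult.assoc)
    qed simp
    also have "\<dots> = of_nat k * X ^ (k - 1) - G * (\<Sum>i<k. Q (k - Suc i) * X ^ i)"
      by (simp add: sum_subtractf sum_distrib_left)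
    finally have H: "of_nat k * X ^ (k - 1) = H + G * (\<Sum>i<k. Q (k - Suc i) * X ^ i)" by simp
    have gen: "(h + g * s) * g ^ Suc M = g ^ M * (g * h) + s * g ^ Suc (Suc M)" for h g s :: "('m, 'k) mpoly"
      by (simp add: algebra_simps)
    have "(of_nat k * X ^ (k - 1)) * G ^ Suc M = G ^ M * (G * H) + (\<Sum>i<k. Q (k - Suc i) * X ^ i) * G ^ N"
      unfolding H M by (rule gen)
    also have "\<dots> \<in> closed_ideal" by (intro is_ideal_add[OF I] is_ideal_mult[OF I] GH N)
    finally have "(of_nat k * X ^ (k - 1)) * G ^ Suc M \<in> closed_ideal" .
    moreover obtain u' where u': "X ^ (k - 1) = Poly_Mapping.single u' (c ^ (k - 1))" unfolding X_def single_power by blast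
    have "of_nat k * X ^ (k - 1) = Poly_Mapping.single u' (of_nat k * c ^ (k - 1))"
      unfolding u' single_of_nat[symmetric] mult_single by simp
    moreover have "of_nat k * c ^ (k - 1) \<noteq> 0"
      using ch k(1) cd(1) by (simp add: of_nat_eq_0_iff_char_dvd)
    ultimately have "G ^ Suc M \<in> closed_ideal" using single_mult_closed_ideal by metis
    then show False using min[of "Suc M"] M by simp
  qed
  then show ?thesis using N by (simp add: G_def)
qed

end

subsection \<open>Radicals and generators of lattice ideals\<close>

text \<open>The substitution of zero for the variables in \<open>J\<close>. It only deletes terms,
  as no two exponents can become equal.\<close>

definition kill :: "'m set \<Rightarrow> ('m, 'k::comm_ring_1) mpoly \<Rightarrow> ('m, 'k) mpoly" where
  "kill J f = filt (\<lambda>u. keys u \<inter> J = {}) f"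

lemma kill_add: "kill J (f + g) = kill J f + kill J g"
  by (simp add: kill_def filt_add)

lemma kill_mult: "kill J (f * g) = kill J f * kill J g"
proof (induction f rule: mpoly_induct)
  case (1 u c)
  show ?case
    by (induction g rule: mpoly_induct)
      (auto simp: mult_single kill_def filt_single filt_add distrib_left keys_add_nat Int_Un_distrib2)
next
  case (2 f g')
  then show ?case by (simp add: distrib_right kill_add)
qed

lemma kill_power: "kill J (f ^ n) = kill J f ^ n"
proof (induction n)
  case 0
  have "kill J (Poly_Mapping.single 0 1) = (Poly_Mapping.single 0 1 :: ('a, 'b) mpoly)" by (simp add: kill_def filt_single del: single_one)
  then show ?case by simp
qed (simp add: kill_mult)

lemma kill_lattice_binomial:
  "kill J (lattice_binomial \<rho> \<alpha>) =
    (if pos_keys \<alpha> \<inter> J = {} then Poly_Mapping.single (pos_part \<alpha>) 1 else 0) -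
    (if neg_keys \<alpha> \<inter> J = {} then Poly_Mapping.single (neg_part \<alpha>) (\<rho> \<alpha>) else 0)"
  by (simp add: kill_def lattice_binomial_def filt_diff filt_single keys_pos_part keys_neg_part)

lemma zero_on_iff_keys: "zero_on J \<alpha> \<longleftrightarrow> pos_keys \<alpha> \<inter> J = {} \<and> neg_keys \<alpha> \<inter> J = {}"
  unfolding zero_on_def pos_keys_def neg_keys_def by (auto simp: disjoint_iff) (metis linorder_neqE_linordered_idom)

lemma CHAR_mpoly: "CHAR(('m, 'k::comm_ring_1) mpoly) = CHAR('k)"
proof (rule CHAR_eqI)
  have e: "of_nat n = (0 :: ('m, 'k) mpoly) \<longleftrightarrow> of_nat n = (0 :: 'k)" for n
  proof
    assume "of_nat n = (0 :: ('m, 'k) mpoly)"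
    then have "lookup (of_nat n :: ('m, 'k) mpoly) 0 = 0" by simp
    then show "of_nat n = (0 :: 'k)" by (simp add: lookup_of_nat)
  next
    assume "of_nat n = (0 :: 'k)"
    then show "of_nat n = (0 :: ('m, 'k) mpoly)" by (metis single_of_nat single_zero)
  qed
  show "of_nat CHAR('k) = (0 :: ('m, 'k) mpoly)" unfolding e by simp
  show "CHAR('k) dvd n" if "of_nat n = (0 :: ('m, 'k) mpoly)" for n
    using that unfolding e by (simp add: of_nat_eq_0_iff_char_dvd)
qed

lemma lattice_binomial_frobenius:
  fixes \<rho> :: "('m \<Rightarrow>\<^sub>0 int) \<Rightarrow> 'k::field"
  assumes p: "prime CHAR('k)"
  shows "lattice_binomial \<rho> \<alpha> ^ (CHAR('k) ^ j) =
     Poly_Mapping.single (pos_part (frag_cmul (int (CHAR('k) ^ j)) \<alpha>)) 1 -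
     Poly_Mapping.single (neg_part (frag_cmul (int (CHAR('k) ^ j)) \<alpha>)) (\<rho> \<alpha> ^ (CHAR('k) ^ j))"
proof -
  let ?p = "CHAR('k)" and ?n = "CHAR('k) ^ j"
  \<comment> \<open>Additivity of the Frobenius power gives the sign rule uniformly, in
    characteristic two as well.\<close>
  have "0 = (\<rho> \<alpha> + - \<rho> \<alpha>) ^ ?n" using p by (simp add: prime_gt_0_nat)
  also have "\<dots> = \<rho> \<alpha> ^ ?n + (- \<rho> \<alpha>) ^ ?n" by (rule freshmans_dream'[OF p refl])
  finally have m: "(- \<rho> \<alpha>) ^ ?n = - (\<rho> \<alpha> ^ ?n)" by (simp add: eq_neg_iff_add_eq_0 add.commute)
  have "lattice_binomial \<rho> \<alpha> ^ ?n = (Poly_Mapping.single (pos_part \<alpha>) 1 + Poly_Mapping.single (neg_part \<alpha>) (- \<rho> \<alpha>)) ^ ?n"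
    by (simp add: lattice_binomial_def single_uminus)
  also have "\<dots> = Poly_Mapping.single (pos_part \<alpha>) 1 ^ ?n + Poly_Mapping.single (neg_part \<alpha>) (- \<rho> \<alpha>) ^ ?n"
    by (rule freshmans_dream') (simp_all add: CHAR_mpoly p)
  finally show ?thesis unfolding single_power pos_part_scale m by (simp add: single_uminus)
qed

context lattice_char
begin

text \<open>The second half of \<open>rad\<close> isolates what depends on the characteristic. It is
  applied to the span of the vectors of \<open>B\<close> that vanish on \<open>J\<close>: setting
  the variables in \<open>J\<close> to zero turns an equation for a power of
  \<open>F \<alpha>\<close> into one over the binomials of these vectors only, that is, into
  membership in the lattice ideal of their span.\<close>

lemma mixed_basis_of_radical:
  assumes q: "q > 0" and B: "finite B" "B \<subseteq> L" "card B \<le> lattice_rank L"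
    and rad: "\<And>\<alpha>. \<alpha> \<in> L \<Longrightarrow> \<exists>n. F \<alpha> ^ n \<in> ideal_gen (F ` B) \<and>
      (\<forall>L0. is_lattice L0 \<longrightarrow> L0 \<subseteq> L \<longrightarrow> F \<alpha> ^ n \<in> lattice_ideal L0 \<rho> \<longrightarrow> (\<exists>k. frag_cmul (int q ^ k) \<alpha> \<in> L0))"
  shows "mixed_basis L q UNIV B"
proof -
  have strat: "(zero_on J \<alpha> \<or> neg_keys \<alpha> \<inter> J \<noteq> {}) \<and> (zero_on J \<alpha> \<longrightarrow> (\<exists>k. frag_cmul (int q ^ k) \<alpha> \<in> zspan {b\<in>B. zero_on J b}))"
    if J: "\<forall>b\<in>B. zero_on J b \<or> crosses pos_keys neg_keys J b" and \<alpha>: "\<alpha> \<in> L" for J \<alpha>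
  proof -
    let ?B = "{b\<in>B. zero_on J b}" and ?I = "ideal_gen (F ` {b\<in>B. zero_on J b})"
    have fB: "finite ?B" and BL: "?B \<subseteq> L" using B(1,2) by auto
    have zL: "zspan ?B \<subseteq> L" by (rule zspan_subset[OF lat BL])
    interpret Z: lattice_char "zspan ?B" \<rho> by (rule sublattice[OF is_lattice_zspan zL])
    have IZ: "?I \<subseteq> lattice_ideal (zspan ?B) \<rho>"
      unfolding lattice_ideal_eq[OF zL] by (intro ideal_gen_mono image_mono subsetI zspan_base[OF fB])
    have "is_ideal {g. kill J g \<in> ?I}"
    proof (rule is_idealI)
      show "0 \<in> {g. kill J g \<in> ?I}" using is_ideal_zero[OF is_ideal_gen, of "F ` ?B"] by (simp add: kill_def)
      show "a + b \<in> {g. kill J g \<in> ?I}" if "a \<in> {g. kill J g \<in> ?I}" "b \<in> {g. kill J g \<in> ?I}" for a b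
        using is_ideal_add[OF is_ideal_gen, of "kill J a" "F ` ?B" "kill J b"] that by (simp add: kill_add)
      show "c * a \<in> {g. kill J g \<in> ?I}" if "a \<in> {g. kill J g \<in> ?I}" for a c
        using is_ideal_mult[OF is_ideal_gen, of "kill J a" "F ` ?B" "kill J c"] that by (simp add: kill_mult)
    qed
    moreover have "F ` B \<subseteq> {g. kill J g \<in> ?I}"
    proof
      fix g assume "g \<in> F ` B"
      then obtain b where b: "b \<in> B" "g = F b" by blast
      show "g \<in> {g. kill J g \<in> ?I}"
      proof (cases "zero_on J b")
        case True
        then have "kill J g = F b" using b(2) by (simp add: kill_lattice_binomial zero_on_iff_keys) (simp add: lattice_binomial_def)
        moreover have "F b \<in> ?I" by (rule ideal_gen_base) (use b True in blast)
        ultimately show ?thesis by simp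
      next
        case False
        then have "crosses pos_keys neg_keys J b" using J b by blast
        then have "kill J g = 0" using b(2) by (simp add: kill_lattice_binomial crosses_def)
        then show ?thesis using is_ideal_zero[OF is_ideal_gen, of "F ` ?B"] by simp
      qed
    qed
    ultimately have sub: "ideal_gen (F ` B) \<subseteq> {g. kill J g \<in> ?I}" by (intro ideal_gen_least)
    obtain n where n: "F \<alpha> ^ n \<in> ideal_gen (F ` B)"
      and X: "\<And>L0. is_lattice L0 \<Longrightarrow> L0 \<subseteq> L \<Longrightarrow> F \<alpha> ^ n \<in> lattice_ideal L0 \<rho> \<Longrightarrow> \<exists>k. frag_cmul (int q ^ k) \<alpha> \<in> L0"
      using rad[OF \<alpha>] by blast
    have kn: "kill J (F \<alpha>) ^ n \<in> ?I" using subsetD[OF sub n] by (simp add: kill_power)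
    show ?thesis
    proof (cases "zero_on J \<alpha>")
      case True
      then have "kill J (F \<alpha>) = F \<alpha>" by (simp add: kill_lattice_binomial zero_on_iff_keys) (simp add: lattice_binomial_def)
      then have "F \<alpha> ^ n \<in> lattice_ideal (zspan ?B) \<rho>" using kn IZ by auto
      from X[OF is_lattice_zspan zL this] True show ?thesis by simp
    next
      case False
      have "neg_keys \<alpha> \<inter> J \<noteq> {}"
      proof
        assume e: "neg_keys \<alpha> \<inter> J = {}"
        then have "pos_keys \<alpha> \<inter> J \<noteq> {}" using False by (simp add: zero_on_iff_keys)
        then have k: "kill J (F \<alpha>) = Poly_Mapping.single (neg_part \<alpha>) (- \<rho> \<alpha>)" using e by (simp add: kill_lattice_binomial single_uminus)
        \<comment> \<open>If only the monomial of the negative part survived, a power of it would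
          lie in an ideal without nonzero terms.\<close>
        have "Poly_Mapping.single (neg_part \<alpha>) (- \<rho> \<alpha>) ^ n \<in> Z.closed_ideal"
          using kn IZ Z.lattice_ideal_subset_closed unfolding k by auto
        then have "(- \<rho> \<alpha>) ^ n = 0" unfolding single_power by (rule Z.single_in_closed_ideal)
        then show False using nz[OF \<alpha>] by simp
      qed
      then show ?thesis using False by simp
    qed
  qed
  \<comment> \<open>For empty \<open>J\<close> the preceding result says that \<open>B\<close> spans
    \<open>L\<close> up to powers of \<open>q\<close>; at most \<open>lattice_rank L\<close> vectors
    can do this only if they are independent.\<close>
  have "indep B"
  proof (rule indep_of_span_card[OF B(1) _ B(3)])
    fix \<alpha> assume \<alpha>: "\<alpha> \<in> L"
    have "\<exists>k. frag_cmul (int q ^ k) \<alpha> \<in> zspan {b\<in>B. zero_on {} b}" using strat[of "{}" \<alpha>] \<alpha> by (simp add: zero_on_def)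
    then obtain k where "frag_cmul (int q ^ k) \<alpha> \<in> zspan B" by (auto simp: zero_on_def)
    then show "\<exists>N. N \<noteq> 0 \<and> frag_cmul N \<alpha> \<in> zspan B" using q by (intro exI[of _ "int q ^ k"]) simp
  qed
  then show ?thesis unfolding mixed_basis_def using B strat by simp
qed

lemma connecting_of_radical:
  assumes pos: "positive_on L UNIV" and q: "q > 0" and B: "finite B" "B \<subseteq> L" "card B \<le> lattice_rank L"
    and rad: "\<And>\<alpha>. \<alpha> \<in> L \<Longrightarrow> \<exists>n. F \<alpha> ^ n \<in> ideal_gen (F ` B) \<and>
      (\<forall>L0. is_lattice L0 \<longrightarrow> L0 \<subseteq> L \<longrightarrow> F \<alpha> ^ n \<in> lattice_ideal L0 \<rho> \<longrightarrow> (\<exists>k. frag_cmul (int q ^ k) \<alpha> \<in> L0))"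
  shows "\<exists>B. connecting L q UNIV B"
proof -
  have "mixed_basis L q UNIV B" by (rule mixed_basis_of_radical[OF q B rad])
  then have "glue_tree L q True UNIV" by (rule mixed_basis_imp_glue_tree[OF lat q pos finite])
  then show ?thesis by (rule glue_tree_imp_connecting[OF lat _ pos])
qed

lemma lattice_binomial_in_sublattice:
  assumes "\<alpha> \<in> L" "is_lattice L0" "L0 \<subseteq> L" "F \<alpha> \<in> lattice_ideal L0 \<rho>"
  shows "\<alpha> \<in> L0"
proof -
  interpret Z: lattice_char L0 \<rho> by (rule sublattice[OF assms(2,3)])
  show ?thesis using Z.lattice_binomial_closed Z.lattice_ideal_subset_closed assms(1,4) nz by blast
qed

lemma conn_binomial:
  assumes B: "B \<subseteq> L" and c: "(move B)\<^sup>*\<^sup>* x y"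
  shows "Poly_Mapping.single (pos_part x) 1 - Poly_Mapping.single (pos_part y) (\<rho> (x - y)) \<in> ideal_gen (F ` B)"
  using c
proof (induction rule: rtranclp_induct)
  case base
  show ?case using is_ideal_zero[OF is_ideal_gen, of "F ` B"] by (simp add: rho_0)
next
  case (step y z)
  note I = is_ideal_gen[of "F ` B"]
  let ?m = "\<lambda>x. Poly_Mapping.single (pos_part x) :: 'k \<Rightarrow> ('m, 'k) mpoly"
  have n: "of_nat_vec (pos_part y) = y" "of_nat_vec (pos_part z) = z"
    using step.hyps(2) of_nat_vec_pos_part unfolding move_def by blast+
  have s: "?m y 1 - ?m z (\<rho> (y - z)) \<in> ideal_gen (F ` B) \<and> y - z \<in> L"
  proof (cases "y - z \<in> B")
    case True
    have "Poly_Mapping.single (pos_part y - pos_part (y - z)) 1 * F (y - z) = ?m y 1 - ?m z (1 * \<rho> (y - z))"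
      by (rule lattice_binomial_shift) (simp add: n)
    moreover have "Poly_Mapping.single (pos_part y - pos_part (y - z)) 1 * F (y - z) \<in> ideal_gen (F ` B)"
      by (intro is_ideal_mult[OF I] ideal_gen_base imageI True)
    ultimately show ?thesis using True B by auto
  next
    case False
    then have zy: "z - y \<in> B" using step.hyps(2) unfolding move_def by blast
    then have zyL: "z - y \<in> L" using B by blast
    \<comment> \<open>This step runs against the direction of the basis vector, and the inverse
      character value rescales the binomial.\<close>
    have inv: "\<rho> (y - z) * \<rho> (z - y) = 1" using rho_uminus[OF zyL] by simp
    have "Poly_Mapping.single (pos_part z - pos_part (z - y)) (- \<rho> (y - z)) * F (z - y) = ?m z (- \<rho> (y - z)) - ?m y (- \<rho> (y - z) * \<rho> (z - y))"
      by (rule lattice_binomial_shift) (simp add: n)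
    also have "\<dots> = ?m y 1 - ?m z (\<rho> (y - z))" using inv by (simp add: single_uminus)
    finally have "?m y 1 - ?m z (\<rho> (y - z)) = Poly_Mapping.single (pos_part z - pos_part (z - y)) (- \<rho> (y - z)) * F (z - y)" ..
    moreover have "Poly_Mapping.single (pos_part z - pos_part (z - y)) (- \<rho> (y - z)) * F (z - y) \<in> ideal_gen (F ` B)"
      by (intro is_ideal_mult[OF I] ideal_gen_base imageI zy)
    ultimately show ?thesis using is_lattice_uminus[OF lat zyL] by simp
  qed
  have xy: "x - y \<in> L" by (rule conn_diff_in[OF lat B step.hyps(1)])
  have m: "\<rho> (x - z) = \<rho> (x - y) * \<rho> (y - z)" using mult[OF xy conjunct2[OF s]] by simp
  have "?m x 1 - ?m z (\<rho> (x - z)) = (?m x 1 - ?m y (\<rho> (x - y))) + Poly_Mapping.single 0 (\<rho> (x - y)) * (?m y 1 - ?m z (\<rho> (y - z)))"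
    unfolding m by (simp add: right_diff_distrib mult_single)
  also have "\<dots> \<in> ideal_gen (F ` B)" by (intro is_ideal_add[OF I step.IH] is_ideal_mult[OF I] conjunct1[OF s])
  finally show ?case .
qed

lemma connecting_binomial:
  assumes B: "connecting L q UNIV B" and \<alpha>: "\<alpha> \<in> L"
  shows "\<exists>k. Poly_Mapping.single (pos_part (frag_cmul (int q ^ k) \<alpha>)) 1 -
    Poly_Mapping.single (neg_part (frag_cmul (int q ^ k) \<alpha>)) (\<rho> (frag_cmul (int q ^ k) \<alpha>)) \<in> ideal_gen (F ` B) \<and>
    frag_cmul (int q ^ k) \<alpha> \<in> zspan B"
proof -
  have fB: "finite B" and BL: "B \<subseteq> L"
    and con: "\<And>u v. nonneg u \<Longrightarrow> nonneg v \<Longrightarrow> u - v \<in> L \<Longrightarrow> qconn q B u v" using B unfolding connecting_def by auto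
  let ?u = "of_nat_vec (pos_part \<alpha>)" and ?v = "of_nat_vec (neg_part \<alpha>)"
  have "qconn q B ?u ?v" by (rule con) (simp_all add: nonneg_of_nat_vec pos_minus_neg_part \<alpha>)
  then obtain k where k: "(move B)\<^sup>*\<^sup>* (frag_cmul (int q ^ k) ?u) (frag_cmul (int q ^ k) ?v)" unfolding qconn_def by blast
  have d: "frag_cmul (int q ^ k) ?u - frag_cmul (int q ^ k) ?v = frag_cmul (int q ^ k) \<alpha>"
  proof -
    have "frag_cmul (int q ^ k) ?u - frag_cmul (int q ^ k) ?v = frag_cmul (int q ^ k) (?u - ?v)"
      by (rule poly_mapping_eqI) (simp add: lookup_minus algebra_simps)
    then show ?thesis by (simp only: pos_minus_neg_part)
  qed
  note ps = pos_part_scale[of "q ^ k" \<alpha>, unfolded of_nat_power]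
  have "B \<subseteq> zspan B" using zspan_base[OF fB] by blast
  from conn_diff_in[OF is_lattice_zspan this k] conn_binomial[OF BL k] show ?thesis unfolding d ps by blast
qed

lemma connecting_card:
  assumes B: "connecting L q UNIV B" and q: "q > 0"
  shows "card B = lattice_rank L"
proof (rule antisym)
  have fB: "finite B" and BL: "B \<subseteq> L" and ind: "indep B" using B unfolding connecting_def by auto
  show "card B \<le> lattice_rank L" by (rule card_le_lattice_rank[OF fB BL ind])
  show "lattice_rank L \<le> card B"
  proof (rule lattice_rank_le_span[OF fB])
    fix \<alpha> assume "\<alpha> \<in> L"
    from connecting_binomial[OF B this] obtain k where "frag_cmul (int q ^ k) \<alpha> \<in> zspan B" by blast
    then show "\<exists>N. N \<noteq> 0 \<and> frag_cmul N \<alpha> \<in> zspan B" using q by (intro exI[of _ "int q ^ k"]) simp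
  qed
qed

lemma connecting_1_generates:
  assumes B: "connecting L 1 UNIV B"
  shows "ideal_gen (F ` B) = lattice_ideal L \<rho>"
  unfolding lattice_ideal_eq[OF subset_refl]
proof (rule antisym)
  show "ideal_gen (F ` B) \<subseteq> ideal_gen (F ` L)" using B unfolding connecting_def by (intro ideal_gen_mono) auto
  show "ideal_gen (F ` L) \<subseteq> ideal_gen (F ` B)"
  proof (rule ideal_gen_least[OF _ is_ideal_gen], rule subsetI)
    fix g assume "g \<in> F ` L"
    then obtain \<alpha> where \<alpha>: "\<alpha> \<in> L" "g = F \<alpha>" by blast
    show "g \<in> ideal_gen (F ` B)" using connecting_binomial[OF B \<alpha>(1)] \<alpha>(2) by (simp add: lattice_binomial_def)
  qed
qed

text \<open>The two monomials of \<open>F \<alpha>\<close> belong to one class modulo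
  \<open>L\<close>, so \<open>F \<alpha>\<close> is homogeneous and multiplication by it shifts
  components.\<close>

lemma filt_class_mult:
  assumes "\<alpha> \<in> L"
  shows "filt (\<lambda>u. of_nat_vec u - w \<in> L) (h * F \<alpha>) = filt (\<lambda>u. of_nat_vec u - (w - of_nat_vec (pos_part \<alpha>)) \<in> L) h * F \<alpha>"
proof (induction h rule: mpoly_induct)
  case (1 u c)
  let ?Q = "\<lambda>v. of_nat_vec (u + v) - w \<in> L"
  have e: "of_nat_vec (u + pos_part \<alpha>) - w = (of_nat_vec (u + neg_part \<alpha>) - w) + \<alpha>"
    using pos_minus_neg_part[of \<alpha>] by (simp add: of_nat_vec_add algebra_simps)
  have iff: "?Q (neg_part \<alpha>) \<longleftrightarrow> ?Q (pos_part \<alpha>)"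
  proof
    assume "?Q (neg_part \<alpha>)"
    from is_lattice_add[OF lat this assms] show "?Q (pos_part \<alpha>)" unfolding e .
  next
    assume "?Q (pos_part \<alpha>)"
    from is_lattice_diff[OF lat this assms] show "?Q (neg_part \<alpha>)" unfolding e by simp
  qed
  have e2: "of_nat_vec (u + pos_part \<alpha>) - w = of_nat_vec u - (w - of_nat_vec (pos_part \<alpha>))"
    by (simp add: of_nat_vec_add algebra_simps)
  have "filt ?Q (F \<alpha>) = (if ?Q (pos_part \<alpha>) then F \<alpha> else 0)"
    unfolding lattice_binomial_def filt_diff filt_single iff by simp
  then show ?case unfolding filt_mult_single filt_single e2 by simp
qed (simp add: distrib_right filt_add)

text \<open>Graded Nakayama lemma for the grading by \<open>\<int>\<^sup>m / L\<close>: positivity of \<open>L\<close> makes the component of degree \<open>0\<close> the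
  field of constants, so a relation with a non-zero constant coefficient makes one of the binomials redundant.\<close>

lemma card_le_of_generators:
  assumes pos: "positive_on L UNIV" and S: "finite S" "ideal_gen S = lattice_ideal L \<rho>"
  shows "\<exists>B. finite B \<and> B \<subseteq> L \<and> ideal_gen (F ` B) = lattice_ideal L \<rho> \<and> card B \<le> card S"
proof -
  let ?I = "lattice_ideal L \<rho>"
  have up: "ideal_gen (F ` B) \<subseteq> ?I" if "B \<subseteq> L" for B
    unfolding lattice_ideal_eq[OF subset_refl] by (intro ideal_gen_mono image_mono that)
  have fin: "\<exists>B. finite B \<and> B \<subseteq> L \<and> g \<in> ideal_gen (F ` B)" if g: "g \<in> ?I" for g
  proof -
    let ?U = "{g. \<exists>B. finite B \<and> B \<subseteq> L \<and> g \<in> ideal_gen (F ` B)}"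
    have "is_ideal ?U"
    proof (rule is_idealI)
      show "0 \<in> ?U" using is_ideal_zero[OF is_ideal_gen, of "F ` {}"] by blast
      fix a b assume "a \<in> ?U" "b \<in> ?U"
      then obtain A B where AB: "finite A" "A \<subseteq> L" "a \<in> ideal_gen (F ` A)" "finite B" "B \<subseteq> L" "b \<in> ideal_gen (F ` B)" by blast
      have "ideal_gen (F ` A) \<subseteq> ideal_gen (F ` (A \<union> B))" "ideal_gen (F ` B) \<subseteq> ideal_gen (F ` (A \<union> B))"
        by (intro ideal_gen_mono image_mono Un_upper1 Un_upper2)+
      then have "a \<in> ideal_gen (F ` (A \<union> B))" "b \<in> ideal_gen (F ` (A \<union> B))" using AB by auto
      then have "a + b \<in> ideal_gen (F ` (A \<union> B))" by (rule is_ideal_add[OF is_ideal_gen])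
      then show "a + b \<in> ?U" using AB by (intro CollectI exI[of _ "A \<union> B"]) simp
    next
      fix a c assume "a \<in> ?U"
      then obtain A where A: "finite A" "A \<subseteq> L" "a \<in> ideal_gen (F ` A)" by blast
      then show "c * a \<in> ?U" using is_ideal_mult[OF is_ideal_gen A(3), of c] by (intro CollectI exI[of _ A]) simp
    qed
    moreover have "F ` L \<subseteq> ?U"
    proof
      fix g assume "g \<in> F ` L"
      then obtain \<alpha> where "\<alpha> \<in> L" "g = F \<alpha>" by blast
      then show "g \<in> ?U" by (intro CollectI exI[of _ "{\<alpha>}"]) (simp add: ideal_gen_base)
    qed
    ultimately have "ideal_gen (F ` L) \<subseteq> ?U" by (intro ideal_gen_least)
    then show ?thesis using g unfolding lattice_ideal_eq[OF subset_refl] by blast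
  qed
  have SI: "S \<subseteq> ?I" unfolding S(2)[symmetric] using ideal_gen_base by blast
  then have "\<forall>s\<in>S. \<exists>B. finite B \<and> B \<subseteq> L \<and> s \<in> ideal_gen (F ` B)" using fin by blast
  then obtain Bs where Bs: "\<And>s. s \<in> S \<Longrightarrow> finite (Bs s) \<and> Bs s \<subseteq> L \<and> s \<in> ideal_gen (F ` Bs s)" by metis
  let ?B = "\<Union>s\<in>S. Bs s"
  have BL: "?B \<subseteq> L" using Bs by blast
  have "S \<subseteq> ideal_gen (F ` ?B)"
  proof
    fix s assume s: "s \<in> S"
    have "ideal_gen (F ` Bs s) \<subseteq> ideal_gen (F ` ?B)" by (intro ideal_gen_mono image_mono) (use s in blast)
    then show "s \<in> ideal_gen (F ` ?B)" using Bs[OF s] by blast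
  qed
  from ideal_gen_least[OF this is_ideal_gen] have "ideal_gen (F ` ?B) = ?I" using up[OF BL] unfolding S(2) by blast
  then have ex: "\<exists>B. finite B \<and> B \<subseteq> L \<and> ideal_gen (F ` B) = ?I" using BL Bs S(1) by (intro exI[of _ ?B]) auto
  let ?P = "\<lambda>B. finite B \<and> B \<subseteq> L \<and> ideal_gen (F ` B) = ?I"
  obtain B1 where "?P B1" using ex by (elim exE)
  from ex_has_least_nat[of ?P B1 card, OF this]
  obtain B where B: "?P B" and min': "\<forall>B'. ?P B' \<longrightarrow> card B \<le> card B'" by (elim exE conjE) (rule that, simp_all)
  have min: "card B \<le> card B'" if "?P B'" for B' using min' that by (elim allE impE)
  have "card B \<le> card S"
  proof (rule ccontr)
    assume n: "\<not> card B \<le> card S"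
    have "\<exists>h. F \<alpha> = (\<Sum>s\<in>S. h s * s)" if "\<alpha> \<in> B" for \<alpha>
    proof -
      have "F \<alpha> \<in> ideal_gen (id ` S)" using lattice_binomial_in[of \<alpha>] B that S(2) by auto
      from ideal_gen_image_sum[OF S(1) this] show ?thesis by simp
    qed
    then have "\<forall>\<alpha>\<in>B. \<exists>h. F \<alpha> = (\<Sum>s\<in>S. h s * s)" by (intro ballI)
    from bchoice[OF this] obtain h where "\<forall>\<alpha>\<in>B. F \<alpha> = (\<Sum>s\<in>S. h \<alpha> s * s)" by (elim exE)
    note h = bspec[OF this]
    have "\<exists>g. s = (\<Sum>\<beta>\<in>B. g \<beta> * F \<beta>)" if "s \<in> S" for s
      by (rule ideal_gen_image_sum) (use B SI that in auto)
    then have "\<forall>s\<in>S. \<exists>g. s = (\<Sum>\<beta>\<in>B. g \<beta> * F \<beta>)" by (intro ballI)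
    from bchoice[OF this] obtain g where "\<forall>s\<in>S. s = (\<Sum>\<beta>\<in>B. g s \<beta> * F \<beta>)" by (elim exE)
    note g = bspec[OF this]
    let ?e = "eval01 UNIV :: ('m, 'k) mpoly \<Rightarrow> 'k" and ?c = "Poly_Mapping.single 0 :: 'k \<Rightarrow> ('m, 'k) mpoly"
    have e_sum: "?e (sum f X) = (\<Sum>x\<in>X. ?e (f x))" for f and X :: "'z set"
      by (induction X rule: infinite_finite_induct) (auto simp: eval01_add, auto simp: eval01_def)
    \<comment> \<open>There are more binomials than generators, so some nontrivial constant
      combination of the binomials has coefficients without constant term when expressed through
      \<open>S\<close>.\<close>
    obtain c where c: "\<exists>\<alpha>\<in>B. c \<alpha> \<noteq> 0" "\<forall>s\<in>S. (\<Sum>\<alpha>\<in>B. c \<alpha> * ?e (h \<alpha> s)) = 0"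
      using homogeneous_system_nontrivial[of S B "\<lambda>\<alpha> s. ?e (h \<alpha> s)"] S(1) B n by auto
    then obtain \<alpha>0 where \<alpha>0: "\<alpha>0 \<in> B" "c \<alpha>0 \<noteq> 0" by blast
    define k where "k = (\<lambda>s. \<Sum>\<alpha>\<in>B. ?c (c \<alpha>) * h \<alpha> s)"
    have k0: "?e (k s) = 0" if "s \<in> S" for s
      using c(2) that by (simp add: k_def e_sum eval01_mult eval01_single)
    \<comment> \<open>The coefficients after \<open>S\<close> has been expressed through the
      binomials again; they inherit the vanishing constant terms of \<open>k\<close>.\<close>
    define m where "m = (\<lambda>\<beta>. \<Sum>s\<in>S. k s * g s \<beta>)"
    have m0: "?e (m \<beta>) = 0" for \<beta> unfolding m_def e_sum eval01_mult by (rule sum.neutral) (simp add: k0)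
    have "(\<Sum>\<alpha>\<in>B. ?c (c \<alpha>) * F \<alpha>) = (\<Sum>\<alpha>\<in>B. \<Sum>s\<in>S. ?c (c \<alpha>) * h \<alpha> s * s)"
      by (rule sum.cong) (simp_all add: h sum_distrib_left mult.assoc)
    also have "\<dots> = (\<Sum>s\<in>S. \<Sum>\<alpha>\<in>B. ?c (c \<alpha>) * h \<alpha> s * s)" by (rule sum.swap)
    also have "\<dots> = (\<Sum>s\<in>S. k s * s)" by (simp add: k_def sum_distrib_right)
    also have "\<dots> = (\<Sum>s\<in>S. \<Sum>\<beta>\<in>B. k s * g s \<beta> * F \<beta>)"
    proof (rule sum.cong)
      fix s assume s: "s \<in> S"
      have "k s * s = k s * (\<Sum>\<beta>\<in>B. g s \<beta> * F \<beta>)" using g[OF s] by (rule arg_cong)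
      then show "k s * s = (\<Sum>\<beta>\<in>B. k s * g s \<beta> * F \<beta>)" by (simp only: sum_distrib_left mult.assoc)
    qed simp
    also have "\<dots> = (\<Sum>\<beta>\<in>B. \<Sum>s\<in>S. k s * g s \<beta> * F \<beta>)" by (rule sum.swap)
    also have "\<dots> = (\<Sum>\<beta>\<in>B. m \<beta> * F \<beta>)" by (simp add: m_def sum_distrib_right)
    finally have z: "(\<Sum>\<alpha>\<in>B. (?c (c \<alpha>) - m \<alpha>) * F \<alpha>) = 0" by (simp add: left_diff_distrib sum_subtractf)
    let ?w = "of_nat_vec (pos_part \<alpha>0)"
    \<comment> \<open>The class of the first exponent of \<open>F \<alpha>0\<close> is chosen so
      that the coefficient of \<open>F \<alpha>0\<close> itself falls into the class of
      zero.\<close>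
    define H where "H = (\<lambda>\<alpha>. filt (\<lambda>u. of_nat_vec u - (?w - of_nat_vec (pos_part \<alpha>)) \<in> L) (?c (c \<alpha>) - m \<alpha>))"
    have BL: "B \<subseteq> L" and fB: "finite B" using B by auto
    have "(\<Sum>\<alpha>\<in>B. H \<alpha> * F \<alpha>) = filt (\<lambda>u. of_nat_vec u - ?w \<in> L) (\<Sum>\<alpha>\<in>B. (?c (c \<alpha>) - m \<alpha>) * F \<alpha>)"
      unfolding filt_sum H_def by (rule sum.cong) (use filt_class_mult BL in auto)
    then have Hz: "(\<Sum>\<alpha>\<in>B. H \<alpha> * F \<alpha>) = 0" unfolding z by simp
    have u0: "of_nat_vec u \<in> L \<longleftrightarrow> u = 0" for u :: "'m \<Rightarrow>\<^sub>0 nat"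
    proof
      assume "of_nat_vec u \<in> L"
      from positive_onD[OF pos this subset_UNIV nonneg_of_nat_vec] have "of_nat_vec u = of_nat_vec 0" by simp
      then show "u = 0" by (simp only: of_nat_vec_inj)
    qed (simp add: is_lattice_zero[OF lat])
    have e0: "?e f = lookup f 0" for f
    proof -
      have "?e f = (\<Sum>u\<in>keys f. if u = 0 then lookup f 0 else 0)" unfolding eval01_def by (rule sum.cong) auto
      then show ?thesis by (auto simp: in_keys_iff)
    qed
    have "H \<alpha>0 = filt (\<lambda>u. u = 0) (?c (c \<alpha>0) - m \<alpha>0)" by (simp add: H_def u0)
    also have "\<dots> = ?c (?e (?c (c \<alpha>0) - m \<alpha>0))" unfolding filt_eq e0 ..
    also have "?e (?c (c \<alpha>0) - m \<alpha>0) = c \<alpha>0" using m0[of \<alpha>0] by (simp add: e0 lookup_minus)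
    finally have H0: "H \<alpha>0 = ?c (c \<alpha>0)" .
    have "(\<Sum>\<alpha>\<in>B. H \<alpha> * F \<alpha>) = H \<alpha>0 * F \<alpha>0 + (\<Sum>\<alpha>\<in>B - {\<alpha>0}. H \<alpha> * F \<alpha>)" by (rule sum.remove[OF fB \<alpha>0(1)])
    then have "?c (c \<alpha>0) * F \<alpha>0 = - (\<Sum>\<alpha>\<in>B - {\<alpha>0}. H \<alpha> * F \<alpha>)" unfolding Hz H0 by (simp add: add_eq_0_iff2)
    also have "\<dots> \<in> ideal_gen (F ` (B - {\<alpha>0}))"
      by (intro is_ideal_uminus[OF is_ideal_gen] is_ideal_sum[OF is_ideal_gen] is_ideal_mult[OF is_ideal_gen] ideal_gen_base imageI)
    finally have "?c (inverse (c \<alpha>0)) * (?c (c \<alpha>0) * F \<alpha>0) \<in> ideal_gen (F ` (B - {\<alpha>0}))" by (rule is_ideal_mult[OF is_ideal_gen])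
    then have F0: "F \<alpha>0 \<in> ideal_gen (F ` (B - {\<alpha>0}))" using \<alpha>0(2) by (simp add: mult_single flip: mult.assoc)
    have "F ` B \<subseteq> ideal_gen (F ` (B - {\<alpha>0}))"
    proof
      fix y assume "y \<in> F ` B"
      then obtain b where b: "b \<in> B" "y = F b" by blast
      show "y \<in> ideal_gen (F ` (B - {\<alpha>0}))"
        by (cases "b = \<alpha>0") (use F0 b ideal_gen_base[of "F b" "F ` (B - {\<alpha>0})"] in auto)
    qed
    from ideal_gen_least[OF this is_ideal_gen] have "ideal_gen (F ` (B - {\<alpha>0})) = ?I"
      using B up[of "B - {\<alpha>0}"] by blast
    then have "card B \<le> card (B - {\<alpha>0})" using B by (intro min) auto
    then show False using \<alpha>0(1) fB by (metis card_Diff1_less not_le)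
  qed
  then show ?thesis using B by blast
qed

end

subsection \<open>Set-theoretic complete intersections on binomials\<close>

context lattice_char
begin

lemma frobenius_lattice_binomial:
  "prime CHAR('k) \<Longrightarrow> \<alpha> \<in> L \<Longrightarrow> F \<alpha> ^ (CHAR('k) ^ j) = F (frag_cmul (int (CHAR('k) ^ j)) \<alpha>)"
  unfolding lattice_binomial_frobenius by (simp only: lattice_binomial_def rho_cmul)

lemma binomial_closed_ideal_form:
  assumes "Poly_Mapping.single u c + Poly_Mapping.single v d \<in> closed_ideal" "d \<noteq> 0"
  shows "\<exists>b\<in>L. \<exists>w. Poly_Mapping.single u c + Poly_Mapping.single v d = Poly_Mapping.single w c * F b"
proof -
  let ?b = "of_nat_vec u - of_nat_vec v"
  note h = binomial_in_closed_ideal[OF assms]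
  then have "d = - (c * \<rho> ?b)" by (simp add: eq_neg_iff_add_eq_0 add.commute)
  then have "Poly_Mapping.single (u - pos_part ?b) c * F ?b = Poly_Mapping.single u c + Poly_Mapping.single v d"
    using lattice_binomial_shift[of ?b u v c \<rho>] by (simp add: single_uminus)
  then show ?thesis using h by metis
qed

text \<open>A power of \<open>g\<close> lies in \<open>closed_ideal\<close>. In characteristic zero
  this already holds for a two-term \<open>g\<close> itself. In positive characteristic the power
  with exponent \<open>CHAR('k) ^ n\<close>, which is at least \<open>n\<close>, is again a two-term
  polynomial and lies there. A single nonzero term is impossible.\<close>

lemma binomial_in_radical_form:
  assumes g: "g \<in> ideal_radical (lattice_ideal L \<rho>)" and b: "is_binomial g"
  shows "\<exists>s. \<exists>b\<in>L. \<exists>w c. g ^ s = Poly_Mapping.single w c * F b"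
proof -
  obtain n where n: "g ^ n \<in> closed_ideal"
    using g lattice_ideal_subset_closed unfolding ideal_radical_def by blast
  have gs: "g = (\<Sum>u\<in>keys g. Poly_Mapping.single u (lookup g u))" by (rule mpoly_sum_monomials)
  consider "card (keys g) = 0" | "card (keys g) = 1" | "card (keys g) = 2"
    using b unfolding is_binomial_def by linarith
  then show ?thesis
  proof cases
    case 1
    then have "g = 0" by simp
    then have "g ^ 1 = Poly_Mapping.single 0 0 * F 0" by simp
    then show ?thesis using is_lattice_zero[OF lat] by blast
  next
    case 2
    then obtain u where u: "keys g = {u}" by (rule card_1_singletonE)
    define c where "c = lookup g u"
    have g1: "g = Poly_Mapping.single u c" using gs u by (simp add: c_def)
    have "c ^ n = 0" using n unfolding g1 single_power by (rule single_in_closed_ideal)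
    moreover have "c \<noteq> 0" using u unfolding c_def by (simp flip: in_keys_iff)
    ultimately show ?thesis by simp
  next
    case 3
    then obtain u v where uv: "keys g = {u, v}" "u \<noteq> v" by (auto simp: card_2_iff)
    define c where "c = lookup g u"
    define d where "d = lookup g v"
    have g2: "g = Poly_Mapping.single u c + Poly_Mapping.single v d" using gs uv by (simp add: c_def d_def)
    have cd: "c \<noteq> 0" "d \<noteq> 0" using uv(1) unfolding c_def d_def by (simp_all flip: in_keys_iff)
    show ?thesis
    proof (cases "CHAR('k) = 0")
      case True
      have "Poly_Mapping.single u c + Poly_Mapping.single v d \<in> closed_ideal"
        by (rule binomial_power_closed_ideal[OF True cd]) (use n g2 in simp)
      from binomial_closed_ideal_form[OF this cd(2)] have "\<exists>b\<in>L. \<exists>w. g ^ 1 = Poly_Mapping.single w c * F b"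
        unfolding g2 power_one_right .
      then show ?thesis by blast
    next
      case False
      then have p: "prime CHAR('k)" using prime_CHAR_semidom by simp
      let ?N = "CHAR('k) ^ n"
      have "n \<le> ?N" using less_exp[of n] power_gt_expt[of "CHAR('k)" n] prime_gt_1_nat[OF p] by simp
      then have "g ^ ?N = g ^ (?N - n) * g ^ n" by (simp flip: power_add)
      also have "\<dots> \<in> closed_ideal" by (rule is_ideal_mult[OF is_ideal_closed_ideal n])
      finally have gN: "g ^ ?N \<in> closed_ideal" .
      have "g ^ ?N = Poly_Mapping.single u c ^ ?N + Poly_Mapping.single v d ^ ?N"
        unfolding g2 by (rule freshmans_dream') (simp_all add: CHAR_mpoly p)
      then have e: "g ^ ?N = Poly_Mapping.single (pos_part (frag_cmul (int ?N) (of_nat_vec u))) (c ^ ?N) +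
          Poly_Mapping.single (pos_part (frag_cmul (int ?N) (of_nat_vec v))) (d ^ ?N)" unfolding single_power .
      have "d ^ ?N \<noteq> 0" using cd(2) by simp
      from binomial_closed_ideal_form[OF gN[unfolded e] this] show ?thesis unfolding e[symmetric] by blast
    qed
  qed
qed

text \<open>The second half of the condition in \<open>connecting_of_radical\<close>, and the only
  place that fixes the relation of \<open>q\<close> to the characteristic in this direction: in
  characteristic zero the exponent \<open>n\<close> can be removed, in positive characteristic
  Frobenius turns a higher power of \<open>F \<alpha>\<close> into the binomial of a multiple of
  \<open>\<alpha>\<close>.\<close>

lemma lattice_binomial_power_in_sublattice:
  assumes q: "q = (if CHAR('k) = 0 then 1 else CHAR('k))" and \<alpha>: "\<alpha> \<in> L"
    and L0: "is_lattice L0" "L0 \<subseteq> L" "F \<alpha> ^ n \<in> lattice_ideal L0 \<rho>"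
  shows "\<exists>k. frag_cmul (int q ^ k) \<alpha> \<in> L0"
proof -
  interpret Z: lattice_char L0 \<rho> by (rule sublattice[OF L0(1,2)])
  have c: "F \<alpha> ^ n \<in> Z.closed_ideal" using L0(3) Z.lattice_ideal_subset_closed by blast
  show ?thesis
  proof (cases "CHAR('k) = 0")
    case True
    have e: "F \<alpha> = Poly_Mapping.single (pos_part \<alpha>) 1 + Poly_Mapping.single (neg_part \<alpha>) (- \<rho> \<alpha>)"
      by (simp add: lattice_binomial_def single_uminus)
    have "F \<alpha> \<in> Z.closed_ideal" unfolding e
      by (rule Z.binomial_power_closed_ideal[OF True]) (use nz[OF \<alpha>] c e in auto)
    then have "\<alpha> \<in> L0" using Z.lattice_binomial_closed nz[OF \<alpha>] by blast
    then show ?thesis by (intro exI[of _ 0]) simp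
  next
    case False
    then have p: "prime CHAR('k)" using prime_CHAR_semidom by simp
    let ?N = "CHAR('k) ^ n"
    have "n \<le> ?N" using power_gt_expt[of "CHAR('k)" n] prime_gt_1_nat[OF p] by simp
    then have "F \<alpha> ^ ?N = F \<alpha> ^ (?N - n) * F \<alpha> ^ n" by (simp flip: power_add)
    also have "\<dots> \<in> Z.closed_ideal" by (rule is_ideal_mult[OF Z.is_ideal_closed_ideal c])
    finally have "F (frag_cmul (int ?N) \<alpha>) \<in> Z.closed_ideal" unfolding frobenius_lattice_binomial[OF p \<alpha>] .
    from Z.lattice_binomial_closed[OF this nz[OF is_lattice_cmul[OF lat \<alpha>]]]
    show ?thesis using False q by (intro exI[of _ n]) simp
  qed
qed

lemma connecting_power_in_ideal:
  assumes q: "q = 1 \<or> prime CHAR('k) \<and> q = CHAR('k)" and B: "connecting L q UNIV B" and \<alpha>: "\<alpha> \<in> L"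
  shows "\<exists>n. F \<alpha> ^ n \<in> ideal_gen (F ` B)"
proof -
  obtain k where k: "F (frag_cmul (int q ^ k) \<alpha>) \<in> ideal_gen (F ` B)"
    using connecting_binomial[OF B \<alpha>] unfolding lattice_binomial_def by blast
  from q show ?thesis
  proof
    assume "q = 1"
    then show ?thesis using k by (intro exI[of _ 1]) simp
  next
    assume p: "prime CHAR('k) \<and> q = CHAR('k)"
    then have "F \<alpha> ^ (CHAR('k) ^ k) = F (frag_cmul (int q ^ k) \<alpha>)"
      using frobenius_lattice_binomial[of \<alpha> k] \<alpha> by simp
    then show ?thesis using k by (intro exI[of _ "CHAR('k) ^ k"]) (simp only:)
  qed
qed

lemma connecting_imp_stci:
  assumes q: "q = 1 \<or> prime CHAR('k) \<and> q = CHAR('k)" and B: "connecting L q UNIV B"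
  shows "stci_on_binomials (lattice_ideal L \<rho>)"
proof -
  have q0: "q > 0" using q by (auto simp: prime_gt_0_nat)
  have fB: "finite B" and BL: "B \<subseteq> L" using B unfolding connecting_def by auto
  obtain bs where bs: "set bs = B" "distinct bs" using finite_distinct_list[OF fB] by blast
  let ?J = "ideal_gen (F ` B)" and ?I = "lattice_ideal L \<rho>"
  have JI: "?J \<subseteq> ?I" unfolding lattice_ideal_eq[OF subset_refl] by (intro ideal_gen_mono image_mono BL)
  have "ideal_radical ?I = ideal_radical ?J"
  proof (intro equalityI subsetI)
    fix g assume g: "g \<in> ideal_radical ?I"
    show "g \<in> ideal_radical ?J"
    proof (rule ideal_radicalI[OF is_ideal_gen])
      fix P assume P: "prime_ideal P" "?J \<subseteq> P"
      have "F ` L \<subseteq> P"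
      proof
        fix y assume "y \<in> F ` L"
        then obtain \<alpha> where \<alpha>: "\<alpha> \<in> L" "y = F \<alpha>" by blast
        obtain n where "F \<alpha> ^ n \<in> P" using connecting_power_in_ideal[OF q B \<alpha>(1)] P(2) by blast
        then show "y \<in> P" unfolding \<alpha>(2) by (rule prime_ideal_power[OF P(1)])
      qed
      from ideal_gen_least[OF this prime_idealD(1)[OF P(1)]] have "?I \<subseteq> P" unfolding lattice_ideal_eq[OF subset_refl] .
      from ideal_radical_in_prime[OF P(1) this g] show "g \<in> P" .
    qed
  next
    fix g assume "g \<in> ideal_radical ?J"
    then show "g \<in> ideal_radical ?I" using JI unfolding ideal_radical_def by blast
  qed
  moreover have "set (map F bs) = F ` B" using bs(1) by simp
  moreover have "length (map F bs) = lattice_rank L"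
    using connecting_card[OF B q0] bs distinct_card by fastforce
  moreover have "is_binomial (F b)" for b
  proof -
    have "card (keys (F b)) \<le> card {pos_part b, neg_part b}" by (rule card_mono[OF _ keys_lattice_binomial]) simp
    also have "\<dots> \<le> 2" by (simp add: card_insert_if)
    finally show ?thesis unfolding is_binomial_def .
  qed
  ultimately show ?thesis unfolding stci_on_binomials_def ideal_height_lattice_ideal
    by (intro exI[of _ "map F bs"]) auto
qed

text \<open>Each of the given binomials has a power that is a multiple of some \<open>F b\<close>
  with \<open>b \<in> L\<close>. Replacing the binomials by these \<open>F b\<close> does not
  increase their number, and a prime containing all \<open>F b\<close> contains the given binomials,
  so the radical does not shrink.\<close>

lemma stci_imp_connecting:
  assumes pos: "positive_on L UNIV" and q: "q = (if CHAR('k) = 0 then 1 else CHAR('k))"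
    and S: "stci_on_binomials (lattice_ideal L \<rho>)"
  shows "\<exists>B. connecting L q UNIV B"
proof -
  let ?I = "lattice_ideal L \<rho>"
  obtain Fs where Fs: "length Fs = lattice_rank L" "\<And>g. g \<in> set Fs \<Longrightarrow> is_binomial g"
    "ideal_radical ?I = ideal_radical (ideal_gen (set Fs))"
    using S unfolding stci_on_binomials_def ideal_height_lattice_ideal by auto
  have "\<exists>b\<in>L. \<exists>s w c. g ^ s = Poly_Mapping.single w c * F b" if g: "g \<in> set Fs" for g
  proof -
    have "g \<in> ideal_radical ?I" unfolding Fs(3) using subset_ideal_radical ideal_gen_base[OF g] by blast
    from binomial_in_radical_form[OF this Fs(2)[OF g]] show ?thesis by blast
  qed
  then obtain bf where bf: "\<And>g. g \<in> set Fs \<Longrightarrow> bf g \<in> L \<and> (\<exists>s w c. g ^ s = Poly_Mapping.single w c * F (bf g))" by metis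
  let ?B = "bf ` set Fs"
  show ?thesis
  proof (rule connecting_of_radical[OF pos])
    show "q > 0" using q by auto
    show "finite ?B" by simp
    show "?B \<subseteq> L" using bf by blast
    have "card ?B \<le> card (set Fs)" by (rule card_image_le) simp
    also have "\<dots> \<le> length Fs" by (rule card_length)
    finally show "card ?B \<le> lattice_rank L" using Fs(1) by simp
    fix \<alpha> assume \<alpha>: "\<alpha> \<in> L"
    have "F \<alpha> \<in> ideal_radical (ideal_gen (F ` ?B))"
    proof (rule ideal_radicalI[OF is_ideal_gen])
      fix P assume P: "prime_ideal P" "ideal_gen (F ` ?B) \<subseteq> P"
      have "set Fs \<subseteq> P"
      proof
        fix g assume g: "g \<in> set Fs"
        obtain s w c where s: "g ^ s = Poly_Mapping.single w c * F (bf g)" using bf[OF g] by blast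
        have "F (bf g) \<in> P" using P(2) ideal_gen_base[of "F (bf g)" "F ` ?B"] g by blast
        then have "g ^ s \<in> P" unfolding s by (rule is_ideal_mult[OF prime_idealD(1)[OF P(1)]])
        then show "g \<in> P" by (rule prime_ideal_power[OF P(1)])
      qed
      from ideal_gen_least[OF this prime_idealD(1)[OF P(1)]] have SP: "ideal_gen (set Fs) \<subseteq> P" .
      have "F \<alpha> \<in> ideal_radical (ideal_gen (set Fs))"
        unfolding Fs(3)[symmetric] using subset_ideal_radical lattice_binomial_in[OF \<alpha>] by blast
      from ideal_radical_in_prime[OF P(1) SP this] show "F \<alpha> \<in> P" .
    qed
    then obtain n where "F \<alpha> ^ n \<in> ideal_gen (F ` ?B)" unfolding ideal_radical_def by blast
    then show "\<exists>n. F \<alpha> ^ n \<in> ideal_gen (F ` ?B) \<and>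
      (\<forall>L0. is_lattice L0 \<longrightarrow> L0 \<subseteq> L \<longrightarrow> F \<alpha> ^ n \<in> lattice_ideal L0 \<rho> \<longrightarrow> (\<exists>k. frag_cmul (int q ^ k) \<alpha> \<in> L0))"
      using lattice_binomial_power_in_sublattice[OF q \<alpha>] by (intro exI[of _ n]) simp
  qed
qed

lemma lattice_rank_le_generators:
  assumes B: "finite B" "B \<subseteq> L" "ideal_gen (F ` B) = lattice_ideal L \<rho>"
  shows "lattice_rank L \<le> card B"
proof (rule lattice_rank_le_span[OF B(1)])
  fix \<alpha> assume \<alpha>: "\<alpha> \<in> L"
  have zL: "zspan B \<subseteq> L" by (rule zspan_subset[OF lat B(2)])
  have "ideal_gen (F ` B) \<subseteq> lattice_ideal (zspan B) \<rho>"
    unfolding lattice_ideal_eq[OF zL] by (intro ideal_gen_mono image_mono subsetI zspan_base[OF B(1)])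
  then have "F \<alpha> \<in> lattice_ideal (zspan B) \<rho>" using lattice_binomial_in[OF \<alpha>] B(3) by blast
  from lattice_binomial_in_sublattice[OF \<alpha> is_lattice_zspan zL this]
  show "\<exists>N. N \<noteq> 0 \<and> frag_cmul N \<alpha> \<in> zspan B" by (intro exI[of _ 1]) simp
qed

text \<open>By \<open>card_le_of_generators\<close> generating sets may be assumed to consist of
  lattice binomials. Their vectors span \<open>L\<close>, so there are at least
  \<open>lattice_rank L\<close> of them, which makes the height a lower bound for the number of
  generators.\<close>

lemma complete_intersection_iff:
  assumes pos: "positive_on L UNIV"
  shows "complete_intersection (lattice_ideal L \<rho>) \<longleftrightarrow> (\<exists>B. connecting L 1 UNIV B)"
proof
  let ?I = "lattice_ideal L \<rho>" and ?N = "{enat (card S) | S. finite S \<and> ideal_gen S = lattice_ideal L \<rho>}"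
  assume "complete_intersection ?I"
  then have e: "Inf ?N = enat (lattice_rank L)"
    unfolding complete_intersection_def min_number_of_generators_def ideal_height_lattice_ideal .
  \<comment> \<open>The infimum of the empty set is infinite in \<open>enat\<close>, so a finite
    value yields an actual generating set of this size.\<close>
  then have "?N \<noteq> {}" by (metis Inf_enat_def enat.distinct(1) top_enat_def)
  then have "Inf ?N \<in> ?N" by (auto simp: Inf_enat_def intro: LeastI)
  then obtain S where S: "finite S" "ideal_gen S = ?I" "card S = lattice_rank L" unfolding e by auto
  obtain B where B: "finite B" "B \<subseteq> L" "ideal_gen (F ` B) = ?I" "card B \<le> card S"
    using card_le_of_generators[OF pos S(1,2)] by blast
  show "\<exists>B. connecting L 1 UNIV B"
  proof (rule connecting_of_radical[OF pos _ B(1,2)])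
    show "card B \<le> lattice_rank L" using B(4) S(3) by simp
    fix \<alpha> assume \<alpha>: "\<alpha> \<in> L"
    show "\<exists>n. F \<alpha> ^ n \<in> ideal_gen (F ` B) \<and>
      (\<forall>L0. is_lattice L0 \<longrightarrow> L0 \<subseteq> L \<longrightarrow> F \<alpha> ^ n \<in> lattice_ideal L0 \<rho> \<longrightarrow> (\<exists>k. frag_cmul (int 1 ^ k) \<alpha> \<in> L0))"
      using lattice_binomial_in_sublattice[OF \<alpha>] lattice_binomial_in[OF \<alpha>] B(3) by (intro exI[of _ 1]) simp
  qed simp
next
  let ?I = "lattice_ideal L \<rho>" and ?N = "{enat (card S) | S. finite S \<and> ideal_gen S = lattice_ideal L \<rho>}"
  assume "\<exists>B. connecting L 1 UNIV B"
  then obtain B where B: "connecting L 1 UNIV B" by blast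
  have fB: "finite B" using B unfolding connecting_def by auto
  have "Inf ?N \<le> enat (card (F ` B))"
    by (rule Inf_lower) (use fB connecting_1_generates[OF B] in blast)
  also have "\<dots> \<le> enat (lattice_rank L)" using card_image_le[OF fB, of F] connecting_card[OF B] by simp
  finally have "Inf ?N \<le> enat (lattice_rank L)" .
  moreover have "enat (lattice_rank L) \<le> Inf ?N"
  proof (rule Inf_greatest)
    fix x assume "x \<in> ?N"
    then obtain S where S: "x = enat (card S)" "finite S" "ideal_gen S = ?I" by blast
    obtain B where B: "finite B" "B \<subseteq> L" "ideal_gen (F ` B) = ?I" "card B \<le> card S"
      using card_le_of_generators[OF pos S(2,3)] by blast
    show "enat (lattice_rank L) \<le> x" using lattice_rank_le_generators[OF B(1-3)] B(4) S(1) by simp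
  qed
  ultimately show "complete_intersection ?I"
    unfolding complete_intersection_def min_number_of_generators_def ideal_height_lattice_ideal by (rule antisym)
qed

end

theorem theorem3p15:
  fixes L :: "('m::finite \<Rightarrow>\<^sub>0 int) set"
    and \<rho> :: "('m \<Rightarrow>\<^sub>0 int) \<Rightarrow> 'k::field"
  assumes "subgroup L (free_Abelian_group UNIV)"
    and "positive_lattice L"
    and "partial_character L \<rho>"
  shows "(complete_intersection (lattice_ideal L \<rho>) \<longleftrightarrow> completely_glued_lattice L)
    \<and> (CHAR('k) = 0 \<longrightarrow>
        (stci_on_binomials (lattice_ideal L \<rho>) \<longleftrightarrow> completely_glued_lattice L))
    \<and> (CHAR('k) > 0 \<longrightarrow>
        (stci_on_binomials (lattice_ideal L \<rho>) \<longleftrightarrow> completely_p_glued_lattice CHAR('k) L))"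
proof -
  interpret lattice_char L \<rho>
    using assms(1,3) unfolding lattice_char_def is_lattice_iff_subgroup partial_character_def by blast
  have pos: "positive_on L UNIV" by (rule positive_lattice_imp_positive_on[OF assms(2)])
  show ?thesis
  proof (intro conjI impI)
    show "complete_intersection (lattice_ideal L \<rho>) \<longleftrightarrow> completely_glued_lattice L"
      unfolding complete_intersection_iff[OF pos] completely_glued_lattice_iff[OF assms(1,2)] ..
    show "stci_on_binomials (lattice_ideal L \<rho>) \<longleftrightarrow> completely_glued_lattice L" if "CHAR('k) = 0"
      unfolding completely_glued_lattice_iff[OF assms(1,2)]
      using stci_imp_connecting[OF pos, of 1] connecting_imp_stci[of 1] that by auto
    show "stci_on_binomials (lattice_ideal L \<rho>) \<longleftrightarrow> completely_p_glued_lattice CHAR('k) L" if p: "CHAR('k) > 0"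
      unfolding completely_p_glued_lattice_iff[OF assms(1,2) p]
      using stci_imp_connecting[OF pos, of "CHAR('k)"] connecting_imp_stci[of "CHAR('k)"] p prime_CHAR_semidom by auto
  qed
qed

end
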